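(* In the setting described in the context, the divisor $H - H^\dagger$ on $D$ represents the class of $T'$ in $\operatorname{Pic}^0(D) \cong E'$.
   Context: $K$ is a number field, $C\subset\mathbb{P}^3$ a non-singular intersection of two quadrics over $K$ with Jacobian $E$. The four singular quadrics in the pencil defining $C$ are cones over conics $\Gamma_1,\dots,\Gamma_4$; projection from the vertex of the $i$-th cone gives a degree-2 morphism $\nu_i: C\to\Gamma_i$ with fibre $\mathfrak{a}_i$. Fix $0\ne T\in E(K)[2]$ with the $\Gamma_i$ ordered so that $\mathfrak{a}_1-\mathfrak{a}_2\sim\mathfrak{a}_3-\mathfrak{a}_4$ represents $T$, and assume the Galois action on the $\Gamma_i$ has image in $\langle(12),(34)\rangle$, so each of the pairs $\{\Gamma_1,\Gamma_2\}$, $\{\Gamma_3,\Gamma_4\}$ consists either of two conics over $K$ or of two conjugate conics over a quadratic extension. Let $\phi: E\to E'$ be the 2-isogeny with kernel $\{0,T\}$, and $\widehat\phi: E'\to E$ its dual with kernel $\{0,T'\}$. A quadratic form $g$ is a pushout form on $C$ if $\operatorname{div}(g/x_1^2) = 2\mathfrak{b}$ with $\mathfrak{b}$ representing $T$ in $\operatorname{Pic}^0(C)\cong E$. From a pair of points $P_1\in\Gamma_1$, $P_2\in\Gamma_2$ (both $K$-rational, or conjugate over the quadratic field of definition) one obtains the pushout form $f=\ell_1\ell_2$, where $\ell_i$ defines the tangent plane to the cone over $\Gamma_i$ at $P_i$, and, by parametrising the conics $\Gamma_1,\Gamma_2$ and eliminating, a non-singular quadric intersection $D\subset\mathbb{P}^3$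 with a degree-2 morphism $\pi: D\to C$ such that $K(D) = K(C)(\sqrt{f/x_1^2})$; $D$ has hyperplane section $H\sim\pi^*\mathfrak{a}_1\sim\pi^*\mathfrak{a}_2$, and $\pi$ is a $\widehat\phi$-covering (so $\operatorname{Pic}^0(D)\cong E'$). Applying the same construction to a pair of points on $\Gamma_3,\Gamma_4$ gives a pushout form $f^\dagger$ and a quadric intersection $D^\dagger$ with morphism $\pi^\dagger : D^\dagger\to C$ and hyperplane section $H^\dagger$. Scale $f$ and $f^\dagger$ so that $f/f^\dagger = h^2$ for some $h\in K(C)$; then $D$ and $D^\dagger$ are isomorphic as coverings of $C$, and $H^\dagger$ is regarded as a divisor on $D$ via this isomorphism. *)

theory Defs
  imports
    "HOL-Library.Poly_Mapping"
    "HOL-Library.Numeral_Type"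
    "HOL-Algebra.Algebraic_Closure_Type"
    "HOL-Combinatorics.Transposition"
begin

text \<open>
  The number field is a type \<open>'k\<close> and its algebraic closure is \<open>'k alg_closure\<close>.
  Varieties are sets of geometric points, and a structure over the number field is recorded
  by the field of coefficients of the defining polynomials and by the Galois action.
  Coordinates are indexed by the types \<open>2\<close>, \<open>3\<close>, \<open>4\<close>, whose elements are written
  \<open>1, \<dots>, n\<close>; the numeral \<open>n\<close> denotes the same index as \<open>0\<close>.
\<close>

definition number_field :: "'k::field_char_0 itself \<Rightarrow> bool" where
  "number_field _ \<longleftrightarrow>
     (\<exists>B :: 'k set. finite B \<and> (\<forall>x. \<exists>c. x = (\<Sum>b\<in>B. of_rat (c b) * b)))"

definition galois_group :: "('k::field alg_closure \<Rightarrow> 'k alg_closure) set" where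
  "galois_group = {\<sigma>. bij \<sigma> \<and> (\<forall>x y. \<sigma> (x + y) = \<sigma> x + \<sigma> y) \<and> (\<forall>x y. \<sigma> (x * y) = \<sigma> x * \<sigma> y) \<and>
     (\<forall>c. \<sigma> (to_ac c) = to_ac c)}"

abbreviation base_field :: "'k::field alg_closure set" where
  "base_field \<equiv> range to_ac"


section \<open>Polynomials in finitely many variables\<close>

type_synonym ('i, 'a) mpoly = "('i \<Rightarrow>\<^sub>0 nat) \<Rightarrow>\<^sub>0 'a"

definition mconst :: "'a::zero \<Rightarrow> ('i, 'a) mpoly" where
  "mconst c = Poly_Mapping.single 0 c"

definition mvar :: "'i \<Rightarrow> ('i, 'a::zero_neq_one) mpoly" where
  "mvar i = Poly_Mapping.single (Poly_Mapping.single i 1) 1"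

definition meval :: "('i::finite, 'a::comm_ring_1) mpoly \<Rightarrow> ('i \<Rightarrow> 'a) \<Rightarrow> 'a" where
  "meval p x = (\<Sum>m\<in>Poly_Mapping.keys p.
     Poly_Mapping.lookup p m * (\<Prod>i\<in>UNIV. x i ^ Poly_Mapping.lookup m i))"

definition msubst ::
    "('j::finite, 'a::comm_ring_1) mpoly \<Rightarrow> ('j \<Rightarrow> ('i, 'a) mpoly) \<Rightarrow> ('i, 'a) mpoly" where
  "msubst p F = (\<Sum>m\<in>Poly_Mapping.keys p.
     mconst (Poly_Mapping.lookup p m) * (\<Prod>j\<in>UNIV. F j ^ Poly_Mapping.lookup m j))"

definition mdiff :: "'i \<Rightarrow> ('i, 'a::comm_ring_1) mpoly \<Rightarrow> ('i, 'a) mpoly" where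
  "mdiff i p = (\<Sum>m\<in>Poly_Mapping.keys p.
     Poly_Mapping.single (m - Poly_Mapping.single i 1)
       (of_nat (Poly_Mapping.lookup m i) * Poly_Mapping.lookup p m))"

definition homogeneous :: "nat \<Rightarrow> ('i::finite, 'a::zero) mpoly \<Rightarrow> bool" where
  "homogeneous d p \<longleftrightarrow> (\<forall>m\<in>Poly_Mapping.keys p. (\<Sum>i\<in>UNIV. Poly_Mapping.lookup m i) = d)"

definition coeffs_in :: "'a set \<Rightarrow> ('i, 'a::zero) mpoly \<Rightarrow> bool" where
  "coeffs_in S p \<longleftrightarrow> (\<forall>m. Poly_Mapping.lookup p m \<in> S)"

abbreviation mmap :: "('a::zero \<Rightarrow> 'b::zero) \<Rightarrow> ('i, 'a) mpoly \<Rightarrow> ('i, 'b) mpoly" where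
  "mmap \<equiv> Poly_Mapping.map"

abbreviation base_change :: "('i, 'k::field) mpoly \<Rightarrow> ('i, 'k alg_closure) mpoly" where
  "base_change \<equiv> mmap to_ac"


section \<open>Projective space\<close>

definition proportional :: "('i \<Rightarrow> 'a::field) \<Rightarrow> ('i \<Rightarrow> 'a) \<Rightarrow> bool" where
  "proportional x y \<longleftrightarrow> x \<noteq> (\<lambda>_. 0) \<and> (\<exists>c. c \<noteq> 0 \<and> y = (\<lambda>i. c * x i))"

lemma part_equivp_proportional: "part_equivp (proportional :: ('i \<Rightarrow> 'a::field) \<Rightarrow> _)"
proof (rule part_equivpI)
  have "(\<lambda>_::'i. 1::'a) \<noteq> (\<lambda>_. 0)" by (metis one_neq_zero)
  moreover have "(1::'a) \<noteq> 0 \<and> (\<lambda>_::'i. 1::'a) = (\<lambda>i. 1 * 1)" by simp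
  ultimately show "\<exists>x :: 'i \<Rightarrow> 'a. proportional x x"
    unfolding proportional_def by blast
next
  show "symp (proportional :: ('i \<Rightarrow> 'a) \<Rightarrow> _)"
  proof (rule sympI)
    fix x y :: "'i \<Rightarrow> 'a"
    assume "proportional x y"
    then obtain c where c: "x \<noteq> (\<lambda>_. 0)" "c \<noteq> 0" and y: "y = (\<lambda>i. c * x i)"
      unfolding proportional_def by blast
    have "inverse c \<noteq> 0 \<and> x = (\<lambda>i. inverse c * y i)"
      using c by (simp add: y flip: mult.assoc)
    moreover have "y \<noteq> (\<lambda>_. 0)"
    proof
      assume "y = (\<lambda>_. 0)"
      then have "x i = 0" for i
        using c(2) y by (metis mult_eq_0_iff)
      then show False using c(1) by blast
    qed
    ultimately show "proportional y x" unfolding proportional_def by blast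
  qed
next
  show "transp (proportional :: ('i \<Rightarrow> 'a) \<Rightarrow> _)"
  proof (rule transpI)
    fix x y z :: "'i \<Rightarrow> 'a"
    assume "proportional x y" "proportional y z"
    then obtain c d where x: "x \<noteq> (\<lambda>_. 0)" and "c \<noteq> 0" "y = (\<lambda>i. c * x i)" "d \<noteq> 0" "z = (\<lambda>i. d * y i)"
      unfolding proportional_def by blast
    then have "d * c \<noteq> 0 \<and> z = (\<lambda>i. (d * c) * x i)" by (simp add: mult.assoc)
    with x show "proportional x z" unfolding proportional_def by blast
  qed
qed

quotient_type (overloaded) ('i, 'a) proj = "'i \<Rightarrow> 'a::field" / partial: proportional
  by (rule part_equivp_proportional)

definition vanishes :: "('i::finite, 'a::field) mpoly \<Rightarrow> ('i, 'a) proj \<Rightarrow> bool" where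
  "vanishes F P \<longleftrightarrow> meval F (rep_proj P) = 0"

definition zeros :: "('i::finite, 'a::field) mpoly set \<Rightarrow> ('i, 'a) proj set" where
  "zeros S = {P. \<forall>F\<in>S. vanishes F P}"

definition not_identically_zero_on ::
    "('i::finite, 'a::field) proj set \<Rightarrow> ('i, 'a) mpoly \<Rightarrow> bool" where
  "not_identically_zero_on Z F \<longleftrightarrow> (\<exists>P\<in>Z. \<not> vanishes F P)"

definition gal_pt :: "('a::field \<Rightarrow> 'a) \<Rightarrow> ('i, 'a) proj \<Rightarrow> ('i, 'a) proj" where
  "gal_pt \<sigma> P = abs_proj (\<sigma> \<circ> rep_proj P)"

text \<open>The value of \<open>proj_of F\<close> at a common zero of the forms \<open>F j\<close> has no meaning.\<close>

definition proj_of ::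
    "('j \<Rightarrow> ('i::finite, 'a::field) mpoly) \<Rightarrow> ('i, 'a) proj \<Rightarrow> ('j, 'a) proj" where
  "proj_of F P = abs_proj (\<lambda>j. meval (F j) (rep_proj P))"


section \<open>Morphisms and rational functions\<close>

definition local_rep ::
    "'a set \<Rightarrow> ('i::finite, 'a::field) proj set \<Rightarrow> (('i, 'a) proj \<Rightarrow> ('j, 'a) proj) \<Rightarrow>
     ('i, 'a) proj \<Rightarrow> ('j \<Rightarrow> ('i, 'a) mpoly) \<Rightarrow> bool" where
  "local_rep S Z f P F \<longleftrightarrow>
     (\<exists>d. \<forall>j. homogeneous d (F j)) \<and> (\<forall>j. coeffs_in S (F j)) \<and> (\<exists>j. \<not> vanishes (F j) P) \<and>
     (\<forall>Q\<in>Z. (\<exists>j. \<not> vanishes (F j) Q) \<longrightarrow> f Q = proj_of F Q)"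

text \<open>Morphisms given locally by forms with coefficients in \<open>S\<close>; \<open>Z\<close> is meant to be
  irreducible, so that a local representation is valid wherever its forms do not all vanish.\<close>

definition morphism_over ::
    "'a set \<Rightarrow> ('i::finite, 'a::field) proj set \<Rightarrow> ('j::finite, 'a) proj set \<Rightarrow>
     (('i, 'a) proj \<Rightarrow> ('j, 'a) proj) \<Rightarrow> bool" where
  "morphism_over S Z Y f \<longleftrightarrow> (\<forall>P\<in>Z. f P \<in> Y \<and> (\<exists>F. local_rep S Z f P F))"

definition iso_over ::
    "'a set \<Rightarrow> ('i::finite, 'a::field) proj set \<Rightarrow> ('j::finite, 'a) proj set \<Rightarrow>
     (('i, 'a) proj \<Rightarrow> ('j, 'a) proj) \<Rightarrow> bool" where
  "iso_over S Z Y f \<longleftrightarrow> morphism_over S Z Y f \<and>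
     (\<exists>g. morphism_over S Y Z g \<and> (\<forall>P\<in>Z. g (f P) = P) \<and> (\<forall>Q\<in>Y. f (g Q) = Q))"

text \<open>A rational function on a curve is represented by a function on its points, two such
  functions being identified if they agree outside a finite set of points.\<close>

definition form_quot ::
    "('i::finite, 'a::field) mpoly \<Rightarrow> ('i, 'a) mpoly \<Rightarrow> ('i, 'a) proj \<Rightarrow> 'a" where
  "form_quot p q P = meval p (rep_proj P) / meval q (rep_proj P)"

definition ae_eq :: "'p set \<Rightarrow> ('p \<Rightarrow> 'a) \<Rightarrow> ('p \<Rightarrow> 'a) \<Rightarrow> bool" where
  "ae_eq Z r s \<longleftrightarrow> finite {P\<in>Z. r P \<noteq> s P}"

definition rational_fun ::
    "'a set \<Rightarrow> ('i::finite, 'a::field) proj set \<Rightarrow> (('i, 'a) proj \<Rightarrow> 'a) \<Rightarrow> bool" where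
  "rational_fun S Z r \<longleftrightarrow>
     (\<exists>d p q. homogeneous d p \<and> homogeneous d q \<and> coeffs_in S p \<and> coeffs_in S q \<and>
        not_identically_zero_on Z q \<and> ae_eq Z r (form_quot p q))"

text \<open>\<open>S(D) = S(C)(\<surd>r)\<close>, where \<open>S(C)\<close> is embedded in \<open>S(D)\<close> by composition with \<open>\<pi>\<close>.\<close>

definition function_field_sqrt ::
    "'a set \<Rightarrow> ('i::finite, 'a::field) proj set \<Rightarrow> ('j::finite, 'a) proj set \<Rightarrow>
     (('i, 'a) proj \<Rightarrow> ('j, 'a) proj) \<Rightarrow> (('j, 'a) proj \<Rightarrow> 'a) \<Rightarrow> bool" where
  "function_field_sqrt S D C \<pi> r \<longleftrightarrow>
     (\<exists>g. rational_fun S D g \<and> ae_eq D (\<lambda>P. (g P)\<^sup>2) (r \<circ> \<pi>) \<and>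
        (\<forall>s. rational_fun S D s \<longrightarrow>
           (\<exists>a b. rational_fun S C a \<and> rational_fun S C b \<and>
              ae_eq D s (\<lambda>P. a (\<pi> P) + b (\<pi> P) * g P))))"


section \<open>Divisors on non-singular curves\<close>

text \<open>\<open>point_power P n\<close> is the \<open>n\<close>-th power of the homogeneous ideal of \<open>P\<close>.\<close>

inductive_set point_power :: "('i::finite, 'a::field) proj \<Rightarrow> nat \<Rightarrow> ('i, 'a) mpoly set"
  for P :: "('i, 'a) proj" and n :: nat where
  prod: "(\<And>k. k < n \<Longrightarrow> \<exists>d. homogeneous d (l k)) \<Longrightarrow> (\<And>k. k < n \<Longrightarrow> vanishes (l k) P) \<Longrightarrow>
     u * (\<Prod>k<n. l k) \<in> point_power P n"
| add: "p \<in> point_power P n \<Longrightarrow> q \<in> point_power P n \<Longrightarrow> p + q \<in> point_power P n"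

text \<open>The form \<open>F\<close> has order at least \<open>n\<close> at \<open>P\<close> if it lies in the \<open>n\<close>-th power of the maximal
  ideal of the local ring at \<open>P\<close>, after division by a form of the same degree not vanishing
  at \<open>P\<close>. Clearing denominators, this says that \<open>U * F\<close> agrees on the affine cone over \<open>Z\<close>
  with an element of \<open>point_power P n\<close>, for some form \<open>U\<close> not vanishing at \<open>P\<close>.\<close>

definition order_ge ::
    "('i::finite, 'a::field) proj set \<Rightarrow> ('i, 'a) proj \<Rightarrow> ('i, 'a) mpoly \<Rightarrow> nat \<Rightarrow> bool" where
  "order_ge Z P F n \<longleftrightarrow>
     (\<exists>d U. homogeneous d U \<and> \<not> vanishes U P \<and>
        (\<exists>M\<in>point_power P n. \<forall>x. x \<noteq> (\<lambda>_. 0) \<and> abs_proj x \<in> Z \<longrightarrow> meval (U * F) x = meval M x))"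

definition order_at ::
    "('i::finite, 'a::field) proj set \<Rightarrow> ('i, 'a) proj \<Rightarrow> ('i, 'a) mpoly \<Rightarrow> nat" where
  "order_at Z P F = (GREATEST n. order_ge Z P F n)"

text \<open>Divisors are elements of the free abelian group on points. In the next definition the
  argument of \<open>Abs_poly_mapping\<close> has finite support if \<open>Z\<close> is an irreducible curve and \<open>F\<close> a form
  that is not identically zero on \<open>Z\<close>.\<close>

type_synonym ('i, 'a) divisor = "('i, 'a) proj \<Rightarrow>\<^sub>0 int"

definition form_div ::
    "('i::finite, 'a::field) proj set \<Rightarrow> ('i, 'a) mpoly \<Rightarrow> ('i, 'a) divisor" where
  "form_div Z F = Abs_poly_mapping (\<lambda>P. if P \<in> Z then int (order_at Z P F) else 0)"

definition div_degree :: "('i, 'a::field) divisor \<Rightarrow> int" where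
  "div_degree d = (\<Sum>P\<in>Poly_Mapping.keys d. Poly_Mapping.lookup d P)"

definition lin_equiv ::
    "('i::finite, 'a::field) proj set \<Rightarrow> ('i, 'a) divisor \<Rightarrow> ('i, 'a) divisor \<Rightarrow> bool" where
  "lin_equiv Z d e \<longleftrightarrow> Poly_Mapping.keys d \<subseteq> Z \<and> Poly_Mapping.keys e \<subseteq> Z \<and>
     (\<exists>n F G. homogeneous n F \<and> homogeneous n G \<and>
        not_identically_zero_on Z F \<and> not_identically_zero_on Z G \<and>
        d - e = form_div Z F - form_div Z G)"

definition ram_index ::
    "('i::finite, 'a::field) proj set \<Rightarrow> ('j::finite, 'a) proj set \<Rightarrow>
     (('i, 'a) proj \<Rightarrow> ('j, 'a) proj) \<Rightarrow> ('i, 'a) proj \<Rightarrow> nat" where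
  "ram_index Z Y f P = (THE e. \<exists>F n t. local_rep UNIV Z f P F \<and> homogeneous n t \<and>
     not_identically_zero_on Y t \<and> order_at Y (f P) t = 1 \<and> e = order_at Z P (msubst t F))"

definition pullback_div ::
    "('i::finite, 'a::field) proj set \<Rightarrow> ('j::finite, 'a) proj set \<Rightarrow>
     (('i, 'a) proj \<Rightarrow> ('j, 'a) proj) \<Rightarrow> ('j, 'a) divisor \<Rightarrow> ('i, 'a) divisor" where
  "pullback_div Z Y f d = Abs_poly_mapping
     (\<lambda>P. if P \<in> Z then int (ram_index Z Y f P) * Poly_Mapping.lookup d (f P) else 0)"

definition push_div ::
    "(('i, 'a::field) proj \<Rightarrow> ('j, 'a) proj) \<Rightarrow> ('i, 'a) divisor \<Rightarrow> ('j, 'a) divisor" where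
  "push_div f d = frag_extend (\<lambda>P. frag_of (f P)) d"


section \<open>Elliptic curves, isogenies and Jacobians of genus one curves\<close>

definition weierstrass_form :: "'a::comm_ring_1 \<times> 'a \<times> 'a \<times> 'a \<times> 'a \<Rightarrow> (3, 'a) mpoly" where
  "weierstrass_form = (\<lambda>(a1, a2, a3, a4, a6).
     (let x = mvar 1; y = mvar 2; z = mvar 3 in
        y\<^sup>2 * z + mconst a1 * x * y * z + mconst a3 * y * z\<^sup>2
        - x ^ 3 - mconst a2 * x\<^sup>2 * z - mconst a4 * x * z\<^sup>2 - mconst a6 * z ^ 3))"

definition elliptic_curve ::
    "'k \<times> 'k \<times> 'k \<times> 'k \<times> 'k \<Rightarrow> (3, 'k::field alg_closure) proj set \<Rightarrow> bool" where
  "elliptic_curve a E \<longleftrightarrow> E = zeros {base_change (weierstrass_form a)} \<and>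
     (\<forall>P\<in>E. \<exists>j. \<not> vanishes (mdiff j (base_change (weierstrass_form a))) P)"

definition pt_inf :: "(3, 'a::field) proj" where
  "pt_inf = abs_proj (\<lambda>i. if i = 2 then 1 else 0)"

definition ell_add ::
    "(3, 'a::field) proj set \<Rightarrow> (3, 'a) proj \<Rightarrow> (3, 'a) proj \<Rightarrow> (3, 'a) proj" where
  "ell_add E P Q =
     (THE R. R \<in> E \<and> lin_equiv E (frag_of P + frag_of Q) (frag_of R + frag_of pt_inf))"

definition isogeny_over ::
    "'a set \<Rightarrow> (3, 'a::field) proj set \<Rightarrow> (3, 'a) proj set \<Rightarrow>
     ((3, 'a) proj \<Rightarrow> (3, 'a) proj) \<Rightarrow> bool" where
  "isogeny_over S E E' \<phi> \<longleftrightarrow> morphism_over S E E' \<phi> \<and> \<phi> pt_inf = pt_inf"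

definition isogeny_kernel ::
    "(3, 'a::field) proj set \<Rightarrow> ((3, 'a) proj \<Rightarrow> (3, 'a) proj) \<Rightarrow> (3, 'a) proj set" where
  "isogeny_kernel E \<phi> = {P\<in>E. \<phi> P = pt_inf}"

text \<open>The dual of an isogeny of degree 2 is the isogeny whose composition with it is
  multiplication by 2. In characteristic 0 the degree is the order of the kernel.\<close>

definition dual_two_isogenies ::
    "'a set \<Rightarrow> (3, 'a::field) proj set \<Rightarrow> (3, 'a) proj set \<Rightarrow>
     ((3, 'a) proj \<Rightarrow> (3, 'a) proj) \<Rightarrow> ((3, 'a) proj \<Rightarrow> (3, 'a) proj) \<Rightarrow> bool" where
  "dual_two_isogenies S E E' \<phi> \<phi>' \<longleftrightarrow>
     isogeny_over S E E' \<phi> \<and> card (isogeny_kernel E \<phi>) = 2 \<and>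
     isogeny_over S E' E \<phi>' \<and> (\<forall>P\<in>E. \<phi>' (\<phi> P) = ell_add E P P)"

text \<open>\<open>E\<close> is the Jacobian of \<open>Z\<close>: \<open>\<alpha>\<close> is a geometric isomorphism which differs from each of its
  Galois conjugates by a translation of \<open>E\<close>. The induced identification of \<open>Pic\<^sup>0(Z)\<close> with
  \<open>Pic\<^sup>0(E)\<close>, hence with \<open>E\<close>, is then Galois equivariant.\<close>

definition jacobian_iso ::
    "('i::finite, 'k::field alg_closure) proj set \<Rightarrow> (3, 'k alg_closure) proj set \<Rightarrow>
     (('i, 'k alg_closure) proj \<Rightarrow> (3, 'k alg_closure) proj) \<Rightarrow> bool" where
  "jacobian_iso Z E \<alpha> \<longleftrightarrow> iso_over UNIV Z E \<alpha> \<and>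
     (\<forall>\<sigma>\<in>galois_group. \<exists>S\<in>E. \<forall>P\<in>Z. gal_pt \<sigma> (\<alpha> P) = ell_add E (\<alpha> (gal_pt \<sigma> P)) S)"

text \<open>The divisor \<open>d\<close> on \<open>Z\<close> represents \<open>T\<close> under the identification of \<open>Pic\<^sup>0(Z)\<close> with \<open>E\<close>
  given by \<open>\<alpha>\<close>; the point \<open>T\<close> of \<open>E\<close> corresponds to the class of \<open>(T) - (0)\<close>.\<close>

definition represents ::
    "('i::finite, 'a::field) proj set \<Rightarrow> (3, 'a) proj set \<Rightarrow> (('i, 'a) proj \<Rightarrow> (3, 'a) proj) \<Rightarrow>
     ('i, 'a) divisor \<Rightarrow> (3, 'a) proj \<Rightarrow> bool" where
  "represents Z E \<alpha> d T \<longleftrightarrow> Poly_Mapping.keys d \<subseteq> Z \<and> div_degree d = 0 \<and>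
     lin_equiv E (push_div \<alpha> d) (frag_of T - frag_of pt_inf)"

text \<open>\<open>\<pi> : D \<rightarrow> C\<close> is a twist of the isogeny \<open>\<phi>' : E' \<rightarrow> E\<close>, compatibly with the
  identification \<open>\<alpha>\<close>; the isomorphism \<open>\<beta>\<close> identifies \<open>Pic\<^sup>0(D)\<close> with \<open>E'\<close>.\<close>

definition isogeny_covering ::
    "('i::finite, 'k::field alg_closure) proj set \<Rightarrow> ('j::finite, 'k alg_closure) proj set \<Rightarrow>
     (('i, 'k alg_closure) proj \<Rightarrow> ('j, 'k alg_closure) proj) \<Rightarrow>
     (3, 'k alg_closure) proj set \<Rightarrow>
     ((3, 'k alg_closure) proj \<Rightarrow> (3, 'k alg_closure) proj) \<Rightarrow>
     (('j, 'k alg_closure) proj \<Rightarrow> (3, 'k alg_closure) proj) \<Rightarrow>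
     (('i, 'k alg_closure) proj \<Rightarrow> (3, 'k alg_closure) proj) \<Rightarrow> bool" where
  "isogeny_covering D C \<pi> E' \<phi>' \<alpha> \<beta> \<longleftrightarrow> morphism_over base_field D C \<pi> \<and>
     jacobian_iso D E' \<beta> \<and> (\<forall>P\<in>D. \<phi>' (\<beta> P) = \<alpha> (\<pi> P))"


section \<open>Intersections of two quadrics and the associated conics\<close>

definition quadric_intersection ::
    "(4, 'k::field) mpoly \<Rightarrow> (4, 'k) mpoly \<Rightarrow> (4, 'k alg_closure) proj set" where
  "quadric_intersection A B = zeros {base_change A, base_change B}"

definition nonsingular_pair :: "(4, 'k::field) mpoly \<Rightarrow> (4, 'k) mpoly \<Rightarrow> bool" where
  "nonsingular_pair A B \<longleftrightarrow> homogeneous 2 A \<and> homogeneous 2 B \<and>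
     (\<forall>P\<in>quadric_intersection A B. \<forall>a b.
        (\<forall>j. a * meval (mdiff j (base_change A)) (rep_proj P)
            + b * meval (mdiff j (base_change B)) (rep_proj P) = 0) \<longrightarrow> a = 0 \<and> b = 0)"

definition singular_member ::
    "(4, 'k::field) mpoly \<Rightarrow> (4, 'k) mpoly \<Rightarrow> (4, 'k alg_closure) mpoly \<Rightarrow> bool" where
  "singular_member A B q \<longleftrightarrow> q \<noteq> 0 \<and>
     (\<exists>a b. q = mconst a * base_change A + mconst b * base_change B) \<and>
     (\<exists>V. \<forall>j. vanishes (mdiff j q) V)"

definition singular_quadrics ::
    "(4, 'k::field) mpoly \<Rightarrow> (4, 'k) mpoly \<Rightarrow> (4 \<Rightarrow> (4, 'k alg_closure) mpoly) \<Rightarrow> bool" where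
  "singular_quadrics A B Q \<longleftrightarrow> (\<forall>i. singular_member A B (Q i)) \<and>
     (\<forall>q. singular_member A B q \<longrightarrow> (\<exists>!i. \<exists>c. q = mconst c * Q i))"

text \<open>\<open>L 1, L 2, L 3\<close> are linear forms whose only common zero is the vertex of the cone \<open>q = 0\<close>.
  They give the projection from the vertex, and \<open>G = 0\<close> is the conic over which \<open>q = 0\<close> is
  a cone.\<close>

definition cone_over ::
    "(4, 'a::field) mpoly \<Rightarrow> (3 \<Rightarrow> (4, 'a) mpoly) \<Rightarrow> (3, 'a) mpoly \<Rightarrow> bool" where
  "cone_over q L G \<longleftrightarrow> (\<forall>j. homogeneous 1 (L j)) \<and> homogeneous 2 G \<and> q = msubst G L \<and>
     (\<forall>P. (\<forall>j. vanishes (L j) P) \<longleftrightarrow> (\<forall>j. vanishes (mdiff j q) P))"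

text \<open>\<open>\<sigma>\<close> permutes the conics, with their projections, as \<open>\<tau>\<close> permutes the indices. The models of
  conjugate conics are thus taken to be conjugate, and a conic fixed by the Galois group is
  given over the base field.\<close>

definition acts_as ::
    "(4 \<Rightarrow> 3 \<Rightarrow> (4, 'a::field) mpoly) \<Rightarrow> (4 \<Rightarrow> (3, 'a) mpoly) \<Rightarrow> ('a \<Rightarrow> 'a) \<Rightarrow> (4 \<Rightarrow> 4) \<Rightarrow> bool" where
  "acts_as L G \<sigma> \<tau> \<longleftrightarrow> (\<forall>i. (\<forall>j. L (\<tau> i) j = mmap \<sigma> (L i j)) \<and> G (\<tau> i) = mmap \<sigma> (G i))"

definition pair_perms :: "(4 \<Rightarrow> 4) set" where
  "pair_perms = {id, transpose 1 2, transpose 3 4, transpose 1 2 \<circ> transpose 3 4}"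

text \<open>A pair of points on the conics \<open>i\<close> and \<open>j\<close>, both rational if the conics are and
  conjugate if the conics are conjugate.\<close>

definition rational_pair ::
    "(4 \<Rightarrow> 3 \<Rightarrow> (4, 'k::field alg_closure) mpoly) \<Rightarrow> (4 \<Rightarrow> (3, 'k alg_closure) mpoly) \<Rightarrow>
     4 \<Rightarrow> 4 \<Rightarrow> (4 \<Rightarrow> (3, 'k alg_closure) proj) \<Rightarrow> bool" where
  "rational_pair L G i j p \<longleftrightarrow> (\<forall>n\<in>{i, j}. p n \<in> zeros {G n}) \<and>
     (\<forall>\<sigma>\<in>galois_group. \<forall>\<tau>\<in>pair_perms. acts_as L G \<sigma> \<tau> \<longrightarrow>
        (\<forall>n\<in>{i, j}. p (\<tau> n) = gal_pt \<sigma> (p n)))"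

definition tangent_form ::
    "(3 \<Rightarrow> (4, 'a::field) mpoly) \<Rightarrow> (3, 'a) mpoly \<Rightarrow> (3, 'a) proj \<Rightarrow> (4, 'a) mpoly" where
  "tangent_form L G p = (\<Sum>j\<in>UNIV. mconst (meval (mdiff j G) (rep_proj p)) * L j)"

text \<open>\<open>f = \<ell>\<^sub>i \<ell>\<^sub>j\<close>, where the linear forms \<open>\<ell>\<^sub>i\<close>, \<open>\<ell>\<^sub>j\<close> are only determined up to scaling;
  \<open>f\<close> itself has coefficients in the base field.\<close>

definition tangent_product ::
    "(4 \<Rightarrow> 3 \<Rightarrow> (4, 'k::field alg_closure) mpoly) \<Rightarrow> (4 \<Rightarrow> (3, 'k alg_closure) mpoly) \<Rightarrow>
     4 \<Rightarrow> 4 \<Rightarrow> (4 \<Rightarrow> (3, 'k alg_closure) proj) \<Rightarrow> (4, 'k) mpoly \<Rightarrow> bool" where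
  "tangent_product L G i j p f \<longleftrightarrow>
     (\<exists>c. c \<noteq> 0 \<and> base_change f =
        mconst c * tangent_form (L i) (G i) (p i) * tangent_form (L j) (G j) (p j))"

definition parametrises :: "(3 \<Rightarrow> (2, 'a::field) mpoly) \<Rightarrow> (3, 'a) mpoly \<Rightarrow> bool" where
  "parametrises R G \<longleftrightarrow> (\<forall>j. homogeneous 2 (R j)) \<and> (\<forall>P. \<exists>j. \<not> vanishes (R j) P) \<and>
     iso_over UNIV UNIV (zeros {G}) (proj_of R)"

definition lin_pair :: "(2 \<Rightarrow> (4, 'a::field) mpoly) \<Rightarrow> (4 \<Rightarrow> 'a) \<Rightarrow> 2 \<Rightarrow> 'a" where
  "lin_pair M w = (\<lambda>k. meval (M k) w)"

text \<open>The parameters on the conics \<open>i\<close> and \<open>j\<close> are pairs \<open>M i\<close>, \<open>M j\<close> of linear forms which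
  together are coordinates on \<open>\<P>\<^sup>3\<close>. If the conics are defined over the base field, then so
  are these coordinates; if the conics are conjugate then the pairs are conjugate, as are the
  parametrisations, so that the construction descends to the base field. Eliminating \<open>x\<close> from
  \<open>L i (x) = R i (M i (w))\<close> and \<open>L j (x) = R j (M j (w))\<close> leaves two quadrics in \<open>w\<close>, which
  define \<open>D\<close>, and \<open>\<pi>\<close> maps \<open>w\<close> to \<open>x\<close>.\<close>

definition lifts ::
    "(4 \<Rightarrow> 3 \<Rightarrow> (4, 'a::field) mpoly) \<Rightarrow> 4 \<Rightarrow> 4 \<Rightarrow> (4 \<Rightarrow> 3 \<Rightarrow> (2, 'a) mpoly) \<Rightarrow>
     (4 \<Rightarrow> 2 \<Rightarrow> (4, 'a) mpoly) \<Rightarrow> (4 \<Rightarrow> 'a) \<Rightarrow> (4 \<Rightarrow> 'a) \<Rightarrow> bool" where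
  "lifts L i j R M w x \<longleftrightarrow> w \<noteq> (\<lambda>_. 0) \<and>
     (\<forall>n\<in>{i, j}. \<forall>k. meval (L n k) x = meval (R n k) (lin_pair (M n) w))"

definition conic_covering ::
    "(4 \<Rightarrow> 3 \<Rightarrow> (4, 'k::field alg_closure) mpoly) \<Rightarrow> (4 \<Rightarrow> (3, 'k alg_closure) mpoly) \<Rightarrow> 4 \<Rightarrow> 4 \<Rightarrow>
     (4 \<Rightarrow> 3 \<Rightarrow> (2, 'k alg_closure) mpoly) \<Rightarrow> (4 \<Rightarrow> 2 \<Rightarrow> (4, 'k alg_closure) mpoly) \<Rightarrow>
     (4, 'k alg_closure) proj set \<Rightarrow>
     ((4, 'k alg_closure) proj \<Rightarrow> (4, 'k alg_closure) proj) \<Rightarrow> bool" where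
  "conic_covering L G i j R M D \<pi> \<longleftrightarrow>
     (\<forall>n\<in>{i, j}. parametrises (R n) (G n) \<and> (\<forall>k. homogeneous 1 (M n k))) \<and>
     (\<nexists>P. \<forall>n\<in>{i, j}. \<forall>k. vanishes (M n k) P) \<and>
     (\<forall>\<sigma>\<in>galois_group. \<forall>\<tau>\<in>pair_perms. acts_as L G \<sigma> \<tau> \<longrightarrow>
        (\<forall>n\<in>{i, j}. (\<forall>k. R (\<tau> n) k = mmap \<sigma> (R n k)) \<and> (\<forall>k. M (\<tau> n) k = mmap \<sigma> (M n k)))) \<and>
     (\<exists>A B. nonsingular_pair A B \<and> D = quadric_intersection A B) \<and>
     D = {abs_proj w | w. \<exists>x. lifts L i j R M w x} \<and>
     (\<forall>w x. lifts L i j R M w x \<longrightarrow> \<pi> (abs_proj w) = abs_proj x)"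

end

theory Submission
  imports Defs
begin

text \<open>
  Over the algebraic closure the pencil defining \<open>C\<close> is diagonal in coordinates \<open>\<xi>\<^sub>1, \<dots>, \<xi>\<^sub>4\<close>, and
  the parameters \<open>u\<close>, \<open>v\<close> on two of the conics are coordinates in which \<open>D\<close> is diagonal as well. The
  involution \<open>\<iota>\<close> of \<open>D\<close> over \<open>C\<close> is \<open>(u, v) \<mapsto> (u, -v)\<close>, and translation by \<open>T'\<close> on \<open>E'\<close> relates the
  two points of a fibre of \<open>\<pi>\<close>. So it suffices that \<open>H - H\<^sup>\<dagger>\<close> is equivalent to \<open>\<iota>(w) - w\<close> for one,
  equivalently every, point \<open>w\<close>. By Riemann--Roch for planes it is equivalent to \<open>w' - w\<close> for some
  \<open>w'\<close>; applying the norm to \<open>C\<close> gives \<open>\<pi>(w') \<sim> \<pi>(w)\<close>, hence \<open>\<pi>(w') = \<pi>(w)\<close>. If \<open>w' = w\<close>, then the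
  plane section \<open>H\<^sup>\<dagger>\<close> of \<open>D\<close> would be invariant under \<open>\<iota>\<close>, hence the pullback of a fibre of \<open>\<nu>\<^sub>1\<close> or
  \<open>\<nu>\<^sub>2\<close> as well as of \<open>\<nu>\<^sub>3\<close>, and these fibres are pairwise inequivalent.

  Orders of vanishing are computed with explicit uniformizers. On a diagonal intersection of two
  quadrics, the norm of a form to one of the conics is a binary form; it splits into tangent planes
  to the cone, whose divisors are explicit. This gives Bezout's theorem, and replaces the general
  theory of divisors on curves.
\<close>

section \<open>Polynomials as functions\<close>

text \<open>That distinct points of the curve are never equivalent is obtained without a notion of
  genus. A function with divisor \<open>P - Q\<close> takes every value, so its zero can be moved
  anywhere, and \<open>z - z'\<close> would be principal for two ramification points of one
  projection. This divisor is symmetric under the reflection belonging to that projection, so the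
  function is even or odd, and its orders at all four ramification points have the same parity; but
  they are 1 at \<open>z\<close> and 0 at a third one.

  Riemann-Roch enters only as a count: three conditions on the four-dimensional space of planes
  leave a plane. The group law of \<open>E'\<close> is avoided by taking for the two points of a
  fibre the preimages of \<open>0\<close> and \<open>T'\<close> under \<open>\<beta>\<close>.

  The curve \<open>E'\<close> is reached only through the abstract isomorphism
  \<open>\<beta>\<close>. Divisors are carried there by substituting one local formula for the
  inverse of \<open>\<beta>\<close>. Such a formula has base points, but at each point they shift
  the order by an amount proportional to the degree of the form, and this cancels in a quotient of
  two forms of the same degree.\<close>

lemma mpoly_sum_singles: "p = (\<Sum>m\<in>Poly_Mapping.keys p. Poly_Mapping.single m (Poly_Mapping.lookup p m))"
proof (rule poly_mapping_eqI)
  fix k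
  have "(\<Sum>m\<in>Poly_Mapping.keys p. Poly_Mapping.lookup (Poly_Mapping.single m (Poly_Mapping.lookup p m)) k)
      = (\<Sum>m\<in>Poly_Mapping.keys p. if m = k then Poly_Mapping.lookup p m else 0)"
    by (rule sum.cong) (auto simp: lookup_single when_def)
  also have "\<dots> = Poly_Mapping.lookup p k"
    by (simp add: in_keys_iff)
  finally show "Poly_Mapping.lookup p k =
      Poly_Mapping.lookup (\<Sum>m\<in>Poly_Mapping.keys p. Poly_Mapping.single m (Poly_Mapping.lookup p m)) k"
    by (simp add: lookup_sum)
qed

lemma mpoly_induct [case_names zero single add]:
  fixes p :: "('i, 'a::comm_ring_1) mpoly"
  assumes "P 0" "\<And>m c. P (Poly_Mapping.single m c)" "\<And>p q. P p \<Longrightarrow> P q \<Longrightarrow> P (p + q)"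
  shows "P p"
proof -
  have "P (\<Sum>m\<in>S. Poly_Mapping.single m (Poly_Mapping.lookup p m))" if "finite S" for S
    using that by (induction S) (auto intro: assms)
  then show ?thesis
    using mpoly_sum_singles[of p] finite_keys by metis
qed

lemma meval_superset:
  assumes "finite S" "Poly_Mapping.keys p \<subseteq> S"
  shows "meval p x = (\<Sum>m\<in>S. Poly_Mapping.lookup p m * (\<Prod>i\<in>UNIV. x i ^ Poly_Mapping.lookup m i))"
  unfolding meval_def using assms
  by (intro sum.mono_neutral_left) (auto simp: in_keys_iff)

lemma meval_0 [simp]: "meval 0 x = 0"
  by (simp add: meval_def)

lemma meval_single [simp]:
  "meval (Poly_Mapping.single m c) x = c * (\<Prod>i\<in>UNIV. x i ^ Poly_Mapping.lookup m i)"
  by (subst meval_superset[of "{m}"]) auto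

lemma meval_add [simp]: "meval (p + q) x = meval p x + meval q x"
proof -
  let ?S = "Poly_Mapping.keys p \<union> Poly_Mapping.keys q"
  have "Poly_Mapping.keys (p + q) \<subseteq> ?S" by (rule keys_add)
  then show ?thesis
    by (simp add: meval_superset[of ?S] lookup_add distrib_right sum.distrib)
qed

lemma meval_sum [simp]: "meval (sum f S) x = (\<Sum>i\<in>S. meval (f i) x)"
  by (induction S rule: infinite_finite_induct) auto

lemma meval_uminus [simp]: "meval (- p) x = - meval p x"
  using meval_add[of p "- p" x] by (simp add: eq_neg_iff_add_eq_0 add.commute del: meval_add)

lemma meval_minus [simp]: "meval (p - q) x = meval p x - meval q x"
  using meval_add[of p "- q" x] by (simp del: meval_add)

lemma meval_mult [simp]: "meval (p * q) x = meval p x * meval q x"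
proof (induction p rule: mpoly_induct)
  case (single m c)
  show ?case
    by (induction q rule: mpoly_induct)
      (auto simp: mult_single lookup_add power_add prod.distrib algebra_simps)
qed (auto simp: algebra_simps)

lemma meval_mconst [simp]: "meval (mconst c) x = c"
  by (simp add: mconst_def)

lemma meval_1 [simp]: "meval 1 x = 1"
  using meval_mconst[of 1 x] by (simp add: mconst_def del: meval_single)

lemma meval_power [simp]: "meval (p ^ n) x = meval p x ^ n"
  by (induction n) auto

lemma meval_prod [simp]: "meval (prod f S) x = (\<Prod>i\<in>S. meval (f i) x)"
  by (induction S rule: infinite_finite_induct) auto

lemma prod_power_single:
  "(\<Prod>j\<in>UNIV. (x j :: 'a::comm_ring_1) ^ Poly_Mapping.lookup (Poly_Mapping.single (i::'i::finite) 1) j) = x i"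
proof -
  have "(\<Prod>j\<in>UNIV. x j ^ Poly_Mapping.lookup (Poly_Mapping.single i 1) j)
      = (\<Prod>j\<in>UNIV. if j = i then x j else 1)"
    by (intro prod.cong) (auto simp: lookup_single when_def)
  then show ?thesis by simp
qed

lemma meval_mvar [simp]: "meval (mvar i) x = x i"
  using prod_power_single[of x i] by (simp add: mvar_def)

lemma meval_msubst [simp]: "meval (msubst p F) x = meval p (\<lambda>j. meval (F j) x)"
  unfolding msubst_def by (simp add: meval_def[of p])

lemma homogeneous_0 [simp]: "homogeneous d 0"
  by (simp add: homogeneous_def)

lemma homogeneous_mconst [simp]: "homogeneous 0 (mconst c)"
  by (auto simp: homogeneous_def mconst_def)

lemma homogeneous_1 [simp]: "homogeneous 0 (1 :: ('i::finite, 'a::comm_ring_1) mpoly)"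
  by (auto simp: homogeneous_def)

lemma homogeneous_mvar [simp]: "homogeneous 1 (mvar i :: ('i::finite, 'a::comm_ring_1) mpoly)"
  by (auto simp: homogeneous_def mvar_def lookup_single when_def)

lemma homogeneous_mvar' [simp]: "homogeneous (Suc 0) (mvar i :: ('i::finite, 'a::comm_ring_1) mpoly)"
  using homogeneous_mvar by (metis One_nat_def)

lemma homogeneous_add: "homogeneous d p \<Longrightarrow> homogeneous d q \<Longrightarrow> homogeneous d (p + q)"
  unfolding homogeneous_def using keys_add[of p q] by blast

lemma homogeneous_uminus: "homogeneous d p \<Longrightarrow> homogeneous d (- p :: ('i::finite, 'a::comm_ring_1) mpoly)"
  by (auto simp: homogeneous_def in_keys_iff)

lemma homogeneous_diff:
  "homogeneous d p \<Longrightarrow> homogeneous d q \<Longrightarrow> homogeneous d (p - q :: ('i::finite, 'a::comm_ring_1) mpoly)"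
  using homogeneous_add[OF _ homogeneous_uminus] by fastforce

lemma homogeneous_mult:
  fixes p q :: "('i::finite, 'a::comm_ring_1) mpoly"
  assumes "homogeneous d p" "homogeneous e q"
  shows "homogeneous (d + e) (p * q)"
  unfolding homogeneous_def
proof
  fix m assume "m \<in> Poly_Mapping.keys (p * q)"
  then obtain a b where "a \<in> Poly_Mapping.keys p" "b \<in> Poly_Mapping.keys q" "m = a + b"
    using keys_mult by blast
  then show "(\<Sum>i\<in>UNIV. Poly_Mapping.lookup m i) = d + e"
    using assms by (auto simp: homogeneous_def lookup_add sum.distrib)
qed

lemma homogeneous_mult': "homogeneous d p \<Longrightarrow> homogeneous e q \<Longrightarrow> n = d + e \<Longrightarrow>
   homogeneous n (p * q :: ('i::finite, 'a::comm_ring_1) mpoly)"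
  using homogeneous_mult by blast

lemma homogeneous_cmult: "homogeneous d p \<Longrightarrow> homogeneous d (mconst c * p :: ('i::finite, 'a::comm_ring_1) mpoly)"
  using homogeneous_mult[OF homogeneous_mconst] by fastforce

lemma homogeneous_sum:
  "(\<And>i. i \<in> S \<Longrightarrow> homogeneous d (f i)) \<Longrightarrow>
   homogeneous d (sum f S :: ('i::finite, 'a::comm_ring_1) mpoly)"
  by (induction S rule: infinite_finite_induct) (auto intro: homogeneous_add)

lemma homogeneous_power:
  "homogeneous d p \<Longrightarrow> homogeneous (d * n) (p ^ n :: ('i::finite, 'a::comm_ring_1) mpoly)"
  by (induction n) (auto intro: homogeneous_mult')

lemma homogeneous_square:
  "homogeneous d p \<Longrightarrow> homogeneous (d + d) (p\<^sup>2 :: ('i::finite, 'a::comm_ring_1) mpoly)"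
  by (simp add: power2_eq_square homogeneous_mult)

lemma homogeneous_prod:
  "(\<And>i. i \<in> S \<Longrightarrow> homogeneous (d i) (f i)) \<Longrightarrow>
   homogeneous (sum d S) (prod f S :: ('i::finite, 'a::comm_ring_1) mpoly)"
  by (induction S rule: infinite_finite_induct) (auto intro: homogeneous_mult)

lemma homogeneous_msubst:
  fixes p :: "('j::finite, 'a::comm_ring_1) mpoly" and F :: "'j \<Rightarrow> ('i::finite, 'a) mpoly"
  assumes "homogeneous d p" "\<And>j. homogeneous e (F j)"
  shows "homogeneous (e * d) (msubst p F)"
  unfolding msubst_def
proof (rule homogeneous_sum)
  fix m assume "m \<in> Poly_Mapping.keys p"
  then have m: "(\<Sum>j\<in>UNIV. Poly_Mapping.lookup m j) = d"
    using assms(1) by (auto simp: homogeneous_def)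
  have "homogeneous (\<Sum>j\<in>UNIV. e * Poly_Mapping.lookup m j)
      (\<Prod>j\<in>UNIV. F j ^ Poly_Mapping.lookup m j)"
    using assms(2) by (intro homogeneous_prod homogeneous_power)
  then show "homogeneous (e * d)
      (mconst (Poly_Mapping.lookup p m) * (\<Prod>j\<in>UNIV. F j ^ Poly_Mapping.lookup m j))"
    by (intro homogeneous_cmult) (simp add: m flip: sum_distrib_left)
qed

lemma meval_scale:
  fixes p :: "('i::finite, 'a::comm_ring_1) mpoly"
  assumes "homogeneous d p"
  shows "meval p (\<lambda>i. c * x i) = c ^ d * meval p x"
proof -
  have "Poly_Mapping.lookup p m * (\<Prod>i\<in>UNIV. (c * x i) ^ Poly_Mapping.lookup m i)
      = c ^ d * (Poly_Mapping.lookup p m * (\<Prod>i\<in>UNIV. x i ^ Poly_Mapping.lookup m i))"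
    if "m \<in> Poly_Mapping.keys p" for m
  proof -
    have "(\<Prod>i\<in>UNIV. c ^ Poly_Mapping.lookup m i) = c ^ d"
      using that assms by (simp add: homogeneous_def flip: power_sum)
    then show ?thesis by (simp add: power_mult_distrib prod.distrib)
  qed
  then show ?thesis
    unfolding meval_def by (simp add: sum_distrib_left)
qed

lemma meval_at_0:
  fixes p :: "('i::finite, 'a::comm_ring_1) mpoly"
  assumes "homogeneous d p" "d > 0"
  shows "meval p (\<lambda>_. 0) = 0"
  using meval_scale[OF assms(1), of 0 "\<lambda>_. 0"] assms(2) by (simp add: power_0_left)

lemma homogeneous_0_const:
  fixes p :: "('i::finite, 'a::comm_ring_1) mpoly"
  assumes "homogeneous 0 p" shows "meval p x = meval p y"
  using meval_scale[OF assms, of 0 x] meval_scale[OF assms, of 0 y] by simp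

lemma monomial_Suc:
  fixes m :: "'i::finite \<Rightarrow>\<^sub>0 nat"
  assumes "(\<Sum>i\<in>UNIV. Poly_Mapping.lookup m i) = Suc n"
  obtains i m' where "m = Poly_Mapping.single i 1 + m'" "(\<Sum>i\<in>UNIV. Poly_Mapping.lookup m' i) = n"
proof -
  obtain i where i: "Poly_Mapping.lookup m i > 0"
    using assms by (metis gr0I nat.distinct(1) sum.neutral)
  define m' where "m' = m - Poly_Mapping.single i 1"
  have m: "m = Poly_Mapping.single i 1 + m'"
    using i by (intro poly_mapping_eqI) (auto simp: m'_def lookup_add lookup_minus lookup_single when_def)
  have "(\<Sum>j\<in>UNIV. Poly_Mapping.lookup (Poly_Mapping.single i (1::nat)) j) = 1"
    by (simp add: lookup_single when_def)
  then have "(\<Sum>i\<in>UNIV. Poly_Mapping.lookup m' i) = n"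
    using assms by (simp add: m lookup_add sum.distrib)
  then show ?thesis using that m by blast
qed

lemma monomial_0:
  fixes m :: "'i::finite \<Rightarrow>\<^sub>0 nat"
  assumes "(\<Sum>i\<in>UNIV. Poly_Mapping.lookup m i) = 0"
  shows "m = 0"
  using assms by (intro poly_mapping_eqI) auto

text \<open>The degree travels along with the induction: a monomial is built by multiplying in one
  variable at a time. This drives the local expansion at a point, the passage from binary forms to
  univariate polynomials, and the parity decomposition on a cone.\<close>

lemma homogeneous_induct [consumes 1, case_names zero const add var]:
  fixes p :: "('i::finite, 'a::comm_ring_1) mpoly"
  assumes "homogeneous n p"
    and zero: "\<And>n. P n 0"
    and const: "\<And>c. P 0 (mconst c)"
    and add: "\<And>n p q. homogeneous n p \<Longrightarrow> homogeneous n q \<Longrightarrow> P n p \<Longrightarrow> P n q \<Longrightarrow> P n (p + q)"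
    and var: "\<And>n p i. homogeneous n p \<Longrightarrow> P n p \<Longrightarrow> P (Suc n) (mvar i * p)"
  shows "P n p"
proof -
  have hs: "homogeneous n (Poly_Mapping.single m c)" if "(\<Sum>i\<in>UNIV. Poly_Mapping.lookup m i) = n"
    for n and m :: "'i \<Rightarrow>\<^sub>0 nat" and c :: 'a
    using that by (auto simp: homogeneous_def)
  have *: "P n (Poly_Mapping.single m c)" if "(\<Sum>i\<in>UNIV. Poly_Mapping.lookup m i) = n"
    for n and m :: "'i \<Rightarrow>\<^sub>0 nat" and c :: 'a
    using that
  proof (induction n arbitrary: m)
    case 0
    then have "m = 0" by (rule monomial_0)
    then show ?case using const[of c] by (simp add: mconst_def)
  next
    case (Suc n)
    from Suc.prems obtain i m' where m: "m = Poly_Mapping.single i 1 + m'"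
      and m': "(\<Sum>i\<in>UNIV. Poly_Mapping.lookup m' i) = n" by (rule monomial_Suc)
    have "Poly_Mapping.single m c = mvar i * Poly_Mapping.single m' c"
      by (simp add: mvar_def mult_single m)
    then show ?case using var[OF hs[OF m'] Suc.IH[OF m']] by simp
  qed
  have "homogeneous n (\<Sum>m\<in>S. Poly_Mapping.single m (Poly_Mapping.lookup p m)) \<and>
      P n (\<Sum>m\<in>S. Poly_Mapping.single m (Poly_Mapping.lookup p m))"
    if "finite S" "S \<subseteq> Poly_Mapping.keys p" for S
    using that
  proof (induction S)
    case (insert m S)
    then have "(\<Sum>i\<in>UNIV. Poly_Mapping.lookup m i) = n"
      using assms(1) by (auto simp: homogeneous_def)
    then show ?case using insert * hs by (auto intro!: add homogeneous_add)
  qed (auto intro: zero)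
  then show ?thesis
    using mpoly_sum_singles[of p] finite_keys by (metis order_refl)
qed

lemma linear_form_coeffs:
  fixes f :: "('i::finite, 'a::comm_ring_1) mpoly"
  assumes "homogeneous 1 f"
  obtains c where "\<And>x. meval f x = (\<Sum>m\<in>UNIV. c m * x m)"
proof -
  have "\<exists>c. \<forall>x. meval p x = (\<Sum>m\<in>UNIV. c m * x m)" if "homogeneous n p" "n = 1"
    for n and p :: "('i, 'a) mpoly"
    using that
  proof (induction rule: homogeneous_induct)
    case (zero n)
    show ?case by (intro exI[of _ "\<lambda>_. 0"]) simp
  next
    case (const c)
    then show ?case by simp
  next
    case (add n p q)
    then obtain c d where "\<forall>x. meval p x = (\<Sum>m\<in>UNIV. c m * x m)" "\<forall>x. meval q x = (\<Sum>m\<in>UNIV. d m * x m)"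
      by blast
    then show ?case by (intro exI[of _ "\<lambda>m. c m + d m"]) (simp add: distrib_right sum.distrib)
  next
    case (var n p i)
    then have "homogeneous 0 p" by simp
    then obtain c where c: "\<And>x. meval p x = c" using homogeneous_0_const by blast
    show ?case
      by (intro exI[of _ "\<lambda>m. if m = i then c else 0"])
        (simp add: c if_distrib[of "\<lambda>c. c * _"] mult.commute[of c] cong: if_cong)
  qed
  from this[OF assms refl] show ?thesis using that by blast
qed

text \<open>Evaluation at the unit vector of a variable that occurs in \<open>f\<close> reads off
  its coefficient. This turns the formal condition \<open>l \<noteq> 0\<close> on the equation of a
  plane into one on values.\<close>

lemma linear_form_nonzero:
  fixes f :: "('i::finite, 'a::comm_ring_1) mpoly"
  assumes "homogeneous 1 f" "f \<noteq> 0"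
  obtains x where "meval f x \<noteq> 0"
proof -
  have deg: "\<exists>i. m = Poly_Mapping.single i 1" if "m \<in> Poly_Mapping.keys f" for m
  proof -
    have "(\<Sum>i\<in>UNIV. Poly_Mapping.lookup m i) = Suc 0"
      using assms(1) that by (simp add: homogeneous_def)
    then obtain i m' where "m = Poly_Mapping.single i 1 + m'" "(\<Sum>i\<in>UNIV. Poly_Mapping.lookup m' i) = 0"
      by (rule monomial_Suc)
    then show ?thesis using monomial_0[of m'] by auto
  qed
  obtain m where m: "m \<in> Poly_Mapping.keys f" using assms(2) by fastforce
  then obtain i where i: "m = Poly_Mapping.single i 1" using deg by blast
  define x :: "'i \<Rightarrow> 'a" where "x = (\<lambda>t. if t = i then 1 else 0)"
  have "Poly_Mapping.lookup f m' * (\<Prod>t\<in>UNIV. x t ^ Poly_Mapping.lookup m' t)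
      = (if m' = m then Poly_Mapping.lookup f m else 0)" if "m' \<in> Poly_Mapping.keys f" for m'
  proof -
    from deg[OF that] obtain i' where i': "m' = Poly_Mapping.single i' 1" by blast
    have "Poly_Mapping.single i' (1::nat) = Poly_Mapping.single i 1 \<longleftrightarrow> i' = i"
      by (metis lookup_single_eq lookup_single_not_eq zero_neq_one)
    then show ?thesis using prod_power_single[of x i'] unfolding i i' by (simp add: x_def)
  qed
  then have "meval f x = Poly_Mapping.lookup f m" using m by (simp add: meval_def)
  then show ?thesis using that[of x] m by (simp add: in_keys_iff)
qed

text \<open>Elements of \<open>point_power\<close> may have inhomogeneous cofactors; the components
  of these are needed to return to forms.\<close>

lemma homogeneous_components:
  fixes p :: "('i::finite, 'a::comm_ring_1) mpoly"
  shows "\<exists>N q. (\<forall>e. homogeneous e (q e)) \<and> (\<forall>e>N. q e = 0) \<and> p = (\<Sum>e\<le>N. q e)"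
proof (induction p rule: mpoly_induct)
  case zero
  show ?case by (intro exI[of _ 0] exI[of _ "\<lambda>_. 0"]) auto
next
  case (single m c)
  let ?n = "\<Sum>i\<in>UNIV. Poly_Mapping.lookup m i"
  show ?case
    by (intro exI[of _ ?n] exI[of _ "\<lambda>e. if e = ?n then Poly_Mapping.single m c else 0"])
      (auto simp: homogeneous_def)
next
  case (add p p')
  then obtain N q N' q' where q: "\<forall>e. homogeneous e (q e)" "\<forall>e>N. q e = 0" "p = (\<Sum>e\<le>N. q e)"
    and q': "\<forall>e. homogeneous e (q' e)" "\<forall>e>N'. q' e = 0" "p' = (\<Sum>e\<le>N'. q' e)" by blast
  have "p = (\<Sum>e\<le>max N N'. q e)" unfolding q(3) by (intro sum.mono_neutral_left) (use q(2) in auto)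
  moreover have "p' = (\<Sum>e\<le>max N N'. q' e)" unfolding q'(3) by (intro sum.mono_neutral_left) (use q'(2) in auto)
  ultimately show ?case using q q'
    by (intro exI[of _ "max N N'"] exI[of _ "\<lambda>e. q e + q' e"]) (auto simp: sum.distrib intro: homogeneous_add)
qed

section \<open>Projective points\<close>

lemma rep_proj_nonzero: "rep_proj P \<noteq> (\<lambda>_. 0)"
  using Quotient_rep_reflp[OF Quotient_proj, of P] by (simp add: proportional_def)

lemma abs_rep_proj [simp]: "abs_proj (rep_proj P) = P"
  using Quotient_abs_rep[OF Quotient_proj] by blast

lemma proportional_refl: "x \<noteq> (\<lambda>_. 0) \<Longrightarrow> proportional x x"
  unfolding proportional_def by (auto intro: exI[of _ 1])

lemma abs_proj_eq_iff:
  assumes "x \<noteq> (\<lambda>_. 0)" "y \<noteq> (\<lambda>_. 0)"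
  shows "abs_proj x = abs_proj y \<longleftrightarrow> (\<exists>c. c \<noteq> 0 \<and> y = (\<lambda>i. c * x i))"
  using Quotient_rel[OF Quotient_proj, of x y] assms proportional_refl
  by (auto simp: proportional_def)

lemma rep_abs_proj:
  assumes "x \<noteq> (\<lambda>_. 0)"
  obtains c where "c \<noteq> 0" "rep_proj (abs_proj x) = (\<lambda>i. c * x i)"
  using abs_proj_eq_iff[OF assms rep_proj_nonzero[of "abs_proj x"]] by auto

lemma proj_cases: obtains x where "x \<noteq> (\<lambda>_. 0)" "P = abs_proj x"
  using rep_proj_nonzero abs_rep_proj by metis

lemma vanishes_abs:
  assumes "homogeneous d F" "x \<noteq> (\<lambda>_. 0)"
  shows "vanishes F (abs_proj x) \<longleftrightarrow> meval F x = 0"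
proof -
  obtain c where c: "c \<noteq> 0" "rep_proj (abs_proj x) = (\<lambda>i. c * x i)"
    using rep_abs_proj[OF assms(2)] .
  show ?thesis unfolding vanishes_def c(2) meval_scale[OF assms(1)] using c(1) by simp
qed

lemma proj_of_abs:
  fixes x :: "'i::finite \<Rightarrow> 'a::field"
  assumes "\<And>j. homogeneous d (F j)" "x \<noteq> (\<lambda>_. 0)"
  shows "proj_of F (abs_proj x) = abs_proj (\<lambda>j. meval (F j) x)"
proof -
  obtain c where c: "c \<noteq> 0" "rep_proj (abs_proj x) = (\<lambda>i. c * x i)"
    using rep_abs_proj[OF assms(2)] .
  have e: "(\<lambda>j. meval (F j) (rep_proj (abs_proj x))) = (\<lambda>j. c ^ d * meval (F j) x)"
    unfolding c(2) using meval_scale[OF assms(1)] by metis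
  show ?thesis
  proof (cases "(\<lambda>j. meval (F j) x) = (\<lambda>_. 0)")
    case True
    then have "meval (F j) x = 0" for j by metis
    then show ?thesis unfolding proj_of_def e by simp
  next
    case nz: False
    then have "(\<lambda>j. c ^ d * meval (F j) x) \<noteq> (\<lambda>_. 0)"
      using c(1) by (auto simp: fun_eq_iff)
    then show ?thesis unfolding proj_of_def e using nz c(1)
      by (subst eq_commute, subst abs_proj_eq_iff) (auto intro!: exI[of _ "c ^ d"])
  qed
qed

text \<open>Identities between forms are checked on representing vectors rather than on points: no
  choice of representative enters, and scaling the vector recovers degrees.\<close>

definition affine_cone :: "('i, 'a::field) proj set \<Rightarrow> ('i \<Rightarrow> 'a) set" where
  "affine_cone Z = {x. x \<noteq> (\<lambda>_. 0) \<and> abs_proj x \<in> Z}"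

lemma affine_cone_scale: "x \<in> affine_cone Z \<Longrightarrow> c \<noteq> 0 \<Longrightarrow> (\<lambda>i. c * x i) \<in> affine_cone Z"
  unfolding affine_cone_def mem_Collect_eq
proof safe
  assume x: "x \<noteq> (\<lambda>_. 0)" "c \<noteq> 0" and Z: "abs_proj x \<in> Z"
  have nz: "(\<lambda>i. c * x i) \<noteq> (\<lambda>_. 0)"
    using x by (auto simp: fun_eq_iff)
  then show False if "(\<lambda>i. c * x i) = (\<lambda>_. 0)" using that by simp
  have "abs_proj x = abs_proj (\<lambda>i. c * x i)"
    using abs_proj_eq_iff[OF x(1) nz] x(2) by blast
  then show "abs_proj (\<lambda>i. c * x i) \<in> Z" using Z by simp
qed

lemma rep_in_affine_cone [simp]: "rep_proj P \<in> affine_cone Z \<longleftrightarrow> P \<in> Z"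
  by (simp add: affine_cone_def rep_proj_nonzero)

lemma affine_cone_nonzero: "x \<in> affine_cone Z \<Longrightarrow> x \<noteq> (\<lambda>_. 0)"
  by (simp add: affine_cone_def)

definition zero_on :: "('i::finite, 'a::field) proj set \<Rightarrow> ('i, 'a) mpoly \<Rightarrow> bool" where
  "zero_on Z F \<longleftrightarrow> (\<forall>x\<in>affine_cone Z. meval F x = 0)"

lemma not_identically_zero_on_iff:
  assumes "homogeneous d F"
  shows "not_identically_zero_on Z F \<longleftrightarrow> \<not> zero_on Z F"
proof
  assume "not_identically_zero_on Z F"
  then show "\<not> zero_on Z F"
    unfolding not_identically_zero_on_def zero_on_def vanishes_def
    using rep_in_affine_cone by blast
next
  assume "\<not> zero_on Z F"
  then obtain x where "x \<in> affine_cone Z" "meval F x \<noteq> 0" unfolding zero_on_def by blast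
  then show "not_identically_zero_on Z F"
    unfolding not_identically_zero_on_def affine_cone_def using vanishes_abs[OF assms] by blast
qed

lemma local_repD:
  assumes "local_rep S Z f P F"
  obtains d where "\<And>j. homogeneous d (F j)" "\<exists>j. meval (F j) (rep_proj P) \<noteq> 0"
    "\<And>x. x \<in> affine_cone Z \<Longrightarrow> (\<lambda>j. meval (F j) x) \<noteq> (\<lambda>_. 0) \<Longrightarrow>
       f (abs_proj x) = abs_proj (\<lambda>j. meval (F j) x)"
proof -
  obtain d where d: "\<And>j. homogeneous d (F j)" using assms unfolding local_rep_def by blast
  show ?thesis
  proof (rule that[OF d])
    show "\<exists>j. meval (F j) (rep_proj P) \<noteq> 0" using assms unfolding local_rep_def vanishes_def by blast
    fix x assume x: "x \<in> affine_cone Z" "(\<lambda>j. meval (F j) x) \<noteq> (\<lambda>_. 0)"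
    then have "\<exists>j. \<not> vanishes (F j) (abs_proj x)"
      using vanishes_abs[OF d affine_cone_nonzero[OF x(1)]] by (auto simp: fun_eq_iff)
    then have "f (abs_proj x) = proj_of F (abs_proj x)"
      using assms x(1) unfolding local_rep_def affine_cone_def by blast
    then show "f (abs_proj x) = abs_proj (\<lambda>j. meval (F j) x)"
      using proj_of_abs[OF d affine_cone_nonzero[OF x(1)]] by simp
  qed
qed

lemma morphism_over_UNIV: "morphism_over K Z Y f \<Longrightarrow> morphism_over UNIV Z Y f"
  unfolding morphism_over_def local_rep_def coeffs_in_def by (meson UNIV_I)

lemma iso_over_UNIV: "iso_over K Z Y f \<Longrightarrow> iso_over UNIV Z Y f"
  unfolding iso_over_def by (blast intro: morphism_over_UNIV)

section \<open>Orders of forms at a point\<close>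

text \<open>Membership of \<open>F\<close> in the ideal generated by \<open>G\<close> in the local
  ring at \<open>P\<close>, with denominators cleared by a form \<open>U\<close> that is a unit at
  \<open>P\<close>. The degrees \<open>n\<close> and \<open>m\<close> are arguments because they
  cannot be read off from a polynomial that may be zero.\<close>

definition local_mult ::
    "('i::finite, 'a::field) proj set \<Rightarrow> ('i, 'a) proj \<Rightarrow> nat \<Rightarrow> ('i, 'a) mpoly \<Rightarrow> nat \<Rightarrow>
     ('i, 'a) mpoly \<Rightarrow> bool" where
  "local_mult Z P n F m G \<longleftrightarrow> (\<exists>dU dV U V. homogeneous dU U \<and> homogeneous dV V \<and>
     dU + n = dV + m \<and> meval U (rep_proj P) \<noteq> 0 \<and>
     (\<forall>x\<in>affine_cone Z. meval U x * meval F x = meval V x * meval G x))"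

text \<open>Equality of the two ideals in the local ring: now \<open>V\<close> is a unit at
  \<open>P\<close> as well.\<close>

definition local_assoc ::
    "('i::finite, 'a::field) proj set \<Rightarrow> ('i, 'a) proj \<Rightarrow> nat \<Rightarrow> ('i, 'a) mpoly \<Rightarrow> nat \<Rightarrow>
     ('i, 'a) mpoly \<Rightarrow> bool" where
  "local_assoc Z P n F m G \<longleftrightarrow> (\<exists>dU dV U V. homogeneous dU U \<and> homogeneous dV V \<and>
     dU + n = dV + m \<and> meval U (rep_proj P) \<noteq> 0 \<and> meval V (rep_proj P) \<noteq> 0 \<and>
     (\<forall>x\<in>affine_cone Z. meval U x * meval F x = meval V x * meval G x))"

text \<open>A generator of the maximal ideal at \<open>P\<close>, tested on linear forms only;
  \<open>uniformizer_mult\<close> extends this to all forms. That \<open>t\<close> is not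
  identically zero is kept as a separate condition.\<close>

definition uniformizer ::
    "('i::finite, 'a::field) proj set \<Rightarrow> ('i, 'a) proj \<Rightarrow> nat \<Rightarrow> ('i, 'a) mpoly \<Rightarrow> bool" where
  "uniformizer Z P d t \<longleftrightarrow> homogeneous d t \<and> vanishes t P \<and>
     (\<forall>l. homogeneous 1 l \<longrightarrow> vanishes l P \<longrightarrow> local_mult Z P 1 l d t)"

text \<open>Powers of such a form adjust degrees without affecting values at
  \<open>P\<close>.\<close>

lemma ex_linear_nonvanishing:
  fixes P :: "('i::finite, 'a::field) proj"
  obtains e where "homogeneous 1 e" "meval e (rep_proj P) = 1"
proof -
  obtain k where "rep_proj P k \<noteq> 0" using rep_proj_nonzero by (metis ext)
  then show ?thesis
    by (intro that[of "mconst (1 / rep_proj P k) * mvar k"] homogeneous_cmult) auto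
qed

lemma local_mult_cong:
  assumes "\<And>x. x \<in> affine_cone Z \<Longrightarrow> meval F x = meval F' x"
    "\<And>x. x \<in> affine_cone Z \<Longrightarrow> meval G x = meval G' x"
  shows "local_mult Z P n F m G \<longleftrightarrow> local_mult Z P n F' m G'"
  unfolding local_mult_def using assms by (metis (no_types, lifting))

lemma local_mult_0:
  fixes Z :: "('i::finite, 'a::field) proj set"
  shows "local_mult Z P n 0 m G"
proof -
  obtain e where e: "homogeneous 1 e" "meval e (rep_proj P) = 1" by (rule ex_linear_nonvanishing)
  show ?thesis unfolding local_mult_def
    by (rule exI[of _ m], rule exI[of _ n], rule exI[of _ "e ^ m"], rule exI[of _ 0])
      (use homogeneous_power[OF e(1), of m] e in auto)
qed

lemma local_mult_refl: "local_mult Z P n F n F"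
  unfolding local_mult_def
  by (rule exI[of _ 0], rule exI[of _ 0], rule exI[of _ 1], rule exI[of _ 1]) auto

lemma local_mult_1: "homogeneous n F \<Longrightarrow> local_mult Z P n F 0 1"
  unfolding local_mult_def
  by (rule exI[of _ 0], rule exI[of _ n], rule exI[of _ 1], rule exI[of _ F]) auto

lemma local_mult_add:
  assumes "local_mult Z P n F m G" "local_mult Z P n F' m G"
  shows "local_mult Z P n (F + F') m G"
proof -
  obtain dU dV U V where 1: "homogeneous dU U" "homogeneous dV V" "dU + n = dV + m"
    "meval U (rep_proj P) \<noteq> 0" "\<And>x. x\<in>affine_cone Z \<Longrightarrow> meval U x * meval F x = meval V x * meval G x"
    using assms(1) unfolding local_mult_def by blast
  obtain dU' dV' U' V' where 2: "homogeneous dU' U'" "homogeneous dV' V'" "dU' + n = dV' + m"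
    "meval U' (rep_proj P) \<noteq> 0" "\<And>x. x\<in>affine_cone Z \<Longrightarrow> meval U' x * meval F' x = meval V' x * meval G x"
    using assms(2) unfolding local_mult_def by blast
  have eq: "meval (U * U') x * meval (F + F') x = meval (V * U' + V' * U) x * meval G x"
    if "x \<in> affine_cone Z" for x
  proof -
    have "meval (U * U') x * meval (F + F') x
        = meval U' x * (meval U x * meval F x) + meval U x * (meval U' x * meval F' x)"
      by (simp add: algebra_simps)
    also have "\<dots> = meval (V * U' + V' * U) x * meval G x"
      unfolding 1(5)[OF that] 2(5)[OF that] by (simp add: algebra_simps)
    finally show ?thesis .
  qed
  have "homogeneous (dV + dU') (V * U' + V' * U)"
    using homogeneous_mult[OF 1(2) 2(1)] homogeneous_mult[OF 2(2) 1(1)] 1(3) 2(3)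
    by (intro homogeneous_add homogeneous_mult'[OF 2(2) 1(1)]) auto
  then show ?thesis unfolding local_mult_def
    by (intro exI[of _ "dU + dU'"] exI[of _ "dV + dU'"] exI[of _ "U * U'"]
        exI[of _ "V * U' + V' * U"]) (use 1(1-4) 2(1-4) eq in \<open>auto intro!: homogeneous_mult\<close>)
qed

lemma local_mult_mult:
  assumes "local_mult Z P n F m G" "local_mult Z P n' F' m' G'"
  shows "local_mult Z P (n + n') (F * F') (m + m') (G * G')"
proof -
  obtain dU dV U V where 1: "homogeneous dU U" "homogeneous dV V" "dU + n = dV + m"
    "meval U (rep_proj P) \<noteq> 0" "\<And>x. x\<in>affine_cone Z \<Longrightarrow> meval U x * meval F x = meval V x * meval G x"
    using assms(1) unfolding local_mult_def by blast
  obtain dU' dV' U' V' where 2: "homogeneous dU' U'" "homogeneous dV' V'" "dU' + n' = dV' + m'"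
    "meval U' (rep_proj P) \<noteq> 0" "\<And>x. x\<in>affine_cone Z \<Longrightarrow> meval U' x * meval F' x = meval V' x * meval G' x"
    using assms(2) unfolding local_mult_def by blast
  have eq: "meval (U * U') x * meval (F * F') x = meval (V * V') x * meval (G * G') x"
    if "x \<in> affine_cone Z" for x
  proof -
    have "meval (U * U') x * meval (F * F') x
        = (meval U x * meval F x) * (meval U' x * meval F' x)"
      by (simp add: algebra_simps)
    also have "\<dots> = meval (V * V') x * meval (G * G') x"
      unfolding 1(5)[OF that] 2(5)[OF that] by (simp add: algebra_simps)
    finally show ?thesis .
  qed
  show ?thesis unfolding local_mult_def
    by (rule exI[of _ "dU + dU'"], rule exI[of _ "dV + dV'"], rule exI[of _ "U * U'"],
        rule exI[of _ "V * V'"])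
      (use 1(1-4) 2(1-4) eq in \<open>auto intro!: homogeneous_mult\<close>)
qed

lemma local_mult_multl:
  assumes "homogeneous k H" "local_mult Z P n F m G"
  shows "local_mult Z P (k + n) (H * F) m G"
  using local_mult_mult[OF local_mult_1[OF assms(1)] assms(2)] by simp

lemma local_mult_trans:
  assumes "local_mult Z P n F m G" "local_mult Z P m G k H"
  shows "local_mult Z P n F k H"
proof -
  obtain dU dV U V where 1: "homogeneous dU U" "homogeneous dV V" "dU + n = dV + m"
    "meval U (rep_proj P) \<noteq> 0" "\<And>x. x\<in>affine_cone Z \<Longrightarrow> meval U x * meval F x = meval V x * meval G x"
    using assms(1) unfolding local_mult_def by blast
  obtain dU' dV' U' V' where 2: "homogeneous dU' U'" "homogeneous dV' V'" "dU' + m = dV' + k"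
    "meval U' (rep_proj P) \<noteq> 0" "\<And>x. x\<in>affine_cone Z \<Longrightarrow> meval U' x * meval G x = meval V' x * meval H x"
    using assms(2) unfolding local_mult_def by blast
  have eq: "meval (U * U') x * meval F x = meval (V * V') x * meval H x"
    if "x \<in> affine_cone Z" for x
  proof -
    have "meval (U * U') x * meval F x = meval V x * (meval U' x * meval G x)"
      using 1(5)[OF that] by (simp add: algebra_simps)
    also have "\<dots> = meval (V * V') x * meval H x"
      unfolding 2(5)[OF that] by (simp add: algebra_simps)
    finally show ?thesis .
  qed
  show ?thesis unfolding local_mult_def
    by (rule exI[of _ "dU + dU'"], rule exI[of _ "dV + dV'"], rule exI[of _ "U * U'"],
        rule exI[of _ "V * V'"])
      (use 1(1-4) 2(1-4) eq in \<open>auto intro!: homogeneous_mult\<close>)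
qed

text \<open>With \<open>e\<close> linear and equal to \<open>1\<close> at \<open>P\<close>, a form \<open>F\<close> of degree \<open>n\<close> is congruent to
  \<open>F(P) e^n\<close> modulo the linear forms vanishing at \<open>P\<close>.\<close>

lemma uniformizer_mult:
  fixes Z :: "('i::finite, 'a::field) proj set"
  assumes t: "uniformizer Z P d t" and F: "homogeneous n F" "vanishes F P"
  shows "local_mult Z P n F d t"
proof -
  let ?p = "rep_proj P"
  obtain e where e: "homogeneous 1 e" "meval e ?p = 1" by (rule ex_linear_nonvanishing)
  have "local_mult Z P n (F - mconst (meval F ?p) * e ^ n) d t"
    using F(1)
  proof (induction rule: homogeneous_induct)
    case (zero n)
    have "local_mult Z P n 0 d t" by (rule local_mult_0)
    then show ?case by (rule iffD1[OF local_mult_cong, rotated -1]) auto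
  next
    case (const c)
    have "local_mult Z P 0 0 d t" by (rule local_mult_0)
    then show ?case by (rule iffD1[OF local_mult_cong, rotated -1]) auto
  next
    case (add n p q)
    show ?case by (rule iffD1[OF local_mult_cong, rotated -1, OF local_mult_add[OF add(3,4)]])
        (auto simp: algebra_simps)
  next
    \<comment> \<open>Product rule: \<open>x_i p - x_i(P) p(P) e^(n+1)\<close> is the sum of
      \<open>p(P) e^n (x_i - x_i(P) e)\<close> and \<open>x_i (p - p(P) e^n)\<close>.\<close>
    case (var n p i)
    have "homogeneous 1 (mvar i - mconst (?p i) * e)"
      by (intro homogeneous_diff homogeneous_cmult e homogeneous_mvar)
    moreover have "vanishes (mvar i - mconst (?p i) * e) P"
      by (simp add: vanishes_def e)
    ultimately have 1: "local_mult Z P 1 (mvar i - mconst (?p i) * e) d t"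
      using t unfolding uniformizer_def by blast
    have "homogeneous n (mconst (meval p ?p) * e ^ n)"
      using homogeneous_cmult[OF homogeneous_power[OF e(1)]] by simp
    from local_mult_multl[OF this 1]
    have 2: "local_mult Z P (Suc n) (mconst (meval p ?p) * e ^ n * (mvar i - mconst (?p i) * e)) d t"
      by simp
    have 3: "local_mult Z P (Suc n) (mvar i * (p - mconst (meval p ?p) * e ^ n)) d t"
      using local_mult_multl[OF homogeneous_mvar var(2)] by simp
    show ?case by (rule iffD1[OF local_mult_cong, rotated -1, OF local_mult_add[OF 2 3]])
        (auto simp: algebra_simps)
  qed
  then show ?thesis
    by (rule iffD1[OF local_mult_cong, rotated -1]) (use F(2) in \<open>auto simp: vanishes_def\<close>)
qed

text \<open>Each of the \<open>n\<close> factors vanishes at \<open>P\<close> and so contributes a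
  factor \<open>t\<close>. Nothing is said about the degree of \<open>V\<close>, since the cofactor
  \<open>u\<close> in \<open>point_power\<close> is arbitrary.\<close>

lemma local_mult_point_power:
  fixes Z :: "('i::finite, 'a::field) proj set"
  assumes t: "uniformizer Z P d t" and M: "M \<in> point_power P n"
  shows "\<exists>dU U V. homogeneous dU U \<and> meval U (rep_proj P) \<noteq> 0 \<and>
     (\<forall>x\<in>affine_cone Z. meval U x * meval M x = meval V x * meval t x ^ n)"
  using M
proof (induction rule: point_power.induct)
  case (prod l u)
  have "\<exists>dU U V. homogeneous dU U \<and> meval U (rep_proj P) \<noteq> 0 \<and>
     (\<forall>x\<in>affine_cone Z. meval U x * meval (\<Prod>k<m. l k) x = meval V x * meval t x ^ m)"
    if "m \<le> n" for m
    using that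
  proof (induction m)
    case 0
    show ?case by (rule exI[of _ 0], rule exI[of _ 1], rule exI[of _ 1]) auto
  next
    case (Suc m)
    then obtain dU U V where 1: "homogeneous dU U" "meval U (rep_proj P) \<noteq> 0"
      "\<And>x. x\<in>affine_cone Z \<Longrightarrow> meval U x * meval (\<Prod>k<m. l k) x = meval V x * meval t x ^ m" by auto
    obtain d' where "homogeneous d' (l m)" "vanishes (l m) P" using prod(1,2)[of m] Suc.prems by auto
    from uniformizer_mult[OF t this] obtain dU' U' V' where 2: "homogeneous dU' U'" "meval U' (rep_proj P) \<noteq> 0"
      "\<And>x. x\<in>affine_cone Z \<Longrightarrow> meval U' x * meval (l m) x = meval V' x * meval t x"
      unfolding local_mult_def by blast
    have "meval (U * U') x * meval (\<Prod>k<Suc m. l k) x = meval (V * V') x * meval t x ^ Suc m"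
      if "x \<in> affine_cone Z" for x
    proof -
      have "meval (U * U') x * meval (\<Prod>k<Suc m. l k) x
          = (meval U x * meval (\<Prod>k<m. l k) x) * (meval U' x * meval (l m) x)"
        by (simp add: algebra_simps)
      then show ?thesis unfolding 1(3)[OF that] 2(3)[OF that] by (simp add: algebra_simps)
    qed
    then show ?case
      using homogeneous_mult[OF 1(1) 2(1)] 1(2) 2(2)
      by (intro exI[of _ "dU + dU'"] exI[of _ "U * U'"] exI[of _ "V * V'"]) auto
  qed
  from this[of n] obtain dU U V where 1: "homogeneous dU U" "meval U (rep_proj P) \<noteq> 0"
      "\<And>x. x\<in>affine_cone Z \<Longrightarrow> meval U x * meval (\<Prod>k<n. l k) x = meval V x * meval t x ^ n" by auto
  have "meval U x * meval (u * (\<Prod>k<n. l k)) x = meval (u * V) x * meval t x ^ n"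
    if "x \<in> affine_cone Z" for x
    using 1(3)[OF that] by (simp add: algebra_simps)
  then show ?case using 1(1,2) by blast
next
  case (add p q)
  then obtain dU U V dU' U' V' where 1: "homogeneous dU U" "meval U (rep_proj P) \<noteq> 0"
      "\<And>x. x\<in>affine_cone Z \<Longrightarrow> meval U x * meval p x = meval V x * meval t x ^ n"
    and 2: "homogeneous dU' U'" "meval U' (rep_proj P) \<noteq> 0"
      "\<And>x. x\<in>affine_cone Z \<Longrightarrow> meval U' x * meval q x = meval V' x * meval t x ^ n" by blast
  have "meval (U * U') x * meval (p + q) x = meval (U' * V + U * V') x * meval t x ^ n"
    if "x \<in> affine_cone Z" for x
  proof -
    have "meval (U * U') x * meval (p + q) x
        = meval U' x * (meval U x * meval p x) + meval U x * (meval U' x * meval q x)"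
      by (simp add: algebra_simps)
    then show ?thesis unfolding 1(3)[OF that] 2(3)[OF that] by (simp add: algebra_simps)
  qed
  then show ?case using homogeneous_mult[OF 1(1) 2(1)] 1(2) 2(2)
    by (intro exI[of _ "dU + dU'"] exI[of _ "U * U'"] exI[of _ "U' * V + U * V'"]) auto
qed

lemma vanishes_rep: "vanishes F P \<longleftrightarrow> meval F (rep_proj P) = 0"
  by (simp add: vanishes_def)

text \<open>The cofactor of \<open>t ^ n\<close> need not be homogeneous, but its component in the right degree
  serves as well.\<close>

lemma order_ge_iff_local_mult:
  fixes Z :: "('i::finite, 'a::field_char_0) proj set"
  assumes t: "uniformizer Z P d t" and F: "homogeneous m F"
  shows "order_ge Z P F n \<longleftrightarrow> local_mult Z P m F (n * d) (t ^ n)"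
proof
  have ht: "homogeneous d t" "vanishes t P" using t by (auto simp: uniformizer_def)
  assume "local_mult Z P m F (n * d) (t ^ n)"
  then obtain dU dV U V where 1: "homogeneous dU U" "homogeneous dV V"
    "meval U (rep_proj P) \<noteq> 0" "\<And>x. x\<in>affine_cone Z \<Longrightarrow> meval U x * meval F x = meval V x * meval (t ^ n) x"
    unfolding local_mult_def by blast
  have "V * (\<Prod>k<n. t) \<in> point_power P n"
    by (rule point_power.prod) (use ht in auto)
  moreover have "meval (U * F) x = meval (V * (\<Prod>k<n. t)) x" if "x \<in> affine_cone Z" for x
    using 1(4)[OF that] by simp
  ultimately show "order_ge Z P F n"
    unfolding order_ge_def vanishes_rep using 1(1,3) unfolding affine_cone_def by blast
next
  have ht: "homogeneous d t" using t by (auto simp: uniformizer_def)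
  assume "order_ge Z P F n"
  then obtain dU U M where U: "homogeneous dU U" "meval U (rep_proj P) \<noteq> 0" and M: "M \<in> point_power P n"
    "\<And>x. x \<in> affine_cone Z \<Longrightarrow> meval (U * F) x = meval M x"
    unfolding order_ge_def vanishes_rep affine_cone_def by blast
  obtain dU' U' V' where U': "homogeneous dU' U'" "meval U' (rep_proj P) \<noteq> 0"
    "\<And>x. x\<in>affine_cone Z \<Longrightarrow> meval U' x * meval M x = meval V' x * meval t x ^ n"
    using local_mult_point_power[OF t M(1)] by blast
  define W where "W = U * U'"
  define D where "D = dU + dU' + m"
  have W: "homogeneous (dU + dU') W" "meval W (rep_proj P) \<noteq> 0"
    using U U' by (auto simp: W_def homogeneous_mult)
  have WF: "homogeneous D (W * F)" unfolding D_def by (rule homogeneous_mult[OF W(1) F])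
  have eq: "meval (W * F) x = meval V' x * meval t x ^ n" if "x \<in> affine_cone Z" for x
  proof -
    have "meval (W * F) x = meval U' x * meval (U * F) x" by (simp add: W_def algebra_simps)
    then show ?thesis by (simp only: M(2)[OF that] U'(3)[OF that])
  qed
  obtain N q where q: "\<And>e. homogeneous e (q e)" "V' = (\<Sum>e\<le>N. q e)"
    "\<And>e. e > N \<Longrightarrow> q e = 0"
    using homogeneous_components[of V'] by blast
  have comp: "meval (W * F) x = (if n * d \<le> D then meval (q (D - n * d)) x * meval t x ^ n else 0)"
    if x: "x \<in> affine_cone Z" for x
  proof -
    \<comment> \<open>Replacing \<open>x\<close> by \<open>c x\<close> makes both sides polynomials
      in \<open>c\<close> that agree for all \<open>c \<noteq> 0\<close>. The coefficient of
      \<open>c^D\<close> isolates the component of \<open>V'\<close> in degree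
      \<open>D - n d\<close>.\<close>
    define p where "p = (\<Sum>e\<le>N. Polynomial.monom (meval (q e) x * meval t x ^ n) (e + n * d))
        - Polynomial.monom (meval (W * F) x) D"
    have "poly p c = 0" if "c \<noteq> 0" for c
    proof -
      have "c ^ D * meval (W * F) x = meval V' (\<lambda>i. c * x i) * meval t (\<lambda>i. c * x i) ^ n"
        using eq[OF affine_cone_scale[OF x that]] by (simp only: meval_scale[OF WF])
      also have "\<dots> = (\<Sum>e\<le>N. c ^ e * meval (q e) x) * (c ^ d * meval t x) ^ n"
        by (simp add: q(2) meval_scale[OF q(1)] meval_scale[OF ht])
      also have "\<dots> = (\<Sum>e\<le>N. meval (q e) x * meval t x ^ n * c ^ (e + n * d))"
        unfolding sum_distrib_right power_mult_distrib power_add power_mult[symmetric]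
        by (intro sum.cong) (simp_all add: mult_ac)
      finally show ?thesis
        by (simp add: p_def poly_monom poly_sum mult_ac)
    qed
    then have "infinite {c. poly p c = 0}"
      using infinite_super[of "UNIV - {0}" "{c. poly p c = 0}"] infinite_UNIV_char_0 by auto
    then have "p = 0" using poly_roots_finite by blast
    then have "coeff p D = 0" by simp
    then have "(\<Sum>e\<le>N. if e + n * d = D then meval (q e) x * meval t x ^ n else 0) = meval (W * F) x"
      by (simp add: p_def coeff_sum del: meval_mult)
    moreover have "(\<Sum>e\<le>N. if e + n * d = D then meval (q e) x * meval t x ^ n else 0)
        = (if n * d \<le> D then meval (q (D - n * d)) x * meval t x ^ n else 0)"
    proof (cases "n * d \<le> D \<and> D - n * d \<le> N")
      case True
      then have "(\<Sum>e\<le>N. if e + n * d = D then meval (q e) x * meval t x ^ n else 0)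
          = (\<Sum>e\<le>N. if e = D - n * d then meval (q e) x * meval t x ^ n else 0)"
        by (intro sum.cong) auto
      then show ?thesis using True by simp
    next
      case False
      then have "(\<Sum>e\<le>N. if e + n * d = D then meval (q e) x * meval t x ^ n else 0) = 0"
        by (intro sum.neutral) auto
      then show ?thesis using False q(3)[of "D - n * d"] by auto
    qed
    ultimately show ?thesis by simp
  qed
  show "local_mult Z P m F (n * d) (t ^ n)"
  proof (cases "n * d \<le> D")
    case True
    then show ?thesis unfolding local_mult_def
      by (intro exI[of _ "dU + dU'"] exI[of _ "D - n * d"] exI[of _ W] exI[of _ "q (D - n * d)"])
        (use W q(1) comp in \<open>auto simp: D_def\<close>)
  next
    \<comment> \<open>No component of \<open>V'\<close> has the right degree, so
      \<open>W * F\<close> vanishes on the cone. The zero cofactor then works, with a power of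
      \<open>e\<close> balancing the degrees.\<close>
    case False
    obtain e where e: "homogeneous 1 e" "meval e (rep_proj P) = 1" by (rule ex_linear_nonvanishing)
    have "homogeneous (n * d - D) (e ^ (n * d - D))"
      using homogeneous_power[OF e(1), of "n * d - D"] by simp
    from homogeneous_mult[OF this W(1)]
    have "homogeneous (n * d - D + (dU + dU')) (e ^ (n * d - D) * W)" .
    then show ?thesis unfolding local_mult_def
      by (intro exI[of _ "n * d - D + (dU + dU')"] exI[of _ 0] exI[of _ "e ^ (n * d - D) * W"]
          exI[of _ 0]) (use False W(2) e(2) comp in \<open>auto simp: D_def\<close>)
  qed
qed

section \<open>Orders under isomorphisms\<close>

lemma point_power_mult: "M \<in> point_power P n \<Longrightarrow> w * M \<in> point_power P n"
proof (induction rule: point_power.induct)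
  case (prod l u)
  show ?case using point_power.prod[of n l P "w * u"] prod by (simp add: mult.assoc)
qed (auto simp: distrib_left intro: point_power.add)

lemma point_power_msubst:
  fixes a :: "'j::finite \<Rightarrow> ('i::finite, 'a::field) mpoly"
  assumes a: "\<And>j. homogeneous e (a j)" and y: "(\<lambda>j. meval (a j) (rep_proj P)) \<noteq> (\<lambda>_. 0)"
    and M: "M \<in> point_power (abs_proj (\<lambda>j. meval (a j) (rep_proj P))) n"
  shows "\<exists>M'\<in>point_power P n. \<forall>x. meval M' x = meval M (\<lambda>j. meval (a j) x)"
  using M
proof (induction rule: point_power.induct)
  case (prod l u)
  have "msubst u a * (\<Prod>k<n. msubst (l k) a) \<in> point_power P n"
  proof (rule point_power.prod)
    fix k assume k: "k < n"
    from prod(1)[OF k] obtain d where d: "homogeneous d (l k)" by blast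
    show "\<exists>d. homogeneous d (msubst (l k) a)" using homogeneous_msubst[of d "l k" e a, OF d a] by blast
    show "vanishes (msubst (l k) a) P"
      using prod(2)[OF k] vanishes_abs[OF d y] by (simp add: vanishes_rep)
  qed
  then show ?case by (rule bexI[rotated]) auto
next
  case (add p q)
  then obtain p' q' where "p' \<in> point_power P n" "\<forall>x. meval p' x = meval p (\<lambda>j. meval (a j) x)"
    "q' \<in> point_power P n" "\<forall>x. meval q' x = meval q (\<lambda>j. meval (a j) x)" by blast
  then show ?case by (intro bexI[of _ "p' + q'"] point_power.add) auto
qed

lemma order_ge_pullback:
  fixes Z :: "('i::finite, 'a::field) proj set" and Y :: "('j::finite, 'a) proj set"
  assumes f: "\<And>P. P \<in> Z \<Longrightarrow> f P \<in> Y" and P: "P \<in> Z" and a: "local_rep S Z f P a"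
    and K: "order_ge Y (f P) K n"
  shows "order_ge Z P (msubst K a) n"
proof -
  obtain e where e: "\<And>j. homogeneous e (a j)" "\<exists>j. meval (a j) (rep_proj P) \<noteq> 0"
    "\<And>x. x \<in> affine_cone Z \<Longrightarrow> (\<lambda>j. meval (a j) x) \<noteq> (\<lambda>_. 0) \<Longrightarrow>
       f (abs_proj x) = abs_proj (\<lambda>j. meval (a j) x)"
    by (rule local_repD[OF a]) blast
  then obtain j where j: "meval (a j) (rep_proj P) \<noteq> 0" by blast
  then have nz: "(\<lambda>j. meval (a j) (rep_proj P)) \<noteq> (\<lambda>_. 0)" by metis
  have fP: "f P = abs_proj (\<lambda>j. meval (a j) (rep_proj P))"
    using e(3)[OF _ nz] P by simp
  obtain d U M where U: "homogeneous d U" "\<not> vanishes U (f P)" "M \<in> point_power (f P) n"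
    and eq: "\<And>y. y \<in> affine_cone Y \<Longrightarrow> meval (U * K) y = meval M y"
    using K unfolding order_ge_def affine_cone_def by blast
  obtain M' where M': "M' \<in> point_power P n" "\<And>x. meval M' x = meval M (\<lambda>j. meval (a j) x)"
    using point_power_msubst[OF e(1) nz] U(3) fP by metis
  \<comment> \<open>The additional factor \<open>a j\<close> makes both sides vanish where the local
    formula for \<open>f\<close> may break down; elsewhere the formula leads into the cone over
    \<open>Y\<close>.\<close>
  have "homogeneous (e + e * d) (a j * msubst U a)"
    by (intro homogeneous_mult homogeneous_msubst e U)
  moreover have "\<not> vanishes (a j * msubst U a) P"
    using j U(2) vanishes_abs[OF U(1) nz] by (simp add: vanishes_rep fP)
  moreover have "meval (a j * msubst U a * msubst K a) x = meval (a j * M') x"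
    if "x \<in> affine_cone Z" for x
  proof (cases "meval (a j) x = 0")
    case False
    then have nz: "(\<lambda>j. meval (a j) x) \<noteq> (\<lambda>_. 0)" by metis
    then have "(\<lambda>j. meval (a j) x) \<in> affine_cone Y"
      using e(3)[OF that nz] f[of "abs_proj x"] that by (auto simp: affine_cone_def)
    from eq[OF this] show ?thesis by (simp add: M')
  qed auto
  ultimately show ?thesis
    unfolding order_ge_def affine_cone_def using point_power_mult[OF M'(1), of "a j"] by blast
qed

text \<open>Pulling back once more along the inverse \<open>g\<close> replaces \<open>K\<close> by
  its composition with \<open>c\<close>, the formula \<open>a\<close> after \<open>b\<close>. On the
  cone over \<open>Y\<close> this \<open>c\<close> is the identity up to a scalar depending on the
  point, so the composition is a power of that scalar times \<open>K\<close>.\<close>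

lemma order_ge_pushforward:
  fixes Z :: "('i::finite, 'a::field) proj set" and Y :: "('j::finite, 'a) proj set"
  assumes f: "\<And>P. P \<in> Z \<Longrightarrow> f P \<in> Y" and g: "\<And>Q. Q \<in> Y \<Longrightarrow> g Q \<in> Z"
    and fg: "\<And>Q. Q \<in> Y \<Longrightarrow> f (g Q) = Q" and gf: "\<And>P. P \<in> Z \<Longrightarrow> g (f P) = P"
    and P: "P \<in> Z" and a: "local_rep S Z f P a" and b: "local_rep S' Y g (f P) b"
    and K: "homogeneous m K" "order_ge Z P (msubst K a) n"
  shows "order_ge Y (f P) K n"
proof -
  let ?q = "rep_proj (f P)"
  obtain e where e: "\<And>j. homogeneous e (a j)" "\<exists>j. meval (a j) (rep_proj P) \<noteq> 0"
    "\<And>x. x \<in> affine_cone Z \<Longrightarrow> (\<lambda>j. meval (a j) x) \<noteq> (\<lambda>_. 0) \<Longrightarrow>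
       f (abs_proj x) = abs_proj (\<lambda>j. meval (a j) x)"
    by (rule local_repD[OF a]) blast
  obtain e' where e': "\<And>j. homogeneous e' (b j)" "\<exists>j. meval (b j) ?q \<noteq> 0"
    "\<And>x. x \<in> affine_cone Y \<Longrightarrow> (\<lambda>j. meval (b j) x) \<noteq> (\<lambda>_. 0) \<Longrightarrow>
       g (abs_proj x) = abs_proj (\<lambda>j. meval (b j) x)"
    by (rule local_repD[OF b]) blast
  obtain j where j: "meval (b j) ?q \<noteq> 0" using e'(2) by blast
  define c where "c = (\<lambda>i. msubst (a i) b)"
  have hc: "homogeneous (e' * e) (c i)" for i unfolding c_def by (intro homogeneous_msubst e e')
  have cval: "\<exists>r. (\<lambda>i. meval (c i) y) = (\<lambda>i. r * y i)"
    if y: "y \<in> affine_cone Y" "meval (b j) y \<noteq> 0" for y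
  proof -
    have nz: "(\<lambda>j. meval (b j) y) \<noteq> (\<lambda>_. 0)" using y(2) by metis
    have gy: "g (abs_proj y) = abs_proj (\<lambda>j. meval (b j) y)" by (rule e'(3)[OF y(1) nz])
    have Yy: "abs_proj y \<in> Y" using y(1) by (simp add: affine_cone_def)
    have cone: "(\<lambda>j. meval (b j) y) \<in> affine_cone Z"
      using g[OF Yy] nz by (simp add: affine_cone_def gy)
    show ?thesis
    proof (cases "(\<lambda>i. meval (c i) y) = (\<lambda>_. 0)")
      case True
      then show ?thesis by (intro exI[of _ 0]) simp
    next
      case nzc: False
      then have "f (g (abs_proj y)) = abs_proj (\<lambda>i. meval (c i) y)"
        unfolding gy c_def meval_msubst by (intro e(3)[OF cone])
      then show ?thesis
        using fg[OF Yy] abs_proj_eq_iff[OF affine_cone_nonzero[OF y(1)] nzc] by auto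
    qed
  qed
  obtain k where k: "?q k \<noteq> 0" using rep_proj_nonzero[of "f P"] by (metis ext)
  have fPY: "f P \<in> Y" by (rule f[OF P])
  \<comment> \<open>If \<open>c k\<close> vanished at \<open>f P\<close>, the scalar
    \<open>r\<close> would be zero there, and all \<open>a i\<close> would vanish at
    \<open>P\<close>, against the choice of \<open>a\<close>.\<close>
  have ck: "meval (c k) ?q \<noteq> 0"
  proof
    assume 0: "meval (c k) ?q = 0"
    obtain r where r: "(\<lambda>i. meval (c i) ?q) = (\<lambda>i. r * ?q i)"
      using cval[of ?q] fPY j by auto
    then have "r * ?q k = 0" using 0 by metis
    then have 00: "meval (a i) (\<lambda>j. meval (b j) ?q) = 0" for i
      using r k unfolding c_def meval_msubst by (metis mult_eq_0_iff)
    have nz: "(\<lambda>j. meval (b j) ?q) \<noteq> (\<lambda>_. 0)" using j by metis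
    then have "P = abs_proj (\<lambda>j. meval (b j) ?q)"
      using e'(3)[OF _ nz] fPY gf[OF P] by simp
    then show False using e(2) vanishes_abs[OF e(1) nz] 00 by (metis vanishes_rep)
  qed
  have "order_ge Y (f P) (msubst (msubst K a) b) n"
    by (rule order_ge_pullback[of Y g Z, OF g fPY b]) (use K gf[OF P] in auto)
  then obtain d U M where U: "homogeneous d U" "\<not> vanishes U (f P)" "M \<in> point_power (f P) n"
    and eq: "\<And>y. y \<in> affine_cone Y \<Longrightarrow> meval (U * msubst (msubst K a) b) y = meval M y"
    unfolding order_ge_def affine_cone_def by blast
  \<comment> \<open>With \<open>c k = r y_k\<close>, multiplying the value \<open>r^m K\<close> by
    \<open>y_k^m\<close> gives \<open>(c k)^m K\<close>, which no longer mentions the scalar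
    \<open>r\<close>.\<close>
  define U' where "U' = U * b j * c k ^ m"
  define M' where "M' = b j * mvar k ^ m * M"
  have "homogeneous (d + e' + e' * e * m) U'"
    unfolding U'_def by (intro homogeneous_mult homogeneous_power hc e' U)
  moreover have "\<not> vanishes U' (f P)"
    using U(2) j ck by (simp add: U'_def vanishes_rep)
  moreover have "M' \<in> point_power (f P) n"
    unfolding M'_def by (intro point_power_mult U)
  moreover have "meval (U' * K) y = meval M' y" if y: "y \<in> affine_cone Y" for y
  proof (cases "meval (b j) y = 0")
    case False
    obtain r where r: "(\<lambda>i. meval (c i) y) = (\<lambda>i. r * y i)" using cval[OF y False] by blast
    have "meval (msubst (msubst K a) b) y = meval K (\<lambda>i. meval (c i) y)"
      by (simp add: c_def)
    also have "\<dots> = r ^ m * meval K y" unfolding r by (rule meval_scale[OF K(1)])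
    finally have Kc: "meval (msubst (msubst K a) b) y = r ^ m * meval K y" .
    have "meval (c k) y = r * y k" using r by metis
    then have "meval (U' * K) y = meval (b j) y * y k ^ m * (meval U y * (r ^ m * meval K y))"
      by (simp add: U'_def power_mult_distrib)
    also have "\<dots> = meval M' y" using eq[OF y] Kc by (simp add: M'_def del: meval_msubst)
    finally show ?thesis .
  qed (simp add: U'_def M'_def)
  ultimately show ?thesis unfolding order_ge_def affine_cone_def by blast
qed

lemma iso_overE:
  assumes "iso_over S Z Y f"
  obtains g where "morphism_over S Z Y f" "morphism_over S Y Z g" "\<And>P. P \<in> Z \<Longrightarrow> f P \<in> Y"
    "\<And>Q. Q \<in> Y \<Longrightarrow> g Q \<in> Z" "\<And>P. P \<in> Z \<Longrightarrow> g (f P) = P" "\<And>Q. Q \<in> Y \<Longrightarrow> f (g Q) = Q"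
  using assms unfolding iso_over_def morphism_over_def by blast

lemma order_ge_iso:
  fixes Z :: "('i::finite, 'a::field) proj set" and Y :: "('j::finite, 'a) proj set"
  assumes "iso_over S Z Y f" "P \<in> Z" "local_rep S' Z f P a" "homogeneous m K"
  shows "order_ge Z P (msubst K a) n \<longleftrightarrow> order_ge Y (f P) K n"
proof -
  obtain g where g: "morphism_over S Z Y f" "morphism_over S Y Z g" "\<And>P. P \<in> Z \<Longrightarrow> f P \<in> Y"
    "\<And>Q. Q \<in> Y \<Longrightarrow> g Q \<in> Z" "\<And>P. P \<in> Z \<Longrightarrow> g (f P) = P" "\<And>Q. Q \<in> Y \<Longrightarrow> f (g Q) = Q"
    using iso_overE[OF assms(1)] by blast
  obtain b where b: "local_rep S Y g (f P) b"
    using g(2) g(3)[OF assms(2)] unfolding morphism_over_def by blast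
  show ?thesis
    using order_ge_pullback[of Z f Y, OF g(3) assms(2,3)]
      order_ge_pushforward[of Z f Y g, OF g(3,4,6,5) assms(2,3) b assms(4)] by blast
qed

lemma order_at_iso:
  fixes Z :: "('i::finite, 'a::field) proj set" and Y :: "('j::finite, 'a) proj set"
  assumes "iso_over S Z Y f" "P \<in> Z" "local_rep S' Z f P a" "homogeneous m K"
  shows "order_at Z P (msubst K a) = order_at Y (f P) K"
  unfolding order_at_def order_ge_iso[OF assms] ..

lemma order_ge_cong:
  assumes "\<And>x. x \<in> affine_cone Z \<Longrightarrow> meval F x = meval G x"
  shows "order_ge Z P F n \<longleftrightarrow> order_ge Z P G n"
  using assms unfolding order_ge_def affine_cone_def by simp

lemma order_at_cong:
  assumes "\<And>x. x \<in> affine_cone Z \<Longrightarrow> meval F x = meval G x"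
  shows "order_at Z P F = order_at Z P G"
proof -
  have "order_ge Z P F = order_ge Z P G" using order_ge_cong[of Z F G P, OF assms] by blast
  then show ?thesis by (simp add: order_at_def)
qed

section \<open>Non-singular irreducible curves\<close>

lemma zero_on_mult: "zero_on Z F \<Longrightarrow> zero_on Z (G * F)" "zero_on Z F \<Longrightarrow> zero_on Z (F * G)"
  by (auto simp: zero_on_def)

lemma not_zero_onI: "P \<in> Z \<Longrightarrow> meval F (rep_proj P) \<noteq> 0 \<Longrightarrow> \<not> zero_on Z F"
  unfolding zero_on_def using rep_in_affine_cone by blast

lemma not_zero_onE:
  assumes "homogeneous n F" "\<not> zero_on Z F"
  obtains P where "P \<in> Z" "meval F (rep_proj P) \<noteq> 0"
  using assms not_identically_zero_on_iff unfolding not_identically_zero_on_def vanishes_rep by blast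

lemma order_ge_0: "homogeneous n F \<Longrightarrow> order_ge Z P F 0"
proof -
  have "F * (\<Prod>k<(0::nat). undefined) \<in> point_power P 0"
    by (rule point_power.prod) auto
  then show ?thesis unfolding order_ge_def
    by (intro exI[of _ 0] exI[of _ 1]) (auto simp: vanishes_rep)
qed

lemma local_assoc_mult:
  assumes "local_assoc Z P n F m G" "local_assoc Z P n' F' m' G'"
  shows "local_assoc Z P (n + n') (F * F') (m + m') (G * G')"
proof -
  obtain dU dV U V where 1: "homogeneous dU U" "homogeneous dV V" "dU + n = dV + m"
    "meval U (rep_proj P) \<noteq> 0" "meval V (rep_proj P) \<noteq> 0"
    "\<And>x. x\<in>affine_cone Z \<Longrightarrow> meval U x * meval F x = meval V x * meval G x"
    using assms(1) unfolding local_assoc_def by blast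
  obtain dU' dV' U' V' where 2: "homogeneous dU' U'" "homogeneous dV' V'" "dU' + n' = dV' + m'"
    "meval U' (rep_proj P) \<noteq> 0" "meval V' (rep_proj P) \<noteq> 0"
    "\<And>x. x\<in>affine_cone Z \<Longrightarrow> meval U' x * meval F' x = meval V' x * meval G' x"
    using assms(2) unfolding local_assoc_def by blast
  have eq: "meval (U * U') x * meval (F * F') x = meval (V * V') x * meval (G * G') x"
    if "x \<in> affine_cone Z" for x
  proof -
    have "meval (U * U') x * meval (F * F') x
        = (meval U x * meval F x) * (meval U' x * meval F' x)"
      by (simp add: algebra_simps)
    also have "\<dots> = meval (V * V') x * meval (G * G') x"
      unfolding 1(6)[OF that] 2(6)[OF that] by (simp add: algebra_simps)
    finally show ?thesis .
  qed
  show ?thesis unfolding local_assoc_def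
    by (rule exI[of _ "dU + dU'"], rule exI[of _ "dV + dV'"], rule exI[of _ "U * U'"],
        rule exI[of _ "V * V'"])
      (use 1(1-5) 2(1-5) eq in \<open>auto intro!: homogeneous_mult\<close>)
qed

text \<open>Finiteness of orders is not yet assumed: for a diagonal curve it is derived inside this
  locale from explicit forms, and only then do \<open>smooth_curve\<close> and
  \<open>projective_curve\<close> apply.\<close>

locale smooth_irreducible =
  fixes Z :: "('i::finite, 'a::field_char_0) proj set"
  assumes irreducible: "homogeneous n F \<Longrightarrow> homogeneous m G \<Longrightarrow> zero_on Z (F * G) \<Longrightarrow>
      zero_on Z F \<or> zero_on Z G"
    and smooth: "P \<in> Z \<Longrightarrow> \<exists>d t. uniformizer Z P d t \<and> \<not> zero_on Z t"
begin

lemma zero_on_power: "homogeneous n F \<Longrightarrow> zero_on Z (F ^ k) \<Longrightarrow> k > 0 \<Longrightarrow> zero_on Z F"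
proof (induction k)
  case (Suc k)
  then show ?case
    using irreducible[OF Suc.prems(1) homogeneous_power[OF Suc.prems(1)], of k]
    by (cases "k = 0") auto
qed simp

lemma not_zero_on_power: "homogeneous n F \<Longrightarrow> \<not> zero_on Z F \<Longrightarrow> Z \<noteq> {} \<Longrightarrow> \<not> zero_on Z (F ^ k)"
  using zero_on_power[of n F k] not_zero_onI[of _ Z 1] by (cases "k = 0") auto

lemma not_zero_on_mult:
  "homogeneous n F \<Longrightarrow> homogeneous m G \<Longrightarrow> \<not> zero_on Z F \<Longrightarrow> \<not> zero_on Z G \<Longrightarrow> \<not> zero_on Z (F * G)"
  using irreducible by blast

text \<open>If \<open>F\<close> also had order at least \<open>j > k\<close>, then
  \<open>t^k (U' V - U V' t^(j-k))\<close> would vanish on the curve. Irreducibility cancels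
  \<open>t^k\<close>, but at \<open>P\<close> the other factor is the nonzero value of
  \<open>U' V\<close>.\<close>

lemma order_at_local_assoc:
  assumes P: "P \<in> Z" and t: "uniformizer Z P d t" "\<not> zero_on Z t" and F: "homogeneous n F"
    and FT: "local_assoc Z P n F (k * d) (t ^ k)"
  shows "order_ge Z P F j \<longleftrightarrow> j \<le> k" "order_at Z P F = k"
proof -
  have ht: "homogeneous d t" "meval t (rep_proj P) = 0" using t by (auto simp: uniformizer_def vanishes_rep)
  obtain dU dV U V where 1: "homogeneous dU U" "homogeneous dV V" "dU + n = dV + k * d"
    "meval U (rep_proj P) \<noteq> 0" "meval V (rep_proj P) \<noteq> 0"
    "\<And>x. x\<in>affine_cone Z \<Longrightarrow> meval U x * meval F x = meval V x * meval (t ^ k) x"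
    using FT unfolding local_assoc_def by blast
  have not: "\<not> order_ge Z P F j" if j: "j > k" for j
  proof
    assume "order_ge Z P F j"
    then obtain dU' dV' U' V' where 2: "homogeneous dU' U'" "homogeneous dV' V'" "dU' + n = dV' + j * d"
      "meval U' (rep_proj P) \<noteq> 0"
      "\<And>x. x\<in>affine_cone Z \<Longrightarrow> meval U' x * meval F x = meval V' x * meval (t ^ j) x"
      unfolding order_ge_iff_local_mult[OF t(1) F] local_mult_def by blast
    define W where "W = U' * V - U * V' * t ^ (j - k)"
    have jd: "j * d = (j - k) * d + k * d" using j by (simp flip: distrib_right)
    have W: "homogeneous (dU' + dV) W" unfolding W_def
    proof (rule homogeneous_diff[OF homogeneous_mult[OF 2(1) 1(2)]])
      show "homogeneous (dU' + dV) (U * V' * t ^ (j - k))"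
        by (rule homogeneous_mult'[OF homogeneous_mult[OF 1(1) 2(2)] homogeneous_power[OF ht(1)]])
          (use 1(3) 2(3) jd in \<open>simp add: mult.commute\<close>)
    qed
    have "meval (t ^ k * W) x = 0" if "x \<in> affine_cone Z" for x
    proof -
      have tj: "meval t x ^ j = meval t x ^ (j - k) * meval t x ^ k"
        using j by (simp flip: power_add)
      have "meval (t ^ k * W) x = meval U' x * (meval V x * meval (t ^ k) x)
          - meval U x * (meval V' x * meval (t ^ j) x)"
        by (simp add: W_def algebra_simps tj)
      also have "\<dots> = 0"
        unfolding 1(6)[OF that, symmetric] 2(5)[OF that, symmetric] by (simp add: algebra_simps)
      finally show ?thesis .
    qed
    then have "zero_on Z (t ^ k * W)" by (simp add: zero_on_def)
    then have "zero_on Z (t ^ k) \<or> zero_on Z W"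
      by (rule irreducible[OF homogeneous_power[OF ht(1)] W])
    moreover have "\<not> zero_on Z (t ^ k)" using not_zero_on_power[OF ht(1) t(2)] P by blast
    moreover have "meval W (rep_proj P) \<noteq> 0"
      using 1 2 ht j by (simp add: W_def power_0_left)
    ultimately show False using not_zero_onI[OF P] by blast
  qed
  have "local_mult Z P n F (k * d) (t ^ k)"
    using FT unfolding local_mult_def local_assoc_def by blast
  then have ge: "local_mult Z P n F (j * d) (t ^ j)" if "j \<le> k" for j
  proof -
    have "k * d = (k - j) * d + j * d" "t ^ k = t ^ (k - j) * t ^ j"
      using that by (simp_all flip: power_add distrib_right)
    then have "local_mult Z P (k * d) (t ^ k) (j * d) (t ^ j)"
      using homogeneous_power[OF ht(1), of "k - j"] unfolding local_mult_def
      by - (rule exI[of _ 0], rule exI[of _ "(k - j) * d"], rule exI[of _ 1],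
          rule exI[of _ "t ^ (k - j)"], simp add: mult.commute)
    then show ?thesis using local_mult_trans[OF \<open>local_mult Z P n F (k * d) (t ^ k)\<close>] by blast
  qed
  show iff: "order_ge Z P F j \<longleftrightarrow> j \<le> k" for j
    using not[of j] ge[of j] order_ge_iff_local_mult[OF t(1) F] by (meson not_le)
  show "order_at Z P F = k"
    unfolding order_at_def by (rule Greatest_equality) (auto simp: iff)
qed

text \<open>Take the last exponent \<open>k\<close> for which divisibility by \<open>t^k\<close>
  holds. If the cofactor vanished at \<open>P\<close>, it would be divisible by \<open>t\<close> and
  \<open>k\<close> would not be the last.\<close>

lemma ex_local_assoc:
  assumes t: "uniformizer Z P d t" and F: "homogeneous n F" and fin: "\<not> order_ge Z P F j"
  shows "\<exists>k. local_assoc Z P n F (k * d) (t ^ k)"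
proof -
  define N where "N = (LEAST j. \<not> order_ge Z P F j)"
  have N: "\<not> order_ge Z P F N" unfolding N_def using fin by (rule LeastI)
  then have "N \<noteq> 0" using order_ge_0[OF F] by metis
  then obtain k where k: "N = Suc k" by (cases N) auto
  have "order_ge Z P F k" using not_less_Least[of k "\<lambda>j. \<not> order_ge Z P F j"] k unfolding N_def by simp
  then obtain dU dV U V where 1: "homogeneous dU U" "homogeneous dV V" "dU + n = dV + k * d"
    "meval U (rep_proj P) \<noteq> 0"
    "\<And>x. x\<in>affine_cone Z \<Longrightarrow> meval U x * meval F x = meval V x * meval (t ^ k) x"
    unfolding order_ge_iff_local_mult[OF t F] local_mult_def by blast
  have "meval V (rep_proj P) \<noteq> 0"
  proof
    assume "meval V (rep_proj P) = 0"
    then have "local_mult Z P dV V d t" using uniformizer_mult[OF t 1(2)] by (simp add: vanishes_rep)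
    from local_mult_mult[OF this local_mult_refl, of "k * d" "t ^ k"]
    have "local_mult Z P (dV + k * d) (V * t ^ k) (Suc k * d) (t ^ Suc k)" by simp
    moreover have "local_mult Z P n F (dV + k * d) (V * t ^ k)"
      unfolding local_mult_def
      by (intro exI[of _ dU] exI[of _ 0] exI[of _ U] exI[of _ 1]) (use 1 in auto)
    ultimately have "local_mult Z P n F (Suc k * d) (t ^ Suc k)" using local_mult_trans by blast
    then show False using N unfolding k order_ge_iff_local_mult[OF t F] by blast
  qed
  then show ?thesis unfolding local_assoc_def using 1 by blast
qed

lemma order_ge_mult_mono:
  assumes "P \<in> Z" "homogeneous n F" "homogeneous m G" "order_ge Z P F k"
  shows "order_ge Z P (G * F) k"
proof -
  obtain d t where t: "uniformizer Z P d t" using smooth[OF assms(1)] by blast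
  show ?thesis using assms(4)
    unfolding order_ge_iff_local_mult[OF t assms(2)]
      order_ge_iff_local_mult[OF t homogeneous_mult[OF assms(3,2)]]
    by (rule local_mult_multl[OF assms(3)])
qed

text \<open>\<open>order_at\<close> is a \<open>GREATEST\<close> and has a meaning only for a
  bounded set of exponents; boundedness is therefore tracked on its own.\<close>

definition finite_order :: "('i, 'a) proj \<Rightarrow> ('i, 'a) mpoly \<Rightarrow> bool" where
  "finite_order P F \<longleftrightarrow> (\<exists>j. \<not> order_ge Z P F j)"

lemma finite_order_local_assoc:
  assumes "P \<in> Z" "uniformizer Z P d t" "\<not> zero_on Z t" "homogeneous n F"
    "local_assoc Z P n F (k * d) (t ^ k)"
  shows "finite_order P F"
  unfolding finite_order_def using order_at_local_assoc(1)[OF assms, of "Suc k"]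
  by (intro exI[of _ "Suc k"]) simp

lemma finite_order_mult:
  assumes P: "P \<in> Z" and F: "homogeneous n F" "finite_order P F" and G: "homogeneous m G" "finite_order P G"
  shows "finite_order P (F * G)"
proof -
  obtain d t where t: "uniformizer Z P d t" "\<not> zero_on Z t" using smooth[OF P] by blast
  obtain k l where "local_assoc Z P n F (k * d) (t ^ k)" "local_assoc Z P m G (l * d) (t ^ l)"
    using ex_local_assoc[OF t(1)] F G unfolding finite_order_def by metis
  from local_assoc_mult[OF this]
  have "local_assoc Z P (n + m) (F * G) ((k + l) * d) (t ^ (k + l))"
    by (simp add: power_add distrib_right)
  then show ?thesis by (rule finite_order_local_assoc[OF P t homogeneous_mult[OF F(1) G(1)]])
qed

lemma finite_order_factor:
  assumes "P \<in> Z" "homogeneous n F" "homogeneous m G" "finite_order P (G * F)"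
  shows "finite_order P F"
  using order_ge_mult_mono[OF assms(1-3)] assms(4) unfolding finite_order_def by blast

lemma finite_order_nonvanishing:
  assumes P: "P \<in> Z" and F: "homogeneous n F" "meval F (rep_proj P) \<noteq> 0"
  shows "finite_order P F"
proof -
  obtain d t where t: "uniformizer Z P d t" "\<not> zero_on Z t" using smooth[OF P] by blast
  have "local_assoc Z P n F (0 * d) (t ^ 0)" unfolding local_assoc_def
    by (intro exI[of _ 0] exI[of _ n] exI[of _ 1] exI[of _ F]) (use F in auto)
  then show ?thesis by (rule finite_order_local_assoc[OF P t F(1)])
qed

lemma finite_order_cong:
  assumes "\<And>x. x \<in> affine_cone Z \<Longrightarrow> meval F x = meval G x" "finite_order P F"
  shows "finite_order P G"
  using order_ge_cong[of Z F G P, OF assms(1)] assms(2) unfolding finite_order_def by blast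

end

section \<open>Valuation properties of the order\<close>

locale smooth_curve = smooth_irreducible +
  assumes order_finite: "P \<in> Z \<Longrightarrow> homogeneous n F \<Longrightarrow> \<not> zero_on Z F \<Longrightarrow> \<exists>j. \<not> order_ge Z P F j"
begin

abbreviation ord where "ord P F \<equiv> order_at Z P F"

lemma ord_local_assoc:
  assumes P: "P \<in> Z" and t: "uniformizer Z P d t" "\<not> zero_on Z t"
    and F: "homogeneous n F" "\<not> zero_on Z F"
  shows "local_assoc Z P n F (ord P F * d) (t ^ ord P F)"
proof -
  obtain j where "\<not> order_ge Z P F j" using order_finite[OF P F] by blast
  then obtain k where k: "local_assoc Z P n F (k * d) (t ^ k)"
    using ex_local_assoc[OF t(1) F(1)] by blast
  then show ?thesis using order_at_local_assoc(2)[OF P t F(1) k] by simp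
qed

lemma order_ge_iff:
  assumes P: "P \<in> Z" and F: "homogeneous n F" "\<not> zero_on Z F"
  shows "order_ge Z P F k \<longleftrightarrow> k \<le> ord P F"
proof -
  obtain d t where t: "uniformizer Z P d t" "\<not> zero_on Z t" using smooth[OF P] by blast
  show ?thesis by (rule order_at_local_assoc(1)[OF P t F(1) ord_local_assoc[OF P t F]])
qed

lemma ord_mult:
  assumes P: "P \<in> Z" and F: "homogeneous n F" "\<not> zero_on Z F" and G: "homogeneous m G" "\<not> zero_on Z G"
  shows "ord P (F * G) = ord P F + ord P G"
proof -
  obtain d t where t: "uniformizer Z P d t" "\<not> zero_on Z t" using smooth[OF P] by blast
  have "local_assoc Z P (n + m) (F * G) ((ord P F + ord P G) * d) (t ^ (ord P F + ord P G))"
    using local_assoc_mult[OF ord_local_assoc[OF P t F] ord_local_assoc[OF P t G]]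
    by (simp add: power_add distrib_right)
  then show ?thesis by (rule order_at_local_assoc(2)[OF P t homogeneous_mult[OF F(1) G(1)]])
qed

lemma ord_pos_iff:
  assumes P: "P \<in> Z" and F: "homogeneous n F" "\<not> zero_on Z F"
  shows "0 < ord P F \<longleftrightarrow> meval F (rep_proj P) = 0"
proof -
  obtain d t where t: "uniformizer Z P d t" "\<not> zero_on Z t" using smooth[OF P] by blast
  obtain dU dV U V where 1: 
    "meval U (rep_proj P) \<noteq> 0" "meval V (rep_proj P) \<noteq> 0"
    "\<And>x. x\<in>affine_cone Z \<Longrightarrow> meval U x * meval F x = meval V x * meval (t ^ ord P F) x"
    using ord_local_assoc[OF P t F] unfolding local_assoc_def by blast
  have "meval t (rep_proj P) = 0" using t by (simp add: uniformizer_def vanishes_rep)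
  then show ?thesis using 1(3)[of "rep_proj P"] P 1(1,2) by (auto simp: power_0_left split: if_splits)
qed

lemma ord_eq_0:
  assumes "P \<in> Z" "homogeneous n F" "meval F (rep_proj P) \<noteq> 0"
  shows "ord P F = 0"
  using ord_pos_iff[OF assms(1,2) not_zero_onI[OF assms(1,3)]] assms(3) by simp

lemma ord_power:
  assumes P: "P \<in> Z" and F: "homogeneous n F" "\<not> zero_on Z F"
  shows "ord P (F ^ k) = k * ord P F"
proof (induction k)
  case 0
  show ?case using ord_eq_0[OF P homogeneous_1] by simp
next
  case (Suc k)
  have "\<not> zero_on Z (F ^ k)" using not_zero_on_power[OF F] P by blast
  then show ?case using ord_mult[OF P F homogeneous_power[OF F(1)], of k] Suc by simp
qed

lemma ord_mconst_mult:
  assumes P: "P \<in> Z" and F: "homogeneous n F" "\<not> zero_on Z F" and c: "c \<noteq> 0"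
  shows "ord P (mconst c * F) = ord P F"
proof -
  have "\<not> zero_on Z (mconst c)" by (rule not_zero_onI[OF P]) (use c in simp)
  then show ?thesis using ord_mult[OF P homogeneous_mconst _ F] ord_eq_0[OF P homogeneous_mconst] c
    by simp
qed

lemma ord_add:
  assumes P: "P \<in> Z" and F: "homogeneous n F" "homogeneous n G"
    and nz: "\<not> zero_on Z F" "\<not> zero_on Z G" "\<not> zero_on Z (F + G)"
    and k: "k \<le> ord P F" "k \<le> ord P G"
  shows "k \<le> ord P (F + G)"
proof -
  obtain d t where t: "uniformizer Z P d t" using smooth[OF P] by blast
  have "order_ge Z P (F + G) k"
    using k order_ge_iff[OF P F(1) nz(1)] order_ge_iff[OF P F(2) nz(2)]
      local_mult_add[of Z P n F "k * d" "t ^ k" G]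
    unfolding order_ge_iff_local_mult[OF t F(1)] order_ge_iff_local_mult[OF t F(2)]
      order_ge_iff_local_mult[OF t homogeneous_add[OF F]] by blast
  then show ?thesis using order_ge_iff[OF P homogeneous_add[OF F] nz(3)] by blast
qed

lemma ord_diff:
  assumes P: "P \<in> Z" and F: "homogeneous n F" "homogeneous n G"
    and nz: "\<not> zero_on Z F" "\<not> zero_on Z G" "\<not> zero_on Z (F - mconst c * G)"
    and k: "k \<le> ord P F" "k \<le> ord P G"
  shows "k \<le> ord P (F - mconst c * G)"
proof (cases "c = 0")
  case True
  then have "ord P (F - mconst c * G) = ord P F" by (intro order_at_cong) simp
  then show ?thesis using k by simp
next
  case False
  have eq: "ord P (F - mconst c * G) = ord P (F + mconst (- c) * G)" by (intro order_at_cong) simp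
  have "\<not> zero_on Z (mconst (- c) * G)" using nz(2) False by (auto simp: zero_on_def)
  moreover have "\<not> zero_on Z (F + mconst (- c) * G)" using nz(3) by (auto simp: zero_on_def)
  ultimately show ?thesis unfolding eq
    using ord_add[OF P F(1) homogeneous_cmult[OF F(2)] nz(1)] k
      ord_mconst_mult[OF P F(2) nz(2), of "- c"] False by simp
qed

text \<open>The quotient \<open>F / G\<close> is regular at \<open>P\<close>; \<open>c\<close> is
  its value there, computed from the unit parts of the two local equations.\<close>

lemma leading_coefficient:
  assumes P: "P \<in> Z" and F: "homogeneous n F" "homogeneous n G"
    and nz: "\<not> zero_on Z F" "\<not> zero_on Z G" and le: "ord P G \<le> ord P F"
  obtains c where "zero_on Z (F - mconst c * G) \<or> ord P G < ord P (F - mconst c * G)"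
proof -
  obtain d t where t: "uniformizer Z P d t" "\<not> zero_on Z t" using smooth[OF P] by blast
  have ht: "homogeneous d t" using t by (simp add: uniformizer_def)
  let ?f = "ord P F" and ?g = "ord P G" and ?p = "rep_proj P"
  obtain dU dV U V where 1: "homogeneous dU U" "homogeneous dV V" "dU + n = dV + ?f * d"
    "meval U ?p \<noteq> 0" "meval V ?p \<noteq> 0"
    "\<And>x. x\<in>affine_cone Z \<Longrightarrow> meval U x * meval F x = meval V x * meval (t ^ ?f) x"
    using ord_local_assoc[OF P t F(1) nz(1)] unfolding local_assoc_def by blast
  obtain dU' dV' U' V' where 2: "homogeneous dU' U'" "homogeneous dV' V'" "dU' + n = dV' + ?g * d"
    "meval U' ?p \<noteq> 0" "meval V' ?p \<noteq> 0"
    "\<And>x. x\<in>affine_cone Z \<Longrightarrow> meval U' x * meval G x = meval V' x * meval (t ^ ?g) x"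
    using ord_local_assoc[OF P t F(2) nz(2)] unfolding local_assoc_def by blast
  define c where "c = meval (U' * V * t ^ (?f - ?g)) ?p / meval (U * V') ?p"
  define W where "W = U' * V * t ^ (?f - ?g) - mconst c * (U * V')"
  have fg: "?f * d = (?f - ?g) * d + ?g * d" using le by (simp flip: distrib_right)
  have W: "homogeneous (dU + dV') W" unfolding W_def
    by (intro homogeneous_diff homogeneous_cmult homogeneous_mult 1 2
        homogeneous_mult'[OF homogeneous_mult[OF 2(1) 1(2)] homogeneous_power[OF ht]])
      (use 1(3) 2(3) fg in \<open>simp add: mult.commute\<close>)
  have "vanishes W P" using 1(4) 2(5) by (simp add: vanishes_rep W_def c_def)
  from uniformizer_mult[OF t(1) W this] have "local_mult Z P (dU + dV') W d t" .
  from local_mult_mult[OF this local_mult_refl, of "?g * d" "t ^ ?g"]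
  have 3: "local_mult Z P (dU + dV' + ?g * d) (W * t ^ ?g) (Suc ?g * d) (t ^ Suc ?g)" by simp
  have eq: "meval (U * U') x * meval (F - mconst c * G) x = meval (W * t ^ ?g) x"
    if x: "x \<in> affine_cone Z" for x
  proof -
    have tf: "meval t x ^ ?f = meval t x ^ (?f - ?g) * meval t x ^ ?g" using le by (simp flip: power_add)
    have "meval (U * U') x * meval (F - mconst c * G) x
        = meval U' x * (meval U x * meval F x) - c * meval U x * (meval U' x * meval G x)"
      by (simp add: algebra_simps)
    then show ?thesis unfolding 1(6)[OF x] 2(6)[OF x] by (simp add: algebra_simps W_def tf)
  qed
  have "local_mult Z P n (F - mconst c * G) (dU + dV' + ?g * d) (W * t ^ ?g)"
    unfolding local_mult_def
    by (intro exI[of _ "dU + dU'"] exI[of _ 0] exI[of _ "U * U'"] exI[of _ 1])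
      (use 1(1,3,4) 2(1,3,4) eq in \<open>auto intro!: homogeneous_mult\<close>)
  from local_mult_trans[OF this 3]
  have "order_ge Z P (F - mconst c * G) (Suc ?g)"
    using order_ge_iff_local_mult[OF t(1) homogeneous_diff[OF F(1) homogeneous_cmult[OF F(2)]]] by blast
  then show ?thesis
    using that[of c] order_ge_iff[OF P homogeneous_diff[OF F(1) homogeneous_cmult[OF F(2)]]]
    by (metis Suc_le_eq)
qed

end

section \<open>Principal divisors and linear systems on a curve satisfying Bezout's theorem\<close>

locale projective_curve = smooth_curve Z for Z :: "('i::finite, 'a::field_char_0) proj set" +
  fixes deg :: nat
  assumes finite_zeros: "homogeneous n F \<Longrightarrow> \<not> zero_on Z F \<Longrightarrow> finite {P\<in>Z. meval F (rep_proj P) = 0}"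
    and bezout: "homogeneous n F \<Longrightarrow> \<not> zero_on Z F \<Longrightarrow>
      (\<Sum>P | P \<in> Z \<and> meval F (rep_proj P) = 0. order_at Z P F) = deg * n"
begin

lemma bezout_superset:
  assumes F: "homogeneous n F" "\<not> zero_on Z F" and S: "finite S" "S \<subseteq> Z"
    "\<And>P. P \<in> Z \<Longrightarrow> meval F (rep_proj P) = 0 \<Longrightarrow> P \<in> S"
  shows "(\<Sum>P\<in>S. ord P F) = deg * n"
proof -
  have "(\<Sum>P | P \<in> Z \<and> meval F (rep_proj P) = 0. ord P F) = (\<Sum>P\<in>S. ord P F)"
    by (rule sum.mono_neutral_left) (use S ord_eq_0[OF _ F(1)] in \<open>blast+\<close>)
  then show ?thesis using bezout[OF F] by simp
qed

text \<open>Divisors are kept as integer functions of which only the values on \<open>Z\<close>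
  matter, so that no finiteness of support has to be carried along.\<close>

definition principal :: "(('i, 'a) proj \<Rightarrow> int) \<Rightarrow> bool" where
  "principal e \<longleftrightarrow> (\<exists>n F G. homogeneous n F \<and> homogeneous n G \<and> \<not> zero_on Z F \<and> \<not> zero_on Z G \<and>
     (\<forall>P\<in>Z. e P = int (ord P F) - int (ord P G)))"

lemma principal_add:
  assumes "principal e" "principal e'"
  shows "principal (\<lambda>P. e P + e' P)"
proof -
  obtain n F G n' F' G' where 1: "homogeneous n F" "homogeneous n G" "\<not> zero_on Z F" "\<not> zero_on Z G"
      "\<And>P. P \<in> Z \<Longrightarrow> e P = int (ord P F) - int (ord P G)"
    and 2: "homogeneous n' F'" "homogeneous n' G'" "\<not> zero_on Z F'" "\<not> zero_on Z G'"
      "\<And>P. P \<in> Z \<Longrightarrow> e' P = int (ord P F') - int (ord P G')"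
    using assms unfolding principal_def by blast
  show ?thesis unfolding principal_def
    by (intro exI[of _ "n + n'"] exI[of _ "F * F'"] exI[of _ "G * G'"])
      (use 1 2 ord_mult[OF _ 1(1,3) 2(1,3)] ord_mult[OF _ 1(2,4) 2(2,4)] in
        \<open>auto intro: homogeneous_mult simp: not_zero_on_mult\<close>)
qed

lemma principal_uminus: "principal e \<Longrightarrow> principal (\<lambda>P. - e P)"
  unfolding principal_def by (metis minus_diff_eq)

lemma principal_cong: "principal e \<Longrightarrow> (\<And>P. P \<in> Z \<Longrightarrow> e P = e' P) \<Longrightarrow> principal e'"
  unfolding principal_def by metis

text \<open>By Bezout both sides have the same total degree, so the inequality leaves no room
  anywhere.\<close>

lemma divisor_eq_of_le:
  assumes F: "homogeneous n F" "\<not> zero_on Z F" and G: "homogeneous n G" "\<not> zero_on Z G"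
    and A: "finite A" "A \<subseteq> Z" "\<And>P. P \<notin> A \<Longrightarrow> e P = 0" "sum e A = 0"
    and le: "\<And>P. P \<in> Z \<Longrightarrow> int (ord P G) + e P \<le> int (ord P F)"
    and P: "P \<in> Z"
  shows "int (ord P F) = int (ord P G) + e P"
proof -
  define S where "S = A \<union> {P} \<union> {P\<in>Z. meval F (rep_proj P) = 0} \<union> {P\<in>Z. meval G (rep_proj P) = 0}"
  have S: "finite S" "S \<subseteq> Z" using A P finite_zeros[OF F] finite_zeros[OF G] by (auto simp: S_def)
  have "(\<Sum>P\<in>S. ord P F) = deg * n" by (rule bezout_superset[OF F S]) (auto simp: S_def)
  then have 1: "(\<Sum>P\<in>S. int (ord P F)) = int (deg * n)" by (metis of_nat_sum)
  have "(\<Sum>P\<in>S. ord P G) = deg * n" by (rule bezout_superset[OF G S]) (auto simp: S_def)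
  then have 2: "(\<Sum>P\<in>S. int (ord P G)) = int (deg * n)" by (metis of_nat_sum)
  have "sum e A = sum e S" by (rule sum.mono_neutral_left) (use S A in \<open>auto simp: S_def\<close>)
  then have "(\<Sum>P\<in>S. int (ord P F) - (int (ord P G) + e P)) = 0"
    using 1 2 A(4) by (simp add: sum_subtractf sum.distrib)
  then have "\<forall>P\<in>S. int (ord P F) - (int (ord P G) + e P) = 0"
    using S le by (subst (asm) sum_nonneg_eq_0_iff) auto
  then show ?thesis using P by (auto simp: S_def)
qed

text \<open>Subtract the multiple of \<open>G\<close> that agrees with \<open>F\<close> at a point
  where \<open>G\<close> does not vanish. A nonzero difference would have the same divisor as
  \<open>G\<close>, and yet vanish at that point.\<close>

lemma proportional_of_divisor_le:
  assumes F: "homogeneous n F" "\<not> zero_on Z F" and G: "homogeneous n G" "\<not> zero_on Z G"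
    and le: "\<And>P. P \<in> Z \<Longrightarrow> ord P G \<le> ord P F"
  obtains c where "c \<noteq> 0" "zero_on Z (F - mconst c * G)"
proof -
  obtain P where P: "P \<in> Z" "meval G (rep_proj P) \<noteq> 0" by (rule not_zero_onE[OF G])
  define c where "c = meval F (rep_proj P) / meval G (rep_proj P)"
  have H: "homogeneous n (F - mconst c * G)" by (intro homogeneous_diff homogeneous_cmult F G)
  have z: "zero_on Z (F - mconst c * G)"
  proof (rule ccontr)
    assume nz: "\<not> zero_on Z (F - mconst c * G)"
    have "int (ord P (F - mconst c * G)) = int (ord P G) + 0"
      by (rule divisor_eq_of_le[OF H nz G, of "{}"])
        (use P le ord_diff[OF _ F(1) G(1) F(2) G(2) nz] in auto)
    moreover have "ord P G = 0" by (rule ord_eq_0[OF P(1) G(1) P(2)])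
    moreover have "meval (F - mconst c * G) (rep_proj P) = 0" using P(2) by (simp add: c_def)
    ultimately show False using ord_pos_iff[OF P(1) H nz] by simp
  qed
  moreover have "c \<noteq> 0" using z F(2) by (auto simp: zero_on_def)
  ultimately show ?thesis using that by blast
qed

text \<open>A function with a single simple pole \<open>Q\<close> keeps this pole when a constant is
  subtracted; subtracting its value at \<open>S\<close> moves the zero from \<open>P\<close> to
  \<open>S\<close>.\<close>

lemma principal_move:
  assumes e: "principal (\<lambda>R. of_bool (R = P) - of_bool (R = Q))"
    and PQ: "P \<in> Z" "Q \<in> Z" "P \<noteq> Q" and S: "S \<in> Z"
  shows "principal (\<lambda>R. of_bool (R = S) - of_bool (R = Q))"
proof (cases "S = Q")
  case True
  have "principal (\<lambda>R. 0)" using principal_add[OF e principal_uminus[OF e]] by simp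
  then show ?thesis by (simp add: True)
next
  case False
  obtain n F G where 1: "homogeneous n F" "homogeneous n G" "\<not> zero_on Z F" "\<not> zero_on Z G"
      "\<And>R. R \<in> Z \<Longrightarrow> of_bool (R = P) - of_bool (R = Q) = int (ord R F) - int (ord R G)"
    using e unfolding principal_def by blast
  have le: "ord S G \<le> ord S F" using 1(5)[OF S] False by (auto simp: of_bool_def split: if_splits)
  obtain c where c: "zero_on Z (F - mconst c * G) \<or> ord S G < ord S (F - mconst c * G)"
    by (rule leading_coefficient[OF S 1(1-4) le])
  have H: "homogeneous n (F - mconst c * G)" by (intro homogeneous_diff homogeneous_cmult 1)
  have nz: "\<not> zero_on Z (F - mconst c * G)"
  proof
    assume z: "zero_on Z (F - mconst c * G)"
    then have c0: "c \<noteq> 0" using 1(3) by (auto simp: zero_on_def)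
    have "ord P F = ord P (mconst c * G)" by (rule order_at_cong) (use z in \<open>auto simp: zero_on_def\<close>)
    then have "ord P F = ord P G" using ord_mconst_mult[OF PQ(1) 1(2,4) c0] by simp
    then show False using 1(5)[OF PQ(1)] PQ(3) by simp
  qed
  let ?e = "\<lambda>R. of_bool (R = S) - of_bool (R = Q) :: int"
  have "int (ord R (F - mconst c * G)) = int (ord R G) + ?e R" if "R \<in> Z" for R
  proof (rule divisor_eq_of_le[OF H nz 1(2,4), of "{S, Q}"])
    show "sum ?e {S, Q} = 0" using False by simp
    fix R assume R: "R \<in> Z"
    consider "R = S" | "R = Q" | "R \<noteq> S" "R \<noteq> Q" by blast
    then show "int (ord R G) + ?e R \<le> int (ord R (F - mconst c * G))"
    proof cases
      case 1
      then show ?thesis using c nz False by simp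
    next
      case 2
      have "int (ord Q F) = int (ord Q G) - 1" using 1(5)[OF PQ(2)] PQ(3) by simp
      then have "ord Q F \<le> ord Q G" by linarith
      then show ?thesis using ord_diff[OF R 1(1,2,3,4) nz, of "ord Q F"] False 2
          \<open>int (ord Q F) = int (ord Q G) - 1\<close> by simp
    next
      case 3
      have "ord R G \<le> ord R F" using 1(5)[OF R] 3 by (auto simp: of_bool_def split: if_splits)
      then show ?thesis using ord_diff[OF R 1(1,2,3,4) nz, of "ord R G"] 3 by simp
    qed
  qed (use S PQ that in auto)
  then show ?thesis unfolding principal_def using H 1(2,4) nz
    by (intro exI[of _ n] exI[of _ "F - mconst c * G"] exI[of _ G]) simp
qed

text \<open>One more zero at \<open>P\<close> costs at most one dimension. A member of exact order
  \<open>\<Delta> P\<close> serves as pivot and is subtracted from the others with the leading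
  coefficients; if there is none, any member may be dropped.\<close>

lemma linear_system_step:
  fixes I :: "'j set"
  assumes I: "finite I" "card I = Suc (Suc n)" and P: "P \<in> Z"
    and f: "\<And>i. i \<in> I \<Longrightarrow> homogeneous d (f i)"
    and indep: "\<And>c. zero_on Z (\<Sum>i\<in>I. mconst (c i) * f i) \<Longrightarrow> \<forall>i\<in>I. c i = 0"
    and ge: "\<And>i R. i \<in> I \<Longrightarrow> R \<in> Z \<Longrightarrow> \<Delta> R \<le> ord R (f i)"
  shows "\<exists>(J :: 'j set) g. finite J \<and> card J = Suc n \<and> (\<forall>i\<in>J. homogeneous d (g i)) \<and>
     (\<forall>c. zero_on Z (\<Sum>i\<in>J. mconst (c i) * g i) \<longrightarrow> (\<forall>i\<in>J. c i = 0)) \<and>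
     (\<forall>i\<in>J. \<forall>R\<in>Z. \<Delta> R + of_bool (R = P) \<le> ord R (g i))"
proof -
  have nz: "\<not> zero_on Z (f i)" if "i \<in> I" for i
  proof
    assume z: "zero_on Z (f i)"
    have "meval (\<Sum>j\<in>I. mconst (of_bool (j = i)) * f j) x = meval (f i) x" for x
      using I(1) that by (simp add: of_bool_def if_distrib[of "\<lambda>c. c * _"] cong: if_cong)
    then have "zero_on Z (\<Sum>j\<in>I. mconst (of_bool (j = i)) * f j)"
      using z unfolding zero_on_def by presburger
    from indep[OF this] that show False by auto
  qed
  show ?thesis
  proof (cases "\<forall>i\<in>I. \<Delta> P < ord P (f i)")
    case True
    obtain m where m: "m \<in> I" using I(2) by fastforce
    have "\<forall>i\<in>I - {m}. c i = 0" if "zero_on Z (\<Sum>i\<in>I - {m}. mconst (c i) * f i)" for c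
    proof -
      have "meval (\<Sum>i\<in>I. mconst (if i = m then 0 else c i) * f i) x
          = meval (\<Sum>i\<in>I - {m}. mconst (c i) * f i) x" for x
        using I(1) m by (simp add: sum.remove[of I m])
      then have "zero_on Z (\<Sum>i\<in>I. mconst (if i = m then 0 else c i) * f i)"
        using that unfolding zero_on_def by presburger
      from indep[OF this] show ?thesis by (metis DiffD1 DiffD2 insertI1)
    qed
    then show ?thesis using I m True f ge
      by - (rule exI[of _ "I - {m}"], rule exI[of _ f], auto simp: Suc_le_eq of_bool_def)
  next
    case False
    then obtain m where m: "m \<in> I" "ord P (f m) = \<Delta> P" using ge[OF _ P] by (metis antisym not_le)
    have "\<exists>c. zero_on Z (f i - mconst c * f m) \<or> ord P (f m) < ord P (f i - mconst c * f m)"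
      if "i \<in> I" for i
      using leading_coefficient[OF P f[OF that] f[OF m(1)] nz[OF that] nz[OF m(1)]]
        ge[OF that P] m(2) by metis
    then obtain b where b: "\<And>i. i \<in> I \<Longrightarrow> zero_on Z (f i - mconst (b i) * f m) \<or>
        ord P (f m) < ord P (f i - mconst (b i) * f m)" by metis
    define g where "g = (\<lambda>i. f i - mconst (b i) * f m)"
    have indep': "\<forall>i\<in>I - {m}. c i = 0" if "zero_on Z (\<Sum>i\<in>I - {m}. mconst (c i) * g i)" for c
    proof -
      define s where "s = (\<Sum>i\<in>I - {m}. c i * b i)"
      have "meval (\<Sum>i\<in>I. mconst (if i = m then - s else c i) * f i) x
          = meval (\<Sum>i\<in>I - {m}. mconst (c i) * g i) x" for x
        using I(1) m
        by (simp add: sum.remove[of I m] g_def right_diff_distrib sum_subtractf s_def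
            sum_distrib_right mult.assoc)
      then have "zero_on Z (\<Sum>i\<in>I. mconst (if i = m then - s else c i) * f i)"
        using that unfolding zero_on_def by presburger
      from indep[OF this] show ?thesis by (metis DiffD1 DiffD2 insertI1)
    qed
    have hg: "homogeneous d (g i)" if "i \<in> I" for i
      unfolding g_def by (intro homogeneous_diff homogeneous_cmult f that m)
    have gnz: "\<not> zero_on Z (g i)" if "i \<in> I - {m}" for i
    proof
      assume z: "zero_on Z (g i)"
      have "meval (\<Sum>j\<in>I - {m}. mconst (of_bool (j = i)) * g j) x = meval (g i) x" for x
        using I(1) that by (simp add: of_bool_def if_distrib[of "\<lambda>c. c * _"] cong: if_cong)
      then have "zero_on Z (\<Sum>j\<in>I - {m}. mconst (of_bool (j = i)) * g j)"
        using z unfolding zero_on_def by presburger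
      from indep'[OF this] that show False by auto
    qed
    have "\<Delta> R + of_bool (R = P) \<le> ord R (g i)" if i: "i \<in> I - {m}" and R: "R \<in> Z" for i R
    proof (cases "R = P")
      case True
      then show ?thesis using b[of i] gnz[OF i] i m(2) by (auto simp: g_def)
    next
      case False
      have "\<Delta> R \<le> ord R (f i - mconst (b i) * f m)"
        by (rule ord_diff[OF R]) (use i m(1) f nz ge[OF _ R] gnz[OF i] in \<open>auto simp: g_def\<close>)
      then show ?thesis using False by (simp add: g_def)
    qed
    then show ?thesis using I m(1) hg indep'
      by - (rule exI[of _ "I - {m}"], rule exI[of _ g], auto)
  qed
qed

end

section \<open>Binary forms\<close>

lemma UNIV_2: "(UNIV :: 2 set) = {1, 2}"
proof -
  have "card {1::2, 2} = card (UNIV :: 2 set)" by simp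
  then show ?thesis by (metis card_subset_eq finite subset_UNIV)
qed

lemma all_2: "(\<forall>i::2. P i) \<longleftrightarrow> P 1 \<and> P 2"
proof -
  have "(\<forall>i::2. P i) \<longleftrightarrow> (\<forall>i\<in>{1, 2}. P i)" by (simp flip: UNIV_2)
  then show ?thesis by simp
qed

lemma fun_2_eq_iff: "x = y \<longleftrightarrow> x (1::2) = y 1 \<and> x 2 = y 2"
  unfolding fun_eq_iff all_2 ..

lemma UNIV_4:
  assumes "distinct [i, j, k, l :: 4]"
  shows "UNIV = {i, j, k, l}"
proof -
  have "card {i, j, k, l} = card (UNIV :: 4 set)" using assms by simp
  then show ?thesis by (metis card_subset_eq finite subset_UNIV)
qed

lemma sum_4:
  assumes "distinct [i, j, k, l :: 4]"
  shows "(\<Sum>t\<in>UNIV. f t) = f i + f j + f k + f l"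
  using assms by (simp add: UNIV_4[OF assms] add.assoc)

lemma all_4:
  assumes "distinct [i, j, k, l :: 4]"
  shows "(\<forall>t. P t) \<longleftrightarrow> P i \<and> P j \<and> P k \<and> P l"
proof -
  have "(\<forall>t. P t) \<longleftrightarrow> (\<forall>t\<in>{i, j, k, l}. P t)" by (simp flip: UNIV_4[OF assms])
  then show ?thesis by simp
qed

lemma ex_remaining_4:
  assumes "i \<noteq> (j::4)"
  obtains k l where "distinct [i, j, k, l]"
proof -
  have "card (UNIV - {i, j}) = 2" using assms by (subst card_Diff_subset) auto
  then obtain k l where "UNIV - {i, j} = {k, l}" "k \<noteq> l" by (meson card_2_iff)
  then have "k \<in> UNIV - {i, j}" "l \<in> UNIV - {i, j}" "k \<noteq> l" by auto
  then show ?thesis using that[of k l] assms by auto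
qed

lemma ex_square_root: "\<exists>y. y\<^sup>2 = (x :: 'a::alg_closed_field)"
  using nth_root_exists[of 2 x] by auto

text \<open>The homogenisation of \<open>P\<close> in degree \<open>n\<close>; a zero at
  \<open>u 2 = 0\<close> is recorded by \<open>degree P < n\<close>.\<close>

definition binary_value :: "nat \<Rightarrow> 'a::comm_ring_1 poly \<Rightarrow> (2 \<Rightarrow> 'a) \<Rightarrow> 'a" where
  "binary_value n P u = (\<Sum>k\<le>n. coeff P k * u 1 ^ k * u 2 ^ (n - k))"

lemma binary_value_add: "binary_value n (P + Q) u = binary_value n P u + binary_value n Q u"
  by (simp add: binary_value_def distrib_right sum.distrib)

lemma binary_value_pCons: "binary_value (Suc n) (pCons 0 P) u = u 1 * binary_value n P u"
  unfolding binary_value_def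
  by (subst sum.atMost_Suc_shift) (simp add: sum_distrib_left mult_ac)

lemma binary_value_Suc:
  assumes "degree P \<le> n"
  shows "binary_value (Suc n) P u = u 2 * binary_value n P u"
proof -
  have "coeff P (Suc n) = 0" using assms by (simp add: coeff_eq_0)
  moreover have "(\<Sum>k\<le>n. coeff P k * u 1 ^ k * u 2 ^ (Suc n - k))
      = (\<Sum>k\<le>n. u 2 * (coeff P k * u 1 ^ k * u 2 ^ (n - k)))"
    by (intro sum.cong) (simp_all add: Suc_diff_le mult_ac)
  ultimately show ?thesis
    unfolding binary_value_def sum.atMost_Suc by (simp add: sum_distrib_left)
qed

lemma binary_value_smult: "binary_value n (smult c P) u = c * binary_value n P u"
  by (simp add: binary_value_def sum_distrib_left mult_ac)

lemma binary_value_affine: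
  assumes "degree P \<le> n" "u 2 = 1"
  shows "binary_value n P u = poly P (u 1)"
  unfolding binary_value_def poly_altdef using assms
  by (intro sum.mono_neutral_cong_right) (auto simp: coeff_eq_0)

lemma binary_form_poly:
  fixes p :: "(2, 'a::comm_ring_1) mpoly"
  assumes "homogeneous n p"
  obtains P where "degree P \<le> n" "\<And>u. meval p u = binary_value n P u"
proof -
  have "\<exists>P. degree P \<le> n \<and> (\<forall>u. meval p u = binary_value n P u)"
    using assms
  proof (induction rule: homogeneous_induct)
    case (zero n)
    show ?case by (intro exI[of _ 0]) (simp add: binary_value_def)
  next
    case (const c)
    show ?case by (intro exI[of _ "[:c:]"]) (simp add: binary_value_def)
  next
    case (add n p q)
    then obtain P Q where "degree P \<le> n" "degree Q \<le> n" "\<forall>u. meval p u = binary_value n P u"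
      "\<forall>u. meval q u = binary_value n Q u" by blast
    then show ?case by (intro exI[of _ "P + Q"]) (auto simp: binary_value_add degree_add_le)
  next
    case (var n p i)
    then obtain P where P: "degree P \<le> n" "\<forall>u. meval p u = binary_value n P u" by blast
    have "i = 1 \<or> i = 2" using UNIV_2 by auto
    then show ?case
    proof
      assume "i = 1"
      moreover have "degree (pCons 0 P) \<le> Suc n" using P(1) by (simp add: degree_pCons_eq_if)
      ultimately show ?thesis using P(2) by (intro exI[of _ "pCons 0 P"]) (simp add: binary_value_pCons)
    next
      assume "i = 2"
      then show ?thesis using P by (intro exI[of _ P]) (simp add: binary_value_Suc)
    qed
  qed
  then show ?thesis using that by blast
qed

definition lin2 :: "(2 \<Rightarrow> 'a::comm_ring_1) \<Rightarrow> (2 \<Rightarrow> 'a) \<Rightarrow> 'a" where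
  "lin2 s u = s 1 * u 1 + s 2 * u 2"

text \<open>A drop in the degree of \<open>P\<close> splits off the factor \<open>u 2\<close>, a
  root \<open>r\<close> the factor \<open>u 1 - r u 2\<close>.\<close>

lemma binary_value_factor:
  fixes P :: "'a::alg_closed_field poly"
  assumes "degree P \<le> n" "P \<noteq> 0"
  shows "\<exists>c s. c \<noteq> 0 \<and> (\<forall>m. s m \<noteq> (\<lambda>_. 0)) \<and> (\<forall>u. binary_value n P u = c * (\<Prod>m<n. lin2 (s m) u))"
  using assms
proof (induction n arbitrary: P)
  case 0
  then obtain c where "P = [:c:]" using degree_0_id by (metis le_zero_eq)
  then show ?case using 0(2) by (intro exI[of _ c] exI[of _ "\<lambda>_ _. 1"]) (auto simp: binary_value_def fun_eq_iff)
next
  case (Suc n)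
  have "\<exists>Q t. degree Q \<le> n \<and> Q \<noteq> 0 \<and> t \<noteq> (\<lambda>_. 0) \<and>
      (\<forall>u. binary_value (Suc n) P u = lin2 t u * binary_value n Q u)"
  proof (cases "degree P \<le> n")
    case True
    have "(\<lambda>i. if i = 2 then 1 else 0) \<noteq> (\<lambda>_::2. 0::'a)" by (auto simp: fun_eq_iff)
    then show ?thesis using True Suc.prems(2)
      by (intro exI[of _ P] exI[of _ "\<lambda>i. if i = 2 then 1 else 0"])
        (simp add: lin2_def binary_value_Suc)
  next
    case False
    then have d: "degree P = Suc n" using Suc.prems(1) by simp
    then obtain r where "poly P r = 0" using alg_closed_imp_poly_has_root[of P] by auto
    then obtain Q where Q: "P = [:- r, 1:] * Q" unfolding poly_eq_0_iff_dvd by (elim dvdE)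
    then have Q0: "Q \<noteq> 0" using Suc.prems(2) by auto
    have "degree P = degree [:- r, 1:] + degree Q"
      unfolding Q by (rule degree_mult_eq) (use Q0 in auto)
    then have dQ: "degree Q \<le> n" using d by simp
    have "P = smult (- r) Q + pCons 0 Q" by (simp add: Q)
    then have "binary_value (Suc n) P u = binary_value (Suc n) (smult (- r) Q + pCons 0 Q) u" for u
      by (rule arg_cong)
    then have "binary_value (Suc n) P u = lin2 (\<lambda>i. if i = 1 then 1 else - r) u * binary_value n Q u" for u
      unfolding binary_value_add binary_value_smult binary_value_pCons binary_value_Suc[OF dQ]
      by (simp only:) (simp add: lin2_def algebra_simps)
    moreover have "(\<lambda>i. if i = 1 then 1 else - r) \<noteq> (\<lambda>_::2. 0)" by (auto simp: fun_eq_iff)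
    ultimately show ?thesis using dQ Q0 by blast
  qed
  then obtain Q t where Q: "degree Q \<le> n" "Q \<noteq> 0" "t \<noteq> (\<lambda>_. 0)"
    "\<And>u. binary_value (Suc n) P u = lin2 t u * binary_value n Q u" by blast
  obtain c s where s: "c \<noteq> 0" "\<And>m. s m \<noteq> (\<lambda>_. 0)" "\<And>u. binary_value n Q u = c * (\<Prod>m<n. lin2 (s m) u)"
    using Suc.IH[OF Q(1,2)] by blast
  have "(\<Prod>m<Suc n. lin2 ((s(n := t)) m) u) = (\<Prod>m<n. lin2 (s m) u) * lin2 t u" for u
    by (simp add: prod.lessThan_Suc)
  then show ?case using s Q
    by (intro exI[of _ c] exI[of _ "s(n := t)"]) (simp add: mult_ac)
qed

lemma binary_form_factor:
  fixes p :: "(2, 'a::alg_closed_field) mpoly"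
  assumes "homogeneous n p" "meval p v \<noteq> 0"
  obtains c s where "c \<noteq> 0" "\<And>m. s m \<noteq> (\<lambda>_. 0)" "\<And>u. meval p u = c * (\<Prod>m<n. lin2 (s m) u)"
proof -
  obtain P where P: "degree P \<le> n" "\<And>u. meval p u = binary_value n P u"
    by (rule binary_form_poly[OF assms(1)]) blast
  then have "P \<noteq> 0" using assms(2) by (auto simp: binary_value_def)
  from binary_value_factor[OF P(1) this] obtain c s where cs: "c \<noteq> 0" "\<forall>m. s m \<noteq> (\<lambda>_. 0)"
    "\<forall>u. binary_value n P u = c * (\<Prod>m<n. lin2 (s m) u)" by blast
  show ?thesis by (rule that[of c s]) (use cs P(2) in auto)
qed

lemma binary_form_mult_zero:
  fixes p q :: "(2, 'a::field_char_0) mpoly"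
  assumes p: "homogeneous n p" and q: "homogeneous m q"
    and 0: "\<And>u. u \<noteq> (\<lambda>_. 0) \<Longrightarrow> meval p u * meval q u = 0"
  shows "(\<forall>u. meval p u = 0) \<or> (\<forall>u. meval q u = 0)"
proof -
  obtain P where P: "degree P \<le> n" "\<And>u. meval p u = binary_value n P u"
    by (rule binary_form_poly[OF p]) blast
  obtain Q where Q: "degree Q \<le> m" "\<And>u. meval q u = binary_value m Q u"
    by (rule binary_form_poly[OF q]) blast
  have "poly (P * Q) s = 0" for s
  proof -
    define u :: "2 \<Rightarrow> 'a" where "u = (\<lambda>i. if i = 1 then s else 1)"
    have "u 2 = 1" by (simp add: u_def)
    then have "u \<noteq> (\<lambda>_. 0)" by auto
    from 0[OF this] show ?thesis
      using P(2) Q(2) binary_value_affine[OF P(1), of u] binary_value_affine[OF Q(1), of u]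
      by (simp add: u_def)
  qed
  then have "P * Q = 0" using poly_all_0_iff_0 by blast
  then have "P = 0 \<or> Q = 0" by simp
  then show ?thesis using P(2) Q(2) by (auto simp: binary_value_def)
qed

text \<open>Compare the parities of the orders at a simple root of the quartic.\<close>

lemma binary_square_eq:
  fixes p q k :: "(2, 'a::{alg_closed_field, field_char_0}) mpoly"
  assumes p: "homogeneous n p" and q: "homogeneous m q"
    and k: "\<And>u. meval k u = c1 * u 1 ^ 4 + c2 * (u 1)\<^sup>2 * (u 2)\<^sup>2 + c1 * u 2 ^ 4"
    and c: "c1 \<noteq> 0" "c2\<^sup>2 \<noteq> 4 * c1\<^sup>2"
    and eq: "\<And>u. u \<noteq> (\<lambda>_. 0) \<Longrightarrow> (meval p u)\<^sup>2 = meval k u * (meval q u)\<^sup>2"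
  shows "meval p u = 0" "meval q u = 0"
proof -
  obtain P where P: "degree P \<le> n" "\<And>u. meval p u = binary_value n P u"
    by (rule binary_form_poly[OF p]) blast
  obtain Q where Q: "degree Q \<le> m" "\<And>u. meval q u = binary_value m Q u"
    by (rule binary_form_poly[OF q]) blast
  define K where "K = [:c1, 0, c2, 0, c1:]"
  have "poly (P\<^sup>2) s = poly (K * Q\<^sup>2) s" for s
  proof -
    define u :: "2 \<Rightarrow> 'a" where "u = (\<lambda>i. if i = 1 then s else 1)"
    have "u 2 = 1" by (simp add: u_def)
    then have "u \<noteq> (\<lambda>_. 0)" by auto
    from eq[OF this] show ?thesis
      using P(2) Q(2) binary_value_affine[OF P(1), of u] binary_value_affine[OF Q(1), of u]
      by (simp add: u_def k K_def power2_eq_square power4_eq_xxxx algebra_simps)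
  qed
  then have PQ: "P\<^sup>2 = K * Q\<^sup>2" using poly_eq_poly_eq_iff by blast
  have K0: "K \<noteq> 0" using c(1) by (simp add: K_def)
  have "Q = 0"
  proof (rule ccontr)
    assume "Q \<noteq> 0"
    then have KQ: "K * Q\<^sup>2 \<noteq> 0" using K0 by simp
    obtain r where r: "poly K r = 0"
      using alg_closed_imp_poly_has_root[of K] c(1) by (auto simp: K_def)
    \<comment> \<open>A double root \<open>r\<close> would satisfy \<open>c2 = -2 c1 r^2\<close> and
      \<open>r^4 = 1\<close>, hence \<open>c2^2 = 4 c1^2\<close>.\<close>
    have "poly (pderiv K) r \<noteq> 0"
    proof
      assume "poly (pderiv K) r = 0"
      then have "r * (4 * c1 * r\<^sup>2 + 2 * c2) = 0"
        by (simp add: K_def pderiv_pCons algebra_simps power2_eq_square)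
      moreover have "r \<noteq> 0" using r c(1) by (auto simp: K_def)
      ultimately have "4 * c1 * r\<^sup>2 + 2 * c2 = 0" by simp
      moreover have "4 * c1 * r\<^sup>2 + 2 * c2 = 2 * (2 * c1 * r\<^sup>2 + c2)" by simp
      ultimately have "2 * c1 * r\<^sup>2 + c2 = 0" by (metis mult_eq_0_iff zero_neq_numeral)
      then have 1: "c2 = - 2 * c1 * r\<^sup>2" by (simp add: eq_neg_iff_add_eq_0 add.commute)
      have "c1 + c2 * r\<^sup>2 + c1 * (r\<^sup>2)\<^sup>2 = 0"
        using r by (simp add: K_def algebra_simps power2_eq_square)
      then have "c1 * (1 - (r\<^sup>2)\<^sup>2) = 0" unfolding 1 by (simp add: algebra_simps power2_eq_square)
      then have "(r\<^sup>2)\<^sup>2 = 1" using c(1) by simp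
      then have "c2\<^sup>2 = 4 * c1\<^sup>2" unfolding 1 by (simp add: power_mult_distrib)
      then show False using c(2) by simp
    qed
    then have "order r (pderiv K) = 0" by (rule order_0I)
    then have "order r K = 1" using order_pderiv[OF K0 r] by simp
    moreover have "P * P \<noteq> 0" using KQ PQ by (metis power2_eq_square)
    moreover from this have "order r (P\<^sup>2) = order r P + order r P"
      using order_mult[of P P r] by (simp add: power2_eq_square)
    moreover have "order r (K * Q\<^sup>2) = order r K + (order r Q + order r Q)"
      using KQ \<open>Q \<noteq> 0\<close> order_mult[of K "Q\<^sup>2" r] order_mult[of Q Q r] by (simp add: power2_eq_square)
    ultimately have "order r P + order r P = 1 + (order r Q + order r Q)" using PQ by simp
    then show False by presburger
  qed
  moreover from this PQ have "P = 0" by simp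
  ultimately show "meval p u = 0" "meval q u = 0" using P(2) Q(2) by (auto simp: binary_value_def)
qed

section \<open>Diagonal quadric intersections\<close>

text \<open>The linear forms \<open>\<xi> i\<close> are coordinates, and \<open>V i\<close> is the dual basis. In these coordinates
  \<open>V i\<close> is the vertex of the \<open>i\<close>-th singular quadric of the pencil.\<close>

locale diagonal_quadrics =
  fixes Z :: "(4, 'a::{alg_closed_field, field_char_0}) proj set"
    and \<xi> :: "4 \<Rightarrow> (4, 'a) mpoly" and V :: "4 \<Rightarrow> 4 \<Rightarrow> 'a" and a b :: "4 \<Rightarrow> 'a"
  assumes homogeneous_xi: "homogeneous 1 (\<xi> i)"
    and coordinates: "x m = (\<Sum>i\<in>UNIV. meval (\<xi> i) x * V i m)"
    and dual: "meval (\<xi> i) (\<lambda>m. \<Sum>j\<in>UNIV. y j * V j m) = y i"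
    and cone_iff: "x \<in> affine_cone Z \<longleftrightarrow> x \<noteq> (\<lambda>_. 0) \<and>
      (\<Sum>i\<in>UNIV. a i * (meval (\<xi> i) x)\<^sup>2) = 0 \<and> (\<Sum>i\<in>UNIV. b i * (meval (\<xi> i) x)\<^sup>2) = 0"
    and minors: "i \<noteq> j \<Longrightarrow> a i * b j - a j * b i \<noteq> 0"
begin

definition minor where "minor i j = a i * b j - a j * b i"

abbreviation co where "co i x \<equiv> meval (\<xi> i) x"

lemma minor_nonzero: "i \<noteq> j \<Longrightarrow> minor i j \<noteq> 0"
  using minors by (simp add: minor_def)

lemma eq_0_iff: "x = (\<lambda>_. 0) \<longleftrightarrow> (\<forall>i. co i x = 0)"
proof
  assume "\<forall>i. co i x = 0"
  then show "x = (\<lambda>_. 0)" using coordinates[of x] by (intro ext) simp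
next
  assume "x = (\<lambda>_. 0)"
  then show "\<forall>i. co i x = 0" using meval_at_0[OF homogeneous_xi] by simp
qed

text \<open>Eliminating the coordinate \<open>\<xi> i\<close> from the two equations leaves the
  singular quadric with vertex \<open>V i\<close>.\<close>

lemma cone_relation:
  assumes "x \<in> affine_cone Z" "distinct [i, j, k, l]"
  shows "minor i j * (co j x)\<^sup>2 + minor i k * (co k x)\<^sup>2 + minor i l * (co l x)\<^sup>2 = 0"
proof -
  have "a i * (\<Sum>t\<in>UNIV. b t * (co t x)\<^sup>2) - b i * (\<Sum>t\<in>UNIV. a t * (co t x)\<^sup>2) = 0"
    using assms(1) by (simp add: cone_iff)
  then show ?thesis unfolding sum_4[OF assms(2)] minor_def by (simp add: algebra_simps)
qed

lemma coneI:
  assumes "distinct [i, j, k, l]" "x \<noteq> (\<lambda>_. 0)"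
    and 1: "minor i j * (co j x)\<^sup>2 + minor i k * (co k x)\<^sup>2 + minor i l * (co l x)\<^sup>2 = 0"
    and 2: "minor j i * (co i x)\<^sup>2 + minor j k * (co k x)\<^sup>2 + minor j l * (co l x)\<^sup>2 = 0"
  shows "x \<in> affine_cone Z"
proof -
  let ?A = "\<Sum>t\<in>UNIV. a t * (co t x)\<^sup>2" and ?B = "\<Sum>t\<in>UNIV. b t * (co t x)\<^sup>2"
  have 3: "a i * ?B - b i * ?A = 0" "a j * ?B - b j * ?A = 0"
    using 1 2 unfolding sum_4[OF assms(1)] minor_def by (simp_all add: algebra_simps)
  have "minor i j * ?A = a j * (a i * ?B - b i * ?A) - a i * (a j * ?B - b j * ?A)"
    "minor i j * ?B = b j * (a i * ?B - b i * ?A) - b i * (a j * ?B - b j * ?A)"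
    unfolding minor_def by (simp_all add: algebra_simps)
  then show ?thesis using 3 assms(1,2) minor_nonzero[of i j] by (simp add: cone_iff)
qed

text \<open>The cones with vertices \<open>V l\<close> and \<open>V k\<close> each determine the
  square of one missing coordinate.\<close>

lemma ex_cone_point:
  assumes ij: "i \<noteq> j" and y: "y \<noteq> 0 \<or> z \<noteq> 0"
  obtains x where "x \<in> affine_cone Z" "co i x = y" "co j x = z"
proof -
  obtain k l where d: "distinct [i, j, k, l]" by (rule ex_remaining_4[OF ij])
  obtain yk where yk: "yk\<^sup>2 = - (minor l i * y\<^sup>2 + minor l j * z\<^sup>2) / minor l k" using ex_square_root by blast
  obtain yl where yl: "yl\<^sup>2 = - (minor k i * y\<^sup>2 + minor k j * z\<^sup>2) / minor k l" using ex_square_root by blast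
  define w where "w = (\<lambda>t. if t = i then y else if t = j then z else if t = k then yk else yl)"
  define x where "x = (\<lambda>m. \<Sum>t\<in>UNIV. w t * V t m)"
  have cow: "co t x = w t" for t unfolding x_def by (rule dual)
  have co: "co i x = y" "co j x = z" "co k x = yk" "co l x = yl" using d unfolding cow w_def by auto
  have n: "minor l k \<noteq> 0" "minor k l \<noteq> 0" using minor_nonzero d by auto
  have "minor l k * yk\<^sup>2 = - (minor l i * y\<^sup>2 + minor l j * z\<^sup>2)"
    "minor k l * yl\<^sup>2 = - (minor k i * y\<^sup>2 + minor k j * z\<^sup>2)"
    unfolding yk yl using n by simp_all
  note y2 = this
  have "x \<in> affine_cone Z"
  proof (rule coneI[of l k j i])
    show "distinct [l, k, j, i]" using d by auto
    show "x \<noteq> (\<lambda>_. 0)" using y co eq_0_iff by auto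
  qed (simp_all add: co y2)
  then show ?thesis using that co by blast
qed

text \<open>The cone with vertex \<open>V k\<close> involves only \<open>\<xi> l\<close> besides the
  two vanishing coordinates, and the one with vertex \<open>V l\<close> only \<open>\<xi> k\<close>;
  so all four would vanish.\<close>

lemma one_zero_coordinate:
  assumes "x \<in> affine_cone Z" "i \<noteq> j" "co i x = 0" "co j x = 0"
  shows False
proof -
  obtain k l where d: "distinct [i, j, k, l]" by (rule ex_remaining_4[OF assms(2)])
  have n: "minor l k \<noteq> 0" "minor k l \<noteq> 0" using minor_nonzero d by auto
  have "co l x = 0" using cone_relation[of x k i j l] assms d n by auto
  moreover have "co k x = 0" using cone_relation[of x l i j k] assms d n by auto
  ultimately have "\<forall>t. co t x = 0" using assms by (simp add: all_4[OF d])
  then show False using assms(1) eq_0_iff by (simp add: cone_iff)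
qed

text \<open>Changes the sign of \<open>\<xi> i\<close> alone, and thus generates the covering group
  of the projection from the vertex \<open>V i\<close>.\<close>

definition reflection :: "4 \<Rightarrow> 4 \<Rightarrow> (4, 'a) mpoly" where
  "reflection i m = mvar m - mconst (2 * V i m) * \<xi> i"

definition reflect :: "4 \<Rightarrow> (4 \<Rightarrow> 'a) \<Rightarrow> 4 \<Rightarrow> 'a" where
  "reflect i x = (\<lambda>m. meval (reflection i m) x)"

lemma homogeneous_reflection: "homogeneous 1 (reflection i m)"
  unfolding reflection_def by (intro homogeneous_diff homogeneous_mvar homogeneous_cmult homogeneous_xi)

lemma co_reflect: "co t (reflect i x) = (if t = i then - co i x else co t x)"
proof -
  have "reflect i x m = (\<Sum>t\<in>UNIV. (if t = i then - co i x else co t x) * V t m)" for m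
  proof -
    have "(\<Sum>t\<in>UNIV. (if t = i then - co i x else co t x) * V t m)
        = (\<Sum>t\<in>UNIV. co t x * V t m - (if t = i then 2 * co i x * V i m else 0))"
      by (intro sum.cong) auto
    also have "\<dots> = x m - 2 * co i x * V i m"
      unfolding sum_subtractf using coordinates[of x m] by simp
    finally show ?thesis by (simp add: reflect_def reflection_def mult_ac)
  qed
  then have "reflect i x = (\<lambda>m. \<Sum>t\<in>UNIV. (if t = i then - co i x else co t x) * V t m)" by blast
  then show ?thesis by (simp only: dual)
qed

lemma coordinates_eqI: "(\<And>t. co t x = co t y) \<Longrightarrow> x = y"
  by (rule ext) (simp only: coordinates[of x] coordinates[of y])

lemma reflect_reflect [simp]: "reflect i (reflect i x) = x"
  by (rule coordinates_eqI) (simp add: co_reflect)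

lemma reflect_cone [simp]: "reflect i x \<in> affine_cone Z \<longleftrightarrow> x \<in> affine_cone Z"
proof -
  have "(co t (reflect i x))\<^sup>2 = (co t x)\<^sup>2" for t by (simp add: co_reflect)
  moreover have "co t (reflect i x) = 0 \<longleftrightarrow> co t x = 0" for t by (simp add: co_reflect)
  ultimately show ?thesis by (simp add: cone_iff eq_0_iff)
qed

lemma reflect_nonzero: "x \<noteq> (\<lambda>_. 0) \<Longrightarrow> reflect i x \<noteq> (\<lambda>_. 0)"
  unfolding eq_0_iff by (auto simp: co_reflect)

definition reflect_point :: "4 \<Rightarrow> (4, 'a) proj \<Rightarrow> (4, 'a) proj" where
  "reflect_point i = proj_of (reflection i)"

lemma reflect_point_abs: "x \<noteq> (\<lambda>_. 0) \<Longrightarrow> reflect_point i (abs_proj x) = abs_proj (reflect i x)"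
  unfolding reflect_point_def reflect_def by (rule proj_of_abs[OF homogeneous_reflection])

lemma reflect_point_in [simp]: "reflect_point i P \<in> Z \<longleftrightarrow> P \<in> Z"
proof -
  have "reflect_point i P = abs_proj (reflect i (rep_proj P))"
    using reflect_point_abs[OF rep_proj_nonzero, of i P] by simp
  then show ?thesis
    using reflect_cone[of i "rep_proj P"] reflect_nonzero[OF rep_proj_nonzero, of i P]
    by (simp add: affine_cone_def rep_proj_nonzero)
qed

lemma reflect_point_reflect_point [simp]: "reflect_point i (reflect_point i P) = P"
  using reflect_point_abs[OF rep_proj_nonzero, of i P]
    reflect_point_abs[OF reflect_nonzero[OF rep_proj_nonzero], of i i P] by simp

lemma local_rep_reflect: "local_rep UNIV Z (reflect_point i) P (reflection i)"
  unfolding local_rep_def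
proof (intro conjI)
  show "\<exists>j. \<not> vanishes (reflection i j) P"
    using reflect_nonzero[OF rep_proj_nonzero, of i P] unfolding reflect_def vanishes_rep by (auto simp: fun_eq_iff)
qed (use homogeneous_reflection in \<open>auto simp: coeffs_in_def reflect_point_def\<close>)

lemma iso_reflect: "iso_over UNIV Z Z (reflect_point i)"
proof -
  have "morphism_over UNIV Z Z (reflect_point i)"
    unfolding morphism_over_def using local_rep_reflect by auto
  then show ?thesis unfolding iso_over_def by (intro conjI exI[of _ "reflect_point i"]) simp_all
qed

lemma order_reflect:
  assumes "P \<in> Z" "homogeneous n F"
  shows "order_at Z P (msubst F (reflection i)) = order_at Z (reflect_point i P) F"
  by (rule order_at_iso[OF iso_reflect assms(1) local_rep_reflect assms(2)])

text \<open>If \<open>co i\<close> is not zero at a fixed point, the scaling factor must be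
  \<open>-1\<close>, which kills the other three coordinates.\<close>

lemma reflect_point_eq_iff:
  assumes "P \<in> Z" shows "reflect_point i P = P \<longleftrightarrow> co i (rep_proj P) = 0"
proof
  assume "co i (rep_proj P) = 0"
  then have "reflect i (rep_proj P) = rep_proj P"
    by (intro coordinates_eqI) (simp add: co_reflect)
  then show "reflect_point i P = P" using reflect_point_abs[OF rep_proj_nonzero, of i P] by simp
next
  let ?p = "rep_proj P"
  assume "reflect_point i P = P"
  then have "abs_proj ?p = abs_proj (reflect i ?p)"
    using reflect_point_abs[OF rep_proj_nonzero, of i P] by simp
  then obtain c where c: "c \<noteq> 0" "reflect i ?p = (\<lambda>m. c * ?p m)"
    using abs_proj_eq_iff[OF rep_proj_nonzero reflect_nonzero[OF rep_proj_nonzero]] by blast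
  then have *: "co t (reflect i ?p) = c * co t ?p" for t
    using meval_scale[OF homogeneous_xi, of t c ?p] by simp
  show "co i ?p = 0"
  proof (rule ccontr)
    assume "co i ?p \<noteq> 0"
    then have "c = -1" using *[of i] by (simp add: co_reflect) (metis mult_cancel_right mult_minus1)
    then have "co t ?p = 0" if "t \<noteq> i" for t
      using *[of t] that by (simp add: co_reflect)
    moreover obtain t t' where "t \<noteq> i" "t' \<noteq> i" "t \<noteq> t'"
    proof -
      have "i \<noteq> i + 1" by simp
      then obtain k l where "distinct [i, i + 1, k, l]" by (rule ex_remaining_4)
      then show ?thesis using that[of k l] by auto
    qed
    ultimately show False using one_zero_coordinate[of ?p t t'] assms by simp
  qed
qed

lemma linear_form_expand:
  assumes "homogeneous 1 f"
  obtains c where "\<And>x. meval f x = (\<Sum>t\<in>UNIV. c t * co t x)"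
proof -
  obtain c where c: "\<And>x. meval f x = (\<Sum>m\<in>UNIV. c m * x m)" by (rule linear_form_coeffs[OF assms]) blast
  have "meval f x = (\<Sum>t\<in>UNIV. (\<Sum>m\<in>UNIV. c m * V t m) * co t x)" for x
  proof -
    have "meval f x = (\<Sum>m\<in>UNIV. c m * (\<Sum>t\<in>UNIV. co t x * V t m))"
      unfolding c using coordinates[of x] by simp
    also have "\<dots> = (\<Sum>t\<in>UNIV. \<Sum>m\<in>UNIV. c m * (co t x * V t m))"
      unfolding sum_distrib_left by (rule sum.swap)
    finally show ?thesis unfolding sum_distrib_right by (simp add: mult_ac)
  qed
  then show ?thesis by (rule that)
qed

text \<open>The plane through \<open>P\<close> and the two vertices other than \<open>V s\<close>
  and \<open>V t\<close>.\<close>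

definition chord :: "(4, 'a) proj \<Rightarrow> 4 \<Rightarrow> 4 \<Rightarrow> (4, 'a) mpoly" where
  "chord P s t = mconst (co s (rep_proj P)) * \<xi> t - mconst (co t (rep_proj P)) * \<xi> s"

lemma homogeneous_chord: "homogeneous 1 (chord P s t)"
  unfolding chord_def by (intro homogeneous_diff homogeneous_cmult homogeneous_xi)

lemma meval_chord: "meval (chord P s t) x = co s (rep_proj P) * co t x - co t (rep_proj P) * co s x"
  by (simp add: chord_def)

text \<open>Cross-multiplying the cone equations at \<open>P\<close> and at \<open>x\<close> removes
  the square of the coordinate \<open>s\<close>; the two remaining differences of squares factor
  into chords.\<close>

lemma chord_relation:
  assumes P: "P \<in> Z" and d: "distinct [r, s, t, z]" and x: "x \<in> affine_cone Z"
  shows "minor r t * (co s (rep_proj P) * co t x + co t (rep_proj P) * co s x) * meval (chord P s t) x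
     = - minor r z * (co s (rep_proj P) * co z x + co z (rep_proj P) * co s x) * meval (chord P s z) x"
proof -
  let ?p = "\<lambda>t. co t (rep_proj P)"
  have 1: "minor r s * (?p s)\<^sup>2 + minor r t * (?p t)\<^sup>2 + minor r z * (?p z)\<^sup>2 = 0"
    using cone_relation[of "rep_proj P"] P d by simp
  have 2: "minor r s * (co s x)\<^sup>2 + minor r t * (co t x)\<^sup>2 + minor r z * (co z x)\<^sup>2 = 0"
    by (rule cone_relation[OF x d])
  have "(?p s)\<^sup>2 * (minor r s * (co s x)\<^sup>2 + minor r t * (co t x)\<^sup>2 + minor r z * (co z x)\<^sup>2)
    - (co s x)\<^sup>2 * (minor r s * (?p s)\<^sup>2 + minor r t * (?p t)\<^sup>2 + minor r z * (?p z)\<^sup>2) = 0"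
    unfolding 1 2 by simp
  then show ?thesis unfolding meval_chord by (simp add: algebra_simps power2_eq_square)
qed

text \<open>A linear form vanishing at \<open>P\<close> is a combination of the chords through
  \<open>s\<close>. By \<open>chord_relation\<close> the chord towards \<open>t \<noteq> z\<close>
  times a unit is a multiple of the chord towards \<open>z\<close>; the unit has value
  \<open>2 minor r t p_s p_t\<close> at \<open>P\<close>, which is why only the coordinate
  \<open>z\<close> of \<open>P\<close> may vanish.\<close>

lemma uniformizer_chord:
  assumes P: "P \<in> Z" and zs: "z \<noteq> s" and nz: "\<And>t. t \<noteq> z \<Longrightarrow> co t (rep_proj P) \<noteq> 0"
  shows "uniformizer Z P 1 (chord P s z)"
  unfolding uniformizer_def
proof (intro conjI allI impI)
  let ?p = "\<lambda>t. co t (rep_proj P)"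
  show "vanishes (chord P s z) P" by (simp add: vanishes_rep meval_chord)
  fix f assume f: "homogeneous 1 f" "vanishes f P"
  obtain c where c: "\<And>x. meval f x = (\<Sum>t\<in>UNIV. c t * co t x)" by (rule linear_form_expand[OF f(1)]) blast
  have 0: "(\<Sum>t\<in>UNIV. c t * ?p t) = 0" using f(2) c by (simp add: vanishes_rep)
  have lm: "local_mult Z P 1 (chord P s t) 1 (chord P s z)" for t
  proof -
    consider "t = s" | "t = z" | "t \<noteq> s" "t \<noteq> z" by blast
    then show ?thesis
    proof cases
      case 1
      have "local_mult Z P 1 0 1 (chord P s z)" by (rule local_mult_0)
      then show ?thesis by (rule iffD1[OF local_mult_cong, rotated -1]) (auto simp: 1 meval_chord)
    next
      case 2
      then show ?thesis by (simp add: local_mult_refl)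
    next
      case 3
      obtain r where d: "distinct [r, s, t, z]"
      proof -
        obtain k l where "distinct [s, t, k, l]" using ex_remaining_4[of s t] 3 by auto
        then have "z \<in> {s, t, k, l}" using UNIV_4 by auto
        then consider "z = k" | "z = l" using 3 zs by auto
        then show ?thesis using that[of l] that[of k] \<open>distinct [s, t, k, l]\<close> by cases auto
      qed
      have hom: "homogeneous 1 (mconst (e * ?p s) * \<xi> t' + mconst (e * ?p t') * \<xi> s)" for e t'
        by (intro homogeneous_add homogeneous_cmult homogeneous_xi)
      show ?thesis unfolding local_mult_def
      proof (intro exI conjI)
        show "homogeneous 1 (mconst (minor r t * ?p s) * \<xi> t + mconst (minor r t * ?p t) * \<xi> s)"
          "homogeneous 1 (mconst (- minor r z * ?p s) * \<xi> z + mconst (- minor r z * ?p z) * \<xi> s)"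
          by (rule hom)+
        show "meval (mconst (minor r t * ?p s) * \<xi> t + mconst (minor r t * ?p t) * \<xi> s) (rep_proj P) \<noteq> 0"
          using minor_nonzero[of r t] nz[of s] nz[of t] 3 zs d by (simp add: mult_ac)
        show "\<forall>x\<in>affine_cone Z. meval (mconst (minor r t * ?p s) * \<xi> t + mconst (minor r t * ?p t) * \<xi> s) x
            * meval (chord P s t) x = meval (mconst (- minor r z * ?p s) * \<xi> z + mconst (- minor r z * ?p z) * \<xi> s) x
            * meval (chord P s z) x"
          using chord_relation[OF P d] by (simp add: algebra_simps)
      qed simp
    qed
  qed
  have "local_mult Z P 1 (\<Sum>t\<in>S. mconst (c t / ?p s) * chord P s t) 1 (chord P s z)" if "finite S" for S
    using that
  proof (induction S)
    case empty
    show ?case by (simp add: local_mult_0)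
  next
    case (insert t S)
    then show ?case
      using local_mult_add[OF local_mult_multl[OF homogeneous_mconst lm[of t], of "c t / ?p s"]] by simp
  qed
  then have "local_mult Z P 1 (\<Sum>t\<in>UNIV. mconst (c t / ?p s) * chord P s t) 1 (chord P s z)" by simp
  then show "local_mult Z P 1 f 1 (chord P s z)"
  proof (rule iffD1[OF local_mult_cong, rotated -1])
    fix x
    have ps: "?p s \<noteq> 0" using nz zs by simp
    have "(\<Sum>t\<in>UNIV. c t / ?p s * meval (chord P s t) x)
        = (\<Sum>t\<in>UNIV. c t * co t x - c t * ?p t * (co s x / ?p s))"
      by (intro sum.cong) (use ps in \<open>auto simp: meval_chord field_simps\<close>)
    also have "\<dots> = meval f x"
      unfolding sum_subtractf sum_distrib_right[symmetric] 0 c by simp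
    finally show "meval (\<Sum>t\<in>UNIV. mconst (c t / ?p s) * chord P s t) x = meval f x" by simp
  qed simp
qed (rule homogeneous_chord)

lemma chord_not_zero_on:
  assumes P: "P \<in> Z" and zs: "z \<noteq> s" and nz: "co s (rep_proj P) \<noteq> 0"
  shows "\<not> zero_on Z (chord P s z)"
proof (cases "co z (rep_proj P) = 0")
  case True
  obtain x where x: "x \<in> affine_cone Z" "co z x = 1" by (rule ex_cone_point[OF zs, of 1 1]) auto
  have "meval (chord P s z) x \<noteq> 0" using True nz x(2) by (simp add: meval_chord)
  then show ?thesis using x(1) unfolding zero_on_def by blast
next
  case False
  let ?x = "reflect s (rep_proj P)"
  have "?x \<in> affine_cone Z" using P by simp
  moreover have "meval (chord P s z) ?x = 2 * co s (rep_proj P) * co z (rep_proj P)"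
    using zs by (simp add: meval_chord co_reflect)
  moreover have "2 * co s (rep_proj P) * co z (rep_proj P) \<noteq> 0" using False nz by simp
  ultimately show ?thesis unfolding zero_on_def by metis
qed

lemma ex_coordinate_zero: "P \<in> Z \<Longrightarrow> \<exists>z. \<forall>t. t \<noteq> z \<longrightarrow> co t (rep_proj P) \<noteq> 0"
  using one_zero_coordinate[of "rep_proj P"] by (metis rep_in_affine_cone)

lemma ex_uniformizer:
  assumes P: "P \<in> Z"
  shows "\<exists>d t. uniformizer Z P d t \<and> \<not> zero_on Z t"
proof -
  obtain z where z: "\<And>t. t \<noteq> z \<Longrightarrow> co t (rep_proj P) \<noteq> 0" using ex_coordinate_zero[OF P] by blast
  obtain s where s: "z \<noteq> s" using ex_remaining_4[of 1 2] by (metis one_neq_zero)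
  have "uniformizer Z P 1 (chord P s z)" by (rule uniformizer_chord[OF P s]) (use z in blast)
  moreover have "\<not> zero_on Z (chord P s z)" by (rule chord_not_zero_on[OF P s z[OF s[symmetric]]])
  ultimately show ?thesis by blast
qed

end

text \<open>A square root of each coefficient of the \<open>i\<close>-th singular quadric gives a parametrisation of
  the conic over which it is a cone, by \<open>tA = u1 ^ 2\<close>, \<open>tB = u1 u2\<close>, \<open>tC = u2 ^ 2\<close>. If \<open>s\<close> and
  \<open>s'\<close> are linear forms in \<open>u1, u2\<close> then \<open>tau s s'\<close> is the linear form on space restricting to
  \<open>s s'\<close>; in particular \<open>tau s s\<close> is a tangent plane.\<close>

locale diagonal_cone = diagonal_quadrics Z \<xi> V a b
  for Z :: "(4, 'a::{alg_closed_field, field_char_0}) proj set" and \<xi> V a b +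
  fixes i j k l :: 4 and rj rk rl :: 'a
  assumes dist: "distinct [i, j, k, l]"
    and roots: "rj\<^sup>2 = - minor i j" "rk\<^sup>2 = minor i k" "rl\<^sup>2 = - minor i l"
begin

lemma roots_nonzero: "rj \<noteq> 0" "rk \<noteq> 0" "rl \<noteq> 0"
  using roots minor_nonzero[of i j] minor_nonzero[of i k] minor_nonzero[of i l] dist by auto

definition tA where "tA = mconst rk * \<xi> k + mconst rl * \<xi> l"
definition tB where "tB = mconst rj * \<xi> j"
definition tC where "tC = mconst rk * \<xi> k - mconst rl * \<xi> l"

definition tau :: "(2 \<Rightarrow> 'a) \<Rightarrow> (2 \<Rightarrow> 'a) \<Rightarrow> (4, 'a) mpoly" where
  "tau s s' = mconst (s 1 * s' 1) * tA + mconst (s 1 * s' 2 + s 2 * s' 1) * tB + mconst (s 2 * s' 2) * tC"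

definition param :: "(4 \<Rightarrow> 'a) \<Rightarrow> (2 \<Rightarrow> 'a) \<Rightarrow> bool" where
  "param x u \<longleftrightarrow> meval tA x = (u 1)\<^sup>2 \<and> meval tB x = u 1 * u 2 \<and> meval tC x = (u 2)\<^sup>2"

lemma homogeneous_tau: "homogeneous 1 (tau s s')"
  unfolding tau_def tA_def tB_def tC_def
  by (intro homogeneous_add homogeneous_diff homogeneous_cmult homogeneous_xi)

lemma meval_tau: "param x u \<Longrightarrow> meval (tau s s') x = lin2 s u * lin2 s' u"
  by (simp add: param_def tau_def lin2_def algebra_simps power2_eq_square)

lemma param_nonzero: "x \<in> affine_cone Z \<Longrightarrow> param x u \<Longrightarrow> u \<noteq> (\<lambda>_. 0)"
proof
  assume x: "x \<in> affine_cone Z" and "param x u" "u = (\<lambda>_. 0)"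
  then have 1: "rk * co k x + rl * co l x = 0" "rk * co k x - rl * co l x = 0" "rj * co j x = 0"
    by (auto simp: param_def tA_def tB_def tC_def)
  have "2 * (rk * co k x) = (rk * co k x + rl * co l x) + (rk * co k x - rl * co l x)" by simp
  then have "rk * co k x = 0" unfolding 1 by simp
  then have "co k x = 0" "co j x = 0" using roots_nonzero 1 by auto
  then show False using one_zero_coordinate[OF x, of k j] dist by auto
qed

text \<open>The signs in \<open>roots\<close> bring the cone into the form
  \<open>tA tC = tB^2\<close>; the rest is extraction of square roots.\<close>

lemma ex_param:
  assumes x: "x \<in> affine_cone Z"
  obtains u where "param x u" "u \<noteq> (\<lambda>_. 0)"
proof -
  have "meval tA x * meval tC x = rk\<^sup>2 * (co k x)\<^sup>2 - rl\<^sup>2 * (co l x)\<^sup>2"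
    by (simp add: tA_def tC_def algebra_simps power2_eq_square)
  also have "\<dots> = rj\<^sup>2 * (co j x)\<^sup>2"
    using cone_relation[OF x dist] unfolding roots by (simp add: algebra_simps eq_neg_iff_add_eq_0)
  finally have AC: "meval tA x * meval tC x = (meval tB x)\<^sup>2"
    by (simp add: tB_def power_mult_distrib)
  have "\<exists>u. param x u"
  proof (cases "meval tA x = 0")
    case True
    then have "meval tB x = 0" using AC by simp
    moreover obtain c where "c\<^sup>2 = meval tC x" using ex_square_root by blast
    ultimately show ?thesis using True
      by (intro exI[of _ "\<lambda>t. if t = 1 then 0 else c"]) (simp add: param_def)
  next
    case False
    obtain c where c: "c\<^sup>2 = meval tA x" using ex_square_root by blast
    then have "c \<noteq> 0" using False by auto
    have "(meval tB x / c)\<^sup>2 = meval tC x"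
      using False by (simp add: power_divide c flip: AC)
    then show ?thesis using c \<open>c \<noteq> 0\<close>
      by (intro exI[of _ "\<lambda>t. if t = 1 then c else meval tB x / c"]) (simp add: param_def)
  qed
  then show ?thesis using param_nonzero[OF x] that by blast
qed

definition qj :: "(2, 'a) mpoly" where "qj = mconst (1 / rj) * (mvar 1 * mvar 2)"
definition qk :: "(2, 'a) mpoly" where "qk = mconst (1 / (2 * rk)) * ((mvar 1)\<^sup>2 + (mvar 2)\<^sup>2)"
definition ql :: "(2, 'a) mpoly" where "ql = mconst (1 / (2 * rl)) * ((mvar 1)\<^sup>2 - (mvar 2)\<^sup>2)"

text \<open>The value of \<open>(co i)^2\<close> in terms of the parameters, found from the cone
  with vertex \<open>V j\<close>. It presents the curve as a double cover of the conic, branched at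
  the four zeros of \<open>kap\<close>.\<close>

definition kap :: "(2, 'a) mpoly" where
  "kap = mconst (- 1 / minor j i) * (mconst (minor j k) * qk\<^sup>2 + mconst (minor j l) * ql\<^sup>2)"

lemma homogeneous_q: "homogeneous 2 qj" "homogeneous 2 qk" "homogeneous 2 ql" "homogeneous 4 kap"
proof -
  have m: "homogeneous (1 + 1) (mvar 1 * mvar 2 :: (2, 'a) mpoly)"
    "homogeneous (1 + 1) ((mvar t)\<^sup>2 :: (2, 'a) mpoly)" for t
    by (intro homogeneous_mult homogeneous_square homogeneous_mvar)+
  show 1: "homogeneous 2 qj" "homogeneous 2 qk" "homogeneous 2 ql"
    unfolding qj_def qk_def ql_def using m
    by (auto intro!: homogeneous_cmult homogeneous_add homogeneous_diff simp: numeral_2_eq_2)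
  have "homogeneous 4 (qk\<^sup>2)" "homogeneous 4 (ql\<^sup>2)"
    using homogeneous_square[OF 1(2)] homogeneous_square[OF 1(3)] by simp_all
  then show "homogeneous 4 kap" unfolding kap_def by (intro homogeneous_cmult homogeneous_add)
qed

lemma param_iff: "param x u \<longleftrightarrow> co j x = meval qj u \<and> co k x = meval qk u \<and> co l x = meval ql u"
proof -
  have "rk * co k x + rl * co l x = (u 1)\<^sup>2 \<and> rk * co k x - rl * co l x = (u 2)\<^sup>2 \<longleftrightarrow>
      2 * (rk * co k x) = (u 1)\<^sup>2 + (u 2)\<^sup>2 \<and> 2 * (rl * co l x) = (u 1)\<^sup>2 - (u 2)\<^sup>2"
  proof safe
    assume *: "2 * (rk * co k x) = (u 1)\<^sup>2 + (u 2)\<^sup>2" "2 * (rl * co l x) = (u 1)\<^sup>2 - (u 2)\<^sup>2"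
    have "2 * (rk * co k x + rl * co l x) = 2 * (u 1)\<^sup>2" "2 * (rk * co k x - rl * co l x) = 2 * (u 2)\<^sup>2"
      unfolding distrib_left right_diff_distrib * by simp_all
    then show "rk * co k x + rl * co l x = (u 1)\<^sup>2" "rk * co k x - rl * co l x = (u 2)\<^sup>2"
      by (metis mult_cancel_left zero_neq_numeral)+
  next
    assume *: "rk * co k x + rl * co l x = (u 1)\<^sup>2" "rk * co k x - rl * co l x = (u 2)\<^sup>2"
    show "2 * (rk * co k x) = (u 1)\<^sup>2 + (u 2)\<^sup>2" "2 * (rl * co l x) = (u 1)\<^sup>2 - (u 2)\<^sup>2"
      unfolding *[symmetric] by simp_all
  qed
  then show ?thesis using roots_nonzero
    by (auto simp: param_def tA_def tB_def tC_def qj_def qk_def ql_def field_simps)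
qed

lemma co_sq_param:
  assumes "x \<in> affine_cone Z" "param x u"
  shows "(co i x)\<^sup>2 = meval kap u"
proof -
  have "minor j i \<noteq> 0" using minor_nonzero dist by auto
  moreover have "minor j i * (co i x)\<^sup>2 + minor j k * (co k x)\<^sup>2 + minor j l * (co l x)\<^sup>2 = 0"
    by (rule cone_relation[OF assms(1)]) (use dist in auto)
  ultimately show ?thesis using assms(2) unfolding param_iff kap_def
    by (simp add: field_simps eq_neg_iff_add_eq_0)
qed

lemma ex_point_param:
  assumes "u \<noteq> (\<lambda>_. 0)"
  obtains x where "x \<in> affine_cone Z" "param x u"
proof -
  obtain y where y: "y\<^sup>2 = meval kap u" using ex_square_root by blast
  define w where "w = (\<lambda>t. if t = i then y else if t = j then meval qj u else if t = k then meval qk u else meval ql u)"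
  define x where "x = (\<lambda>m. \<Sum>t\<in>UNIV. w t * V t m)"
  have cow: "co t x = w t" for t unfolding x_def by (rule dual)
  have co: "co i x = y" "co j x = meval qj u" "co k x = meval qk u" "co l x = meval ql u"
    using dist unfolding cow w_def by auto
  have pm: "param x u" unfolding param_iff co by simp
  have n: "minor j i \<noteq> 0" using minor_nonzero dist by auto
  have "x \<in> affine_cone Z"
  proof (rule coneI[OF dist])
    show "x \<noteq> (\<lambda>_. 0)"
    proof
      assume "x = (\<lambda>_. 0)"
      then have "\<forall>t. co t x = 0" using eq_0_iff by blast
      then have "(u 1)\<^sup>2 = 0" "(u 2)\<^sup>2 = 0" using pm by (auto simp: param_def tA_def tC_def)
      then have "u = (\<lambda>_. 0)" by (simp add: fun_2_eq_iff)
      then show False using assms by simp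
    qed
    have "rk\<^sup>2 * (co k x)\<^sup>2 - rl\<^sup>2 * (co l x)\<^sup>2 = meval tA x * meval tC x"
      by (simp add: tA_def tC_def algebra_simps power2_eq_square)
    also have "\<dots> = (meval tB x)\<^sup>2" using pm by (simp add: param_def power_mult_distrib)
    also have "\<dots> = rj\<^sup>2 * (co j x)\<^sup>2" by (simp add: tB_def power_mult_distrib)
    finally show "minor i j * (co j x)\<^sup>2 + minor i k * (co k x)\<^sup>2 + minor i l * (co l x)\<^sup>2 = 0"
      unfolding roots by (simp add: algebra_simps eq_neg_iff_add_eq_0)
    have "minor j i * y\<^sup>2 = - (minor j k * (meval qk u)\<^sup>2 + minor j l * (meval ql u)\<^sup>2)"
      using n unfolding y kap_def by simp
    then show "minor j i * (co i x)\<^sup>2 + minor j k * (co k x)\<^sup>2 + minor j l * (co l x)\<^sup>2 = 0"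
      by (simp add: co)
  qed
  then show ?thesis using that pm by blast
qed

lemma param_reflect [simp]: "param (reflect i x) u \<longleftrightarrow> param x u"
  using dist by (auto simp: param_iff co_reflect)

text \<open>The form is \<open>al (u1^2 + u2^2)^2 + ga (u1^2 - u2^2)^2\<close>. Its leading
  coefficient is nonzero by the Pluecker relation between the minors, and
  \<open>c2^2 - 4 c1^2 = -16 al ga\<close> shows that there is no repeated root.\<close>

lemma meval_kap:
  obtains c1 c2 where "c1 \<noteq> 0" "c2\<^sup>2 \<noteq> 4 * c1\<^sup>2"
    "\<And>u. meval kap u = c1 * u 1 ^ 4 + c2 * (u 1)\<^sup>2 * (u 2)\<^sup>2 + c1 * u 2 ^ 4"
proof -
  define al where "al = - minor j k / (4 * minor i k * minor j i)"
  define ga where "ga = minor j l / (4 * minor i l * minor j i)"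
  have n: "minor j i \<noteq> 0" "minor i k \<noteq> 0" "minor i l \<noteq> 0" "minor j k \<noteq> 0" "minor j l \<noteq> 0" "minor i j \<noteq> 0"
    "minor k l \<noteq> 0"
    using minor_nonzero dist by auto
  have 1: "minor j l * minor i k - minor j k * minor i l = minor i j * minor k l"
    unfolding minor_def by (simp add: algebra_simps)
  have c: "(al + ga) * (4 * minor i k * minor i l * minor j i) = minor j l * minor i k - minor j k * minor i l"
    using n by (simp add: al_def ga_def field_simps)
  then have c1: "al + ga \<noteq> 0" using n unfolding 1 by auto
  have "(2 * al - 2 * ga)\<^sup>2 - 4 * (al + ga)\<^sup>2 = - 16 * al * ga"
    by (simp add: power2_eq_square algebra_simps)
  moreover have "- 16 * al * ga \<noteq> 0" using n by (simp add: al_def ga_def)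
  ultimately have c2: "(2 * al - 2 * ga)\<^sup>2 \<noteq> 4 * (al + ga)\<^sup>2" by auto
  have v: "(meval qk u)\<^sup>2 = ((u 1)\<^sup>2 + (u 2)\<^sup>2)\<^sup>2 / (4 * minor i k)"
    "(meval ql u)\<^sup>2 = - (((u 1)\<^sup>2 - (u 2)\<^sup>2)\<^sup>2 / (4 * minor i l))" for u
    using n roots by (simp_all add: qk_def ql_def power_mult_distrib power_divide)
  have "meval kap u = al * ((u 1)\<^sup>2 + (u 2)\<^sup>2)\<^sup>2 + ga * ((u 1)\<^sup>2 - (u 2)\<^sup>2)\<^sup>2" for u
    unfolding kap_def al_def ga_def meval_mult meval_add meval_power meval_mconst v
    using n by (simp add: field_simps)
  then have "meval kap u = (al + ga) * u 1 ^ 4 + (2 * al - 2 * ga) * (u 1)\<^sup>2 * (u 2)\<^sup>2 + (al + ga) * u 2 ^ 4" for u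
    by (simp add: power2_eq_square power4_eq_xxxx algebra_simps)
  then show ?thesis using that c1 c2 by blast
qed

text \<open>Modulo \<open>co i ^ 2 = kap\<close>, a form of degree \<open>n\<close> is \<open>p + co i q\<close> with \<open>p\<close> and \<open>q\<close> in \<open>u\<close>.\<close>

lemma parity_decomposition:
  assumes "homogeneous n F"
  obtains m p q where "homogeneous (2 * n) p" "homogeneous m q" "homogeneous (4 * n) (p\<^sup>2 - kap * q\<^sup>2)"
    "\<And>x u. x \<in> affine_cone Z \<Longrightarrow> param x u \<Longrightarrow> meval F x = meval p u + co i x * meval q u"
proof -
  \<comment> \<open>For \<open>n = 0\<close> the subtraction \<open>2 * n - 2\<close> is truncated,
    so the vanishing of \<open>q\<close> has to be demanded separately.\<close>
  define R where "R = (\<lambda>n (F :: (4, 'a) mpoly). \<exists>p q. homogeneous (2 * n) p \<and> homogeneous (2 * n - 2) q \<and>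
    (n = 0 \<longrightarrow> q = 0) \<and> (\<forall>x u. x \<in> affine_cone Z \<longrightarrow> param x u \<longrightarrow> meval F x = meval p u + co i x * meval q u))"
  have "R n F" using assms
  proof (induction rule: homogeneous_induct)
    case (zero n)
    show ?case unfolding R_def by (intro exI[of _ 0]) simp
  next
    case (const c)
    show ?case unfolding R_def by (intro exI[of _ "mconst c"] exI[of _ 0]) simp
  next
    case (add n p q)
    then obtain p1 q1 p2 q2 where "homogeneous (2 * n) p1" "homogeneous (2 * n - 2) q1" "n = 0 \<longrightarrow> q1 = 0"
      "\<forall>x u. x \<in> affine_cone Z \<longrightarrow> param x u \<longrightarrow> meval p x = meval p1 u + co i x * meval q1 u"
      "homogeneous (2 * n) p2" "homogeneous (2 * n - 2) q2" "n = 0 \<longrightarrow> q2 = 0"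
      "\<forall>x u. x \<in> affine_cone Z \<longrightarrow> param x u \<longrightarrow> meval q x = meval p2 u + co i x * meval q2 u"
      unfolding R_def by blast
    then show ?case unfolding R_def
      by (intro exI[of _ "p1 + p2"] exI[of _ "q1 + q2"]) (auto intro: homogeneous_add simp: algebra_simps)
  next
    case (var n F m)
    then obtain p q where 1: "homogeneous (2 * n) p" "homogeneous (2 * n - 2) q" "n = 0 \<longrightarrow> q = 0"
      "\<And>x u. x \<in> affine_cone Z \<Longrightarrow> param x u \<Longrightarrow> meval F x = meval p u + co i x * meval q u"
      unfolding R_def by blast
    \<comment> \<open>On the curve \<open>x_m = V i m (co i x) + Q(u)\<close>. Multiply
      \<open>p + co i q\<close> by this and replace \<open>(co i)^2\<close> by
      \<open>kap\<close>.\<close>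
    define Q where "Q = mconst (V j m) * qj + mconst (V k m) * qk + mconst (V l m) * ql"
    have Q: "homogeneous 2 Q" unfolding Q_def by (intro homogeneous_add homogeneous_cmult homogeneous_q)
    have h1: "homogeneous (2 * Suc n) (p * Q + mconst (V i m) * (kap * q))"
    proof (intro homogeneous_add homogeneous_cmult)
      show "homogeneous (2 * Suc n) (p * Q)" by (rule homogeneous_mult'[OF 1(1) Q]) simp
      show "homogeneous (2 * Suc n) (kap * q)"
        using 1(3) by (cases "n = 0") (auto intro!: homogeneous_mult'[OF homogeneous_q(4) 1(2)])
    qed
    have h2: "homogeneous (2 * Suc n - 2) (mconst (V i m) * p + q * Q)"
      using 1(3) homogeneous_mult'[OF 1(2) Q, of "2 * n"] homogeneous_cmult[OF 1(1), of "V i m"]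
      by (cases "n = 0") (auto intro!: homogeneous_add)
    have "meval (mvar m * F) x = meval (p * Q + mconst (V i m) * (kap * q)) u
        + co i x * meval (mconst (V i m) * p + q * Q) u"
      if x: "x \<in> affine_cone Z" and u: "param x u" for x u
    proof -
      have xm: "x m = co i x * V i m + meval Q u"
        using coordinates[of x m] u unfolding sum_4[OF dist] by (simp add: Q_def param_iff)
      have "meval (mvar m * F) x = meval p u * meval Q u + V i m * ((co i x)\<^sup>2 * meval q u)
          + co i x * (V i m * meval p u + meval q u * meval Q u)"
        by (simp add: 1(4)[OF x u] xm algebra_simps power2_eq_square)
      then show ?thesis unfolding co_sq_param[OF x u] by simp
    qed
    then show ?case unfolding R_def using h1 h2
      by (intro exI[of _ "p * Q + mconst (V i m) * (kap * q)"] exI[of _ "mconst (V i m) * p + q * Q"]) auto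
  qed
  then obtain p q where 1: "homogeneous (2 * n) p" "homogeneous (2 * n - 2) q" "n = 0 \<longrightarrow> q = 0"
      "\<And>x u. x \<in> affine_cone Z \<Longrightarrow> param x u \<Longrightarrow> meval F x = meval p u + co i x * meval q u"
    unfolding R_def by blast
  have "homogeneous (4 * n) (p\<^sup>2 - kap * q\<^sup>2)"
  proof (rule homogeneous_diff)
    show "homogeneous (4 * n) (p\<^sup>2)" using homogeneous_square[OF 1(1)] by simp
    show "homogeneous (4 * n) (kap * q\<^sup>2)"
      using 1(3) homogeneous_mult'[OF homogeneous_q(4) homogeneous_square[OF 1(2)], of "4 * n"]
      by (cases "n = 0") auto
  qed
  then show ?thesis using that[OF 1(1,2) _ 1(4)] by blast
qed

text \<open>The norm to the conic is \<open>p^2 - kap q^2\<close>. It vanishes only for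
  \<open>F = 0\<close> on the curve, because \<open>kap\<close> has simple roots and so is not a
  quotient of squares.\<close>

lemma norm_form:
  assumes "homogeneous n F"
  obtains N where "homogeneous (4 * n) N"
    "\<And>x u. x \<in> affine_cone Z \<Longrightarrow> param x u \<Longrightarrow> meval F x * meval F (reflect i x) = meval N u"
    "(\<forall>u. meval N u = 0) \<Longrightarrow> zero_on Z F"
proof -
  obtain m p q where 1: "homogeneous (2 * n) p" "homogeneous m q" "homogeneous (4 * n) (p\<^sup>2 - kap * q\<^sup>2)"
    "\<And>x u. x \<in> affine_cone Z \<Longrightarrow> param x u \<Longrightarrow> meval F x = meval p u + co i x * meval q u"
    by (rule parity_decomposition[OF assms]) blast
  show ?thesis
  proof (rule that[OF 1(3)])
    fix x u assume x: "x \<in> affine_cone Z" and u: "param x u"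
    have r: "meval F (reflect i x) = meval p u - co i x * meval q u"
      using 1(4)[of "reflect i x" u] x u by (simp add: co_reflect)
    have "meval F x * meval F (reflect i x) = (meval p u)\<^sup>2 - (co i x)\<^sup>2 * (meval q u)\<^sup>2"
      unfolding 1(4)[OF x u] r by (simp add: algebra_simps power2_eq_square)
    then show "meval F x * meval F (reflect i x) = meval (p\<^sup>2 - kap * q\<^sup>2) u"
      by (simp add: co_sq_param[OF x u])
  next
    assume 0: "\<forall>u. meval (p\<^sup>2 - kap * q\<^sup>2) u = 0"
    obtain c1 c2 where c: "c1 \<noteq> 0" "c2\<^sup>2 \<noteq> 4 * c1\<^sup>2"
      "\<And>u. meval kap u = c1 * u 1 ^ 4 + c2 * (u 1)\<^sup>2 * (u 2)\<^sup>2 + c1 * u 2 ^ 4" by (rule meval_kap) blast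
    have "(meval p u)\<^sup>2 = meval kap u * (meval q u)\<^sup>2" for u using 0 by simp
    from binary_square_eq[OF 1(1,2) c(3,1,2) this] have "meval p u = 0" "meval q u = 0" for u by blast+
    then show "zero_on Z F" unfolding zero_on_def using 1(4) ex_param by (metis add.right_neutral mult_zero_right)
  qed
qed

text \<open>The norm is multiplicative, and binary forms have no zero divisors.\<close>

lemma irreducible_cone:
  assumes F: "homogeneous n F" and G: "homogeneous m G" and FG: "zero_on Z (F * G)"
  shows "zero_on Z F \<or> zero_on Z G"
proof -
  obtain N where N: "homogeneous (4 * n) N"
    "\<And>x u. x \<in> affine_cone Z \<Longrightarrow> param x u \<Longrightarrow> meval F x * meval F (reflect i x) = meval N u"
    "(\<forall>u. meval N u = 0) \<Longrightarrow> zero_on Z F" by (rule norm_form[OF F]) blast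
  obtain N' where N': "homogeneous (4 * m) N'"
    "\<And>x u. x \<in> affine_cone Z \<Longrightarrow> param x u \<Longrightarrow> meval G x * meval G (reflect i x) = meval N' u"
    "(\<forall>u. meval N' u = 0) \<Longrightarrow> zero_on Z G" by (rule norm_form[OF G]) blast
  have "meval N u * meval N' u = 0" if u: "u \<noteq> (\<lambda>_. 0)" for u
  proof -
    obtain x where x: "x \<in> affine_cone Z" "param x u" by (rule ex_point_param[OF u])
    have "meval F x * meval G x = 0" using FG x by (simp add: zero_on_def)
    then show ?thesis unfolding N(2)[OF x, symmetric] N'(2)[OF x, symmetric] by auto
  qed
  from binary_form_mult_zero[OF N(1) N'(1) this] show ?thesis using N(3) N'(3) by blast
qed

sublocale smooth_irreducible Z
  by unfold_locales (use irreducible_cone ex_uniformizer in blast)+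

end

context smooth_irreducible
begin

lemma local_assoc_uniformizer: "local_assoc Z P d t (1 * d) (t ^ 1)"
  unfolding local_assoc_def
  by (intro exI[of _ 0] exI[of _ 1]) auto

end

lemma lin2_nonzero:
  assumes "s \<noteq> (\<lambda>_. 0 :: 'a::field)"
  obtains u where "lin2 s u = 1" "u \<noteq> (\<lambda>_. 0)"
proof -
  have "s 1 \<noteq> 0 \<or> s 2 \<noteq> 0" using assms by (auto simp: fun_2_eq_iff)
  then have "\<exists>u. lin2 s u = 1"
  proof
    assume "s 1 \<noteq> 0"
    then show ?thesis by (intro exI[of _ "\<lambda>t. if t = 1 then 1 / s 1 else 0"]) (simp add: lin2_def)
  next
    assume "s 2 \<noteq> 0"
    then show ?thesis by (intro exI[of _ "\<lambda>t. if t = 1 then 0 else 1 / s 2"]) (simp add: lin2_def)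
  qed
  then obtain u where "lin2 s u = 1" by blast
  moreover from this have "u \<noteq> (\<lambda>_. 0)" by (auto simp: lin2_def)
  ultimately show ?thesis by (rule that)
qed

lemma lin2_zero:
  assumes "lin2 s u = 0" "s \<noteq> (\<lambda>_. 0 :: 'a::field)"
  obtains c where "u 1 = c * s 2" "u 2 = - c * s 1"
proof (cases "s 1 = 0")
  case True
  then have "s 2 \<noteq> 0" using assms(2) by (auto simp: fun_2_eq_iff)
  moreover from this True assms(1) have "u 2 = 0" by (simp add: lin2_def)
  ultimately show ?thesis using True that[of "u 1 / s 2"] by simp
next
  case False
  moreover have "s 1 * u 1 = - (s 2 * u 2)" using assms(1) by (simp add: lin2_def eq_neg_iff_add_eq_0)
  ultimately have "u 1 = - (s 2 * u 2) / s 1" by (metis nonzero_mult_div_cancel_left)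
  then show ?thesis using False that[of "- u 2 / s 1"] by simp
qed

lemma lin2_basis:
  assumes "lin2 s r = 0" "s \<noteq> (\<lambda>_. 0 :: 'a::field)" "lin2 s' r = 1"
  obtains e1 e2 where "\<And>u. u 1 = r 1 * lin2 s' u + e1 * lin2 s u" "\<And>u. u 2 = r 2 * lin2 s' u + e2 * lin2 s u"
proof -
  obtain c where c: "r 1 = c * s 2" "r 2 = - c * s 1" by (rule lin2_zero[OF assms(1,2)])
  define D where "D = s' 1 * s 2 - s' 2 * s 1"
  have D: "c * D = 1" using assms(3) by (simp add: lin2_def c D_def algebra_simps)
  then have "c \<noteq> 0" by auto
  have "c * D * u 1 = r 1 * lin2 s' u + (- c * s' 2) * lin2 s u"
    "c * D * u 2 = r 2 * lin2 s' u + (c * s' 1) * lin2 s u" for u :: "2 \<Rightarrow> 'a"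
    unfolding c D_def lin2_def by (simp_all add: algebra_simps)
  then show ?thesis unfolding D mult_1 using that by blast
qed

section \<open>Local equations of tangent planes and finiteness of orders\<close>

context diagonal_cone
begin

text \<open>On the curve such a form is a binary quadratic form in the parameters: it comes from a
  line in the plane of the conic.\<close>

definition span_form :: "(4, 'a) mpoly \<Rightarrow> 'a \<Rightarrow> 'a \<Rightarrow> 'a \<Rightarrow> bool" where
  "span_form g c1 c2 c3 \<longleftrightarrow> (\<forall>x\<in>affine_cone Z. meval g x = c1 * meval tA x + c2 * meval tB x + c3 * meval tC x)"

lemma co_span: "co j x = 1 / rj * meval tB x"
  "co k x = 1 / (2 * rk) * meval tA x + 1 / (2 * rk) * meval tC x"
  "co l x = 1 / (2 * rl) * meval tA x - 1 / (2 * rl) * meval tC x"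
  using roots_nonzero by (simp_all add: tA_def tB_def tC_def field_simps)

lemma chord_span:
  assumes "s \<noteq> i" "t \<noteq> i"
  obtains c1 c2 c3 where "span_form (chord P s t) c1 c2 c3"
proof -
  have 1: "\<exists>c1 c2 c3. \<forall>x. co t x = c1 * meval tA x + c2 * meval tB x + c3 * meval tC x" if "t \<noteq> i" for t
  proof -
    have "t = j \<or> t = k \<or> t = l" using UNIV_4[OF dist] that by auto
    then show ?thesis
    proof (elim disjE)
      assume t: "t = j"
      show ?thesis unfolding t co_span by (rule exI[of _ 0], rule exI[of _ "1 / rj"], rule exI[of _ 0]) simp
    next
      assume t: "t = k"
      show ?thesis unfolding t co_span
        by (rule exI[of _ "1 / (2 * rk)"], rule exI[of _ 0], rule exI[of _ "1 / (2 * rk)"]) simp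
    next
      assume t: "t = l"
      show ?thesis unfolding t co_span
        by (rule exI[of _ "1 / (2 * rl)"], rule exI[of _ 0], rule exI[of _ "- 1 / (2 * rl)"]) simp
    qed
  qed
  obtain c1 c2 c3 where c: "\<And>x. co t x = c1 * meval tA x + c2 * meval tB x + c3 * meval tC x"
    using 1[OF assms(2)] by blast
  obtain d1 d2 d3 where d: "\<And>x. co s x = d1 * meval tA x + d2 * meval tB x + d3 * meval tC x"
    using 1[OF assms(1)] by blast
  let ?p = "\<lambda>t. co t (rep_proj P)"
  show ?thesis
    by (rule that[of "?p s * c1 - ?p t * d1" "?p s * c2 - ?p t * d2" "?p s * c3 - ?p t * d3"])
      (simp add: span_form_def meval_chord c d algebra_simps)
qed

text \<open>A binary quadratic form vanishing at \<open>r\<close> is divisible by \<open>s\<close>,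
  hence a combination of \<open>s s'\<close> and \<open>s s\<close>.\<close>

lemma tau_generates:
  assumes P: "P \<in> Z" and r: "param (rep_proj P) r" and g: "span_form g c1 c2 c3" "meval g (rep_proj P) = 0"
    and s: "lin2 s r = 0" "s \<noteq> (\<lambda>_. 0)" "lin2 s' r = 1"
  obtains \<alpha> \<beta> where "\<And>x. x \<in> affine_cone Z \<Longrightarrow> meval g x = \<alpha> * meval (tau s s') x + \<beta> * meval (tau s s) x"
proof -
  obtain e1 e2 where e: "\<And>u. u 1 = r 1 * lin2 s' u + e1 * lin2 s u" "\<And>u. u 2 = r 2 * lin2 s' u + e2 * lin2 s u"
    by (rule lin2_basis[OF s]) blast
  have 0: "c1 * (r 1)\<^sup>2 + c2 * (r 1 * r 2) + c3 * (r 2)\<^sup>2 = 0"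
    using g P r unfolding span_form_def param_def by auto
  show ?thesis
  proof (rule that)
    fix x assume x: "x \<in> affine_cone Z"
    obtain u where u: "param x u" by (rule ex_param[OF x])
    define m where "m = lin2 s' u"
    define n where "n = lin2 s u"
    have "meval g x = c1 * (u 1)\<^sup>2 + c2 * (u 1 * u 2) + c3 * (u 2)\<^sup>2"
      using g(1) x u unfolding span_form_def param_def by auto
    also have "\<dots> = c1 * (r 1 * m + e1 * n)\<^sup>2 + c2 * ((r 1 * m + e1 * n) * (r 2 * m + e2 * n))
        + c3 * (r 2 * m + e2 * n)\<^sup>2"
      using e(1)[of u] e(2)[of u] by (simp add: m_def n_def)
    also have "\<dots> = (c1 * (r 1)\<^sup>2 + c2 * (r 1 * r 2) + c3 * (r 2)\<^sup>2) * m\<^sup>2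
        + (2 * c1 * r 1 * e1 + c2 * (r 1 * e2 + e1 * r 2) + 2 * c3 * r 2 * e2) * (n * m)
        + (c1 * e1\<^sup>2 + c2 * e1 * e2 + c3 * e2\<^sup>2) * (n * n)"
      by (simp add: power2_eq_square algebra_simps)
    finally show "meval g x = (2 * c1 * r 1 * e1 + c2 * (r 1 * e2 + e1 * r 2) + 2 * c3 * r 2 * e2) * meval (tau s s') x
        + (c1 * e1\<^sup>2 + c2 * e1 * e2 + c3 * e2\<^sup>2) * meval (tau s s) x"
      unfolding 0 meval_tau[OF u] m_def n_def by simp
  qed
qed

text \<open>At a ramification point \<open>chord P k i\<close> is a multiple of
  \<open>\<xi> i\<close>, and \<open>chord_relation\<close> then expresses any chord coming from the
  conic as a unit times its square.\<close>

lemma chord_square: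
  assumes P: "P \<in> Z" and 0: "co i (rep_proj P) = 0" and d: "distinct [i, t, k, r]"
  shows "uniformizer Z P 1 (chord P k i)" "\<not> zero_on Z (chord P k i)"
    "local_assoc Z P 1 (chord P k t) (2 * 1) (chord P k i ^ 2)"
proof -
  have nz: "co t (rep_proj P) \<noteq> 0" if "t \<noteq> i" for t
    using one_zero_coordinate[of "rep_proj P" t i] P 0 that by auto
  have ik: "i \<noteq> k" using d by simp
  show "uniformizer Z P 1 (chord P k i)" by (rule uniformizer_chord[OF P ik nz])
  show "\<not> zero_on Z (chord P k i)" by (rule chord_not_zero_on[OF P ik nz[OF ik[symmetric]]])
  let ?p = "\<lambda>t. co t (rep_proj P)"
  have dr: "distinct [r, k, t, i]" using d by auto
  define U where "U = mconst (minor r t * ?p k) * \<xi> t + mconst (minor r t * ?p t) * \<xi> k"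
  have "homogeneous 1 U" unfolding U_def by (intro homogeneous_add homogeneous_cmult homogeneous_xi)
  moreover have "meval U (rep_proj P) \<noteq> 0"
    using minor_nonzero[of r t] nz[of t] nz[of k] d by (auto simp: U_def mult_ac)
  moreover have "minor r i \<noteq> 0" using minor_nonzero d by auto
  moreover have "meval U x * meval (chord P k t) x = meval (mconst (- minor r i)) x * meval (chord P k i ^ 2) x"
    if "x \<in> affine_cone Z" for x
    using chord_relation[OF P dr that] 0 by (simp add: U_def meval_chord algebra_simps power2_eq_square)
  ultimately show "local_assoc Z P 1 (chord P k t) (2 * 1) (chord P k i ^ 2)"
    unfolding local_assoc_def
    by (intro exI[of _ 1] exI[of _ 0] exI[of _ U] exI[of _ "mconst (- minor r i)"]) auto
qed

definition ram :: "(4, 'a) proj \<Rightarrow> nat" where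
  "ram P = (if co i (rep_proj P) = 0 then 2 else 1)"

text \<open>\<open>ram P\<close> is the ramification index of the projection to the conic: a suitable chord pulled back
  from the conic has this order at \<open>P\<close>.\<close>

lemma ex_span_form_order:
  assumes P: "P \<in> Z"
  obtains g c1 c2 c3 t where "homogeneous 1 g" "span_form g c1 c2 c3" "meval g (rep_proj P) = 0"
    "uniformizer Z P 1 t" "\<not> zero_on Z t" "local_assoc Z P 1 g (ram P * 1) (t ^ ram P)"
proof (cases "co i (rep_proj P) = 0")
  case True
  have kj: "k \<noteq> i" "j \<noteq> i" using dist by auto
  obtain c1 c2 c3 where c: "span_form (chord P k j) c1 c2 c3" by (rule chord_span[OF kj])
  have "local_assoc Z P 1 (chord P k j) (ram P * 1) (chord P k i ^ ram P)"
    using chord_square(3)[OF P True, of j l] dist True by (auto simp: ram_def)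
  then show ?thesis using that[OF homogeneous_chord c] chord_square(1,2)[OF P True, of j l] dist
    by (auto simp: meval_chord)
next
  case False
  obtain z0 where z0: "\<And>t. t \<noteq> z0 \<Longrightarrow> co t (rep_proj P) \<noteq> 0" using ex_coordinate_zero[OF P] by blast
  define z where "z = (if z0 = i then j else z0)"
  have z: "z \<noteq> i" "\<And>t. t \<noteq> z \<Longrightarrow> co t (rep_proj P) \<noteq> 0"
    using z0 False dist unfolding z_def by (metis distinct_length_2_or_more)+
  define s where "s = (if z = j then k else j)"
  have s: "z \<noteq> s" "s \<noteq> i" using dist by (auto simp: s_def)
  obtain c1 c2 c3 where c: "span_form (chord P s z) c1 c2 c3" by (rule chord_span[OF s(2) z(1)])
  have u: "uniformizer Z P 1 (chord P s z)" by (rule uniformizer_chord[OF P s(1) z(2)])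
  have n: "\<not> zero_on Z (chord P s z)" by (rule chord_not_zero_on[OF P s(1) z(2)[OF s(1)[symmetric]]])
  show ?thesis using that[OF homogeneous_chord c _ u n] local_assoc_uniformizer[of P 1 "chord P s z"] False
    by (simp add: meval_chord ram_def)
qed

text \<open>In the ramified case the form, which does not involve \<open>\<xi> i\<close>, is a
  combination of two chords coming from the conic, each of which is a multiple of the square of the
  uniformizer.\<close>

lemma tau_order_ge:
  assumes P: "P \<in> Z" and 0: "meval (tau s s') (rep_proj P) = 0"
  shows "order_ge Z P (tau s s') (ram P)"
proof (cases "co i (rep_proj P) = 0")
  case False
  obtain d t where t: "uniformizer Z P d t" using smooth[OF P] by blast
  have "local_mult Z P 1 (tau s s') d t"
    by (rule uniformizer_mult[OF t homogeneous_tau]) (simp add: vanishes_rep 0)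
  then show ?thesis using False order_ge_iff_local_mult[OF t homogeneous_tau, of s s' 1] by (simp add: ram_def)
next
  case True
  let ?p = "\<lambda>t. co t (rep_proj P)"
  let ?t = "chord P k i"
  have lm: "local_mult Z P 1 (chord P k t) (2 * 1) (?t ^ 2)" if "distinct [i, t, k, r]" for t r
    using chord_square(3)[OF P True that] unfolding local_assoc_def local_mult_def by blast
  have pk: "?p k \<noteq> 0" using one_zero_coordinate[of "rep_proj P" k i] P True dist by auto
  define gj where "gj = (s 1 * s' 2 + s 2 * s' 1) * rj"
  define gk where "gk = (s 1 * s' 1 + s 2 * s' 2) * rk"
  define gl where "gl = (s 1 * s' 1 - s 2 * s' 2) * rl"
  have tau: "meval (tau s s') x = gj * co j x + gk * co k x + gl * co l x" for x
    by (simp add: tau_def tA_def tB_def tC_def gj_def gk_def gl_def algebra_simps)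
  have "?p k * meval (tau s s') x = gj * meval (chord P k j) x + gl * meval (chord P k l) x" for x
  proof -
    have g: "gk * ?p k = - (gj * ?p j + gl * ?p l)" using 0 unfolding tau
      by (simp add: eq_neg_iff_add_eq_0 algebra_simps)
    have "?p k * meval (tau s s') x = gj * ?p k * co j x + (gk * ?p k) * co k x + gl * ?p k * co l x"
      unfolding tau by (simp add: algebra_simps)
    then show ?thesis unfolding g meval_chord by (simp add: algebra_simps)
  qed
  then have eq: "meval (tau s s') x = gj / ?p k * meval (chord P k j) x + gl / ?p k * meval (chord P k l) x" for x
    using pk by (simp add: field_simps)
  have "local_mult Z P (0 + 1) (mconst (gj / ?p k) * chord P k j) (2 * 1) (?t ^ 2)"
    "local_mult Z P (0 + 1) (mconst (gl / ?p k) * chord P k l) (2 * 1) (?t ^ 2)"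
    by (intro local_mult_multl homogeneous_mconst lm[of j l] lm[of l j]; use dist in auto)+
  from local_mult_add[OF this]
  have "local_mult Z P 1 (mconst (gj / ?p k) * chord P k j + mconst (gl / ?p k) * chord P k l) (2 * 1) (?t ^ 2)"
    by simp
  then have "local_mult Z P 1 (tau s s') (2 * 1) (?t ^ 2)"
    by (rule iffD1[OF local_mult_cong, rotated -1]) (auto simp: eq)
  then show ?thesis
    using order_ge_iff_local_mult[OF chord_square(1)[OF P True, of j l] homogeneous_tau, of s s' 2] dist True
    by (auto simp: ram_def)
qed

lemma tau_not_zero_on:
  assumes "s \<noteq> (\<lambda>_. 0)" "s' \<noteq> (\<lambda>_. 0)"
  shows "\<not> zero_on Z (tau s s')"
proof -
  have "\<exists>u. lin2 s u * lin2 s' u \<noteq> 0 \<and> u \<noteq> (\<lambda>_. 0)"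
  proof -
    obtain u where u: "lin2 s u = 1" "u \<noteq> (\<lambda>_. 0)" by (rule lin2_nonzero[OF assms(1)])
    obtain v where v: "lin2 s' v = 1" "v \<noteq> (\<lambda>_. 0)" by (rule lin2_nonzero[OF assms(2)])
    consider "lin2 s' u \<noteq> 0" | "lin2 s v \<noteq> 0" | "lin2 s' u = 0" "lin2 s v = 0" by blast
    then show ?thesis
    proof cases
      \<comment> \<open>Here \<open>s\<close> vanishes at \<open>v\<close> and \<open>s'\<close> at
        \<open>u\<close>, so neither vanishes at the sum \<open>u + v\<close>.\<close>
      case 3
      have "lin2 s (\<lambda>t. u t + v t) = 1" "lin2 s' (\<lambda>t. u t + v t) = 1"
        using 3 u v by (simp_all add: lin2_def algebra_simps)
      moreover from this have "(\<lambda>t. u t + v t) \<noteq> (\<lambda>_. 0)"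
        by (metis lin2_def mult_zero_right add_0 zero_neq_one)
      ultimately show ?thesis by (intro exI[of _ "\<lambda>t. u t + v t"]) simp
    qed (use u v in \<open>auto intro: exI[of _ u] exI[of _ v]\<close>)
  qed
  then obtain u where u: "lin2 s u * lin2 s' u \<noteq> 0" "u \<noteq> (\<lambda>_. 0)" by blast
  obtain x where "x \<in> affine_cone Z" "param x u" by (rule ex_point_param[OF u(2)])
  then show ?thesis using u(1) meval_tau unfolding zero_on_def by metis
qed

text \<open>Choose \<open>s'\<close> with value 1 at the parameter of \<open>P\<close>. Then
  \<open>tau s' s'\<close> is a unit at \<open>P\<close>, \<open>tau s s'\<close> is the equation
  pulled back from the point on the conic, and \<open>tau s s\<close> is its square up to this
  unit.\<close>

lemma tau_local_equations:
  assumes P: "P \<in> Z" and s: "s \<noteq> (\<lambda>_. 0)" "meval (tau s s) (rep_proj P) = 0"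
  obtains s' where "meval (tau s' s') (rep_proj P) \<noteq> 0" "meval (tau s s') (rep_proj P) = 0" "s' \<noteq> (\<lambda>_. 0)"
    "\<And>x. x \<in> affine_cone Z \<Longrightarrow> meval (tau s' s' * tau s s) x = meval (tau s s' * tau s s') x"
    "\<And>g c1 c2 c3. span_form g c1 c2 c3 \<Longrightarrow> meval g (rep_proj P) = 0 \<Longrightarrow>
      \<exists>\<alpha> \<beta>. \<forall>x\<in>affine_cone Z. meval g x = \<alpha> * meval (tau s s') x + \<beta> * meval (tau s s) x"
proof -
  obtain r where r: "param (rep_proj P) r" "r \<noteq> (\<lambda>_. 0)" using ex_param[of "rep_proj P"] P by auto
  have sr: "lin2 s r = 0" using s(2) by (simp add: meval_tau[OF r(1)])
  have comm: "lin2 a b = lin2 b a" for a b :: "2 \<Rightarrow> 'a" by (simp add: lin2_def mult.commute)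
  obtain s' where s': "lin2 s' r = 1" "s' \<noteq> (\<lambda>_. 0)" using lin2_nonzero[OF r(2)] comm by metis
  show ?thesis
  proof (rule that[of s'])
    show "meval (tau s' s' * tau s s) x = meval (tau s s' * tau s s') x" if x: "x \<in> affine_cone Z" for x
    proof -
      obtain u where "param x u" by (rule ex_param[OF x])
      then show ?thesis by (simp add: meval_tau)
    qed
    show "\<exists>\<alpha> \<beta>. \<forall>x\<in>affine_cone Z. meval g x = \<alpha> * meval (tau s s') x + \<beta> * meval (tau s s) x"
      if "span_form g c1 c2 c3" "meval g (rep_proj P) = 0" for g c1 c2 c3
      using tau_generates[OF P r(1) that sr s(1) s'(1)] by metis
  qed (use s' in \<open>simp_all add: meval_tau[OF r(1)] sr\<close>)
qed

text \<open>A form \<open>g\<close> of known order, times the unit \<open>tau s' s'\<close>, is a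
  multiple of \<open>tau s s'\<close>. So \<open>tau s s'\<close> has finite order, and with it
  \<open>tau s s\<close>, which is its square up to a unit.\<close>

lemma finite_order_tau:
  assumes P: "P \<in> Z" and s: "s \<noteq> (\<lambda>_. 0)"
  shows "finite_order P (tau s s)"
proof (cases "meval (tau s s) (rep_proj P) = 0")
  case False
  then show ?thesis by (rule finite_order_nonvanishing[OF P homogeneous_tau])
next
  case True
  obtain s' where s': "meval (tau s' s') (rep_proj P) \<noteq> 0" "meval (tau s s') (rep_proj P) = 0" "s' \<noteq> (\<lambda>_. 0)"
    and sq: "\<And>x. x \<in> affine_cone Z \<Longrightarrow> meval (tau s' s' * tau s s) x = meval (tau s s' * tau s s') x"
    and gen: "\<And>g c1 c2 c3. span_form g c1 c2 c3 \<Longrightarrow> meval g (rep_proj P) = 0 \<Longrightarrow>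
      \<exists>\<alpha> \<beta>. \<forall>x\<in>affine_cone Z. meval g x = \<alpha> * meval (tau s s') x + \<beta> * meval (tau s s) x"
    by (rule tau_local_equations[OF P s True]) blast
  obtain g c1 c2 c3 t where g: "homogeneous 1 g" "span_form g c1 c2 c3" "meval g (rep_proj P) = 0"
    "uniformizer Z P 1 t" "\<not> zero_on Z t" "local_assoc Z P 1 g (ram P * 1) (t ^ ram P)"
    by (rule ex_span_form_order[OF P])
  obtain \<alpha> \<beta> where ab: "\<And>x. x \<in> affine_cone Z \<Longrightarrow> meval g x = \<alpha> * meval (tau s s') x + \<beta> * meval (tau s s) x"
    using gen[OF g(2,3)] by blast
  have "finite_order P g" by (rule finite_order_local_assoc[OF P g(4,5,1,6)])
  then have "finite_order P (g * tau s' s')"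
    using finite_order_mult[OF P g(1) _ homogeneous_tau finite_order_nonvanishing[OF P homogeneous_tau s'(1)]]
    by blast
  then have "finite_order P ((mconst \<alpha> * tau s' s' + mconst \<beta> * tau s s') * tau s s')"
  proof (rule finite_order_cong[rotated])
    fix x assume x: "x \<in> affine_cone Z"
    have "meval (g * tau s' s') x
      = \<alpha> * meval (tau s s') x * meval (tau s' s') x + \<beta> * meval (tau s' s' * tau s s) x"
      by (simp add: ab[OF x] algebra_simps)
    then show "meval (g * tau s' s') x = meval ((mconst \<alpha> * tau s' s' + mconst \<beta> * tau s s') * tau s s') x"
      unfolding sq[OF x] by (simp add: algebra_simps)
  qed
  moreover have "homogeneous 1 (mconst \<alpha> * tau s' s' + mconst \<beta> * tau s s')"
    by (intro homogeneous_add homogeneous_cmult homogeneous_tau)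
  ultimately have t: "finite_order P (tau s s')"
    using finite_order_factor[OF P homogeneous_tau] by blast
  have "finite_order P (tau s' s' * tau s s)"
    using finite_order_cong[OF _ finite_order_mult[OF P homogeneous_tau t homogeneous_tau t]] sq by metis
  then show ?thesis by (rule finite_order_factor[OF P homogeneous_tau homogeneous_tau])
qed

lemma prod_tau:
  assumes "\<And>m. s m \<noteq> (\<lambda>_. 0)"
  shows "homogeneous n (\<Prod>m<n. tau (s m) (s m))"
    "P \<in> Z \<Longrightarrow> finite_order P (\<Prod>m<n. tau (s m) (s m))"
    "x \<in> affine_cone Z \<Longrightarrow> param x u \<Longrightarrow> meval (\<Prod>m<n. tau (s m) (s m)) x = (\<Prod>m<n. lin2 (s m) u)\<^sup>2"
proof -
  show h: "homogeneous n (\<Prod>m<n. tau (s m) (s m))" for n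
    using homogeneous_prod[of "{..<n}" "\<lambda>_. 1" "\<lambda>m. tau (s m) (s m)"] homogeneous_tau by simp
  show "finite_order P (\<Prod>m<n. tau (s m) (s m))" if "P \<in> Z"
  proof (induction n)
    case 0
    show ?case using finite_order_nonvanishing[OF that homogeneous_1] by simp
  next
    case (Suc n)
    show ?case
      using finite_order_mult[OF that h[of n] Suc homogeneous_tau finite_order_tau[OF that assms]] by simp
  qed
  show "meval (\<Prod>m<n. tau (s m) (s m)) x = (\<Prod>m<n. lin2 (s m) u)\<^sup>2"
    if "x \<in> affine_cone Z" "param x u"
    using that by (simp add: meval_tau power2_eq_square flip: prod.distrib)
qed

abbreviation reflect_form :: "(4, 'a) mpoly \<Rightarrow> (4, 'a) mpoly" where
  "reflect_form F \<equiv> msubst F (reflection i)"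

lemma homogeneous_reflect_form: "homogeneous n F \<Longrightarrow> homogeneous n (reflect_form F)"
  using homogeneous_msubst[of n F 1 "reflection i"] homogeneous_reflection by simp

lemma meval_reflect_form: "meval (reflect_form F) x = meval F (reflect i x)"
  by (simp add: reflect_def)

lemma reflect_form_not_zero_on: "\<not> zero_on Z F \<Longrightarrow> \<not> zero_on Z (reflect_form F)"
  unfolding zero_on_def meval_reflect_form by (metis reflect_cone reflect_reflect)

text \<open>A linear form in the parameters is not a form on the curve, but its square is a tangent
  plane. Therefore it is the square of the norm that becomes a product of such planes.\<close>

lemma norm_square:
  assumes F: "homogeneous n F" "\<not> zero_on Z F"
  obtains c s where "c \<noteq> 0" "\<And>m. s m \<noteq> (\<lambda>_. 0)"
    "\<And>x. x \<in> affine_cone Z \<Longrightarrow>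
      meval ((F * reflect_form F)\<^sup>2) x = meval (mconst c * (\<Prod>m<4 * n. tau (s m) (s m))) x"
proof -
  obtain N where N: "homogeneous (4 * n) N"
    "\<And>x u. x \<in> affine_cone Z \<Longrightarrow> param x u \<Longrightarrow> meval F x * meval F (reflect i x) = meval N u"
    "(\<forall>u. meval N u = 0) \<Longrightarrow> zero_on Z F" by (rule norm_form[OF F(1)]) blast
  obtain v where "meval N v \<noteq> 0" using N(3) F(2) by blast
  from binary_form_factor[OF N(1) this] obtain c s where cs: "c \<noteq> 0" "\<And>m. s m \<noteq> (\<lambda>_. 0)"
    "\<And>u. meval N u = c * (\<Prod>m<4 * n. lin2 (s m) u)" by blast
  show ?thesis
  proof (rule that[of "c\<^sup>2" s])
    fix x assume x: "x \<in> affine_cone Z"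
    obtain u where u: "param x u" by (rule ex_param[OF x])
    have "meval ((F * reflect_form F)\<^sup>2) x = (meval F x * meval F (reflect i x))\<^sup>2"
      by (simp only: meval_power meval_mult meval_reflect_form)
    then show "meval ((F * reflect_form F)\<^sup>2) x = meval (mconst (c\<^sup>2) * (\<Prod>m<4 * n. tau (s m) (s m))) x"
      unfolding meval_mult meval_mconst prod_tau(3)[OF cs(2) x u] N(2)[OF x u] cs(3)
      by (simp add: power_mult_distrib)
  qed (use cs in simp_all)
qed

text \<open>\<open>F\<close> divides its squared norm, a product of tangent planes, each of which
  has finite order.\<close>

sublocale smooth_curve Z
proof
  fix P n F assume P: "P \<in> Z" and F: "homogeneous n F" "\<not> zero_on Z F"
  obtain c s where cs: "c \<noteq> 0" "\<And>m. s m \<noteq> (\<lambda>_. 0)"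
    "\<And>x. x \<in> affine_cone Z \<Longrightarrow>
      meval ((F * reflect_form F)\<^sup>2) x = meval (mconst c * (\<Prod>m<4 * n. tau (s m) (s m))) x"
    by (rule norm_square[OF F]) blast
  have "finite_order P (mconst c)"
    by (rule finite_order_nonvanishing[OF P homogeneous_mconst]) (use cs(1) in simp)
  from finite_order_mult[OF P homogeneous_mconst this prod_tau(1)[of s, OF cs(2)]
      prod_tau(2)[of s, OF cs(2) P]]
  have "finite_order P (mconst c * (\<Prod>m<4 * n. tau (s m) (s m)))" .
  then have "finite_order P ((F * reflect_form F * reflect_form F) * F)"
    by (rule finite_order_cong[rotated])
      (subst cs(3)[symmetric], auto simp: power2_eq_square mult_ac)
  then have "finite_order P F"
    by (rule finite_order_factor[OF P F(1) homogeneous_mult[OF homogeneous_mult[OF F(1)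
        homogeneous_reflect_form[OF F(1)]] homogeneous_reflect_form[OF F(1)]]])
  then show "\<exists>j. \<not> order_ge Z P F j" by (simp add: finite_order_def)
qed

end

section \<open>Divisors of tangent planes and Bezout's theorem\<close>

context diagonal_cone
begin

text \<open>The order of \<open>tau s s'\<close> is at least \<open>ram P\<close>. It cannot be
  larger, because a form of order exactly \<open>ram P\<close> is a combination of
  \<open>tau s s'\<close> and its square up to a unit, \<open>tau s s\<close>.\<close>

lemma ord_tau:
  assumes P: "P \<in> Z" and s: "s \<noteq> (\<lambda>_. 0)" "meval (tau s s) (rep_proj P) = 0"
  shows "ord P (tau s s) = 2 * ram P"
proof -
  obtain s' where s': "meval (tau s' s') (rep_proj P) \<noteq> 0" "meval (tau s s') (rep_proj P) = 0" "s' \<noteq> (\<lambda>_. 0)"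
    and sq: "\<And>x. x \<in> affine_cone Z \<Longrightarrow> meval (tau s' s' * tau s s) x = meval (tau s s' * tau s s') x"
    and gen: "\<And>g c1 c2 c3. span_form g c1 c2 c3 \<Longrightarrow> meval g (rep_proj P) = 0 \<Longrightarrow>
      \<exists>\<alpha> \<beta>. \<forall>x\<in>affine_cone Z. meval g x = \<alpha> * meval (tau s s') x + \<beta> * meval (tau s s) x"
    by (rule tau_local_equations[OF P s]) blast
  obtain g c1 c2 c3 t where g: "homogeneous 1 g" "span_form g c1 c2 c3" "meval g (rep_proj P) = 0"
    "uniformizer Z P 1 t" "\<not> zero_on Z t" "local_assoc Z P 1 g (ram P * 1) (t ^ ram P)"
    by (rule ex_span_form_order[OF P])
  obtain \<alpha> \<beta> where ab: "\<And>x. x \<in> affine_cone Z \<Longrightarrow> meval g x = \<alpha> * meval (tau s s') x + \<beta> * meval (tau s s) x"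
    using gen[OF g(2,3)] by blast
  note h = homogeneous_tau
  have nz: "\<not> zero_on Z (tau s s)" "\<not> zero_on Z (tau s s')" "\<not> zero_on Z (tau s' s')"
    using tau_not_zero_on s s' by auto
  have "ord P (tau s' s' * tau s s) = ord P (tau s s' * tau s s')" by (rule order_at_cong[OF sq])
  then have eq: "ord P (tau s s) = 2 * ord P (tau s s')"
    using ord_mult[OF P h nz(3) h nz(1)] ord_mult[OF P h nz(2) h nz(2)] ord_eq_0[OF P h s'(1)] by simp
  have "ram P \<le> ord P (tau s s')"
    using tau_order_ge[OF P s'(2)] order_ge_iff[OF P h nz(2)] by blast
  moreover have "\<not> ram P < ord P (tau s s')"
  proof
    assume "ram P < ord P (tau s s')"
    then have "order_ge Z P (tau s s') (Suc (ram P))" "order_ge Z P (tau s s) (Suc (ram P))"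
      using order_ge_iff[OF P h nz(2)] order_ge_iff[OF P h nz(1)] eq by auto
    then have "local_mult Z P 1 (tau s s') (Suc (ram P) * 1) (t ^ Suc (ram P))"
      "local_mult Z P 1 (tau s s) (Suc (ram P) * 1) (t ^ Suc (ram P))"
      using order_ge_iff_local_mult[OF g(4) h] by blast+
    from local_mult_add[OF local_mult_multl[OF homogeneous_mconst this(1)]
        local_mult_multl[OF homogeneous_mconst this(2)], of \<alpha> \<beta>]
    have "local_mult Z P 1 (mconst \<alpha> * tau s s' + mconst \<beta> * tau s s) (Suc (ram P) * 1) (t ^ Suc (ram P))"
      by simp
    then have "local_mult Z P 1 g (Suc (ram P) * 1) (t ^ Suc (ram P))"
      by (rule iffD1[OF local_mult_cong, rotated -1]) (auto simp: ab)
    then have "order_ge Z P g (Suc (ram P))" using order_ge_iff_local_mult[OF g(4,1)] by blast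
    then show False using order_at_local_assoc(1)[OF P g(4,5,1,6)] by simp
  qed
  ultimately show ?thesis using eq by simp
qed

lemma param_scale: "param x u \<Longrightarrow> param (\<lambda>m. c\<^sup>2 * x m) (\<lambda>t. c * u t)"
proof -
  have "homogeneous 1 tA" "homogeneous 1 tB" "homogeneous 1 tC"
    unfolding tA_def tB_def tC_def
    by (intro homogeneous_add homogeneous_diff homogeneous_cmult homogeneous_xi)+
  then show "param x u \<Longrightarrow> param (\<lambda>m. c\<^sup>2 * x m) (\<lambda>t. c * u t)"
    by (simp add: param_def meval_scale power_mult_distrib power2_eq_square mult_ac)
qed

text \<open>The plane touches the cone along the generator over the root \<open>r\<close> of
  \<open>s\<close>. This line meets the curve where \<open>co i\<close> is one of the two square
  roots of \<open>kap r\<close>, and these points are exchanged by the reflection. If they coincide,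
  both indicators count and the order is 4.\<close>

lemma tau_divisor:
  assumes s: "s \<noteq> (\<lambda>_. 0)"
  obtains P where "P \<in> Z" "\<And>Q. Q \<in> Z \<Longrightarrow> meval (tau s s) (rep_proj Q) = 0 \<longleftrightarrow> Q = P \<or> Q = reflect_point i P"
    "\<And>Q. Q \<in> Z \<Longrightarrow> ord Q (tau s s) = 2 * (of_bool (Q = P) + of_bool (Q = reflect_point i P))"
proof -
  define r where "r = (\<lambda>t::2. if t = 1 then s 2 else - s 1)"
  have r: "r \<noteq> (\<lambda>_. 0)" "lin2 s r = 0" using s by (auto simp: r_def fun_2_eq_iff lin2_def)
  obtain x where x: "x \<in> affine_cone Z" "param x r" by (rule ex_point_param[OF r(1)])
  define P where "P = abs_proj x"
  have P: "P \<in> Z" "x \<noteq> (\<lambda>_. 0)" using x(1) by (simp_all add: affine_cone_def P_def)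
  have JP: "reflect_point i P = abs_proj (reflect i x)" unfolding P_def by (rule reflect_point_abs[OF P(2)])
  have "meval (tau s s) x = 0" by (simp add: meval_tau[OF x(2)] r)
  then have 1: "meval (tau s s) (rep_proj P) = 0"
    using vanishes_abs[OF homogeneous_tau P(2)] by (simp add: P_def vanishes_rep)
  have "meval (tau s s) (reflect i x) = 0" by (simp add: meval_tau[of "reflect i x" r] x r)
  then have 2: "meval (tau s s) (rep_proj (reflect_point i P)) = 0"
    using vanishes_abs[OF homogeneous_tau reflect_nonzero[OF P(2)]] by (simp add: JP vanishes_rep)
  have 3: "Q = P \<or> Q = reflect_point i P" if Q: "Q \<in> Z" and 0: "meval (tau s s) (rep_proj Q) = 0" for Q
  proof -
    let ?q = "rep_proj Q"
    obtain u where u: "param ?q u" "u \<noteq> (\<lambda>_. 0)" using ex_param[of ?q] Q by auto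
    have "lin2 s u = 0" using 0 by (simp add: meval_tau[OF u(1)])
    then obtain c where c: "u 1 = c * s 2" "u 2 = - c * s 1" by (rule lin2_zero[OF _ s])
    then have ur: "u = (\<lambda>t. c * r t)" by (simp add: fun_2_eq_iff r_def)
    then have "c \<noteq> 0" using u(2) by auto
    define z where "z = (\<lambda>m. c\<^sup>2 * x m)"
    have z1: "z \<in> affine_cone Z"
      unfolding z_def by (rule affine_cone_scale[OF x(1)]) (use \<open>c \<noteq> 0\<close> in simp)
    then have zn: "z \<noteq> (\<lambda>_. 0)" by (simp add: affine_cone_def)
    have "abs_proj x = abs_proj z"
      using abs_proj_eq_iff[OF P(2) zn] \<open>c \<noteq> 0\<close> z_def by (metis zero_eq_power2)
    then have z: "z \<in> affine_cone Z" "abs_proj z = P" using z1 by (simp_all add: P_def)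
    have pz: "param z u" unfolding z_def ur by (rule param_scale[OF x(2)])
    have "(co i ?q)\<^sup>2 = (co i z)\<^sup>2" using co_sq_param[OF _ u(1)] co_sq_param[OF z(1) pz] Q by simp
    then consider "co i ?q = co i z" | "co i ?q = - co i z" using power2_eq_iff by blast
    then show ?thesis
    proof cases
      case 1
      then have "\<forall>t. co t ?q = co t z" using u(1) pz unfolding all_4[OF dist] param_iff by simp
      then have "?q = z" using coordinates_eqI by blast
      then show ?thesis using z(2) abs_rep_proj[of Q] by simp
    next
      case 2
      then have "\<forall>t. co t ?q = co t (reflect i z)"
        using u(1) pz dist unfolding all_4[OF dist] param_iff by (auto simp: co_reflect)
      then have "?q = reflect i z" using coordinates_eqI by blast
      then have "Q = abs_proj (reflect i z)" using abs_rep_proj[of Q] by simp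
      then show ?thesis using reflect_point_abs[OF zn, of i] z(2) by simp
    qed
  qed
  show ?thesis
  proof (rule that[OF P(1)])
    show iff: "meval (tau s s) (rep_proj Q) = 0 \<longleftrightarrow> Q = P \<or> Q = reflect_point i P" if "Q \<in> Z" for Q
      using 1 2 3[OF that] by blast
    show "ord Q (tau s s) = 2 * (of_bool (Q = P) + of_bool (Q = reflect_point i P))" if Q: "Q \<in> Z" for Q
    proof (cases "Q = P \<or> Q = reflect_point i P")
      case True
      have "reflect_point i Q = Q \<longleftrightarrow> P = reflect_point i P" using True by (metis reflect_point_reflect_point)
      then have "co i (rep_proj Q) = 0 \<longleftrightarrow> P = reflect_point i P" using reflect_point_eq_iff[OF Q] by simp
      then show ?thesis using ord_tau[OF Q s] iff[OF Q] True by (auto simp: ram_def)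
    next
      case False
      then show ?thesis using ord_eq_0[OF Q homogeneous_tau] iff[OF Q] by simp
    qed
  qed
qed

lemma tau_through:
  assumes P: "P \<in> Z"
  obtains s where "s \<noteq> (\<lambda>_. 0)"
    "\<And>Q. Q \<in> Z \<Longrightarrow> ord Q (tau s s) = 2 * (of_bool (Q = P) + of_bool (Q = reflect_point i P))"
proof -
  obtain r where r: "param (rep_proj P) r" "r \<noteq> (\<lambda>_. 0)" using ex_param[of "rep_proj P"] P by auto
  define s where "s = (\<lambda>t::2. if t = 1 then r 2 else - r 1)"
  have s: "s \<noteq> (\<lambda>_. 0)" "lin2 s r = 0" using r by (auto simp: s_def fun_2_eq_iff lin2_def)
  obtain P0 where P0: "P0 \<in> Z" "\<And>Q. Q \<in> Z \<Longrightarrow> meval (tau s s) (rep_proj Q) = 0 \<longleftrightarrow> Q = P0 \<or> Q = reflect_point i P0"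
    "\<And>Q. Q \<in> Z \<Longrightarrow> ord Q (tau s s) = 2 * (of_bool (Q = P0) + of_bool (Q = reflect_point i P0))"
    by (rule tau_divisor[OF s(1)]) blast
  have "meval (tau s s) (rep_proj P) = 0" by (simp add: meval_tau[OF r(1)] s)
  then have "P = P0 \<or> P = reflect_point i P0" using P0(2)[OF P] by blast
  then have "of_bool (Q = P0) + of_bool (Q = reflect_point i P0)
      = (of_bool (Q = P) + of_bool (Q = reflect_point i P) :: nat)" for Q
    by (metis add.commute reflect_point_reflect_point)
  then show ?thesis using that[OF s(1)] P0(3) by metis
qed

lemma sum_ord_tau:
  assumes s: "s \<noteq> (\<lambda>_. 0)" and S: "finite S" "S \<subseteq> Z"
    "\<And>Q. Q \<in> Z \<Longrightarrow> meval (tau s s) (rep_proj Q) = 0 \<Longrightarrow> Q \<in> S"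
  shows "(\<Sum>Q\<in>S. ord Q (tau s s)) = 4"
proof -
  obtain P where P: "P \<in> Z" "\<And>Q. Q \<in> Z \<Longrightarrow> meval (tau s s) (rep_proj Q) = 0 \<longleftrightarrow> Q = P \<or> Q = reflect_point i P"
    "\<And>Q. Q \<in> Z \<Longrightarrow> ord Q (tau s s) = 2 * (of_bool (Q = P) + of_bool (Q = reflect_point i P))"
    by (rule tau_divisor[OF s]) blast
  have in_S: "P \<in> S" "reflect_point i P \<in> S" using S P by auto
  have "(\<Sum>Q\<in>S. ord Q (tau s s)) = (\<Sum>Q\<in>S. 2 * (of_bool (Q = P) + of_bool (Q = reflect_point i P)))"
    by (rule sum.cong) (use P(3) S in auto)
  also have "\<dots> = 4" using S(1) in_S by (simp add: sum.distrib of_bool_def flip: sum_distrib_left)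
  finally show ?thesis .
qed

lemma ord_prod_tau:
  fixes n :: nat
  assumes "P \<in> Z" "\<And>m. s m \<noteq> (\<lambda>_. 0)"
  shows "ord P (\<Prod>m<n. tau (s m) (s m)) = (\<Sum>m<n. ord P (tau (s m) (s m)))"
    "\<not> zero_on Z (\<Prod>m<n. tau (s m) (s m))"
proof -
  have "\<not> zero_on Z (\<Prod>m<n. tau (s m) (s m)) \<and>
      ord P (\<Prod>m<n. tau (s m) (s m)) = (\<Sum>m<n. ord P (tau (s m) (s m)))"
  proof (induction n)
    case 0
    show ?case using ord_eq_0[OF assms(1) homogeneous_1] not_zero_onI[OF assms(1), of 1] by simp
  next
    case (Suc k)
    have nz: "\<not> zero_on Z (tau (s k) (s k))" by (rule tau_not_zero_on[OF assms(2) assms(2)])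
    show ?case
      using ord_mult[OF assms(1) prod_tau(1)[of s, OF assms(2)] conjunct1[OF Suc] homogeneous_tau nz]
        not_zero_on_mult[OF prod_tau(1)[of s, OF assms(2)] homogeneous_tau conjunct1[OF Suc] nz] Suc
      by simp
  qed
  then show "ord P (\<Prod>m<n. tau (s m) (s m)) = (\<Sum>m<n. ord P (tau (s m) (s m)))"
    "\<not> zero_on Z (\<Prod>m<n. tau (s m) (s m))" by blast+
qed

lemma zeros_subset_tau:
  assumes F: "homogeneous n F" "\<not> zero_on Z F"
  obtains s where "\<And>m. s m \<noteq> (\<lambda>_. 0)"
    "\<And>Q. Q \<in> Z \<Longrightarrow> 2 * (ord Q F + ord (reflect_point i Q) F) = (\<Sum>m<4 * n. ord Q (tau (s m) (s m)))"
    "\<And>Q. Q \<in> Z \<Longrightarrow> meval F (rep_proj Q) = 0 \<Longrightarrow> \<exists>m<4 * n. meval (tau (s m) (s m)) (rep_proj Q) = 0"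
proof -
  obtain c s where cs: "c \<noteq> 0" "\<And>m. s m \<noteq> (\<lambda>_. 0)"
    "\<And>x. x \<in> affine_cone Z \<Longrightarrow>
      meval ((F * reflect_form F)\<^sup>2) x = meval (mconst c * (\<Prod>m<4 * n. tau (s m) (s m))) x"
    by (rule norm_square[OF F]) blast
  show ?thesis
  proof (rule that[OF cs(2)])
    fix Q assume Q: "Q \<in> Z"
    note F' = homogeneous_reflect_form[OF F(1)] reflect_form_not_zero_on[OF F(2)]
    have FF: "homogeneous (n + n) (F * reflect_form F)" "\<not> zero_on Z (F * reflect_form F)"
      using homogeneous_mult[OF F(1) F'(1)] not_zero_on_mult[OF F(1) F'(1) F(2) F'(2)] by blast+
    have "ord Q ((F * reflect_form F)\<^sup>2) = 2 * (ord Q F + ord Q (reflect_form F))"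
      using ord_power[OF Q FF, of 2] ord_mult[OF Q F F'] by simp
    moreover have "ord Q (reflect_form F) = ord (reflect_point i Q) F"
      by (rule order_reflect[OF Q F(1)])
    moreover have "ord Q ((F * reflect_form F)\<^sup>2) = ord Q (mconst c * (\<Prod>m<4 * n. tau (s m) (s m)))"
      by (rule order_at_cong[OF cs(3)])
    moreover have "\<dots> = (\<Sum>m<4 * n. ord Q (tau (s m) (s m)))"
      using ord_mconst_mult[OF Q prod_tau(1)[of s, OF cs(2)] ord_prod_tau(2)[of Q s, OF Q cs(2)] cs(1)]
        ord_prod_tau(1)[of Q s, OF Q cs(2)] by simp
    ultimately show eq: "2 * (ord Q F + ord (reflect_point i Q) F) = (\<Sum>m<4 * n. ord Q (tau (s m) (s m)))"
      by simp
    show "\<exists>m<4 * n. meval (tau (s m) (s m)) (rep_proj Q) = 0" if "meval F (rep_proj Q) = 0"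
    proof (rule ccontr)
      assume "\<not> ?thesis"
      then have "(\<Sum>m<4 * n. ord Q (tau (s m) (s m))) = 0"
        using ord_eq_0[OF Q homogeneous_tau] by (intro sum.neutral) auto
      then show False using eq that ord_pos_iff[OF Q F] by simp
    qed
  qed
qed

text \<open>Add the identity \<open>2 (ord F + ord of the reflected form)\<close> = sum of the
  orders of \<open>4 n\<close> tangent planes over a finite set stable under the reflection. Each
  tangent plane has degree 4, so four times the degree of \<open>F\<close> is
  \<open>16 n\<close>.\<close>

lemma projective_curve_cone: "projective_curve Z 4"
proof
  fix n F assume F: "homogeneous n F" "\<not> zero_on Z F"
  obtain s where s: "\<And>m. s m \<noteq> (\<lambda>_. 0)"
    "\<And>Q. Q \<in> Z \<Longrightarrow> 2 * (ord Q F + ord (reflect_point i Q) F) = (\<Sum>m<4 * n. ord Q (tau (s m) (s m)))"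
    "\<And>Q. Q \<in> Z \<Longrightarrow> meval F (rep_proj Q) = 0 \<Longrightarrow> \<exists>m<4 * n. meval (tau (s m) (s m)) (rep_proj Q) = 0"
    by (rule zeros_subset_tau[OF F]) blast
  define S where "S = {Q\<in>Z. \<exists>m<4 * n. meval (tau (s m) (s m)) (rep_proj Q) = 0}"
  have zeros: "\<exists>P. \<forall>Q\<in>Z. meval (tau (s m) (s m)) (rep_proj Q) = 0 \<longleftrightarrow> Q = P \<or> Q = reflect_point i P" for m
    using tau_divisor[OF s(1), of m] by metis
  then obtain p where p: "\<And>m Q. Q \<in> Z \<Longrightarrow>
      meval (tau (s m) (s m)) (rep_proj Q) = 0 \<longleftrightarrow> Q = p m \<or> Q = reflect_point i (p m)" by metis
  have "S \<subseteq> p ` {..<4 * n} \<union> (\<lambda>m. reflect_point i (p m)) ` {..<4 * n}"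
    using p by (auto simp: S_def)
  then have S: "finite S" "S \<subseteq> Z" by (auto intro: finite_subset simp: S_def)
  have sub: "{P \<in> Z. meval F (rep_proj P) = 0} \<subseteq> S" using s(3) by (auto simp: S_def)
  then show "finite {P \<in> Z. meval F (rep_proj P) = 0}" using S(1) finite_subset by blast
  have J: "bij_betw (reflect_point i) S S"
  proof (rule bij_betwI[of _ _ _ "reflect_point i"])
    have "reflect_point i Q \<in> S" if Q: "Q \<in> S" for Q
    proof -
      obtain m where m: "m < 4 * n" "Q = p m \<or> Q = reflect_point i (p m)" "Q \<in> Z"
        using Q p by (auto simp: S_def)
      then have "meval (tau (s m) (s m)) (rep_proj (reflect_point i Q)) = 0"
        using p[of "reflect_point i Q" m] by (metis reflect_point_in reflect_point_reflect_point)
      then show ?thesis using m by (auto simp: S_def)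
    qed
    then show "reflect_point i \<in> S \<rightarrow> S" "reflect_point i \<in> S \<rightarrow> S" by auto
  qed auto
  have "(\<Sum>Q\<in>S. ord (reflect_point i Q) F) = (\<Sum>Q\<in>S. ord Q F)"
    by (rule sum.reindex_bij_betw[OF J])
  then have "4 * (\<Sum>Q\<in>S. ord Q F) = (\<Sum>Q\<in>S. 2 * (ord Q F + ord (reflect_point i Q) F))"
    by (simp add: sum.distrib flip: sum_distrib_left)
  also have "\<dots> = (\<Sum>Q\<in>S. \<Sum>m<4 * n. ord Q (tau (s m) (s m)))"
    by (rule sum.cong) (use s(2) S in auto)
  also have "\<dots> = (\<Sum>m<4 * n. \<Sum>Q\<in>S. ord Q (tau (s m) (s m)))" by (rule sum.swap)
  also have "\<dots> = (\<Sum>m<4 * n. 4)"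
    by (rule sum.cong[OF refl], rule sum_ord_tau[OF s(1) S]) (auto simp: S_def)
  finally have "(\<Sum>Q\<in>S. ord Q F) = 4 * n" by simp
  moreover have "(\<Sum>P | P \<in> Z \<and> meval F (rep_proj P) = 0. ord P F) = (\<Sum>Q\<in>S. ord Q F)"
    by (rule sum.mono_neutral_left) (use S sub ord_eq_0[OF _ F(1)] in \<open>blast+\<close>)
  ultimately show "(\<Sum>P | P \<in> Z \<and> meval F (rep_proj P) = 0. ord P F) = 4 * n" by simp
qed

end

context diagonal_quadrics
begin

lemma ex_diagonal_cone:
  assumes "distinct [i, j, k, l]"
  obtains rj rk rl where "diagonal_cone Z \<xi> V a b i j k l rj rk rl"
proof -
  obtain rj rk rl where "rj\<^sup>2 = - minor i j" "rk\<^sup>2 = minor i k" "rl\<^sup>2 = - minor i l"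
    using ex_square_root by metis
  then show ?thesis
    by (intro that[of rj rk rl]) (unfold_locales, use assms in auto)
qed

end

text \<open>Any of the four cones may be used for the proof, since the statement does not mention a
  cone.\<close>

sublocale diagonal_quadrics \<subseteq> projective_curve Z 4
proof -
  have "distinct [1, 2, 3, 4 :: 4]" by simp
  then obtain rj rk rl where "diagonal_cone Z \<xi> V a b 1 2 3 4 rj rk rl" by (rule ex_diagonal_cone)
  then interpret diagonal_cone Z \<xi> V a b 1 2 3 4 rj rk rl .
  show "projective_curve Z 4" by (rule projective_curve_cone)
qed

section \<open>Parity of orders at the ramification points\<close>

context diagonal_cone
begin

lemma tau_ramified:
  assumes "P \<in> Z" "co i (rep_proj P) = 0" "s \<noteq> (\<lambda>_. 0)"
  shows "4 dvd ord P (tau s s)"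
  using ord_tau[OF assms(1,3)] ord_eq_0[OF assms(1) homogeneous_tau, of s s] assms(2)
  by (cases "meval (tau s s) (rep_proj P) = 0") (auto simp: ram_def)

lemma ord_xi:
  assumes P: "P \<in> Z" "co i (rep_proj P) = 0"
  shows "ord P (\<xi> i) = 1"
proof -
  have u: "uniformizer Z P 1 (chord P k i)" "\<not> zero_on Z (chord P k i)"
    using chord_square(1,2)[OF P, of j l] dist by auto
  have pk: "co k (rep_proj P) \<noteq> 0" using one_zero_coordinate[of "rep_proj P" k i] P dist by auto
  have 1: "ord P (chord P k i) = 1"
    by (rule order_at_local_assoc(2)[OF P(1) u homogeneous_chord local_assoc_uniformizer])
  have "ord P (chord P k i) = ord P (mconst (co k (rep_proj P)) * \<xi> i)"
    by (rule order_at_cong) (simp add: meval_chord P(2))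
  moreover have "\<not> zero_on Z (\<xi> i)" using u(2) by (auto simp: zero_on_def meval_chord P(2))
  ultimately show ?thesis using ord_mconst_mult[OF P(1) homogeneous_xi _ pk] 1 by simp
qed

text \<open>A binary form pulled back to the curve has even order at the ramification points, and
  \<open>\<xi> i\<close> has order one.\<close>

lemma parity_even:
  assumes F: "homogeneous n F" "\<not> zero_on Z F"
    and inv: "\<And>x. x \<in> affine_cone Z \<Longrightarrow> meval F (reflect i x) = meval F x"
    and P: "P \<in> Z" "co i (rep_proj P) = 0"
  shows "even (ord P F)"
proof -
  obtain m p q where 1: "homogeneous (2 * n) p" "homogeneous m q"
    "\<And>x u. x \<in> affine_cone Z \<Longrightarrow> param x u \<Longrightarrow> meval F x = meval p u + co i x * meval q u"
    by (rule parity_decomposition[OF F(1)]) blast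
  have Fp: "meval F x = meval p u" if x: "x \<in> affine_cone Z" and u: "param x u" for x u
  proof -
    have "meval F x = meval p u - co i x * meval q u"
      using 1(3)[of "reflect i x" u] inv[OF x] x u by (simp add: co_reflect)
    then have "2 * meval F x = 2 * meval p u" using 1(3)[OF x u] by (simp add: algebra_simps)
    then show ?thesis by simp
  qed
  obtain x where x: "x \<in> affine_cone Z" "meval F x \<noteq> 0" using F(2) by (auto simp: zero_on_def)
  obtain v where "param x v" by (rule ex_param[OF x(1)])
  then have "meval p v \<noteq> 0" using Fp x by auto
  from binary_form_factor[OF 1(1) this] obtain c s where cs: "c \<noteq> 0" "\<And>m. s m \<noteq> (\<lambda>_. 0)"
    "\<And>u. meval p u = c * (\<Prod>m<2 * n. lin2 (s m) u)" by blast
  have "ord P (F\<^sup>2) = ord P (mconst (c\<^sup>2) * (\<Prod>m<2 * n. tau (s m) (s m)))"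
  proof (rule order_at_cong)
    fix x assume x: "x \<in> affine_cone Z"
    obtain u where u: "param x u" by (rule ex_param[OF x])
    show "meval (F\<^sup>2) x = meval (mconst (c\<^sup>2) * (\<Prod>m<2 * n. tau (s m) (s m))) x"
      unfolding meval_mult meval_mconst meval_power prod_tau(3)[of s, OF cs(2) x u] Fp[OF x u] cs(3)
      by (simp add: power_mult_distrib)
  qed
  also have "\<dots> = (\<Sum>m<2 * n. ord P (tau (s m) (s m)))"
    using ord_mconst_mult[OF P(1) prod_tau(1)[of s, OF cs(2)] ord_prod_tau(2)[of P s, OF P(1) cs(2)], of "c\<^sup>2"]
      ord_prod_tau(1)[of P s, OF P(1) cs(2)] cs(1) by simp
  finally have "2 * ord P F = (\<Sum>m<2 * n. ord P (tau (s m) (s m)))" using ord_power[OF P(1) F] by simp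
  moreover have "4 dvd (\<Sum>m<2 * n. ord P (tau (s m) (s m)))"
    by (rule dvd_sum) (use tau_ramified[OF P cs(2)] in blast)
  ultimately show ?thesis by presburger
qed

text \<open>For an odd form the even part drops out and \<open>F\<close> is \<open>co i\<close>
  times a binary form; the first factor has order one at \<open>P\<close>, and the second
  contributes an even amount.\<close>

lemma parity_odd:
  assumes F: "homogeneous n F" "\<not> zero_on Z F"
    and inv: "\<And>x. x \<in> affine_cone Z \<Longrightarrow> meval F (reflect i x) = - meval F x"
    and P: "P \<in> Z" "co i (rep_proj P) = 0"
  shows "odd (ord P F)"
proof -
  obtain m p q where 1: "homogeneous (2 * n) p" "homogeneous m q"
    "\<And>x u. x \<in> affine_cone Z \<Longrightarrow> param x u \<Longrightarrow> meval F x = meval p u + co i x * meval q u"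
    by (rule parity_decomposition[OF F(1)]) blast
  have Fq: "meval F x = co i x * meval q u" if x: "x \<in> affine_cone Z" and u: "param x u" for x u
  proof -
    have "- meval F x = meval p u - co i x * meval q u"
      using 1(3)[of "reflect i x" u] inv[OF x] x u by (simp add: co_reflect)
    then have "2 * meval F x = 2 * (co i x * meval q u)" using 1(3)[OF x u] by (simp add: algebra_simps)
    then show ?thesis by simp
  qed
  obtain x where x: "x \<in> affine_cone Z" "meval F x \<noteq> 0" using F(2) by (auto simp: zero_on_def)
  obtain v where "param x v" by (rule ex_param[OF x(1)])
  then have "meval q v \<noteq> 0" using Fq x by auto
  from binary_form_factor[OF 1(2) this] obtain c s where cs: "c \<noteq> 0" "\<And>m. s m \<noteq> (\<lambda>_. 0)"
    "\<And>u. meval q u = c * (\<Prod>r<m. lin2 (s r) u)" by blast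
  have xi: "\<not> zero_on Z (\<xi> i)" using Fq x by (metis ex_param mult_zero_left zero_on_def)
  let ?\<Pi> = "\<Prod>r<m. tau (s r) (s r)"
  note hP = prod_tau(1)[of s m, OF cs(2)] and nP = ord_prod_tau(2)[of P s m, OF P(1) cs(2)]
  have hcP: "homogeneous m (mconst (c\<^sup>2) * ?\<Pi>)" "\<not> zero_on Z (mconst (c\<^sup>2) * ?\<Pi>)"
    using homogeneous_cmult[OF hP] nP cs(1) by (auto simp: zero_on_def)
  have "ord P (F\<^sup>2) = ord P ((\<xi> i)\<^sup>2 * (mconst (c\<^sup>2) * ?\<Pi>))"
  proof (rule order_at_cong)
    fix x assume x: "x \<in> affine_cone Z"
    obtain u where u: "param x u" by (rule ex_param[OF x])
    show "meval (F\<^sup>2) x = meval ((\<xi> i)\<^sup>2 * (mconst (c\<^sup>2) * ?\<Pi>)) x"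
      unfolding meval_mult meval_mconst meval_power prod_tau(3)[of s, OF cs(2) x u] Fq[OF x u] cs(3)
      by (simp add: power_mult_distrib)
  qed
  also have "\<dots> = ord P ((\<xi> i)\<^sup>2) + ord P (mconst (c\<^sup>2) * ?\<Pi>)"
    using ord_mult[OF P(1) homogeneous_power[OF homogeneous_xi[of i], of 2] not_zero_on_power[OF homogeneous_xi xi] hcP] P(1)
    by blast
  also have "\<dots> = 2 + (\<Sum>r<m. ord P (tau (s r) (s r)))"
    using ord_mconst_mult[OF P(1) hP nP, of "c\<^sup>2"] ord_prod_tau(1)[of P s, OF P(1) cs(2)] cs(1)
      ord_power[OF P(1) homogeneous_xi xi, of 2] ord_xi[OF P] by simp
  finally have "2 * ord P F = 2 + (\<Sum>r<m. ord P (tau (s r) (s r)))" using ord_power[OF P(1) F] by simp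
  moreover have "4 dvd (\<Sum>r<m. ord P (tau (s r) (s r)))"
    by (rule dvd_sum) (use tau_ramified[OF P cs(2)] in blast)
  ultimately show ?thesis by presburger
qed

end

section \<open>Inequivalence of distinct points, and of fibres of different projections\<close>

lemma square_one_cases:
  assumes "c * c = (1 :: 'a::field)" obtains "c = 1" | "c = -1"
  using assms that by (metis square_eq_1_iff)

text \<open>Both points may be moved to ramification points \<open>z\<close>, \<open>z'\<close> of
  the projection from \<open>V 1\<close>. The quotient is then fixed by the reflection up to a
  constant \<open>c\<close> with \<open>c^2 = 1\<close>. For \<open>c = 1\<close> its order at
  \<open>z\<close>, which is 1, would be even; for \<open>c = -1\<close> its order at a third
  ramification point \<open>z''\<close>, which is 0, would be odd.\<close>

lemma (in diagonal_quadrics) principal_imp_eq: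
  assumes e: "principal (\<lambda>R. of_bool (R = P) - of_bool (R = Q))" and P: "P \<in> Z" "Q \<in> Z"
  shows "P = Q"
proof (rule ccontr)
  assume PQ: "P \<noteq> Q"
  have d: "distinct [1, 2, 3, 4 :: 4]" by simp
  then obtain rj rk rl where "diagonal_cone Z \<xi> V a b 1 2 3 4 rj rk rl" by (rule ex_diagonal_cone)
  then interpret diagonal_cone Z \<xi> V a b 1 2 3 4 rj rk rl .
  obtain x where x: "x \<in> affine_cone Z" "co 1 x = 0" "co 2 x = 1"
    by (rule ex_cone_point[of 1 2 0 1]) auto
  have nz: "co 3 x \<noteq> 0" "co 4 x \<noteq> 0" using one_zero_coordinate[OF x(1), of 3 1] one_zero_coordinate[OF x(1), of 4 1] x(2)
    by auto
  have x0: "x \<noteq> (\<lambda>_. 0)" using x(1) by (simp add: affine_cone_def)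
  define z where "z = abs_proj x"
  define z' where "z' = reflect_point 3 z"
  define z'' where "z'' = reflect_point 4 z"
  have z: "z \<in> Z" "z' \<in> Z" "z'' \<in> Z" using x(1) by (auto simp: z_def z'_def z''_def affine_cone_def)
  have zabs: "z' = abs_proj (reflect 3 x)" "z'' = abs_proj (reflect 4 x)"
    unfolding z'_def z''_def z_def by (rule reflect_point_abs[OF x0])+
  have co0: "co t (rep_proj (abs_proj y)) = 0 \<longleftrightarrow> co t y = 0" if "y \<noteq> (\<lambda>_. 0)" for t y
    using vanishes_abs[OF homogeneous_xi that] by (simp add: vanishes_rep)
  have ram: "co 1 (rep_proj z) = 0" "co 1 (rep_proj z') = 0" "co 1 (rep_proj z'') = 0"
    unfolding zabs unfolding z_def using x(2) x0 reflect_nonzero[OF x0] by (simp_all add: co0 co_reflect)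
  have fix1: "reflect_point 1 R = z \<longleftrightarrow> R = z" "reflect_point 1 R = z' \<longleftrightarrow> R = z'" for R
    using reflect_point_eq_iff[OF z(1), of 1] reflect_point_eq_iff[OF z(2), of 1] ram
    by (metis reflect_point_reflect_point)+
  have "z' \<noteq> z" unfolding z'_def using reflect_point_eq_iff[OF z(1), of 3] nz co0[OF x0, of 3] by (simp add: z_def)
  moreover have "z'' \<noteq> z" unfolding z''_def using reflect_point_eq_iff[OF z(1), of 4] nz co0[OF x0, of 4] by (simp add: z_def)
  moreover have "z'' \<noteq> z'"
  proof
    assume "z'' = z'"
    then obtain c where c: "reflect 4 x = (\<lambda>m. c * reflect 3 x m)"
      using abs_proj_eq_iff[OF reflect_nonzero[OF x0] reflect_nonzero[OF x0], of 3 4] zabs by auto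
    have *: "co t (reflect 4 x) = c * co t (reflect 3 x)" for t
      unfolding c using meval_scale[OF homogeneous_xi, of t c "reflect 3 x"] by simp
    have "c = 1" using *[of 2] x(3) by (simp add: co_reflect)
    then have "co 3 x = - co 3 x" using *[of 3] by (simp add: co_reflect)
    then have "2 * co 3 x = 0" by (metis add.right_inverse mult_2)
    then show False using nz by simp
  qed
  ultimately have zz: "z \<noteq> z'" "z'' \<noteq> z" "z'' \<noteq> z'" by auto
  have "principal (\<lambda>R. (of_bool (R = z) - of_bool (R = Q)) + - (of_bool (R = z') - of_bool (R = Q)))"
    by (intro principal_add principal_uminus principal_move[OF e P PQ] z)
  then have "principal (\<lambda>R. of_bool (R = z) - of_bool (R = z'))" by simp
  then obtain n F G where FG: "homogeneous n F" "homogeneous n G" "\<not> zero_on Z F" "\<not> zero_on Z G"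
      "\<And>R. R \<in> Z \<Longrightarrow> of_bool (R = z) - of_bool (R = z') = int (ord R F) - int (ord R G)"
    unfolding principal_def by blast
  note h = FG(1,2) homogeneous_reflect_form[OF FG(1)] homogeneous_reflect_form[OF FG(2)]
  note nz = FG(3,4) reflect_form_not_zero_on[OF FG(3)] reflect_form_not_zero_on[OF FG(4)]
  \<comment> \<open>\<open>A / N\<close> is the function \<open>F / G\<close> written with the
    symmetric denominator \<open>N\<close>, and \<open>B / N\<close> is its reflection.\<close>
  define A where "A = F * reflect_form G"
  define B where "B = reflect_form F * G"
  define N where "N = G * reflect_form G"
  have hA: "homogeneous (n + n) A" "\<not> zero_on Z A"
    unfolding A_def by (rule homogeneous_mult[OF h(1,4)], rule not_zero_on_mult[OF h(1,4) nz(1,4)])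
  have hB: "homogeneous (n + n) B" "\<not> zero_on Z B"
    unfolding B_def by (rule homogeneous_mult[OF h(3,2)], rule not_zero_on_mult[OF h(3,2) nz(3,2)])
  have hN: "homogeneous (n + n) N" "\<not> zero_on Z N"
    unfolding N_def by (rule homogeneous_mult[OF h(2,4)], rule not_zero_on_mult[OF h(2,4) nz(2,4)])
  have ordA: "int (ord R A) = int (ord R N) + (of_bool (R = z) - of_bool (R = z'))" if R: "R \<in> Z" for R
    using ord_mult[OF R h(1) nz(1) h(4) nz(4)] ord_mult[OF R h(2) nz(2) h(4) nz(4)] FG(5)[OF R]
    by (simp add: A_def N_def)
  have "ord R B \<le> ord R A" if R: "R \<in> Z" for R
    using ord_mult[OF R h(1) nz(1) h(4) nz(4)] ord_mult[OF R h(3) nz(3) h(2) nz(2)]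
      order_reflect[OF R FG(1), of 1] order_reflect[OF R FG(2), of 1] FG(5)[OF R] FG(5)[of "reflect_point 1 R"] R
      fix1[of R]
    by (simp add: A_def B_def)
  then obtain c where c: "c \<noteq> 0" "zero_on Z (A - mconst c * B)"
    by (rule proportional_of_divisor_le[OF hA hB]) blast
  have AB: "meval A y = c * meval B y" if "y \<in> affine_cone Z" for y
    using c(2) that by (simp add: zero_on_def)
  have sw: "meval A (reflect 1 y) = meval B y" "meval B (reflect 1 y) = meval A y"
    "meval N (reflect 1 y) = meval N y" for y
    by (simp_all only: A_def B_def N_def meval_mult meval_reflect_form reflect_reflect mult.commute)
  obtain y where y: "y \<in> affine_cone Z" "meval A y \<noteq> 0" using hA(2) by (auto simp: zero_on_def)
  have "meval A y = c * (c * meval A y)" using AB[OF y(1)] AB[of "reflect 1 y"] y(1) sw[of y] by simp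
  then have "c * c = 1" using y(2) by (metis mult.assoc mult_cancel_right2)
  then show False
  proof (cases rule: square_one_cases)
    case 1
    have "even (ord z A)" by (rule parity_even[OF hA _ z(1) ram(1)]) (simp add: sw AB 1)
    moreover have "even (ord z N)" by (rule parity_even[OF hN _ z(1) ram(1)]) (simp add: sw)
    moreover have "ord z A = Suc (ord z N)" using ordA[OF z(1)] zz by simp
    ultimately show False by simp
  next
    case 2
    have "odd (ord z'' A)" by (rule parity_odd[OF hA _ z(3) ram(3)]) (simp add: sw AB 2)
    moreover have "even (ord z'' N)" by (rule parity_even[OF hN _ z(3) ram(3)]) (simp add: sw)
    ultimately show False using ordA[OF z(3)] zz by simp
  qed
qed

text \<open>Take \<open>z\<close> on both the curve and the plane \<open>\<xi> i = 0\<close>. The tangent planes through \<open>z\<close> cut out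
  \<open>4 z\<close> and \<open>2 z + 2 z'\<close> respectively, with \<open>z' \<noteq> z\<close>, so that the half difference is \<open>z - z'\<close>.\<close>

lemma (in diagonal_quadrics) cones_inequivalent:
  assumes "diagonal_cone Z \<xi> V a b i j k l rj rk rl" "diagonal_cone Z \<xi> V a b i' j' k' l' rj' rk' rl'"
    and ii: "i \<noteq> i'" and s: "s \<noteq> (\<lambda>_. 0)" "s' \<noteq> (\<lambda>_. 0)" and e: "principal e"
    and half: "\<And>Q. Q \<in> Z \<Longrightarrow> 2 * e Q = int (ord Q (diagonal_cone.tau \<xi> j k l rj rk rl s s))
        - int (ord Q (diagonal_cone.tau \<xi> j' k' l' rj' rk' rl' s' s'))"
  shows False
proof -
  interpret A: diagonal_cone Z \<xi> V a b i j k l rj rk rl by (rule assms(1))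
  interpret B: diagonal_cone Z \<xi> V a b i' j' k' l' rj' rk' rl' by (rule assms(2))
  obtain x where x: "x \<in> affine_cone Z" "co i x = 0" "co i' x = 1"
    by (rule ex_cone_point[OF ii, of 0 1]) auto
  have x0: "x \<noteq> (\<lambda>_. 0)" using x(1) by (simp add: affine_cone_def)
  define z where "z = abs_proj x"
  have z: "z \<in> Z" using x(1) by (simp add: z_def affine_cone_def)
  have co0: "co t (rep_proj z) = 0 \<longleftrightarrow> co t x = 0" for t
    using vanishes_abs[OF homogeneous_xi x0] by (simp add: vanishes_rep z_def)
  have fixz: "reflect_point i z = z" "reflect_point i' z \<noteq> z"
    using reflect_point_eq_iff[OF z] co0 x by auto
  obtain r where r: "r \<noteq> (\<lambda>_. 0)"
    "\<And>Q. Q \<in> Z \<Longrightarrow> ord Q (A.tau r r) = 2 * (of_bool (Q = z) + of_bool (Q = reflect_point i z))"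
    by (rule A.tau_through[OF z]) blast
  obtain r' where r': "r' \<noteq> (\<lambda>_. 0)"
    "\<And>Q. Q \<in> Z \<Longrightarrow> ord Q (B.tau r' r') = 2 * (of_bool (Q = z) + of_bool (Q = reflect_point i' z))"
    by (rule B.tau_through[OF z]) blast
  \<comment> \<open>On one cone \<open>tau s s * tau r r\<close> equals the square of
    \<open>tau s r\<close>, so the halves of the divisors of two tangent planes differ by the
    principal divisor of \<open>tau s r / tau r r\<close>. This allows moving both given planes to
    planes through \<open>z\<close>.\<close>
  have change: "\<exists>d. principal d \<and> (\<forall>Q\<in>Z. 2 * d Q = int (ord Q (diagonal_cone.tau \<xi> j k l rj rk rl s s))
      - int (ord Q (diagonal_cone.tau \<xi> j k l rj rk rl r r)))"
    if "diagonal_cone Z \<xi> V a b i j k l rj rk rl" "s \<noteq> (\<lambda>_. 0)" "r \<noteq> (\<lambda>_. 0)" for i j k l rj rk rl s r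
  proof -
    interpret C: diagonal_cone Z \<xi> V a b i j k l rj rk rl by (rule that(1))
    note h = C.homogeneous_tau
    note nz = C.tau_not_zero_on[OF that(2,2)] C.tau_not_zero_on[OF that(2,3)] C.tau_not_zero_on[OF that(3,3)]
    have "ord Q (C.tau s s) + ord Q (C.tau r r) = 2 * ord Q (C.tau s r)" if Q: "Q \<in> Z" for Q
    proof -
      have "ord Q (C.tau s s * C.tau r r) = ord Q (C.tau s r * C.tau s r)"
      proof (rule order_at_cong)
        fix x assume x: "x \<in> affine_cone Z"
        obtain u where "C.param x u" by (rule C.ex_param[OF x])
        then show "meval (C.tau s s * C.tau r r) x = meval (C.tau s r * C.tau s r) x"
          by (simp add: C.meval_tau)
      qed
      then show ?thesis using ord_mult[OF Q h nz(1) h nz(3)] ord_mult[OF Q h nz(2) h nz(2)] by simp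
    qed
    then have "2 * (int (ord Q (C.tau s r)) - int (ord Q (C.tau r r)))
        = int (ord Q (C.tau s s)) - int (ord Q (C.tau r r))" if "Q \<in> Z" for Q
      using that by (simp add: algebra_simps) (metis of_nat_add mult_2 of_nat_mult of_nat_numeral)
    moreover have "principal (\<lambda>Q. int (ord Q (C.tau s r)) - int (ord Q (C.tau r r)))"
      unfolding principal_def using h nz by blast
    ultimately show ?thesis by blast
  qed
  obtain d where d: "principal d" "\<And>Q. Q \<in> Z \<Longrightarrow> 2 * d Q = int (ord Q (A.tau s s)) - int (ord Q (A.tau r r))"
    using change[OF assms(1) s(1) r(1)] by blast
  obtain d' where d': "principal d'" "\<And>Q. Q \<in> Z \<Longrightarrow> 2 * d' Q = int (ord Q (B.tau s' s')) - int (ord Q (B.tau r' r'))"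
    using change[OF assms(2) s(2) r'(1)] by blast
  have "principal (\<lambda>Q. (e Q + - d Q) + d' Q)" by (intro principal_add principal_uminus e d d')
  then have "principal (\<lambda>Q. of_bool (Q = z) - of_bool (Q = reflect_point i' z))"
  proof (rule principal_cong)
    fix Q assume Q: "Q \<in> Z"
    have "2 * ((e Q + - d Q) + d' Q) = int (ord Q (A.tau r r)) - int (ord Q (B.tau r' r'))"
      using half[OF Q] d(2)[OF Q] d'(2)[OF Q] by simp
    then show "(e Q + - d Q) + d' Q = of_bool (Q = z) - of_bool (Q = reflect_point i' z)"
      using r(2)[OF Q] r'(2)[OF Q] fixz by (simp add: of_bool_def split: if_splits)
  qed
  from principal_imp_eq[OF this] have "z = reflect_point i' z" using z by simp
  then show False using fixz by simp
qed

section \<open>Linear algebra\<close>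

lemma underdetermined_system:
  fixes c :: "'m \<Rightarrow> 'n \<Rightarrow> 'a::field"
  assumes "finite I" "finite J" "card I < card J"
  shows "\<exists>y. (\<exists>j\<in>J. y j \<noteq> 0) \<and> (\<forall>i\<in>I. (\<Sum>j\<in>J. c i j * y j) = 0)"
  using assms
proof (induction I arbitrary: J c)
  case empty
  then have "J \<noteq> {}" by auto
  then show ?case by (intro exI[of _ "\<lambda>_. 1"]) auto
next
  case (insert i I)
  show ?case
  proof (cases "\<forall>j\<in>J. c i j = 0")
    case True
    have "card I < card J" using insert by simp
    from insert.IH[OF insert.prems(1) this, of c] obtain y where
      y: "\<exists>j\<in>J. y j \<noteq> 0" "\<forall>i\<in>I. (\<Sum>j\<in>J. c i j * y j) = 0" by blast
    moreover have "(\<Sum>j\<in>J. c i j * y j) = 0" using True by (intro sum.neutral) simp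
    ultimately show ?thesis by (intro exI[of _ y]) simp
  next
    case False
    then obtain p where p: "p \<in> J" "c i p \<noteq> 0" by blast
    \<comment> \<open>Gaussian elimination: the unknown \<open>p\<close> is removed from the
      remaining equations by means of equation \<open>i\<close>.\<close>
    define c' where "c' = (\<lambda>r j. c r j - c r p * c i j / c i p)"
    have "card I < card (J - {p})" using insert p by (simp add: card_Diff_singleton)
    then obtain y where y: "\<exists>j\<in>J - {p}. y j \<noteq> 0" "\<forall>r\<in>I. (\<Sum>j\<in>J - {p}. c' r j * y j) = 0"
      using insert.IH[of "J - {p}" c'] insert.prems(1) by auto
    define s where "s = (\<Sum>j\<in>J - {p}. c i j * y j)"
    define y' where "y' = y(p := - s / c i p)"
    have sum: "(\<Sum>j\<in>J. c r j * y' j) = (\<Sum>j\<in>J - {p}. c r j * y j) - c r p * s / c i p" for r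
    proof -
      have "(\<Sum>j\<in>J - {p}. c r j * y' j) = (\<Sum>j\<in>J - {p}. c r j * y j)"
        by (rule sum.cong) (auto simp: y'_def)
      then show ?thesis
        using sum.remove[OF insert.prems(1) p(1), of "\<lambda>j. c r j * y' j"] by (simp add: y'_def)
    qed
    have "(\<Sum>j\<in>J. c r j * y' j) = 0" if "r \<in> I" for r
    proof -
      have "(\<Sum>j\<in>J - {p}. c' r j * y j) = (\<Sum>j\<in>J - {p}. c r j * y j) - c r p * s / c i p"
      proof -
        have "(\<Sum>j\<in>J - {p}. c' r j * y j) = (\<Sum>j\<in>J - {p}. c r j * y j - c r p / c i p * (c i j * y j))"
          by (rule sum.cong) (simp_all add: c'_def left_diff_distrib)
        then show ?thesis by (simp add: sum_subtractf s_def flip: sum_distrib_left sum_divide_distrib)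
      qed
      then show ?thesis using y(2) that sum by simp
    qed
    moreover have "(\<Sum>j\<in>J. c i j * y' j) = 0" unfolding sum using p by (simp add: s_def)
    moreover have "\<exists>j\<in>J. y' j \<noteq> 0" using y(1) by (auto simp: y'_def)
    ultimately show ?thesis by blast
  qed
qed

text \<open>With \<open>-b\<close> as a further column the homogeneous system has more unknowns than
  equations. A nontrivial solution has a nonzero entry in the new column by injectivity, and
  dividing by it solves the original system.\<close>

lemma injective_system_solvable:
  fixes c :: "'m \<Rightarrow> 'n \<Rightarrow> 'a::field"
  assumes fin: "finite I" "finite J" "card I \<le> card J"
    and inj: "\<And>y. (\<And>i. i \<in> I \<Longrightarrow> (\<Sum>j\<in>J. c i j * y j) = 0) \<Longrightarrow> \<forall>j\<in>J. y j = 0"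
  shows "\<exists>y. \<forall>i\<in>I. (\<Sum>j\<in>J. c i j * y j) = b i"
proof -
  define c' where "c' = (\<lambda>i q. case q of Some j \<Rightarrow> c i j | None \<Rightarrow> - b i)"
  let ?J = "insert None (Some ` J)"
  have "card ?J = Suc (card J)" using fin by (simp add: card_image)
  then have "finite ?J" "card I < card ?J" using fin by simp_all
  from underdetermined_system[OF fin(1) this, of c']
  obtain y where y: "\<exists>q\<in>?J. y q \<noteq> 0" "\<forall>i\<in>I. (\<Sum>q\<in>?J. c' i q * y q) = 0" by blast
  have sum: "(\<Sum>q\<in>?J. c' i q * y q) = (\<Sum>j\<in>J. c i j * y (Some j)) - b i * y None" for i
  proof -
    have "(\<Sum>q\<in>?J. c' i q * y q) = c' i None * y None + (\<Sum>q\<in>Some ` J. c' i q * y q)"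
      by (rule sum.insert) (use fin in auto)
    also have "(\<Sum>q\<in>Some ` J. c' i q * y q) = (\<Sum>j\<in>J. c' i (Some j) * y (Some j))"
      by (rule sum.reindex_cong[of Some]) auto
    finally show ?thesis by (simp add: c'_def)
  qed
  have "y None \<noteq> 0"
  proof
    assume 0: "y None = 0"
    have "\<forall>j\<in>J. y (Some j) = 0"
    proof (rule inj)
      fix i assume "i \<in> I"
      then have "(\<Sum>q\<in>?J. c' i q * y q) = 0" using y(2) by blast
      then show "(\<Sum>j\<in>J. c i j * y (Some j)) = 0" unfolding sum 0 by simp
    qed
    then show False using y(1) 0 by blast
  qed
  then have "(\<Sum>j\<in>J. c i j * (y (Some j) / y None)) = b i" if "i \<in> I" for i
  proof -
    have "(\<Sum>j\<in>J. c i j * (y (Some j) / y None)) = (\<Sum>j\<in>J. c i j * y (Some j)) / y None"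
      by (simp add: sum_divide_distrib)
    moreover have "(\<Sum>j\<in>J. c i j * y (Some j)) = b i * y None" using bspec[OF y(2) that] unfolding sum by simp
    ultimately show ?thesis using \<open>y None \<noteq> 0\<close> by simp
  qed
  then show ?thesis by (intro exI[of _ "\<lambda>j. y (Some j) / y None"] ballI)
qed

lemma linear_form_add:
  fixes f :: "('i::finite, 'a::comm_ring_1) mpoly"
  assumes "homogeneous 1 f"
  shows "meval f (\<lambda>m. x m + y m) = meval f x + meval f y"
    "meval f (\<lambda>m. x m - y m) = meval f x - meval f y"
    "meval f (\<lambda>m. \<Sum>j\<in>S. c j * v j m) = (\<Sum>j\<in>S. c j * meval f (v j))"
proof -
  obtain d where d: "\<And>x. meval f x = (\<Sum>m\<in>UNIV. d m * x m)" by (rule linear_form_coeffs[OF assms]) blast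
  show "meval f (\<lambda>m. x m + y m) = meval f x + meval f y" "meval f (\<lambda>m. x m - y m) = meval f x - meval f y"
    unfolding d by (simp_all add: algebra_simps sum.distrib sum_subtractf)
  have "(\<Sum>m\<in>UNIV. d m * (\<Sum>j\<in>S. c j * v j m)) = (\<Sum>j\<in>S. \<Sum>m\<in>UNIV. d m * (c j * v j m))"
    unfolding sum_distrib_left by (rule sum.swap)
  then show "meval f (\<lambda>m. \<Sum>j\<in>S. c j * v j m) = (\<Sum>j\<in>S. c j * meval f (v j))"
    unfolding d sum_distrib_left by (simp add: mult_ac)
qed

definition dual_bases :: "('i::finite \<Rightarrow> ('i, 'a::comm_ring_1) mpoly) \<Rightarrow> ('i \<Rightarrow> 'i \<Rightarrow> 'a) \<Rightarrow> bool" where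
  "dual_bases \<xi> V \<longleftrightarrow> (\<forall>i. homogeneous 1 (\<xi> i)) \<and>
     (\<forall>x m. x m = (\<Sum>i\<in>UNIV. meval (\<xi> i) x * V i m)) \<and>
     (\<forall>i y. meval (\<xi> i) (\<lambda>m. \<Sum>j\<in>UNIV. y j * V j m) = y i)"

lemma ex_dual_basis:
  fixes \<xi> :: "'i::finite \<Rightarrow> ('i, 'a::field) mpoly"
  assumes hom: "\<And>i. homogeneous 1 (\<xi> i)" and inj: "\<And>x. (\<forall>i. meval (\<xi> i) x = 0) \<Longrightarrow> x = (\<lambda>_. 0)"
  obtains V where "dual_bases \<xi> V"
proof -
  have "\<forall>i. \<exists>c. \<forall>x. meval (\<xi> i) x = (\<Sum>m\<in>UNIV. c m * x m)"
  proof
    fix i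
    obtain c where "\<And>x. meval (\<xi> i) x = (\<Sum>m\<in>UNIV. c m * x m)"
      by (rule linear_form_coeffs[OF hom[of i]]) blast
    then show "\<exists>c. \<forall>x. meval (\<xi> i) x = (\<Sum>m\<in>UNIV. c m * x m)" by blast
  qed
  from choice[OF this] obtain c where c: "\<And>i x. meval (\<xi> i) x = (\<Sum>m\<in>UNIV. c i m * x m)" by blast
  have "\<forall>j. \<exists>y. \<forall>i\<in>UNIV. (\<Sum>m\<in>UNIV. c i m * y m) = (if i = j then 1 else 0)"
  proof
    fix j
    show "\<exists>y. \<forall>i\<in>UNIV. (\<Sum>m\<in>UNIV. c i m * y m) = (if i = j then 1 else 0)"
    proof (rule injective_system_solvable)
      fix y assume "\<And>i. i \<in> UNIV \<Longrightarrow> (\<Sum>m\<in>UNIV. c i m * y m) = 0"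
      then have "y = (\<lambda>_. 0)" by - (rule inj, simp add: c)
      then show "\<forall>j\<in>UNIV. y j = 0" by simp
    qed simp_all
  qed
  from choice[OF this] obtain V
    where "\<forall>j. \<forall>i\<in>UNIV. (\<Sum>m\<in>UNIV. c i m * V j m) = (if i = j then 1 else 0)" by blast
  then have V: "\<And>i j. meval (\<xi> i) (V j) = (if i = j then 1 else 0)" by (simp add: c)
  have dual: "meval (\<xi> i) (\<lambda>m. \<Sum>j\<in>UNIV. y j * V j m) = y i" for i y
    unfolding linear_form_add(3)[OF hom] V by (simp add: if_distrib[of "\<lambda>c. _ * c"] cong: if_cong)
  have "x m = (\<Sum>i\<in>UNIV. meval (\<xi> i) x * V i m)" for x m
  proof -
    have "(\<lambda>m. x m - (\<Sum>i\<in>UNIV. meval (\<xi> i) x * V i m)) = (\<lambda>_. 0)"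
      by (rule inj) (simp add: linear_form_add(2)[OF hom] dual)
    then have "x m - (\<Sum>i\<in>UNIV. meval (\<xi> i) x * V i m) = 0" by metis
    then show ?thesis by simp
  qed
  note coords = this
  have "dual_bases \<xi> V" unfolding dual_bases_def by (intro conjI allI hom coords dual)
  then show ?thesis by (rule that)
qed

lemma ex_dual_forms:
  fixes V :: "'i::finite \<Rightarrow> 'i \<Rightarrow> 'a::field"
  assumes indep: "\<And>y. (\<forall>m. (\<Sum>i\<in>UNIV. y i * V i m) = 0) \<Longrightarrow> \<forall>i. y i = 0"
  obtains \<xi> where "dual_bases \<xi> V"
proof -
  have "\<forall>n. \<exists>y. \<forall>m\<in>UNIV. (\<Sum>i\<in>UNIV. V i m * y i) = (if m = n then 1 else 0)"
  proof
    fix n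
    show "\<exists>y. \<forall>m\<in>UNIV. (\<Sum>i\<in>UNIV. V i m * y i) = (if m = n then 1 else 0)"
    proof (rule injective_system_solvable)
      fix y assume "\<And>m. m \<in> UNIV \<Longrightarrow> (\<Sum>i\<in>UNIV. V i m * y i) = 0"
      then have "\<forall>i. y i = 0" by - (rule indep, simp add: mult.commute)
      then show "\<forall>i\<in>UNIV. y i = 0" by simp
    qed simp_all
  qed
  from choice[OF this] obtain e
    where "\<forall>n. \<forall>m\<in>UNIV. (\<Sum>i\<in>UNIV. V i m * e n i) = (if m = n then 1 else 0)" by blast
  then have e: "\<And>n m. (\<Sum>i\<in>UNIV. V i m * e n i) = (if m = n then 1 else 0)" by simp
  define \<xi> :: "'i \<Rightarrow> ('i, 'a) mpoly" where "\<xi> = (\<lambda>i. \<Sum>n\<in>UNIV. mconst (e n i) * mvar n)"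
  have hom: "homogeneous 1 (\<xi> i)" for i
    unfolding \<xi>_def by (intro homogeneous_sum homogeneous_cmult homogeneous_mvar)
  have coords: "x m = (\<Sum>i\<in>UNIV. meval (\<xi> i) x * V i m)" for x m
  proof -
    have "(\<Sum>i\<in>UNIV. meval (\<xi> i) x * V i m) = (\<Sum>i\<in>UNIV. \<Sum>n\<in>UNIV. e n i * x n * V i m)"
      by (simp add: \<xi>_def sum_distrib_right)
    also have "\<dots> = (\<Sum>n\<in>UNIV. \<Sum>i\<in>UNIV. e n i * x n * V i m)" by (rule sum.swap)
    also have "\<dots> = (\<Sum>n\<in>UNIV. x n * (\<Sum>i\<in>UNIV. V i m * e n i))"
      by (simp add: sum_distrib_left mult_ac)
    finally show ?thesis unfolding e by (simp add: if_distrib[of "\<lambda>c. _ * c"] cong: if_cong)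
  qed
  have "meval (\<xi> i) (\<lambda>m. \<Sum>j\<in>UNIV. y j * V j m) = y i" for i y
  proof -
    let ?w = "\<lambda>m. \<Sum>j\<in>UNIV. y j * V j m"
    have "(\<Sum>i\<in>UNIV. (meval (\<xi> i) ?w - y i) * V i m) = 0" for m
      unfolding left_diff_distrib sum_subtractf right_minus_eq by (rule coords[of ?w m, symmetric])
    then have "\<forall>i. meval (\<xi> i) ?w - y i = 0" by - (rule indep, rule allI)
    then show ?thesis by simp
  qed
  note dual = this
  have "dual_bases \<xi> V" unfolding dual_bases_def by (intro conjI allI hom coords dual)
  then show ?thesis by (rule that)
qed

section \<open>Quadratic forms\<close>

lemma mdiff_superset:
  assumes "finite S" "Poly_Mapping.keys p \<subseteq> S"
  shows "mdiff i p = (\<Sum>m\<in>S. Poly_Mapping.single (m - Poly_Mapping.single i 1)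
       (of_nat (Poly_Mapping.lookup m i) * Poly_Mapping.lookup p m))"
  unfolding mdiff_def using assms by (intro sum.mono_neutral_left) (auto simp: in_keys_iff)

lemma mdiff_add: "mdiff i (p + q) = mdiff i p + mdiff i q"
proof -
  let ?S = "Poly_Mapping.keys p \<union> Poly_Mapping.keys q"
  have "Poly_Mapping.keys (p + q) \<subseteq> ?S" by (rule keys_add)
  then show ?thesis
    by (simp add: mdiff_superset[of ?S] lookup_add distrib_left single_add sum.distrib)
qed

lemma mdiff_single: "mdiff i (Poly_Mapping.single m c)
   = Poly_Mapping.single (m - Poly_Mapping.single i 1) (of_nat (Poly_Mapping.lookup m i) * c)"
  by (subst mdiff_superset[of "{m}"]) auto

text \<open>Connects the formal derivative \<open>mdiff\<close> with values of \<open>q\<close>; a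
  single monomial is checked directly. The matrix need not be symmetric.\<close>

lemma quadratic_form_matrix:
  fixes q :: "('i::finite, 'a::comm_ring_1) mpoly"
  assumes "homogeneous 2 q"
  obtains c where "\<And>x. meval q x = (\<Sum>i\<in>UNIV. \<Sum>j\<in>UNIV. c i j * x i * x j)"
    "\<And>k x. meval (mdiff k q) x = (\<Sum>i\<in>UNIV. (c i k + c k i) * x i)"
proof -
  define R where "R = (\<lambda>q :: ('i, 'a) mpoly. \<exists>c. (\<forall>x. meval q x = (\<Sum>i\<in>UNIV. \<Sum>j\<in>UNIV. c i j * x i * x j)) \<and>
    (\<forall>k x. meval (mdiff k q) x = (\<Sum>i\<in>UNIV. (c i k + c k i) * x i)))"
  have mono: "R (Poly_Mapping.single m r)" if m: "(\<Sum>i\<in>UNIV. Poly_Mapping.lookup m i) = 2" for m and r :: 'a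
  proof -
    obtain a m' where m': "m = Poly_Mapping.single a 1 + m'" "(\<Sum>i\<in>UNIV. Poly_Mapping.lookup m' i) = 1"
      using monomial_Suc[of m 1] m by auto
    obtain b m'' where m'': "m' = Poly_Mapping.single b 1 + m''" "(\<Sum>i\<in>UNIV. Poly_Mapping.lookup m'' i) = 0"
      using monomial_Suc[of m' 0] m'(2) by auto
    have ab: "m = Poly_Mapping.single a 1 + Poly_Mapping.single b 1"
      using m' m'' monomial_0[OF m''(2)] by simp
    define c where "c = (\<lambda>i j. if i = a \<and> j = b then r else 0)"
    have "Poly_Mapping.single m r = mvar a * (mvar b * mconst r)"
      by (simp add: mvar_def mconst_def mult_single ab)
    then have v: "meval (Poly_Mapping.single m r) x = r * x a * x b" for x
      by (simp del: meval_single add: mult_ac)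
    have sum1: "(\<Sum>i\<in>UNIV. \<Sum>j\<in>UNIV. c i j * x i * x j) = r * x a * x b" for x
    proof -
      have "(\<Sum>j\<in>UNIV. c i j * x i * x j) = (if i = a then r * x a * x b else 0)" for i
      proof -
        have "(\<Sum>j\<in>UNIV. c i j * x i * x j) = (\<Sum>j\<in>UNIV. if j = b then (if i = a then r * x a * x b else 0) else 0)"
          by (rule sum.cong) (auto simp: c_def)
        then show ?thesis by simp
      qed
      then show ?thesis by simp
    qed
    have sum2: "(\<Sum>i\<in>UNIV. (c i k + c k i) * x i)
        = (if k = b then r * x a else 0) + (if k = a then r * x b else 0)" for k x
    proof -
      have "(\<Sum>i\<in>UNIV. (c i k + c k i) * x i)
        = (\<Sum>i\<in>UNIV. (if i = a then (if k = b then r * x a else 0) else 0)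
           + (if i = b then (if k = a then r * x b else 0) else 0))"
        by (rule sum.cong) (auto simp: c_def algebra_simps)
      then show ?thesis by (simp add: sum.distrib)
    qed
    have lk: "Poly_Mapping.lookup m k = (if k = a then 1 else 0) + (if k = b then 1 else 0)" for k
      by (simp add: ab lookup_add lookup_single when_def)
    have ma: "m - Poly_Mapping.single a 1 = Poly_Mapping.single b 1"
      by (simp add: ab)
    have mb: "m - Poly_Mapping.single b 1 = Poly_Mapping.single a 1"
      by (simp add: ab)
    have "meval (mdiff k (Poly_Mapping.single m r)) x
        = (if k = b then r * x a else 0) + (if k = a then r * x b else 0)" for k x
    proof -
      consider "k = a" | "k = b" "k \<noteq> a" | "k \<noteq> a" "k \<noteq> b" by blast
      then show ?thesis
      proof cases
        case 1
        show ?thesis unfolding mdiff_single meval_single 1 ma prod_power_single lk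
          by (auto simp: algebra_simps)
      next
        case 2
        show ?thesis unfolding mdiff_single meval_single 2(1) mb prod_power_single lk
          using 2 by (auto simp: algebra_simps)
      qed (simp add: mdiff_single lk)
    qed
    then show ?thesis unfolding R_def using v sum1 sum2 by (intro exI[of _ c]) simp
  qed
  have zero: "R 0" unfolding R_def by (intro exI[of _ "\<lambda>_ _. 0"]) (simp add: mdiff_def)
  have add: "R (p + q)" if "R p" "R q" for p q
  proof -
    obtain c d where "\<forall>x. meval p x = (\<Sum>i\<in>UNIV. \<Sum>j\<in>UNIV. c i j * x i * x j)"
      "\<forall>k x. meval (mdiff k p) x = (\<Sum>i\<in>UNIV. (c i k + c k i) * x i)"
      "\<forall>x. meval q x = (\<Sum>i\<in>UNIV. \<Sum>j\<in>UNIV. d i j * x i * x j)"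
      "\<forall>k x. meval (mdiff k q) x = (\<Sum>i\<in>UNIV. (d i k + d k i) * x i)"
      using \<open>R p\<close> \<open>R q\<close> unfolding R_def by blast
    then show ?thesis unfolding R_def
      by (intro exI[of _ "\<lambda>i j. c i j + d i j"]) (auto simp: mdiff_add algebra_simps sum.distrib)
  qed
  have "R (\<Sum>m\<in>S. Poly_Mapping.single m (Poly_Mapping.lookup q m))"
    if "finite S" "S \<subseteq> Poly_Mapping.keys q" for S
    using that
  proof (induction S)
    case (insert m S)
    then show ?case using add mono assms by (auto simp: homogeneous_def)
  qed (simp add: zero)
  then have "R q" using mpoly_sum_singles[of q] finite_keys by (metis order_refl)
  then show ?thesis using that unfolding R_def by blast
qed

definition polar :: "('i::finite, 'a::comm_ring_1) mpoly \<Rightarrow> ('i \<Rightarrow> 'a) \<Rightarrow> ('i \<Rightarrow> 'a) \<Rightarrow> 'a" where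
  "polar q x y = meval q (\<lambda>i. x i + y i) - meval q x - meval q y"

lemma polar_commute: "polar q x y = polar q y x"
  by (simp add: polar_def add.commute)

lemma polar_mdiff:
  assumes "homogeneous 2 q"
  shows "polar q x y = (\<Sum>k\<in>UNIV. meval (mdiff k q) x * y k)"
proof -
  obtain c where c: "\<And>x. meval q x = (\<Sum>i\<in>UNIV. \<Sum>j\<in>UNIV. c i j * x i * x j)"
    "\<And>k x. meval (mdiff k q) x = (\<Sum>i\<in>UNIV. (c i k + c k i) * x i)"
    by (rule quadratic_form_matrix[OF assms]) blast
  have "polar q x y = (\<Sum>i\<in>UNIV. \<Sum>j\<in>UNIV. c i j * x i * y j) + (\<Sum>i\<in>UNIV. \<Sum>j\<in>UNIV. c i j * y i * x j)"
    unfolding polar_def c(1) by (simp add: algebra_simps sum.distrib)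
  also have "(\<Sum>i\<in>UNIV. \<Sum>j\<in>UNIV. c i j * x i * y j) = (\<Sum>j\<in>UNIV. \<Sum>i\<in>UNIV. c i j * x i * y j)"
    by (rule sum.swap)
  finally show ?thesis
    unfolding c(2) sum_distrib_right distrib_right sum.distrib by (simp add: mult_ac)
qed

lemma polar_sum:
  assumes "homogeneous 2 q"
  shows "polar q x (\<lambda>m. \<Sum>i\<in>S. y i * v i m) = (\<Sum>i\<in>S. y i * polar q x (v i))"
proof -
  have "(\<Sum>k\<in>UNIV. meval (mdiff k q) x * (\<Sum>i\<in>S. y i * v i k))
      = (\<Sum>i\<in>S. \<Sum>k\<in>UNIV. meval (mdiff k q) x * (y i * v i k))"
    unfolding sum_distrib_left by (rule sum.swap)
  then show ?thesis unfolding polar_mdiff[OF assms] sum_distrib_left by (simp add: mult_ac)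
qed

lemma polar_self:
  assumes "homogeneous 2 q"
  shows "polar q x x = 2 * meval q x"
proof -
  have "meval q (\<lambda>i. x i + x i) = 2\<^sup>2 * meval q x"
    using meval_scale[OF assms, of 2 x] by (simp only: mult_2)
  then show ?thesis by (simp add: polar_def)
qed

text \<open>The singular points of a quadric are the radical of its polar form.\<close>

lemma polar_mdiff_zero:
  assumes "homogeneous 2 q"
  shows "(\<forall>k. meval (mdiff k q) x = 0) \<longleftrightarrow> (\<forall>y. polar q x y = 0)"
proof
  assume 0: "\<forall>y. polar q x y = 0"
  show "\<forall>k. meval (mdiff k q) x = 0"
  proof
    fix k
    have "polar q x (\<lambda>m. if m = k then 1 else 0) = meval (mdiff k q) x"
      unfolding polar_mdiff[OF assms] by (simp add: if_distrib[of "\<lambda>c. _ * c"] cong: if_cong)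
    then show "meval (mdiff k q) x = 0" using 0 by simp
  qed
qed (simp add: polar_mdiff[OF assms])

lemma diagonal_quadratic_form:
  fixes q :: "('i::finite, 'a::field_char_0) mpoly" and v :: "'i \<Rightarrow> 'i \<Rightarrow> 'a"
  assumes q: "homogeneous 2 q" and orth: "\<And>i j. i \<noteq> j \<Longrightarrow> polar q (v i) (v j) = 0"
  shows "meval q (\<lambda>m. \<Sum>i\<in>UNIV. y i * v i m) = (\<Sum>i\<in>UNIV. meval q (v i) * (y i)\<^sup>2)"
    "polar q (\<lambda>m. \<Sum>i\<in>UNIV. y i * v i m) (v j) = 2 * meval q (v j) * y j"
proof -
  let ?x = "\<lambda>m. \<Sum>i\<in>UNIV. y i * v i m"
  have 1: "polar q ?x (v j) = 2 * meval q (v j) * y j" for j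
  proof -
    have "polar q (v j) ?x = (\<Sum>i\<in>UNIV. y i * polar q (v j) (v i))" by (rule polar_sum[OF q])
    also have "\<dots> = (\<Sum>i\<in>UNIV. if i = j then y i * polar q (v j) (v j) else 0)"
      by (rule sum.cong) (use orth in auto)
    also have "\<dots> = 2 * meval q (v j) * y j" by (simp add: polar_self[OF q])
    finally show ?thesis by (simp add: polar_commute)
  qed
  then show "polar q ?x (v j) = 2 * meval q (v j) * y j" .
  have "polar q ?x ?x = (\<Sum>i\<in>UNIV. y i * (2 * meval q (v i) * y i))" unfolding polar_sum[OF q] 1 ..
  then have "2 * meval q ?x = 2 * (\<Sum>i\<in>UNIV. meval q (v i) * (y i)\<^sup>2)"
    unfolding polar_self[OF q] by (simp add: sum_distrib_left power2_eq_square mult_ac)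
  then show "meval q ?x = (\<Sum>i\<in>UNIV. meval q (v i) * (y i)\<^sup>2)" by simp
qed

lemma homogeneous_base_change: "homogeneous d p \<Longrightarrow> homogeneous d (base_change p)"
  by (auto simp: homogeneous_def in_keys_iff Poly_Mapping.map.rep_eq when_def split: if_splits)

text \<open>The vertices of the four singular quadrics are conjugate with respect to every quadric of the
  pencil.\<close>

lemma simultaneous_diagonalisation:
  fixes A B :: "(4, 'k::field_char_0) mpoly"
  assumes AB: "nonsingular_pair A B" and Q: "singular_quadrics A B Q"
  obtains \<xi> V a b where "diagonal_quadrics (quadric_intersection A B) \<xi> V a b"
    "\<And>i. homogeneous 2 (Q i)"
    "\<And>i. \<exists>g. g \<noteq> 0 \<and> (\<forall>x. meval (Q i) x = (\<Sum>t\<in>UNIV. g * (a i * b t - a t * b i) * (meval (\<xi> t) x)\<^sup>2))"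
    "\<And>i x. (\<forall>k. meval (mdiff k (Q i)) x = 0) \<longleftrightarrow> (\<forall>t. t \<noteq> i \<longrightarrow> meval (\<xi> t) x = 0)"
proof -
  define A' where "A' = base_change A"
  define B' where "B' = base_change B"
  have h: "homogeneous 2 A'" "homogeneous 2 B'"
    using AB by (auto simp: nonsingular_pair_def A'_def B'_def intro: homogeneous_base_change)
  have sing: "\<And>i. singular_member A B (Q i)" using Q by (simp add: singular_quadrics_def)
  then have "\<exists>\<alpha> \<beta>. \<forall>i. Q i = mconst (\<alpha> i) * A' + mconst (\<beta> i) * B'"
    unfolding singular_member_def A'_def B'_def by metis
  then obtain \<alpha> \<beta> where Qi: "\<And>i. Q i = mconst (\<alpha> i) * A' + mconst (\<beta> i) * B'" by blast
  have "\<exists>P. \<forall>i j. vanishes (mdiff j (Q i)) (P i)" using sing unfolding singular_member_def by metis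
  then obtain P where P: "\<And>i j. vanishes (mdiff j (Q i)) (P i)" by blast
  define v where "v = (\<lambda>i. rep_proj (P i))"
  have hQ: "homogeneous 2 (Q i)" for i unfolding Qi by (intro homogeneous_add homogeneous_cmult h)
  have pol: "polar (Q i) x y = \<alpha> i * polar A' x y + \<beta> i * polar B' x y" for i x y
    by (simp add: polar_def Qi algebra_simps)
  have vert: "polar (Q i) (v i) y = 0" for i y
    using polar_mdiff_zero[OF hQ, of i "v i"] P[of _ i] by (simp add: vanishes_rep v_def)
  \<comment> \<open>Proportional coefficients would make \<open>Q t\<close> a multiple of
    \<open>Q i\<close>, whereas the index of a singular member is unique.\<close>
  have det: "\<alpha> i * \<beta> t - \<alpha> t * \<beta> i \<noteq> 0" if "i \<noteq> t" for i t
  proof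
    assume 0: "\<alpha> i * \<beta> t - \<alpha> t * \<beta> i = 0"
    have "Q i \<noteq> 0" using sing by (simp add: singular_member_def)
    then have nz: "\<alpha> i \<noteq> 0 \<or> \<beta> i \<noteq> 0" unfolding Qi by (auto simp: mconst_def)
    have "\<exists>c. \<alpha> t = c * \<alpha> i \<and> \<beta> t = c * \<beta> i"
    proof (cases "\<alpha> i = 0")
      case True
      then show ?thesis using nz 0 by (intro exI[of _ "\<beta> t / \<beta> i"]) auto
    next
      case False
      then show ?thesis using 0 by (intro exI[of _ "\<alpha> t / \<alpha> i"]) (simp add: field_simps)
    qed
    then obtain c where c: "\<alpha> t = c * \<alpha> i" "\<beta> t = c * \<beta> i" by blast
    have mm: "mconst (r * s) = mconst r * mconst s" for r s :: "'k alg_closure"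
      by (simp add: mconst_def mult_single)
    have "Q t = mconst c * Q i" unfolding Qi c mm by (simp add: algebra_simps)
    moreover have "Q t = mconst 1 * Q t" by (simp add: mconst_def)
    moreover have "\<exists>!i. \<exists>c. Q t = mconst c * Q i" using Q sing unfolding singular_quadrics_def by blast
    ultimately show False using that by blast
  qed
  \<comment> \<open>The vector \<open>v i\<close> is in the radical of \<open>Q i\<close>, and
    \<open>v t\<close> in that of \<open>Q t\<close>. This gives two equations for the two polar
    values, with determinant \<open>\<alpha> i * \<beta> t - \<alpha> t * \<beta> i\<close>.\<close>
  have orth: "polar A' (v i) (v t) = 0" "polar B' (v i) (v t) = 0" if "i \<noteq> t" for i t
  proof -
    have 1: "\<alpha> i * polar A' (v i) (v t) + \<beta> i * polar B' (v i) (v t) = 0"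
      using vert[of i "v t"] by (simp add: pol)
    have 2: "\<alpha> t * polar A' (v i) (v t) + \<beta> t * polar B' (v i) (v t) = 0"
      using vert[of t "v i"] by (simp add: pol polar_commute[of _ "v t"])
    have "(\<alpha> i * \<beta> t - \<alpha> t * \<beta> i) * polar A' (v i) (v t)
        = \<beta> t * (\<alpha> i * polar A' (v i) (v t) + \<beta> i * polar B' (v i) (v t))
          - \<beta> i * (\<alpha> t * polar A' (v i) (v t) + \<beta> t * polar B' (v i) (v t))"
      "(\<alpha> i * \<beta> t - \<alpha> t * \<beta> i) * polar B' (v i) (v t)
        = \<alpha> i * (\<alpha> t * polar A' (v i) (v t) + \<beta> t * polar B' (v i) (v t))
          - \<alpha> t * (\<alpha> i * polar A' (v i) (v t) + \<beta> i * polar B' (v i) (v t))"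
      by (simp_all add: algebra_simps)
    then show "polar A' (v i) (v t) = 0" "polar B' (v i) (v t) = 0"
      unfolding 1 2 using det[OF that] by auto
  qed
  define a where "a = (\<lambda>i. meval A' (v i))"
  define b where "b = (\<lambda>i. meval B' (v i))"
  have rel: "\<alpha> i * a i + \<beta> i * b i = 0" for i
  proof -
    have "2 * (\<alpha> i * a i + \<beta> i * b i) = 0"
      using vert[of i "v i"] unfolding pol polar_self[OF h(1)] polar_self[OF h(2)]
      by (simp add: a_def b_def algebra_simps)
    then show ?thesis by (metis mult_eq_0_iff zero_neq_numeral)
  qed
  have \<alpha>\<beta>: "\<alpha> i \<noteq> 0 \<or> \<beta> i \<noteq> 0" for i
    using sing[of i] unfolding singular_member_def Qi by (auto simp: mconst_def)
  \<comment> \<open>Otherwise the vertex would lie on the curve, and the vanishing gradient of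
    \<open>Q i\<close> there would be a dependence between the gradients of the two
    quadrics.\<close>
  have ab: "a i \<noteq> 0 \<or> b i \<noteq> 0" for i
  proof (rule ccontr)
    assume "\<not> ?thesis"
    then have "P i \<in> quadric_intersection A B"
      by (simp add: quadric_intersection_def zeros_def vanishes_rep a_def b_def v_def A'_def B'_def)
    moreover have "\<forall>j. \<alpha> i * meval (mdiff j A') (rep_proj (P i)) + \<beta> i * meval (mdiff j B') (rep_proj (P i)) = 0"
    proof
      fix j
      have e: "meval (mdiff j q) (v i) = polar q (v i) (\<lambda>m. if m = j then 1 else 0)"
        if "homogeneous 2 q" for q :: "(4, 'k alg_closure) mpoly"
        unfolding polar_mdiff[OF that] by (simp add: if_distrib[of "\<lambda>c. _ * c"] cong: if_cong)
      show "\<alpha> i * meval (mdiff j A') (rep_proj (P i)) + \<beta> i * meval (mdiff j B') (rep_proj (P i)) = 0"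
        using vert[of i "\<lambda>m. if m = j then 1 else 0"] unfolding pol
        by (simp add: e[OF h(1), unfolded v_def] e[OF h(2), unfolded v_def] v_def)
    qed
    ultimately have "\<alpha> i = 0 \<and> \<beta> i = 0"
      using AB unfolding nonsingular_pair_def A'_def B'_def by blast
    then show False using \<alpha>\<beta>[of i] by simp
  qed
  \<comment> \<open>As \<open>Q i\<close> vanishes at its own vertex, its coefficients are
    determined up to a factor by \<open>a i\<close> and \<open>b i\<close>.\<close>
  have "\<exists>g. g \<noteq> 0 \<and> \<alpha> i = - g * b i \<and> \<beta> i = g * a i" for i
  proof (cases "a i = 0")
    case True
    then have b: "b i \<noteq> 0" using ab[of i] by simp
    then have "\<beta> i = 0" using rel[of i] True by simp
    then show ?thesis using \<alpha>\<beta>[of i] b True by (intro exI[of _ "- \<alpha> i / b i"]) simp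
  next
    case False
    have "\<alpha> i = - (\<beta> i / a i) * b i" using rel[of i] False by (simp add: field_simps eq_neg_iff_add_eq_0)
    moreover from this have "\<beta> i \<noteq> 0" using \<alpha>\<beta>[of i] by auto
    ultimately show ?thesis using False by (intro exI[of _ "\<beta> i / a i"]) simp
  qed
  then obtain g where g: "\<And>i. g i \<noteq> 0" "\<And>i. \<alpha> i = - g i * b i" "\<And>i. \<beta> i = g i * a i" by metis
  have minors: "a i * b t - a t * b i \<noteq> 0" if "i \<noteq> t" for i t
  proof
    assume 0: "a i * b t - a t * b i = 0"
    have "\<alpha> i * \<beta> t - \<alpha> t * \<beta> i = g i * g t * (a i * b t - a t * b i)"
      by (simp add: g(2,3) algebra_simps)
    then show False using det[OF that] 0 by simp
  qed
  have "\<forall>i. y i = 0" if 0: "\<forall>m. (\<Sum>i\<in>UNIV. y i * v i m) = 0" for y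
  proof
    fix i
    have z: "(\<lambda>m. \<Sum>i\<in>UNIV. y i * v i m) = (\<lambda>_. 0)" using 0 by blast
    have p0: "polar q (\<lambda>_. 0) w = 0" if "homogeneous 2 q" for q :: "(4, 'k alg_closure) mpoly" and w
      using meval_at_0[OF that] by (simp add: polar_def)
    have "2 * a i * y i = 0" "2 * b i * y i = 0"
      using diagonal_quadratic_form(2)[where v = v, OF h(1) orth(1), of y i]
        diagonal_quadratic_form(2)[where v = v, OF h(2) orth(2), of y i]
      unfolding z p0[OF h(1)] p0[OF h(2)] a_def b_def by simp_all
    then show "y i = 0" using ab[of i] by auto
  qed
  then obtain \<xi> where xi: "dual_bases \<xi> v" using ex_dual_forms[of v] by blast
  have coords: "x = (\<lambda>m. \<Sum>i\<in>UNIV. meval (\<xi> i) x * v i m)" for x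
    using xi unfolding dual_bases_def by (intro ext) blast
  have val: "meval A' x = (\<Sum>i\<in>UNIV. a i * (meval (\<xi> i) x)\<^sup>2)"
    "meval B' x = (\<Sum>i\<in>UNIV. b i * (meval (\<xi> i) x)\<^sup>2)" for x
    using diagonal_quadratic_form(1)[where v = v, OF h(1) orth(1), of "\<lambda>i. meval (\<xi> i) x"]
      diagonal_quadratic_form(1)[where v = v, OF h(2) orth(2), of "\<lambda>i. meval (\<xi> i) x"]
    unfolding coords[of x, symmetric] a_def b_def by blast+
  show ?thesis
  proof (rule that[of \<xi> v a b])
    show "diagonal_quadrics (quadric_intersection A B) \<xi> v a b"
    proof
      show "homogeneous 1 (\<xi> i)" "meval (\<xi> i) (\<lambda>m. \<Sum>j\<in>UNIV. y j * v j m) = y i"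
        "x m = (\<Sum>i\<in>UNIV. meval (\<xi> i) x * v i m)" for i y x m
        using xi unfolding dual_bases_def by blast+
      show "x \<in> affine_cone (quadric_intersection A B) \<longleftrightarrow> x \<noteq> (\<lambda>_. 0) \<and>
        (\<Sum>i\<in>UNIV. a i * (meval (\<xi> i) x)\<^sup>2) = 0 \<and> (\<Sum>i\<in>UNIV. b i * (meval (\<xi> i) x)\<^sup>2) = 0" for x
        unfolding val[symmetric] affine_cone_def quadric_intersection_def zeros_def
        using vanishes_abs[OF h(1), of x] vanishes_abs[OF h(2), of x] by (auto simp: A'_def B'_def)
    qed (rule minors)
    show "\<exists>g. g \<noteq> 0 \<and> (\<forall>x. meval (Q i) x = (\<Sum>t\<in>UNIV. g * (a i * b t - a t * b i) * (meval (\<xi> t) x)\<^sup>2))" for i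
    proof (intro exI[of _ "g i"] conjI allI)
      fix x
      have "meval (Q i) x = - g i * b i * (\<Sum>t\<in>UNIV. a t * (meval (\<xi> t) x)\<^sup>2)
          + g i * a i * (\<Sum>t\<in>UNIV. b t * (meval (\<xi> t) x)\<^sup>2)"
        by (simp add: Qi val g(2,3))
      also have "\<dots> = (\<Sum>t\<in>UNIV. - g i * b i * (a t * (meval (\<xi> t) x)\<^sup>2) + g i * a i * (b t * (meval (\<xi> t) x)\<^sup>2))"
        by (simp only: sum.distrib sum_distrib_left)
      also have "\<dots> = (\<Sum>t\<in>UNIV. g i * (a i * b t - a t * b i) * (meval (\<xi> t) x)\<^sup>2)"
        by (rule sum.cong) (simp_all add: algebra_simps)
      finally show "meval (Q i) x = (\<Sum>t\<in>UNIV. g i * (a i * b t - a t * b i) * (meval (\<xi> t) x)\<^sup>2)" .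
    qed (rule g(1))
    have Qv: "meval (Q i) (v t) = g i * (a i * b t - a t * b i)" for i t
      by (simp add: Qi g(2,3) a_def b_def algebra_simps)
    have orthQ: "polar (Q i) (v s) (v t) = 0" if "s \<noteq> t" for i s t
      using orth[OF that] by (simp add: pol)
    show "(\<forall>k. meval (mdiff k (Q i)) x = 0) \<longleftrightarrow> (\<forall>t. t \<noteq> i \<longrightarrow> meval (\<xi> t) x = 0)" for i x
    proof -
      have p: "polar (Q i) x (v t) = 2 * meval (Q i) (v t) * meval (\<xi> t) x" for t
        using diagonal_quadratic_form(2)[where v = v, OF hQ orthQ, of i "\<lambda>i. meval (\<xi> i) x" t]
        unfolding coords[of x, symmetric] by blast
      have "(\<forall>y. polar (Q i) x y = 0) \<longleftrightarrow> (\<forall>t. polar (Q i) x (v t) = 0)"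
      proof
        assume 0: "\<forall>t. polar (Q i) x (v t) = 0"
        show "\<forall>y. polar (Q i) x y = 0"
        proof
          fix y
          have "polar (Q i) x y = polar (Q i) x (\<lambda>m. \<Sum>t\<in>UNIV. meval (\<xi> t) y * v t m)"
            using coords[of y] by simp
          then show "polar (Q i) x y = 0" unfolding polar_sum[OF hQ] using 0 by simp
        qed
      qed blast
      moreover have "polar (Q i) x (v t) = 0 \<longleftrightarrow> (t \<noteq> i \<longrightarrow> meval (\<xi> t) x = 0)" for t
        unfolding p Qv using g(1)[of i] minors[of i t] by auto
      ultimately show ?thesis unfolding polar_mdiff_zero[OF hQ] by blast
    qed
  qed (rule hQ)
qed

section \<open>Coverings by a pair of conics\<close>

definition linear_mpoly2 :: "(2 \<Rightarrow> 'a::comm_ring_1) \<Rightarrow> (2, 'a) mpoly" where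
  "linear_mpoly2 s = mconst (s 1) * mvar 1 + mconst (s 2) * mvar 2"

lemma homogeneous_linear_mpoly2: "homogeneous 1 (linear_mpoly2 s)"
  unfolding linear_mpoly2_def by (intro homogeneous_add homogeneous_cmult homogeneous_mvar)

lemma meval_linear_mpoly2 [simp]: "meval (linear_mpoly2 s) u = lin2 s u"
  by (simp add: linear_mpoly2_def lin2_def)

lemma lin2_proportional:
  assumes "s \<noteq> (\<lambda>_. 0 :: 'a::field)" "lin2 t (\<lambda>i. if i = 1 then s 2 else - s 1) = 0"
  obtains c where "\<And>u. lin2 t u = c * lin2 s u"
proof -
  have 0: "t 1 * s 2 = t 2 * s 1" using assms(2) by (simp add: lin2_def)
  have "s 1 \<noteq> 0 \<or> s 2 \<noteq> 0" using assms(1) by (auto simp: fun_2_eq_iff)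
  then have "\<exists>c. t 1 = c * s 1 \<and> t 2 = c * s 2"
  proof
    assume "s 1 \<noteq> 0"
    then have "t 1 = t 1 / s 1 * s 1 \<and> t 2 = t 1 / s 1 * s 2" unfolding times_divide_eq_left 0 by simp
    then show ?thesis by (rule exI)
  next
    assume "s 2 \<noteq> 0"
    then have "t 1 = t 2 / s 2 * s 1 \<and> t 2 = t 2 / s 2 * s 2"
      unfolding times_divide_eq_left 0[symmetric] by simp
    then show ?thesis by (rule exI)
  qed
  then obtain c where "t 1 = c * s 1" "t 2 = c * s 2" by blast
  then have "lin2 t u = c * lin2 s u" for u by (simp add: lin2_def algebra_simps)
  then show ?thesis by (rule that)
qed

lemma binary_quadratic_factor:
  fixes p :: "(2, 'a::alg_closed_field) mpoly"
  assumes "homogeneous 2 p" "meval p v \<noteq> 0"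
  obtains s t where "s \<noteq> (\<lambda>_. 0)" "t \<noteq> (\<lambda>_. 0)" "\<And>u. meval p u = lin2 s u * lin2 t u"
proof -
  obtain c s where cs: "c \<noteq> 0" "\<And>m. s m \<noteq> (\<lambda>_. 0)" "\<And>u. meval p u = c * (\<Prod>m<(2::nat). lin2 (s m) u)"
    by (rule binary_form_factor[OF assms]) (rule that)
  define s0 where "s0 = (\<lambda>i. c * s 0 i)"
  have "s0 \<noteq> (\<lambda>_. 0)" using cs(2)[of 0] cs(1) unfolding s0_def fun_2_eq_iff by simp
  moreover have "meval p u = lin2 s0 u * lin2 (s 1) u" for u
  proof -
    have "lin2 s0 u = c * lin2 (s 0) u" by (simp add: lin2_def s0_def distrib_left mult.assoc)
    then show ?thesis unfolding cs(3) by (simp add: numeral_2_eq_2 mult.assoc)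
  qed
  ultimately show ?thesis by (rule that[OF _ cs(2)])
qed

text \<open>Where \<open>p\<close> vanishes so does \<open>q\<close>, hence \<open>p\<close> vanishes doubly there, as \<open>r\<close> does not vanish.\<close>

lemma binary_square_root:
  fixes p q r :: "(2, 'a::{alg_closed_field, field_char_0}) mpoly"
  assumes h: "homogeneous 2 p" "homogeneous 2 q" "homogeneous 2 r"
    and eq: "\<And>u. meval p u * meval r u = (meval q u)\<^sup>2"
    and nz: "\<And>u. u \<noteq> (\<lambda>_. 0) \<Longrightarrow> meval p u \<noteq> 0 \<or> meval q u \<noteq> 0 \<or> meval r u \<noteq> 0"
  obtains s where "\<And>u. meval p u = (lin2 s u)\<^sup>2"
proof -
  let ?root = "\<lambda>s (i::2). if i = 1 then s (2::2) else - s 1 :: 'a"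
  have root: "?root s \<noteq> (\<lambda>_. 0)" "lin2 s (?root s) = 0" if "s \<noteq> (\<lambda>_. 0)" for s
  proof
    assume e: "?root s = (\<lambda>_. 0)"
    have "s 2 = 0" "s 1 = 0" using fun_cong[OF e, of 1] fun_cong[OF e, of 2] by simp_all
    then show False using that by (simp add: fun_2_eq_iff)
  qed (simp add: lin2_def)
  have "\<exists>v. meval p v \<noteq> 0"
  proof (rule ccontr)
    assume "\<not> ?thesis"
    then have 0: "\<And>u. meval p u = 0" "\<And>u. meval q u = 0" using eq by auto
    have "meval r (\<lambda>_. 1) \<noteq> 0" using nz[of "\<lambda>_. 1"] 0 by (auto simp: fun_eq_iff)
    from binary_quadratic_factor[OF h(3) this]
    obtain s t where st: "s \<noteq> (\<lambda>_. 0)" "\<And>u. meval r u = lin2 s u * lin2 t u" by blast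
    then show False using nz[OF root(1)[OF st(1)]] 0 root(2)[OF st(1)] by simp
  qed
  then obtain v where v: "meval p v \<noteq> 0" by blast
  obtain s t where st: "s \<noteq> (\<lambda>_. 0)" "t \<noteq> (\<lambda>_. 0)" "\<And>u. meval p u = lin2 s u * lin2 t u"
    by (rule binary_quadratic_factor[OF h(1) v]) blast
  let ?\<rho> = "?root s"
  have p0: "meval p ?\<rho> = 0" by (simp only: st(3) root(2)[OF st(1)] mult_zero_left)
  then have q0: "meval q ?\<rho> = 0" using eq[of ?\<rho>] by simp
  have r0: "meval r ?\<rho> \<noteq> 0" using nz[OF root(1)[OF st(1)]] p0 q0 by simp
  have "\<exists>t'. \<forall>u. meval q u = lin2 s u * lin2 t' u"
  proof (cases "\<exists>w. meval q w \<noteq> 0")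
    case False
    then show ?thesis by (intro exI[of _ "\<lambda>_. 0"]) (simp add: lin2_def)
  next
    case True
    then obtain w where "meval q w \<noteq> 0" by blast
    from binary_quadratic_factor[OF h(2) this]
    obtain a b where ab: "\<And>u. meval q u = lin2 a u * lin2 b u" by blast
    have scale: "lin2 (\<lambda>i. c * b i) u = c * lin2 b u" for c and b :: "2 \<Rightarrow> 'a" and u
      by (simp add: lin2_def algebra_simps)
    from q0 consider "lin2 a ?\<rho> = 0" | "lin2 b ?\<rho> = 0" unfolding ab by auto
    then show ?thesis
    proof cases
      case 1
      then obtain c where "\<And>u. lin2 a u = c * lin2 s u" by (rule lin2_proportional[OF st(1)]) blast
      then show ?thesis by (intro exI[of _ "\<lambda>i. c * b i"]) (simp add: ab scale)
    next
      case 2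
      then obtain c where "\<And>u. lin2 b u = c * lin2 s u" by (rule lin2_proportional[OF st(1)]) blast
      then show ?thesis by (intro exI[of _ "\<lambda>i. c * a i"]) (simp add: ab scale)
    qed
  qed
  then obtain t' where t': "\<And>u. meval q u = lin2 s u * lin2 t' u" by blast
  \<comment> \<open>Cancelling the factor \<open>s\<close> in \<open>p r = q^2\<close> leaves
    \<open>t r = s t'^2\<close>. At the root of \<open>s\<close> this gives \<open>t = 0\<close>, so
    \<open>t\<close> is proportional to \<open>s\<close>.\<close>
  define W where "W = linear_mpoly2 t * r - linear_mpoly2 s * (linear_mpoly2 t')\<^sup>2"
  have "homogeneous (1 + 2) W" unfolding W_def
    using homogeneous_square[OF homogeneous_linear_mpoly2, of t']
    by (intro homogeneous_diff homogeneous_mult homogeneous_linear_mpoly2 h) (simp add: numeral_2_eq_2)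
  moreover have "meval (linear_mpoly2 s) u * meval W u = 0" for u
  proof -
    have "meval (linear_mpoly2 s) u * meval W u = meval p u * meval r u - (meval q u)\<^sup>2"
      by (simp add: W_def st(3) t' algebra_simps power2_eq_square)
    then show ?thesis by (simp only: eq diff_self)
  qed
  ultimately have "(\<forall>u. meval (linear_mpoly2 s) u = 0) \<or> (\<forall>u. meval W u = 0)"
    using binary_form_mult_zero[OF homogeneous_linear_mpoly2] by blast
  moreover have "meval (linear_mpoly2 s) v \<noteq> 0" using v by (simp add: st(3))
  ultimately have "meval W ?\<rho> = 0" by blast
  then have "lin2 t ?\<rho> = 0"
    unfolding W_def meval_minus meval_mult meval_linear_mpoly2 root(2)[OF st(1)] using r0 by simp
  then obtain c where c: "\<And>u. lin2 t u = c * lin2 s u" by (rule lin2_proportional[OF st(1)]) blast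
  obtain d where d: "d\<^sup>2 = c" using ex_square_root by blast
  show ?thesis
  proof (rule that[of "\<lambda>i. d * s i"])
    fix u
    have "lin2 (\<lambda>i. d * s i) u = d * lin2 s u" by (simp add: lin2_def algebra_simps)
    then show "meval p u = (lin2 (\<lambda>i. d * s i) u)\<^sup>2"
      by (simp only: st(3) c power_mult_distrib d) (simp add: power2_eq_square)
  qed
qed

text \<open>A parametrisation of \<open>p r = q^2\<close> by quadratic forms without common zero is
  the standard one up to a linear substitution. The outer forms are squares, and the sign of one
  root is adjusted by \<open>(q - s t)(q + s t) = 0\<close>.\<close>

lemma binary_conic_square_roots:
  fixes p q r :: "(2, 'a::{alg_closed_field, field_char_0}) mpoly"
  assumes h: "homogeneous 2 p" "homogeneous 2 q" "homogeneous 2 r"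
    and eq: "\<And>u. meval p u * meval r u = (meval q u)\<^sup>2"
    and nz: "\<And>u. u \<noteq> (\<lambda>_. 0) \<Longrightarrow> meval p u \<noteq> 0 \<or> meval q u \<noteq> 0 \<or> meval r u \<noteq> 0"
  obtains s t where "\<And>u. meval p u = (lin2 s u)\<^sup>2" "\<And>u. meval q u = lin2 s u * lin2 t u"
    "\<And>u. meval r u = (lin2 t u)\<^sup>2" "\<And>u. lin2 s u = 0 \<Longrightarrow> lin2 t u = 0 \<Longrightarrow> u = (\<lambda>_. 0)"
proof -
  obtain s where s: "\<And>u. meval p u = (lin2 s u)\<^sup>2" using binary_square_root[OF h eq nz] by blast
  obtain t where t: "\<And>u. meval r u = (lin2 t u)\<^sup>2"
  proof (rule binary_square_root[OF h(3,2,1)])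
    show "meval r u * meval p u = (meval q u)\<^sup>2" for u using eq[of u] by (simp add: mult.commute)
    show "meval r u \<noteq> 0 \<or> meval q u \<noteq> 0 \<or> meval p u \<noteq> 0" if "u \<noteq> (\<lambda>_. 0)" for u using nz[OF that] by blast
  qed blast
  let ?st = "linear_mpoly2 s * linear_mpoly2 t"
  have hst: "homogeneous 2 (q - ?st)" "homogeneous 2 (q + ?st)"
    using homogeneous_mult[OF homogeneous_linear_mpoly2 homogeneous_linear_mpoly2, of s t]
    by (intro homogeneous_diff homogeneous_add h; simp add: numeral_2_eq_2)+
  have "meval (q - ?st) u * meval (q + ?st) u = 0" for u
  proof -
    have "meval (q - ?st) u * meval (q + ?st) u = (meval q u)\<^sup>2 - meval p u * meval r u"
      by (simp add: s t algebra_simps power2_eq_square)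
    then show ?thesis by (simp only: eq diff_self)
  qed
  from binary_form_mult_zero[OF hst this]
  have "\<exists>t'. (\<forall>u. meval q u = lin2 s u * lin2 t' u) \<and> (\<forall>u. (lin2 t' u)\<^sup>2 = (lin2 t u)\<^sup>2)"
  proof
    assume "\<forall>u. meval (q - ?st) u = 0"
    then show ?thesis by (intro exI[of _ t]) simp
  next
    assume 0: "\<forall>u. meval (q + ?st) u = 0"
    have neg: "lin2 (\<lambda>i. - t i) u = - lin2 t u" for u by (simp add: lin2_def)
    have "meval q u = - (lin2 s u * lin2 t u)" for u using 0 by (simp add: eq_neg_iff_add_eq_0)
    then show ?thesis by (intro exI[of _ "\<lambda>i. - t i"]) (simp add: neg)
  qed
  then obtain t' where t': "\<And>u. meval q u = lin2 s u * lin2 t' u" "\<And>u. (lin2 t' u)\<^sup>2 = (lin2 t u)\<^sup>2" by blast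
  show ?thesis
  proof (rule that[OF s t'(1)])
    show "meval r u = (lin2 t' u)\<^sup>2" for u by (simp add: t t'(2))
    show "u = (\<lambda>_. 0)" if "lin2 s u = 0" "lin2 t' u = 0" for u
      using nz[of u] that t'(2)[of u] by (auto simp: s t t'(1))
  qed
qed

lemma (in diagonal_cone) param_unique:
  assumes "param x u" "param x u'"
  obtains e where "e = 1 \<or> e = -1" "u' = (\<lambda>t. e * u t)"
proof -
  have 1: "(u' 1)\<^sup>2 = (u 1)\<^sup>2" "u' 1 * u' 2 = u 1 * u 2" "(u' 2)\<^sup>2 = (u 2)\<^sup>2"
    using assms by (simp_all add: param_def)
  from 1(1) consider "u' 1 = u 1" | "u' 1 = - u 1" using power2_eq_iff by blast
  then show ?thesis
  proof cases
    case 1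
    show ?thesis
    proof (cases "u 1 = 0")
      case True
      from \<open>(u' 2)\<^sup>2 = (u 2)\<^sup>2\<close> consider "u' 2 = u 2" | "u' 2 = - u 2" using power2_eq_iff by blast
      then show ?thesis
        by cases (use that[of 1] that[of "-1"] 1 True in \<open>auto simp: fun_2_eq_iff\<close>)
    next
      case False
      then have "u' 2 = u 2" using 1 \<open>u' 1 * u' 2 = u 1 * u 2\<close> by simp
      then show ?thesis using that[of 1] 1 by (simp add: fun_2_eq_iff)
    qed
  next
    case 2
    show ?thesis
    proof (cases "u 1 = 0")
      case True
      from \<open>(u' 2)\<^sup>2 = (u 2)\<^sup>2\<close> consider "u' 2 = u 2" | "u' 2 = - u 2" using power2_eq_iff by blast
      then show ?thesis
        by cases (use that[of 1] that[of "-1"] 2 True in \<open>auto simp: fun_2_eq_iff\<close>)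
    next
      case False
      have "u 1 * (- u' 2) = u 1 * u 2" using 2 \<open>u' 1 * u' 2 = u 1 * u 2\<close> by simp
      then have "- u' 2 = u 2" using False by (metis mult_cancel_left)
      then have "u' 2 = - u 2" by (metis minus_minus)
      then show ?thesis using that[of "-1"] 2 by (simp add: fun_2_eq_iff)
    qed
  qed
qed

text \<open>\<open>\<eta> 1\<close>, \<open>\<eta> 2\<close> are the parameters \<open>u\<close> for
  the cone with vertex \<open>V i\<close>, and \<open>\<eta> 3\<close>, \<open>\<eta> 4\<close> the
  parameters \<open>v\<close> for the one with vertex \<open>V j\<close>. Both determine the
  coordinates \<open>k\<close> and \<open>l\<close> of \<open>x\<close>; equating the two values is
  the elimination that defines \<open>D\<close>.\<close>

locale diagonal_covering =
  I: diagonal_cone C \<xi> V a b i j k l rj rk rl + II: diagonal_cone C \<xi> V a b j i k l si sk sl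
  for C :: "(4, 'a::{alg_closed_field, field_char_0}) proj set" and \<xi> V a b i j k l rj rk rl si sk sl +
  fixes D :: "(4, 'a) proj set" and \<eta> :: "4 \<Rightarrow> (4, 'a) mpoly"
  assumes homogeneous_eta: "homogeneous 1 (\<eta> t)"
    and eta_injective: "(\<forall>t. meval (\<eta> t) w = 0) \<Longrightarrow> w = (\<lambda>_. 0)"
    and D_eq: "D = {abs_proj w | w x. w \<noteq> (\<lambda>_. 0) \<and>
      I.param x (\<lambda>t. if t = 1 then meval (\<eta> 1) w else meval (\<eta> 2) w) \<and>
      II.param x (\<lambda>t. if t = 1 then meval (\<eta> 3) w else meval (\<eta> 4) w)}"
begin

definition uu :: "(4 \<Rightarrow> 'a) \<Rightarrow> 2 \<Rightarrow> 'a" where "uu w = (\<lambda>t. if t = 1 then meval (\<eta> 1) w else meval (\<eta> 2) w)"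
definition vv :: "(4 \<Rightarrow> 'a) \<Rightarrow> 2 \<Rightarrow> 'a" where "vv w = (\<lambda>t. if t = 1 then meval (\<eta> 3) w else meval (\<eta> 4) w)"

lemma uu_vv_simps [simp]: "uu w 1 = meval (\<eta> 1) w" "uu w 2 = meval (\<eta> 2) w"
  "vv w 1 = meval (\<eta> 3) w" "vv w 2 = meval (\<eta> 4) w"
  by (simp_all add: uu_def vv_def)

lemma uu_vv_scale: "uu (\<lambda>m. c * w m) = (\<lambda>t. c * uu w t)" "vv (\<lambda>m. c * w m) = (\<lambda>t. c * vv w t)"
  using meval_scale[OF homogeneous_eta, of _ c w] by (simp_all add: fun_2_eq_iff)

lemma four_distinct: "distinct [1, 2, 3, 4 :: 4]" by simp

text \<open>Equating the coordinates \<open>k\<close> and \<open>l\<close> gives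
  \<open>(sk/rk)(u1^2 + u2^2) = v1^2 + v2^2\<close> and
  \<open>(sl/rl)(u1^2 - u2^2) = v1^2 - v2^2\<close>. Solved for the squares of \<open>v\<close>,
  this is \<open>v1^2 = A1 u1^2 + B1 u2^2\<close> and
  \<open>v2^2 = B1 u1^2 + A1 u2^2\<close>.\<close>

definition A1 where "A1 = (sk / rk + sl / rl) / 2"
definition B1 where "B1 = (sk / rk - sl / rl) / 2"

text \<open>Up to sign \<open>A1\<close>, \<open>B1\<close>, \<open>A1^2 - B1^2\<close> and 1 are
  the minors of the diagonal pencil of \<open>D\<close>. The product \<open>A1 B1\<close> is nonzero
  by the Pluecker relation for the minors of \<open>C\<close>.\<close>

lemma AB_facts: "A1 \<noteq> 0" "B1 \<noteq> 0" "A1 * A1 \<noteq> B1 * B1" "sk / rk = A1 + B1" "sl / rl = A1 - B1"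
proof -
  have n: "rk \<noteq> 0" "rl \<noteq> 0" "sk \<noteq> 0" "sl \<noteq> 0" using I.roots_nonzero II.roots_nonzero by auto
  have m: "I.minor i k \<noteq> 0" "I.minor i l \<noteq> 0" "I.minor i j \<noteq> 0" "I.minor k l \<noteq> 0"
    using I.minor_nonzero I.dist by auto
  have r: "rk\<^sup>2 = I.minor i k" "rl\<^sup>2 = - I.minor i l" "sk\<^sup>2 = I.minor j k" "sl\<^sup>2 = - I.minor j l"
    using I.roots II.roots by auto
  have "A1 * B1 = ((sk / rk)\<^sup>2 - (sl / rl)\<^sup>2) / 4"
    by (simp add: A1_def B1_def power2_eq_square algebra_simps)
  also have "\<dots> = (I.minor j k / I.minor i k - I.minor j l / I.minor i l) / 4"
    by (simp add: power_divide r)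
  also have "\<dots> = (I.minor j k * I.minor i l - I.minor j l * I.minor i k) / (4 * I.minor i k * I.minor i l)"
    using m by (simp add: field_simps)
  also have "I.minor j k * I.minor i l - I.minor j l * I.minor i k = - I.minor i j * I.minor k l"
    unfolding I.minor_def by (simp add: algebra_simps)
  finally have "A1 * B1 \<noteq> 0" using m by simp
  then show "A1 \<noteq> 0" "B1 \<noteq> 0" by auto
  have "((x + y) / 2) * ((x + y) / 2) - ((x - y) / 2) * ((x - y) / 2) = x * y" for x y :: 'a
    by (simp add: field_simps)
  then have "A1 * A1 - B1 * B1 = (sk / rk) * (sl / rl)" unfolding A1_def B1_def .
  moreover have "(sk / rk) * (sl / rl) \<noteq> 0" using n by simp
  ultimately show "A1 * A1 \<noteq> B1 * B1" by (metis right_minus_eq)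
  have h: "x = (x + y) / 2 + (x - y) / 2" "y = (x + y) / 2 - (x - y) / 2" for x y :: 'a
    by (simp_all add: field_simps)
  show "sk / rk = A1 + B1" "sl / rl = A1 - B1" unfolding A1_def B1_def by (rule h)+
qed

text \<open>The covering map in coordinates: the coordinate \<open>i\<close> of the image is
  computed from \<open>v\<close>, the other three from \<open>u\<close>.\<close>

definition pt_form :: "4 \<Rightarrow> (4, 'a) mpoly" where
  "pt_form m = mconst (V i m / si) * (\<eta> 3 * \<eta> 4) + mconst (V j m / rj) * (\<eta> 1 * \<eta> 2)
     + mconst (V k m / (2 * rk)) * ((\<eta> 1)\<^sup>2 + (\<eta> 2)\<^sup>2) + mconst (V l m / (2 * rl)) * ((\<eta> 1)\<^sup>2 - (\<eta> 2)\<^sup>2)"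

definition pt :: "(4 \<Rightarrow> 'a) \<Rightarrow> 4 \<Rightarrow> 'a" where "pt w = (\<lambda>m. meval (pt_form m) w)"

lemma homogeneous_pt_form: "homogeneous 2 (pt_form m)"
proof -
  have "homogeneous (1 + 1) (pt_form m)" unfolding pt_form_def
    by (intro homogeneous_add homogeneous_diff homogeneous_cmult homogeneous_mult homogeneous_square homogeneous_eta)
  then show ?thesis by (simp add: numeral_2_eq_2)
qed

lemma co_pt: "I.co i (pt w) = vv w 1 * vv w 2 / si" "I.co j (pt w) = uu w 1 * uu w 2 / rj"
  "I.co k (pt w) = ((uu w 1)\<^sup>2 + (uu w 2)\<^sup>2) / (2 * rk)" "I.co l (pt w) = ((uu w 1)\<^sup>2 - (uu w 2)\<^sup>2) / (2 * rl)"
proof -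
  define y where "y = (\<lambda>t. if t = i then vv w 1 * vv w 2 / si else if t = j then uu w 1 * uu w 2 / rj
    else if t = k then ((uu w 1)\<^sup>2 + (uu w 2)\<^sup>2) / (2 * rk) else ((uu w 1)\<^sup>2 - (uu w 2)\<^sup>2) / (2 * rl))"
  have "pt w = (\<lambda>m. \<Sum>t\<in>UNIV. y t * V t m)"
    unfolding sum_4[OF I.dist] pt_def pt_form_def using I.dist by (auto simp: y_def mult_ac)
  then have "I.co t (pt w) = y t" for t by (simp only: I.dual)
  then show "I.co i (pt w) = vv w 1 * vv w 2 / si" "I.co j (pt w) = uu w 1 * uu w 2 / rj"
    "I.co k (pt w) = ((uu w 1)\<^sup>2 + (uu w 2)\<^sup>2) / (2 * rk)" "I.co l (pt w) = ((uu w 1)\<^sup>2 - (uu w 2)\<^sup>2) / (2 * rl)"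
    using I.dist by (auto simp: y_def)
qed

lemma param_I_iff: "I.param x u \<longleftrightarrow> I.co j x = u 1 * u 2 / rj \<and>
    I.co k x = ((u 1)\<^sup>2 + (u 2)\<^sup>2) / (2 * rk) \<and> I.co l x = ((u 1)\<^sup>2 - (u 2)\<^sup>2) / (2 * rl)"
  unfolding I.param_iff by (simp add: I.qj_def I.qk_def I.ql_def)

lemma param_II_iff: "II.param x u \<longleftrightarrow> I.co i x = u 1 * u 2 / si \<and>
    I.co k x = ((u 1)\<^sup>2 + (u 2)\<^sup>2) / (2 * sk) \<and> I.co l x = ((u 1)\<^sup>2 - (u 2)\<^sup>2) / (2 * sl)"
  unfolding II.param_iff by (simp add: II.qj_def II.qk_def II.ql_def)

lemma param_I_pt: "I.param (pt w) (uu w)"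
  by (simp only: param_I_iff co_pt simp_thms)

definition on_D :: "(4 \<Rightarrow> 'a) \<Rightarrow> bool" where
  "on_D w \<longleftrightarrow> A1 * (meval (\<eta> 1) w)\<^sup>2 + B1 * (meval (\<eta> 2) w)\<^sup>2 - (meval (\<eta> 3) w)\<^sup>2 = 0 \<and>
    B1 * (meval (\<eta> 1) w)\<^sup>2 + A1 * (meval (\<eta> 2) w)\<^sup>2 - (meval (\<eta> 4) w)\<^sup>2 = 0"

lemma on_D_iff: "on_D w \<longleftrightarrow> ((uu w 1)\<^sup>2 + (uu w 2)\<^sup>2) / (2 * rk) = ((vv w 1)\<^sup>2 + (vv w 2)\<^sup>2) / (2 * sk) \<and>
    ((uu w 1)\<^sup>2 - (uu w 2)\<^sup>2) / (2 * rl) = ((vv w 1)\<^sup>2 - (vv w 2)\<^sup>2) / (2 * sl)"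
proof -
  have n: "rk \<noteq> 0" "rl \<noteq> 0" "sk \<noteq> 0" "sl \<noteq> 0" using I.roots_nonzero II.roots_nonzero by auto
  have h: "x / (2 * r) = y / (2 * s) \<longleftrightarrow> s / r * x = y" if "r \<noteq> 0" "s \<noteq> 0" for x y r s :: 'a
  proof -
    have "x / (2 * r) = inverse 2 * (x / r)" "y / (2 * s) = inverse 2 * (y / s)"
      using that by (simp_all add: field_simps)
    then have "x / (2 * r) = y / (2 * s) \<longleftrightarrow> x / r = y / s"
      by (metis mult_cancel_left inverse_nonzero_iff_nonzero zero_neq_numeral)
    moreover have "x / r = y / s \<longleftrightarrow> s / r * x = y" using that by (simp add: field_simps)
    ultimately show ?thesis by simp
  qed
  define U1 U2 V1 V2 where d: "U1 = (uu w 1)\<^sup>2" "U2 = (uu w 2)\<^sup>2" "V1 = (vv w 1)\<^sup>2" "V2 = (vv w 2)\<^sup>2"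
  have "(U1 + U2) / (2 * rk) = (V1 + V2) / (2 * sk) \<longleftrightarrow> (sk / rk) * (U1 + U2) = V1 + V2"
    "(U1 - U2) / (2 * rl) = (V1 - V2) / (2 * sl) \<longleftrightarrow> (sl / rl) * (U1 - U2) = V1 - V2"
    using n by (auto simp: h)
  moreover have "(A1 + B1) * (U1 + U2) = V1 + V2 \<and> (A1 - B1) * (U1 - U2) = V1 - V2 \<longleftrightarrow>
      A1 * U1 + B1 * U2 - V1 = 0 \<and> B1 * U1 + A1 * U2 - V2 = 0"
  proof
    assume *: "(A1 + B1) * (U1 + U2) = V1 + V2 \<and> (A1 - B1) * (U1 - U2) = V1 - V2"
    have "2 * (A1 * U1 + B1 * U2 - V1) = ((A1 + B1) * (U1 + U2) - (V1 + V2)) + ((A1 - B1) * (U1 - U2) - (V1 - V2))"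
      "2 * (B1 * U1 + A1 * U2 - V2) = ((A1 + B1) * (U1 + U2) - (V1 + V2)) - ((A1 - B1) * (U1 - U2) - (V1 - V2))"
      by (simp_all add: algebra_simps)
    then have "2 * (A1 * U1 + B1 * U2 - V1) = 0" "2 * (B1 * U1 + A1 * U2 - V2) = 0" using * by simp_all
    then show "A1 * U1 + B1 * U2 - V1 = 0 \<and> B1 * U1 + A1 * U2 - V2 = 0"
      by (metis mult_eq_0_iff zero_neq_numeral)
  next
    assume "A1 * U1 + B1 * U2 - V1 = 0 \<and> B1 * U1 + A1 * U2 - V2 = 0"
    then have "V1 = A1 * U1 + B1 * U2" "V2 = B1 * U1 + A1 * U2" by simp_all
    then show "(A1 + B1) * (U1 + U2) = V1 + V2 \<and> (A1 - B1) * (U1 - U2) = V1 - V2"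
      by (simp add: algebra_simps)
  qed
  ultimately show ?thesis unfolding on_D_def AB_facts(4,5) by (simp add: d)
qed

lemma param_II_pt: "II.param (pt w) (vv w) \<longleftrightarrow> on_D w"
  unfolding param_II_iff co_pt on_D_iff by simp

lemma params_imp_pt:
  assumes "I.param x (uu w)" "II.param x (vv w)"
  shows "x = pt w" "on_D w"
proof -
  show x: "x = pt w"
  proof (rule I.coordinates_eqI)
    fix t
    have "\<forall>t. I.co t x = I.co t (pt w)"
      unfolding all_4[OF I.dist] co_pt using assms unfolding param_I_iff param_II_iff by simp
    then show "I.co t x = I.co t (pt w)" by blast
  qed
  show "on_D w" using assms(2) unfolding x param_II_pt .
qed

lemma on_D_scale: "c \<noteq> 0 \<Longrightarrow> on_D (\<lambda>m. c * w m) \<longleftrightarrow> on_D w"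
proof -
  assume c: "c \<noteq> 0"
  have 1: "meval (\<eta> t) (\<lambda>m. c * w m) = c * meval (\<eta> t) w" for t
    using meval_scale[OF homogeneous_eta, of t c w] by simp
  have "A1 * (c * x)\<^sup>2 + B1 * (c * y)\<^sup>2 - (c * z)\<^sup>2 = c\<^sup>2 * (A1 * x\<^sup>2 + B1 * y\<^sup>2 - z\<^sup>2)"
    "B1 * (c * x)\<^sup>2 + A1 * (c * y)\<^sup>2 - (c * z)\<^sup>2 = c\<^sup>2 * (B1 * x\<^sup>2 + A1 * y\<^sup>2 - z\<^sup>2)" for x y z
    by (simp_all add: power_mult_distrib algebra_simps)
  then show ?thesis unfolding on_D_def 1 using c by simp
qed

lemma cone_D_iff: "w \<in> affine_cone D \<longleftrightarrow> w \<noteq> (\<lambda>_. 0) \<and> on_D w"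
proof
  assume w: "w \<in> affine_cone D"
  then have w0: "w \<noteq> (\<lambda>_. 0)" by (simp add: affine_cone_def)
  obtain w' x where w': "abs_proj w = abs_proj w'" "w' \<noteq> (\<lambda>_. 0)" "I.param x (uu w')" "II.param x (vv w')"
    using w unfolding affine_cone_def D_eq uu_def vv_def by blast
  obtain c where "c \<noteq> 0" "w' = (\<lambda>m. c * w m)" using abs_proj_eq_iff[OF w0 w'(2)] w'(1) by blast
  then show "w \<noteq> (\<lambda>_. 0) \<and> on_D w" using params_imp_pt(2)[OF w'(3,4)] on_D_scale w0 by simp
next
  assume "w \<noteq> (\<lambda>_. 0) \<and> on_D w"
  then show "w \<in> affine_cone D"
    unfolding affine_cone_def D_eq using param_I_pt[of w] param_II_pt[of w] unfolding uu_def vv_def by blast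
qed

definition aD :: "4 \<Rightarrow> 'a" where "aD t = (if t = 1 then A1 else if t = 2 then B1 else if t = 3 then -1 else 0)"
definition bD :: "4 \<Rightarrow> 'a" where "bD t = (if t = 1 then B1 else if t = 2 then A1 else if t = 3 then 0 else -1)"
definition VD :: "4 \<Rightarrow> 4 \<Rightarrow> 'a" where "VD = (SOME V. dual_bases \<eta> V)"

lemma dual_bases_D: "dual_bases \<eta> VD"
proof -
  have "\<exists>V'. dual_bases \<eta> V'" using ex_dual_basis[of \<eta>, OF homogeneous_eta eta_injective] by blast
  then show ?thesis unfolding VD_def by (rule someI_ex)
qed

text \<open>The covering curve is again a diagonal intersection, so that orders, Bezout and the
  inequivalence of points are available on \<open>D\<close> as on \<open>C\<close>.\<close>

sublocale D: diagonal_quadrics D \<eta> VD aD bD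
proof
  show "homogeneous 1 (\<eta> t)" "meval (\<eta> t) (\<lambda>m. \<Sum>j\<in>UNIV. y j * VD j m) = y t"
    "x m = (\<Sum>i\<in>UNIV. meval (\<eta> i) x * VD i m)" for t y x m
    using dual_bases_D unfolding dual_bases_def by blast+
  have "(\<Sum>t\<in>UNIV. aD t * (meval (\<eta> t) x)\<^sup>2) = 0 \<and> (\<Sum>t\<in>UNIV. bD t * (meval (\<eta> t) x)\<^sup>2) = 0 \<longleftrightarrow> on_D x" for x
    unfolding sum_4[OF four_distinct] on_D_def by (simp add: aD_def bD_def)
  then show "x \<in> affine_cone D \<longleftrightarrow> x \<noteq> (\<lambda>_. 0) \<and>
      (\<Sum>t\<in>UNIV. aD t * (meval (\<eta> t) x)\<^sup>2) = 0 \<and> (\<Sum>t\<in>UNIV. bD t * (meval (\<eta> t) x)\<^sup>2) = 0" for x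
    unfolding cone_D_iff by blast
  have "\<forall>s t. s \<noteq> t \<longrightarrow> aD s * bD t - aD t * bD s \<noteq> 0"
    unfolding all_4[OF four_distinct] using AB_facts(1-3) by (simp add: aD_def bD_def)
  then show "s \<noteq> t \<Longrightarrow> aD s * bD t - aD t * bD s \<noteq> 0" for s t by blast
qed

lemma uu_nonzero: "w \<in> affine_cone D \<Longrightarrow> uu w \<noteq> (\<lambda>_. 0)"
  using D.one_zero_coordinate[of w 1 2] by (auto simp: fun_2_eq_iff)

lemma vv_nonzero: "w \<in> affine_cone D \<Longrightarrow> vv w \<noteq> (\<lambda>_. 0)"
  using D.one_zero_coordinate[of w 3 4] by (auto simp: fun_2_eq_iff)

lemma pt_in_cone:
  assumes w: "w \<in> affine_cone D" shows "pt w \<in> affine_cone C"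
proof (rule I.coneI[OF I.dist])
  have p: "I.param (pt w) (uu w)" "II.param (pt w) (vv w)"
    using param_I_pt param_II_pt w cone_D_iff by auto
  show "pt w \<noteq> (\<lambda>_. 0)"
  proof
    assume "pt w = (\<lambda>_. 0)"
    then have "\<forall>t. I.co t (pt w) = 0" using I.eq_0_iff by blast
    then have "(uu w 1)\<^sup>2 = 0" "(uu w 2)\<^sup>2 = 0" using p(1) unfolding I.param_def
      by (auto simp: I.tA_def I.tC_def)
    then show False using uu_nonzero[OF w] by (simp add: fun_2_eq_iff)
  qed
  have "rk\<^sup>2 * (I.co k (pt w))\<^sup>2 - rl\<^sup>2 * (I.co l (pt w))\<^sup>2 = meval I.tA (pt w) * meval I.tC (pt w)"
    by (simp add: I.tA_def I.tC_def algebra_simps power2_eq_square)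
  also have "\<dots> = (meval I.tB (pt w))\<^sup>2" using p(1) by (simp add: I.param_def power_mult_distrib)
  also have "\<dots> = rj\<^sup>2 * (I.co j (pt w))\<^sup>2" by (simp add: I.tB_def power_mult_distrib)
  finally show "I.minor i j * (I.co j (pt w))\<^sup>2 + I.minor i k * (I.co k (pt w))\<^sup>2
      + I.minor i l * (I.co l (pt w))\<^sup>2 = 0"
    unfolding I.roots by (simp add: algebra_simps eq_neg_iff_add_eq_0)
  have "sk\<^sup>2 * (I.co k (pt w))\<^sup>2 - sl\<^sup>2 * (I.co l (pt w))\<^sup>2 = meval II.tA (pt w) * meval II.tC (pt w)"
    by (simp add: II.tA_def II.tC_def algebra_simps power2_eq_square)
  also have "\<dots> = (meval II.tB (pt w))\<^sup>2" using p(2) by (simp add: II.param_def power_mult_distrib)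
  also have "\<dots> = si\<^sup>2 * (I.co i (pt w))\<^sup>2" by (simp add: II.tB_def power_mult_distrib)
  finally show "I.minor j i * (I.co i (pt w))\<^sup>2 + I.minor j k * (I.co k (pt w))\<^sup>2
      + I.minor j l * (I.co l (pt w))\<^sup>2 = 0"
    unfolding II.roots by (simp add: algebra_simps eq_neg_iff_add_eq_0)
qed

lemma pt_surjective:
  assumes x: "x \<in> affine_cone C"
  obtains w where "w \<in> affine_cone D" "pt w = x"
proof -
  obtain u where u: "I.param x u" "u \<noteq> (\<lambda>_. 0)" by (rule I.ex_param[OF x])
  obtain v where v: "II.param x v" by (rule II.ex_param[OF x])
  define y where "y = (\<lambda>t::4. if t = 1 then u 1 else if t = 2 then u 2 else if t = 3 then v 1 else v 2)"
  define w where "w = (\<lambda>m. \<Sum>t\<in>UNIV. y t * VD t m)"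
  have "meval (\<eta> t) w = y t" for t unfolding w_def by (rule D.dual)
  then have uv: "uu w = u" "vv w = v" by (simp_all add: fun_2_eq_iff y_def)
  have "x = pt w" "on_D w" using params_imp_pt[of x w] u v uv by auto
  moreover have "w \<noteq> (\<lambda>_. 0)"
  proof
    assume "w = (\<lambda>_. 0)"
    then have "\<forall>t. meval (\<eta> t) w = 0" using D.eq_0_iff by blast
    then have "uu w = (\<lambda>_. 0)" by (simp add: fun_2_eq_iff)
    then show False using uv(1) u(2) by simp
  qed
  ultimately show ?thesis using that cone_D_iff by blast
qed

definition proj_pt :: "(4, 'a) proj \<Rightarrow> (4, 'a) proj" where "proj_pt P = abs_proj (pt (rep_proj P))"

lemma proj_pt_in: "P \<in> D \<Longrightarrow> proj_pt P \<in> C"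
proof -
  assume "P \<in> D"
  then have "rep_proj P \<in> affine_cone D" by simp
  from pt_in_cone[OF this] show ?thesis by (simp add: proj_pt_def affine_cone_def)
qed

lemma pt_scale: "pt (\<lambda>m. c * w m) = (\<lambda>m. c\<^sup>2 * pt w m)"
  by (rule ext) (simp add: pt_def meval_scale[OF homogeneous_pt_form])

lemma proj_pt_abs:
  assumes "w \<in> affine_cone D" shows "proj_pt (abs_proj w) = abs_proj (pt w)"
proof -
  obtain c where c: "c \<noteq> 0" "rep_proj (abs_proj w) = (\<lambda>m. c * w m)"
    by (rule rep_abs_proj[OF affine_cone_nonzero[OF assms]])
  have nz: "pt w \<noteq> (\<lambda>_. 0)" using affine_cone_nonzero[OF pt_in_cone[OF assms]] .
  have "abs_proj w \<in> D" using assms by (simp add: affine_cone_def)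
  then have "rep_proj (abs_proj w) \<in> affine_cone D" by simp
  then have nz': "pt (rep_proj (abs_proj w)) \<noteq> (\<lambda>_. 0)" using affine_cone_nonzero[OF pt_in_cone] by blast
  have "abs_proj (pt w) = abs_proj (pt (rep_proj (abs_proj w)))"
    unfolding abs_proj_eq_iff[OF nz nz'] using c by (intro exI[of _ "c\<^sup>2"]) (simp add: pt_scale)
  then show ?thesis by (simp add: proj_pt_def)
qed

definition iota :: "(4 \<Rightarrow> 'a) \<Rightarrow> 4 \<Rightarrow> 'a" where "iota w = D.reflect 3 (D.reflect 4 w)"
definition iota_pt :: "(4, 'a) proj \<Rightarrow> (4, 'a) proj" where
  "iota_pt P = D.reflect_point 3 (D.reflect_point 4 P)"
definition iota_form :: "(4, 'a) mpoly \<Rightarrow> (4, 'a) mpoly" where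
  "iota_form F = msubst (msubst F (D.reflection 3)) (D.reflection 4)"

lemma eta_iota: "meval (\<eta> t) (iota w) = (if t = 3 \<or> t = 4 then - meval (\<eta> t) w else meval (\<eta> t) w)"
  by (auto simp: iota_def D.co_reflect)

lemma uu_iota: "uu (iota w) = uu w" "vv (iota w) = (\<lambda>t. - vv w t)"
  by (simp_all add: fun_2_eq_iff eta_iota)

lemma iota_iota [simp]: "iota (iota w) = w"
  by (rule D.coordinates_eqI) (simp add: eta_iota)

lemma iota_cone [simp]: "iota w \<in> affine_cone D \<longleftrightarrow> w \<in> affine_cone D"
  by (simp add: iota_def)

lemma iota_pt_abs: "w \<noteq> (\<lambda>_. 0) \<Longrightarrow> iota_pt (abs_proj w) = abs_proj (iota w)"
  unfolding iota_pt_def iota_def by (simp add: D.reflect_point_abs D.reflect_nonzero)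

lemma iota_pt_in [simp]: "iota_pt P \<in> D \<longleftrightarrow> P \<in> D"
  by (simp add: iota_pt_def)

lemma iota_pt_iota_pt [simp]: "iota_pt (iota_pt P) = P"
proof -
  obtain w where w: "w \<noteq> (\<lambda>_. 0)" "P = abs_proj w" by (rule proj_cases)
  have "iota w \<noteq> (\<lambda>_. 0)" unfolding iota_def by (intro D.reflect_nonzero w)
  then show ?thesis using w by (simp add: iota_pt_abs)
qed

lemma pt_iota [simp]: "pt (iota w) = pt w"
proof (rule I.coordinates_eqI)
  fix t
  have "\<forall>t. I.co t (pt (iota w)) = I.co t (pt w)"
    unfolding all_4[OF I.dist] co_pt uu_iota by simp
  then show "I.co t (pt (iota w)) = I.co t (pt w)" by blast
qed

text \<open>The scaling factor at a fixed point would be 1 because of \<open>u\<close> and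
  \<open>-1\<close> because of \<open>v\<close>, and neither vanishes on \<open>D\<close>.\<close>

lemma iota_pt_no_fixed_point: "P \<in> D \<Longrightarrow> iota_pt P \<noteq> P"
proof
  assume P: "P \<in> D" and fixed: "iota_pt P = P"
  let ?w = "rep_proj P"
  have w: "?w \<in> affine_cone D" "iota ?w \<in> affine_cone D" using P by simp_all
  have "abs_proj ?w = abs_proj (iota ?w)" using fixed iota_pt_abs[OF rep_proj_nonzero, of P] by simp
  then obtain c where c: "iota ?w = (\<lambda>m. c * ?w m)"
    using abs_proj_eq_iff[OF affine_cone_nonzero[OF w(1)] affine_cone_nonzero[OF w(2)]] by blast
  note e = uu_iota[of ?w, unfolded c uu_vv_scale]
  have *: "c * uu ?w t = uu ?w t" "c * vv ?w t = - vv ?w t" for t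
    using fun_cong[OF e(1), of t] fun_cong[OF e(2), of t] by simp_all
  obtain t where "uu ?w t \<noteq> 0" using uu_nonzero[OF w(1)] by (auto simp: fun_eq_iff)
  then have "c = 1" using *(1)[of t] by simp
  obtain t' where "vv ?w t' \<noteq> 0" using vv_nonzero[OF w(1)] by (auto simp: fun_eq_iff)
  then have "c = -1" using *(2)[of t'] by (metis mult_cancel_right mult_minus1)
  with \<open>c = 1\<close> have "(1 :: 'a) = -1" by simp
  then show False by simp
qed

lemma proj_pt_iota [simp]: "P \<in> D \<Longrightarrow> proj_pt (iota_pt P) = proj_pt P"
  using iota_pt_abs[OF rep_proj_nonzero, of P] proj_pt_abs[of "iota (rep_proj P)"]
  by (simp add: proj_pt_def)

text \<open>The map is quadratic, so rescaling by a square root makes the image vectors equal. Then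
  \<open>u\<close> and \<open>v\<close> are each determined up to sign: equal signs give the same
  point, opposite signs its image under the involution.\<close>

lemma proj_pt_fibre:
  assumes P: "P \<in> D" and P': "P' \<in> D" and eq: "proj_pt P' = proj_pt P"
  shows "P' = P \<or> P' = iota_pt P"
proof -
  let ?w = "rep_proj P" and ?w' = "rep_proj P'"
  have w: "?w \<in> affine_cone D" "?w' \<in> affine_cone D" using P P' by simp_all
  have nz: "pt ?w \<noteq> (\<lambda>_. 0)" "pt ?w' \<noteq> (\<lambda>_. 0)" using pt_in_cone w affine_cone_nonzero by blast+
  obtain c where c: "c \<noteq> 0" "pt ?w' = (\<lambda>m. c * pt ?w m)"
    using eq abs_proj_eq_iff[OF nz] unfolding proj_pt_def by auto
  obtain r where r: "r\<^sup>2 = c" using ex_square_root by blast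
  then have r0: "r \<noteq> 0" using c(1) by auto
  define z where "z = (\<lambda>m. r * ?w m)"
  have z: "z \<in> affine_cone D" "z \<noteq> (\<lambda>_. 0)" "abs_proj z = P"
  proof -
    show 1: "z \<in> affine_cone D" unfolding z_def by (rule affine_cone_scale[OF w(1) r0])
    then show 2: "z \<noteq> (\<lambda>_. 0)" by (rule affine_cone_nonzero)
    have "abs_proj ?w = abs_proj z" using abs_proj_eq_iff[OF rep_proj_nonzero 2] r0 z_def by blast
    then show "abs_proj z = P" by simp
  qed
  have pz: "pt z = pt ?w'" unfolding z_def pt_scale r c(2) ..
  have p: "I.param (pt z) (uu z)" "II.param (pt z) (vv z)" "I.param (pt z) (uu ?w')" "II.param (pt z) (vv ?w')"
    using param_I_pt[of z] param_II_pt[of z] param_I_pt[of ?w'] param_II_pt[of ?w'] z w unfolding pz cone_D_iff by auto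
  obtain e where e: "e = 1 \<or> e = -1" "uu ?w' = (\<lambda>t. e * uu z t)" by (rule I.param_unique[OF p(1,3)])
  obtain d where d: "d = 1 \<or> d = -1" "vv ?w' = (\<lambda>t. d * vv z t)" by (rule II.param_unique[OF p(2,4)])
  have co: "uu ?w' t = e * uu z t" "vv ?w' t = d * vv z t" for t by (simp_all only: e(2) d(2))
  have sc: "meval (\<eta> t) (\<lambda>m. e * y m) = e * meval (\<eta> t) y" for t e y
    using meval_scale[OF homogeneous_eta, of t e y] by simp
  have P'abs: "P' = abs_proj ?w'" by simp
  have e0: "e \<noteq> 0" using e(1) by auto
  show ?thesis
  proof (cases "d = e")
    case True
    have "\<forall>t. meval (\<eta> t) ?w' = meval (\<eta> t) (\<lambda>m. e * z m)"
      unfolding all_4[OF four_distinct] sc using co(1)[of 1] co(1)[of 2] co(2)[of 1] co(2)[of 2] True by simp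
    then have "?w' = (\<lambda>m. e * z m)" using D.coordinates_eqI by blast
    then have "abs_proj z = abs_proj ?w'" using abs_proj_eq_iff[OF z(2) rep_proj_nonzero] e0 by blast
    then show ?thesis using z(3) by simp
  next
    case False
    then have "d = - e" using d(1) e(1) by auto
    then have "\<forall>t. meval (\<eta> t) ?w' = meval (\<eta> t) (\<lambda>m. e * iota z m)"
      unfolding all_4[OF four_distinct] sc eta_iota using co(1)[of 1] co(1)[of 2] co(2)[of 1] co(2)[of 2] by simp
    then have "?w' = (\<lambda>m. e * iota z m)" using D.coordinates_eqI by blast
    moreover have "iota z \<noteq> (\<lambda>_. 0)" unfolding iota_def by (intro D.reflect_nonzero z)
    ultimately have "abs_proj (iota z) = abs_proj ?w'" using abs_proj_eq_iff[OF _ rep_proj_nonzero] e0 by blast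
    then show ?thesis using z(3) iota_pt_abs[OF z(2)] by simp
  qed
qed

lemma homogeneous_iota_form: "homogeneous n F \<Longrightarrow> homogeneous n (iota_form F)"
  unfolding iota_form_def
  using homogeneous_msubst[of n F 1 "D.reflection 3"] D.homogeneous_reflection
    homogeneous_msubst[of n "msubst F (D.reflection 3)" 1 "D.reflection 4"] by simp

lemma meval_iota_form: "meval (iota_form F) w = meval F (iota w)"
  by (simp add: iota_form_def iota_def D.reflect_def)

lemma iota_form_not_zero_on: "\<not> zero_on D F \<Longrightarrow> \<not> zero_on D (iota_form F)"
  unfolding zero_on_def meval_iota_form by (metis iota_cone iota_iota)

lemma order_iota_form:
  assumes "P \<in> D" "homogeneous n F"
  shows "order_at D P (iota_form F) = order_at D (iota_pt P) F"
proof -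
  have "homogeneous n (msubst F (D.reflection 3))"
    using homogeneous_msubst[of n F 1 "D.reflection 3"] D.homogeneous_reflection assms(2) by simp
  then have "order_at D P (iota_form F) = order_at D (D.reflect_point 4 P) (msubst F (D.reflection 3))"
    unfolding iota_form_def by (rule D.order_reflect[OF assms(1)])
  also have "\<dots> = order_at D (D.reflect_point 3 (D.reflect_point 4 P)) F"
    by (rule D.order_reflect[OF _ assms(2)]) (use assms(1) in simp)
  finally show ?thesis by (simp add: iota_pt_def)
qed

end

section \<open>Transport of principal divisors\<close>

text \<open>Forms on \<open>Z\<close> become forms on \<open>Y\<close> by substituting one fixed
  local formula \<open>b\<close> for the inverse of \<open>f\<close>. Near \<open>P\<close>, the
  formula \<open>c\<close>, which is \<open>b\<close> after a formula for \<open>f\<close>, is a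
  multiple of the identity by \<open>c_i / x_i\<close>. So a form of degree \<open>n\<close> has its
  order shifted by \<open>n\<close> times the order of this factor, whatever the form is.\<close>

lemma (in projective_curve) transport_forms:
  fixes Y :: "('j::finite, 'a) proj set"
  assumes iso: "iso_over S Z Y f" and P0: "P0 \<in> Z"
  obtains b :: "'i \<Rightarrow> ('j, 'a) mpoly" and e :: nat and \<delta> :: "('i, 'a) proj \<Rightarrow> int"
    where "\<And>n F. homogeneous n F \<Longrightarrow> homogeneous (e * n) (msubst F b)"
    "\<And>n F. homogeneous n F \<Longrightarrow> \<not> zero_on Z F \<Longrightarrow> \<not> zero_on Y (msubst F b)"
    "\<And>n F P. homogeneous n F \<Longrightarrow> \<not> zero_on Z F \<Longrightarrow> P \<in> Z \<Longrightarrow>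
      int (order_at Y (f P) (msubst F b)) = int (ord P F) + int n * \<delta> P"
proof -
  obtain g where mor: "morphism_over S Z Y f" "morphism_over S Y Z g" and fY: "\<And>P. P \<in> Z \<Longrightarrow> f P \<in> Y"
    and gf: "\<And>P. P \<in> Z \<Longrightarrow> g (f P) = P"
    using iso_overE[OF iso] by metis
  obtain b where b: "local_rep S Y g (f P0) b" using mor(2) fY[OF P0] by (auto simp: morphism_over_def)
  obtain e where hb: "\<And>j. homogeneous e (b j)" and b0: "\<exists>j. meval (b j) (rep_proj (f P0)) \<noteq> 0"
    and bg: "\<And>y. y \<in> affine_cone Y \<Longrightarrow> (\<lambda>j. meval (b j) y) \<noteq> (\<lambda>_. 0) \<Longrightarrow> g (abs_proj y) = abs_proj (\<lambda>j. meval (b j) y)"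
    by (rule local_repD[OF b]) (rule that)
  obtain j0 where j0: "meval (b j0) (rep_proj (f P0)) \<noteq> 0" using b0 by blast
  obtain a' where a': "local_rep S Z f P0 a'" using mor(1) P0 by (auto simp: morphism_over_def)
  obtain d' where ha': "\<And>j. homogeneous d' (a' j)" and a'0: "\<exists>j. meval (a' j) (rep_proj P0) \<noteq> 0"
    and a'f: "\<And>x. x \<in> affine_cone Z \<Longrightarrow> (\<lambda>j. meval (a' j) x) \<noteq> (\<lambda>_. 0) \<Longrightarrow> f (abs_proj x) = abs_proj (\<lambda>j. meval (a' j) x)"
    by (rule local_repD[OF a']) (rule that)
  have ba': "\<not> zero_on Z (msubst (b j0) a')"
  proof (rule not_zero_onI[OF P0])
    let ?y = "\<lambda>j. meval (a' j) (rep_proj P0)"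
    have y: "?y \<noteq> (\<lambda>_. 0)" using a'0 by (auto simp: fun_eq_iff)
    have "f P0 = abs_proj ?y" using a'f[of "rep_proj P0"] P0 y by simp
    then have "\<not> vanishes (b j0) (abs_proj ?y)" using j0 by (simp add: vanishes_rep)
    then show "meval (msubst (b j0) a') (rep_proj P0) \<noteq> 0" by (simp add: vanishes_abs[OF hb y])
  qed
  have main: "\<exists>\<delta>. \<forall>n F. homogeneous n F \<longrightarrow> \<not> zero_on Z F \<longrightarrow> \<not> zero_on Y (msubst F b) \<and>
      int (order_at Y (f P) (msubst F b)) = int (ord P F) + int n * \<delta>" if P: "P \<in> Z" for P
  proof -
    obtain a where a: "local_rep S Z f P a" using mor(1) P by (auto simp: morphism_over_def)
    obtain d where ha: "\<And>j. homogeneous d (a j)" and a0: "\<exists>j. meval (a j) (rep_proj P) \<noteq> 0"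
      and af: "\<And>x. x \<in> affine_cone Z \<Longrightarrow> (\<lambda>j. meval (a j) x) \<noteq> (\<lambda>_. 0) \<Longrightarrow> f (abs_proj x) = abs_proj (\<lambda>j. meval (a j) x)"
      by (rule local_repD[OF a]) (rule that)
    obtain k where k: "meval (a k) (rep_proj P) \<noteq> 0" using a0 by blast
    have ak: "\<not> zero_on Z (a k)" by (rule not_zero_onI[OF P k])
    define c where "c j = msubst (b j) a" for j
    have hc: "homogeneous (d * e) (c j)" for j unfolding c_def by (rule homogeneous_msubst[OF hb ha])
    have aY: "(\<lambda>j. meval (a j) x) \<in> affine_cone Y" if "x \<in> affine_cone Z" "meval (a k) x \<noteq> 0" for x
    proof -
      have n: "(\<lambda>j. meval (a j) x) \<noteq> (\<lambda>_. 0)" using that(2) by (auto simp: fun_eq_iff)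
      have "abs_proj x \<in> Z" using that(1) by (simp add: affine_cone_def)
      from fY[OF this] show ?thesis using n af[OF that(1) n] by (simp add: affine_cone_def)
    qed
    \<comment> \<open>Proportionality to the identity is evident where \<open>a k\<close> and the
      formula \<open>b\<close> do not vanish; multiplying by \<open>a k\<close> makes it an identity
      on the whole curve, and irreducibility removes this factor again.\<close>
    have cx: "meval (c i) x * x j = meval (c j) x * x i" if x: "x \<in> affine_cone Z" for x i j
    proof -
      have "zero_on Z (a k * (c i * mvar j - c j * mvar i))" unfolding zero_on_def
      proof
        fix x assume x: "x \<in> affine_cone Z"
        let ?y = "\<lambda>j. meval (a j) x" let ?z = "\<lambda>j. meval (b j) ?y"
        have cz: "meval (c j) x = ?z j" for j by (simp add: c_def)
        show "meval (a k * (c i * mvar j - c j * mvar i)) x = 0"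
        proof (cases "meval (a k) x = 0 \<or> ?z = (\<lambda>_. 0)")
          case True
          then show ?thesis
          proof
            assume "?z = (\<lambda>_. 0)"
            from fun_cong[OF this] show ?thesis by (simp add: cz)
          qed simp
        next
          case False
          then have y: "?y \<in> affine_cone Y" and z: "?z \<noteq> (\<lambda>_. 0)" using aY[OF x] by auto
          have x0: "x \<noteq> (\<lambda>_. 0)" "abs_proj x \<in> Z" using x by (auto simp: affine_cone_def)
          have "abs_proj x = abs_proj ?z"
            using gf[OF x0(2)] af[OF x affine_cone_nonzero[OF y]] bg[OF y z] by simp
          then obtain r where r: "?z = (\<lambda>i. r * x i)" using abs_proj_eq_iff[OF x0(1) z] by blast
          from fun_cong[OF r, of i] fun_cong[OF r, of j] show ?thesis by (simp add: cz)
        qed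
      qed
      moreover have "homogeneous (d * e + 1) (c i * mvar j - c j * mvar i)"
        by (intro homogeneous_diff homogeneous_mult hc homogeneous_mvar)
      ultimately have "zero_on Z (c i * mvar j - c j * mvar i)" using irreducible[OF ha] ak by blast
      then show ?thesis using x by (simp add: zero_on_def)
    qed
    have aa': "meval (a k) x * meval (a' j) x = meval (a' k) x * meval (a j) x" if x: "x \<in> affine_cone Z" for x j
    proof (cases "(\<lambda>j. meval (a j) x) = (\<lambda>_. 0) \<or> (\<lambda>j. meval (a' j) x) = (\<lambda>_. 0)")
      case True
      then show ?thesis
      proof
        assume "(\<lambda>j. meval (a j) x) = (\<lambda>_. 0)"
        from fun_cong[OF this] show ?thesis by simp
      next
        assume "(\<lambda>j. meval (a' j) x) = (\<lambda>_. 0)"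
        from fun_cong[OF this] show ?thesis by simp
      qed
    next
      case False
      then have "(\<lambda>j. meval (a j) x) \<noteq> (\<lambda>_. 0)" "(\<lambda>j. meval (a' j) x) \<noteq> (\<lambda>_. 0)" by blast+
      from af[OF x this(1)] a'f[OF x this(2)] abs_proj_eq_iff[OF this]
      obtain r where r: "(\<lambda>j. meval (a' j) x) = (\<lambda>j. r * meval (a j) x)" by auto
      from fun_cong[OF r, of j] fun_cong[OF r, of k] show ?thesis by simp
    qed
    \<comment> \<open>The formulas \<open>a\<close> and \<open>a'\<close> represent the same map and
      are proportional. Up to powers of \<open>a k\<close> and \<open>a' k\<close>, the composition
      of \<open>b j0\<close> with \<open>a\<close> is therefore that with \<open>a'\<close>, which
      is nonzero at \<open>P0\<close>.\<close>
    have cj0: "\<not> zero_on Z (c j0)"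
    proof
      assume z: "zero_on Z (c j0)"
      have "zero_on Z (a k ^ e * msubst (b j0) a')" unfolding zero_on_def
      proof
        fix x assume x: "x \<in> affine_cone Z"
        have "meval (a k ^ e * msubst (b j0) a') x = meval (b j0) (\<lambda>j. meval (a k) x * meval (a' j) x)"
          by (simp add: meval_scale[OF hb])
        also have "\<dots> = meval (b j0) (\<lambda>j. meval (a' k) x * meval (a j) x)" by (simp only: aa'[OF x])
        also have "\<dots> = meval (a' k) x ^ e * meval (c j0) x" by (simp add: meval_scale[OF hb] c_def)
        also have "\<dots> = 0" using z x by (simp add: zero_on_def)
        finally show "meval (a k ^ e * msubst (b j0) a') x = 0" .
      qed
      moreover have "\<not> zero_on Z (a k ^ e)" using not_zero_on_power[OF ha ak] P by blast
      ultimately show False 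
        using irreducible[OF homogeneous_power[OF ha[of k], of e] homogeneous_msubst[of e "b j0" d' a', OF hb ha']] ba' by blast
    qed
    obtain i where i: "rep_proj P i \<noteq> 0" using rep_proj_nonzero[of P] by (auto simp: fun_eq_iff)
    have xi: "\<not> zero_on Z (mvar i)" by (rule not_zero_onI[OF P]) (simp add: i)
    have ci: "\<not> zero_on Z (c i)"
    proof
      assume z: "zero_on Z (c i)"
      have "zero_on Z (c j0 * mvar i)" using z cx[of _ i j0] by (simp add: zero_on_def)
      then show False using irreducible[OF hc homogeneous_mvar] cj0 xi by blast
    qed
    have "\<not> zero_on Y (msubst F b) \<and> int (order_at Y (f P) (msubst F b))
        = int (ord P F) + int n * (int (ord P (c i)) - int (ord P (mvar i)))"
      if F: "homogeneous n F" "\<not> zero_on Z F" for n F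
    proof
      let ?K = "msubst (msubst F b) a"
      have hF: "homogeneous (e * n) (msubst F b)" by (rule homogeneous_msubst[OF F(1) hb])
      have hK: "homogeneous (d * (e * n)) ?K" by (rule homogeneous_msubst[OF hF ha])
      have K: "meval (?K * mvar i ^ n) x = meval (c i ^ n * F) x" if x: "x \<in> affine_cone Z" for x
      proof -
        have "meval (?K * mvar i ^ n) x = meval F (\<lambda>j. x i * meval (c j) x)"
          by (simp add: meval_scale[OF F(1)] c_def)
        also have "(\<lambda>j. x i * meval (c j) x) = (\<lambda>j. meval (c i) x * x j)"
          using cx[OF x, of i] by (simp add: mult.commute)
        also have "meval F \<dots> = meval (c i ^ n * F) x" by (simp add: meval_scale[OF F(1)])
        finally show ?thesis .
      qed
      have cin: "\<not> zero_on Z (c i ^ n)" using not_zero_on_power[OF hc ci] P by blast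
      have xin: "\<not> zero_on Z (mvar i ^ n)" using not_zero_on_power[OF homogeneous_mvar xi] P by blast
      have "\<not> zero_on Z (c i ^ n * F)" using not_zero_on_mult[OF homogeneous_power[OF hc] F(1) cin F(2)] .
      then obtain x0 where x0: "x0 \<in> affine_cone Z" "meval (c i ^ n * F) x0 \<noteq> 0" unfolding zero_on_def by blast
      have K0: "\<not> zero_on Z ?K"
      proof
        assume "zero_on Z ?K"
        then have "zero_on Z (?K * mvar i ^ n)" by (rule zero_on_mult(2))
        then show False using x0 K[OF x0(1)] unfolding zero_on_def by metis
      qed
      have "ord P ?K + n * ord P (mvar i) = ord P (?K * mvar i ^ n)"
        using ord_mult[OF P hK K0 homogeneous_power[OF homogeneous_mvar] xin] ord_power[OF P homogeneous_mvar xi] by simp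
      also have "\<dots> = ord P (c i ^ n * F)" by (rule order_at_cong[OF K])
      also have "\<dots> = n * ord P (c i) + ord P F"
        using ord_mult[OF P homogeneous_power[OF hc] cin F] ord_power[OF P hc ci] by simp
      finally have "int (ord P ?K) + int n * int (ord P (mvar i)) = int n * int (ord P (c i)) + int (ord P F)"
        by (metis of_nat_add of_nat_mult)
      moreover have "ord P ?K = order_at Y (f P) (msubst F b)" by (rule order_at_iso[OF iso P a hF])
      ultimately show "int (order_at Y (f P) (msubst F b))
        = int (ord P F) + int n * (int (ord P (c i)) - int (ord P (mvar i)))" by (simp add: algebra_simps)
      have "\<not> zero_on Z (a k * ?K)" by (rule not_zero_on_mult[OF ha hK ak K0])
      then obtain x where x: "x \<in> affine_cone Z" "meval (a k) x \<noteq> 0" "meval (msubst F b) (\<lambda>j. meval (a j) x) \<noteq> 0"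
        by (auto simp: zero_on_def)
      then show "\<not> zero_on Y (msubst F b)" using aY[OF x(1,2)] unfolding zero_on_def by blast
    qed
    then show ?thesis by blast
  qed
  have "\<forall>P\<in>Z. \<exists>\<delta>. \<forall>n F. homogeneous n F \<longrightarrow> \<not> zero_on Z F \<longrightarrow> \<not> zero_on Y (msubst F b) \<and>
      int (order_at Y (f P) (msubst F b)) = int (ord P F) + int n * \<delta>" by (rule ballI) (rule main)
  from bchoice[OF this] obtain \<delta> where
    \<delta>: "\<forall>P\<in>Z. \<forall>n F. homogeneous n F \<longrightarrow> \<not> zero_on Z F \<longrightarrow> \<not> zero_on Y (msubst F b) \<and>
      int (order_at Y (f P) (msubst F b)) = int (ord P F) + int n * \<delta> P" by (rule exE) (rule that)
  show ?thesis
  proof (rule that)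
    show "homogeneous n F \<Longrightarrow> homogeneous (e * n) (msubst F b)" for n F by (rule homogeneous_msubst[OF _ hb])
    show "homogeneous n F \<Longrightarrow> \<not> zero_on Z F \<Longrightarrow> \<not> zero_on Y (msubst F b)" for n F using \<delta> P0 by blast
    show "homogeneous n F \<Longrightarrow> \<not> zero_on Z F \<Longrightarrow> P \<in> Z \<Longrightarrow>
      int (order_at Y (f P) (msubst F b)) = int (ord P F) + int n * \<delta> P" for n F P using \<delta> by blast
  qed
qed

lemma (in projective_curve) principal_transport:
  fixes Y :: "('j::finite, 'a) proj set"
  assumes e: "principal e" and iso: "iso_over S Z Y f" and ne: "Z \<noteq> {}"
  obtains n F G where "homogeneous n F" "homogeneous n G" "\<not> zero_on Y F" "\<not> zero_on Y G"
    "\<And>P. P \<in> Z \<Longrightarrow> e P = int (order_at Y (f P) F) - int (order_at Y (f P) G)"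
proof -
  obtain P0 where P0: "P0 \<in> Z" using ne by blast
  obtain n F G where FG: "homogeneous n F" "homogeneous n G" "\<not> zero_on Z F" "\<not> zero_on Z G"
    and eq: "\<And>P. P \<in> Z \<Longrightarrow> e P = int (ord P F) - int (ord P G)"
    using e unfolding principal_def by blast
  obtain b d \<delta> where h: "\<And>n F. homogeneous n F \<Longrightarrow> homogeneous (d * n) (msubst F b)"
    and nz: "\<And>n F. homogeneous n F \<Longrightarrow> \<not> zero_on Z F \<Longrightarrow> \<not> zero_on Y (msubst F b)"
    and o: "\<And>n F P. homogeneous n F \<Longrightarrow> \<not> zero_on Z F \<Longrightarrow> P \<in> Z \<Longrightarrow>
      int (order_at Y (f P) (msubst F b)) = int (ord P F) + int n * \<delta> P"
    by (rule transport_forms[OF iso P0]) (rule that)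
  show ?thesis
    by (rule that[OF h[OF FG(1)] h[OF FG(2)] nz[OF FG(1,3)] nz[OF FG(2,4)]])
      (simp add: eq o[OF FG(1,3)] o[OF FG(2,4)])
qed

text \<open>The lower bound of Riemann-Roch: \<open>k\<close> conditions, imposed one at a time by
  \<open>linear_system_step\<close>, leave a nonzero member of a system of dimension
  \<open>k + 1\<close>.\<close>

lemma (in projective_curve) ex_form_through:
  fixes I :: "'j set" and f :: "'j \<Rightarrow> ('i, 'a) mpoly"
  assumes I: "finite I" "card I = Suc k" and f: "\<And>i. i \<in> I \<Longrightarrow> homogeneous d (f i)"
    and indep: "\<And>c. zero_on Z (\<Sum>i\<in>I. mconst (c i) * f i) \<Longrightarrow> \<forall>i\<in>I. c i = 0"
    and A: "finite A" "A \<subseteq> Z" "\<And>R. R \<in> Z - A \<Longrightarrow> \<Delta> R = 0" "sum \<Delta> A = k"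
  obtains g where "homogeneous d g" "\<not> zero_on Z g" "\<And>R. R \<in> Z \<Longrightarrow> \<Delta> R \<le> ord R g"
proof -
  have "n < card I \<Longrightarrow> (\<And>R. R \<in> Z - A \<Longrightarrow> \<Delta> R = 0) \<Longrightarrow> sum \<Delta> A = n \<Longrightarrow>
    \<exists>(J :: 'j set) g. finite J \<and> card J + n = card I \<and> (\<forall>i\<in>J. homogeneous d (g i)) \<and>
     (\<forall>c. zero_on Z (\<Sum>i\<in>J. mconst (c i) * g i) \<longrightarrow> (\<forall>i\<in>J. c i = 0)) \<and>
     (\<forall>i\<in>J. \<forall>R\<in>Z. \<Delta> R \<le> ord R (g i))" for n \<Delta>
  proof (induction n arbitrary: \<Delta>)
    case 0
    have "\<Delta> R = 0" if "R \<in> Z" for R using 0 that A(1) by (cases "R \<in> A") auto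
    then show ?case using I(1) f indep by (intro exI[of _ I] exI[of _ f]) auto
  next
    case (Suc n)
    have "\<exists>P\<in>A. \<Delta> P \<noteq> 0"
    proof (rule ccontr)
      assume "\<not> ?thesis"
      then have "sum \<Delta> A = 0" by simp
      then show False using Suc.prems(3) by simp
    qed
    then obtain P where P: "P \<in> A" "\<Delta> P \<noteq> 0" by blast
    define \<Delta>' where "\<Delta>' = (\<lambda>R. \<Delta> R - of_bool (R = P))"
    have \<Delta>': "\<Delta> R = \<Delta>' R + of_bool (R = P)" for R using P(2) by (simp add: \<Delta>'_def)
    have "sum \<Delta> A = sum \<Delta>' A + 1" unfolding \<Delta>' sum.distrib using A(1) P(1) by simp
    then have "sum \<Delta>' A = n" using Suc.prems(3) by simp
    moreover have "\<Delta>' R = 0" if "R \<in> Z - A" for R using Suc.prems(2)[OF that] by (simp add: \<Delta>'_def)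
    ultimately obtain J :: "'j set" and g where J: "finite J" "card J + n = card I"
      "\<forall>i\<in>J. homogeneous d (g i)" "\<forall>c. zero_on Z (\<Sum>i\<in>J. mconst (c i) * g i) \<longrightarrow> (\<forall>i\<in>J. c i = 0)"
      "\<forall>i\<in>J. \<forall>R\<in>Z. \<Delta>' R \<le> ord R (g i)"
      using Suc.IH[of \<Delta>'] Suc.prems(1) by auto
    have "card J = Suc (Suc (card I - Suc (Suc n)))" using J(2) Suc.prems(1) by simp
    from linear_system_step[of J "card I - Suc (Suc n)" P d g \<Delta>', OF J(1) this] J(3,4,5) P(1) A(2)
    obtain J' :: "'j set" and g' where J': "finite J'" "card J' = Suc (card I - Suc (Suc n))"
      "\<forall>i\<in>J'. homogeneous d (g' i)" "\<forall>c. zero_on Z (\<Sum>i\<in>J'. mconst (c i) * g' i) \<longrightarrow> (\<forall>i\<in>J'. c i = 0)"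
      "\<forall>i\<in>J'. \<forall>R\<in>Z. \<Delta>' R + of_bool (R = P) \<le> ord R (g' i)"
      by blast
    have "card J' + Suc n = card I" using J'(2) Suc.prems(1) by simp
    then show ?case using J' unfolding \<Delta>' by blast
  qed
  from this[of k \<Delta>] A(3,4) I(2) obtain J :: "'j set" and g where J: "card J = 1"
      "\<forall>i\<in>J. homogeneous d (g i)" "\<forall>c. zero_on Z (\<Sum>i\<in>J. mconst (c i) * g i) \<longrightarrow> (\<forall>i\<in>J. c i = 0)"
      "\<forall>i\<in>J. \<forall>R\<in>Z. \<Delta> R \<le> ord R (g i)" by auto
  obtain q where q: "J = {q}" using J(1) by (rule card_1_singletonE)
  have "\<not> zero_on Z (g q)" using J(3)[THEN spec, of "\<lambda>_. 1"] by (auto simp: q zero_on_def)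
  then show ?thesis using that[of "g q"] J(2,4) by (simp add: q)
qed

section \<open>Independence of the coordinates on the curve\<close>

context diagonal_quadrics
begin

text \<open>At a point with \<open>co t x = 1\<close> and at its reflection the values of the form
  differ by \<open>2 * c t\<close>.\<close>

lemma linear_form_coeffs_zero:
  assumes "\<And>x. x \<in> affine_cone Z \<Longrightarrow> (\<Sum>t\<in>UNIV. c t * co t x) = 0"
  shows "c t = 0"
proof -
  obtain t' where t': "t \<noteq> t'"
    by (cases "t = 1") (use that[of 2] that[of 1] in auto)
  obtain x where x: "x \<in> affine_cone Z" "co t x = 1" by (rule ex_cone_point[OF t', of 1 0]) auto
  have "0 = (\<Sum>s\<in>UNIV. c s * co s x) - (\<Sum>s\<in>UNIV. c s * co s (reflect t x))" using assms x(1) by simp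
  also have "\<dots> = (\<Sum>s\<in>UNIV. c s * co s x - c s * co s (reflect t x))" by (simp add: sum_subtractf)
  also have "\<dots> = (\<Sum>s\<in>UNIV. if s = t then 2 * c t else 0)" by (rule sum.cong) (auto simp: co_reflect x(2))
  also have "\<dots> = 2 * c t" by simp
  finally show ?thesis by simp
qed

lemma linear_form_not_zero_on:
  assumes f: "homogeneous 1 f" "meval f y \<noteq> 0"
  shows "\<not> zero_on Z f"
proof
  assume "zero_on Z f"
  obtain c where c: "\<And>x. meval f x = (\<Sum>t\<in>UNIV. c t * co t x)" by (rule linear_form_expand[OF f(1)]) blast
  have "c t = 0" for t by (rule linear_form_coeffs_zero) (use \<open>zero_on Z f\<close> in \<open>simp add: zero_on_def flip: c\<close>)
  then show False using f(2) c by simp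
qed

lemma nonempty: "Z \<noteq> {}"
proof -
  obtain x where "x \<in> affine_cone Z" by (rule ex_cone_point[of 1 2 1 0]) auto
  then show ?thesis by (auto simp: affine_cone_def)
qed

end

section \<open>The hyperplane sections of the two coverings\<close>

context diagonal_covering
begin

abbreviation pull :: "(4, 'a) mpoly \<Rightarrow> (4, 'a) mpoly" where "pull m \<equiv> msubst m pt_form"

lemma homogeneous_pull: "homogeneous n m \<Longrightarrow> homogeneous (2 * n) (pull m)"
  by (rule homogeneous_msubst[OF _ homogeneous_pt_form])

lemma meval_pull: "meval (pull m) w = meval m (pt w)"
  by (simp add: pt_def)

lemma pt_nonzero: "P \<in> D \<Longrightarrow> pt (rep_proj P) \<noteq> (\<lambda>_. 0)"
  using affine_cone_nonzero[OF pt_in_cone] by simp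

lemma meval_proj_pt:
  assumes "P \<in> D" "homogeneous n m"
  shows "meval m (rep_proj (proj_pt P)) = 0 \<longleftrightarrow> meval m (pt (rep_proj P)) = 0"
  using vanishes_abs[OF assms(2) pt_nonzero[OF assms(1)]] by (simp add: vanishes_rep proj_pt_def)

lemma proj_pt_surjective:
  assumes "Q \<in> C" obtains P where "P \<in> D" "proj_pt P = Q"
proof -
  have "rep_proj Q \<in> affine_cone C" using assms by simp
  then obtain w where w: "w \<in> affine_cone D" "pt w = rep_proj Q" by (rule pt_surjective)
  then have "abs_proj w \<in> D" "proj_pt (abs_proj w) = Q" by (simp_all add: proj_pt_abs) (simp add: affine_cone_def)
  then show ?thesis by (rule that)
qed

lemma pull_not_zero_on: "\<not> zero_on C m \<Longrightarrow> \<not> zero_on D (pull m)"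
proof -
  assume "\<not> zero_on C m"
  then obtain x where x: "x \<in> affine_cone C" "meval m x \<noteq> 0" by (auto simp: zero_on_def)
  obtain w where "w \<in> affine_cone D" "pt w = x" using x(1) by (rule pt_surjective)
  then show ?thesis using x(2) meval_pull[of m w] unfolding zero_on_def by metis
qed

text \<open>The chord at \<open>P\<close> through a pair of parameters is a uniformizer, and a multiple of it is
  the pullback of a linear form; hence the covering is unramified.\<close>

lemma ex_pulled_chord:
  assumes P: "P \<in> D"
  obtains g s z where "homogeneous 1 g" "meval (\<eta> s) (rep_proj P) \<noteq> 0" "uniformizer D P 1 (D.chord P s z)"
    "\<not> zero_on D (D.chord P s z)" "\<And>w. w \<in> affine_cone D \<Longrightarrow> meval (pull g) w = meval (D.chord P s z * \<eta> s) w"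
proof -
  obtain z where z: "\<And>t. t \<noteq> z \<Longrightarrow> meval (\<eta> t) (rep_proj P) \<noteq> 0" using D.ex_coordinate_zero[OF P] by blast
  have u: "I.param (pt w) (uu w)" "II.param (pt w) (vv w)" if "w \<in> affine_cone D" for w
    using that cone_D_iff param_I_pt param_II_pt by auto
  note goal = that
  have use_it: thesis if zs: "z \<noteq> s" and g: "homogeneous 1 g"
    "\<And>w. w \<in> affine_cone D \<Longrightarrow> meval (pull g) w = meval (D.chord P s z * \<eta> s) w" for s g
  proof (rule goal[OF g(1) z[OF zs[symmetric]] _ D.chord_not_zero_on[OF P zs z[OF zs[symmetric]]] g(2)])
    show "uniformizer D P 1 (D.chord P s z)" by (rule D.uniformizer_chord[OF P zs]) (rule z)
  qed
  let ?p = "\<lambda>x y (t::2). if t = 1 then x else y :: 'a" and ?e = "\<lambda>t. meval (\<eta> t) (rep_proj P)"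
  have "z \<in> {1, 2, 3, 4}" using UNIV_4[OF four_distinct] by blast
  then consider "z = 1" | "z = 2" | "z = 3" | "z = 4" by blast
  then show ?thesis
  proof cases
    \<comment> \<open>The chord is a linear form in \<open>u\<close> if \<open>z\<close> is 1 or 2,
      and in \<open>v\<close> otherwise. Its product with \<open>\<eta> s\<close> is quadratic in
      the same parameters, so it descends to a form \<open>tau\<close> for the corresponding
      cone.\<close>
    case 1
    show ?thesis
      by (rule use_it[of 2 "I.tau (?p (?e 2) (- ?e 1)) (?p 0 1)"], simp add: 1, rule I.homogeneous_tau, simp add: 1 meval_pull I.meval_tau[OF u(1)] lin2_def D.meval_chord del: meval_msubst)
  next
    case 2
    show ?thesis
      by (rule use_it[of 1 "I.tau (?p (- ?e 2) (?e 1)) (?p 1 0)"], simp add: 2, rule I.homogeneous_tau, simp add: 2 meval_pull I.meval_tau[OF u(1)] lin2_def D.meval_chord del: meval_msubst)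
  next
    case 3
    show ?thesis
      by (rule use_it[of 4 "II.tau (?p (?e 4) (- ?e 3)) (?p 0 1)"], simp add: 3, rule II.homogeneous_tau, simp add: 3 meval_pull II.meval_tau[OF u(2)] lin2_def D.meval_chord del: meval_msubst)
  next
    case 4
    show ?thesis
      by (rule use_it[of 3 "II.tau (?p (- ?e 4) (?e 3)) (?p 1 0)"], simp add: 4, rule II.homogeneous_tau, simp add: 4 meval_pull II.meval_tau[OF u(2)] lin2_def D.meval_chord del: meval_msubst)
  qed
qed

text \<open>The order is positive because \<open>t\<close> vanishes at the image point. It is at
  most one because the pulled back linear form of \<open>ex_pulled_chord\<close>, of order one, is
  locally a multiple of the pullback of \<open>t\<close>.\<close>

lemma ord_pull_uniformizer:
  assumes P: "P \<in> D" and t: "uniformizer C (proj_pt P) d t" "\<not> zero_on C t"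
  shows "D.ord P (pull t) = 1"
proof -
  have ht: "homogeneous d t" "meval t (rep_proj (proj_pt P)) = 0"
    using t(1) by (auto simp: uniformizer_def vanishes_rep)
  note pt = homogeneous_pull[OF ht(1)] pull_not_zero_on[OF t(2)]
  have "meval (pull t) (rep_proj P) = 0" using ht(2) meval_proj_pt[OF P ht(1)] by (simp only: meval_pull)
  then have pos: "0 < D.ord P (pull t)" using D.ord_pos_iff[OF P pt] by blast
  obtain g s z where g: "homogeneous 1 g" and s: "meval (\<eta> s) (rep_proj P) \<noteq> 0"
    and ch: "uniformizer D P 1 (D.chord P s z)" "\<not> zero_on D (D.chord P s z)"
    and eq: "\<And>w. w \<in> affine_cone D \<Longrightarrow> meval (pull g) w = meval (D.chord P s z * \<eta> s) w"
    by (rule ex_pulled_chord[OF P]) (rule that)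
  let ?c = "D.chord P s z"
  have "meval ?c (rep_proj P) = 0" by (simp add: D.meval_chord)
  then have "meval (pull g) (rep_proj P) = 0" using eq[of "rep_proj P"] P by simp
  then have "meval g (rep_proj (proj_pt P)) = 0" using meval_proj_pt[OF P g] by (simp only: meval_pull)
  then have "local_mult C (proj_pt P) 1 g d t" by (intro uniformizer_mult[OF t(1) g]) (simp add: vanishes_rep)
  then obtain dU dV U W where UW: "homogeneous dU U" "homogeneous dV W" "meval U (rep_proj (proj_pt P)) \<noteq> 0"
    "\<And>x. x \<in> affine_cone C \<Longrightarrow> meval U x * meval g x = meval W x * meval t x"
    unfolding local_mult_def by blast
  have U: "meval (pull U) (rep_proj P) \<noteq> 0" using UW(3) meval_proj_pt[OF P UW(1)] by (simp only: meval_pull not_False_eq_True)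
  have c1: "D.ord P ?c = 1"
    by (rule D.order_at_local_assoc(2)[OF P ch D.homogeneous_chord D.local_assoc_uniformizer])
  have hce: "homogeneous (1 + 1) (?c * \<eta> s)" by (intro homogeneous_mult D.homogeneous_chord homogeneous_eta)
  have es: "\<not> zero_on D (\<eta> s)" by (rule not_zero_onI[OF P s])
  have ce: "\<not> zero_on D (?c * \<eta> s)"
    by (rule D.not_zero_on_mult[OF D.homogeneous_chord homogeneous_eta ch(2) es])
  have ordce: "D.ord P (?c * \<eta> s) = 1"
    using D.ord_mult[OF P D.homogeneous_chord ch(2) homogeneous_eta es] D.ord_eq_0[OF P homogeneous_eta s] c1 by simp
  have Unz: "\<not> zero_on D (pull U)" by (rule not_zero_onI[OF P U])
  have E: "meval (pull U * (?c * \<eta> s)) w = meval (pull W * pull t) w" if w: "w \<in> affine_cone D" for w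
    using UW(4)[OF pt_in_cone[OF w]] by (simp only: meval_mult[of "pull U"] meval_mult[of "pull W"] meval_pull flip: eq[OF w])
  have nz: "\<not> zero_on D (pull U * (?c * \<eta> s))"
    by (rule D.not_zero_on_mult[OF homogeneous_pull[OF UW(1)] hce Unz ce])
  have W: "\<not> zero_on D (pull W)"
  proof
    assume "zero_on D (pull W)"
    then have "zero_on D (pull W * pull t)" by (rule zero_on_mult)
    then show False using nz E unfolding zero_on_def by metis
  qed
  have "D.ord P (pull U * (?c * \<eta> s)) = D.ord P (pull W * pull t)" by (rule order_at_cong[OF E])
  then have "1 = D.ord P (pull W) + D.ord P (pull t)"
    using D.ord_mult[OF P homogeneous_pull[OF UW(1)] Unz hce ce] D.ord_eq_0[OF P homogeneous_pull[OF UW(1)] U] ordce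
      D.ord_mult[OF P homogeneous_pull[OF UW(2)] W pt] by simp
  then show ?thesis using pos by simp
qed

lemma ord_pull:
  assumes P: "P \<in> D" and m: "homogeneous n m" "\<not> zero_on C m"
  shows "D.ord P (pull m) = order_at C (proj_pt P) m"
proof -
  have Q: "proj_pt P \<in> C" by (rule proj_pt_in[OF P])
  obtain d t where t: "uniformizer C (proj_pt P) d t" "\<not> zero_on C t" using I.smooth[OF Q] by blast
  have ht: "homogeneous d t" using t(1) by (simp add: uniformizer_def)
  define k where "k = order_at C (proj_pt P) m"
  from I.ord_local_assoc[OF Q t m, folded k_def] obtain dU dV U W where UW: "homogeneous dU U" "homogeneous dV W"
    "meval U (rep_proj (proj_pt P)) \<noteq> 0" "meval W (rep_proj (proj_pt P)) \<noteq> 0"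
    "\<And>x. x \<in> affine_cone C \<Longrightarrow> meval U x * meval m x = meval W x * meval (t ^ k) x"
    unfolding local_assoc_def by blast
  have U: "meval (pull U) (rep_proj P) \<noteq> 0" using UW(3) meval_proj_pt[OF P UW(1)] by (simp only: meval_pull not_False_eq_True)
  have W: "meval (pull W) (rep_proj P) \<noteq> 0" using UW(4) meval_proj_pt[OF P UW(2)] by (simp only: meval_pull not_False_eq_True)
  note pm = homogeneous_pull[OF m(1)] pull_not_zero_on[OF m(2)]
  note pt = homogeneous_pull[OF ht] pull_not_zero_on[OF t(2)]
  have ptk: "\<not> zero_on D (pull t ^ k)" using D.not_zero_on_power[OF pt] P by blast
  have E: "meval (pull U * pull m) w = meval (pull W * pull t ^ k) w" if w: "w \<in> affine_cone D" for w
    using UW(5)[OF pt_in_cone[OF w]] by (simp only: meval_mult meval_power meval_pull)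
  have "D.ord P (pull U * pull m) = D.ord P (pull W * pull t ^ k)" by (rule order_at_cong[OF E])
  then show ?thesis
    using D.ord_mult[OF P homogeneous_pull[OF UW(1)] not_zero_onI[OF P U] pm] D.ord_eq_0[OF P homogeneous_pull[OF UW(1)] U]
      D.ord_mult[OF P homogeneous_pull[OF UW(2)] not_zero_onI[OF P W] homogeneous_power[OF pt(1)] ptk]
      D.ord_eq_0[OF P homogeneous_pull[OF UW(2)] W] D.ord_power[OF P pt] ord_pull_uniformizer[OF P t]
    by (simp add: k_def)
qed

definition uform :: "(2 \<Rightarrow> 'a) \<Rightarrow> (4, 'a) mpoly" where "uform s = mconst (s 1) * \<eta> 1 + mconst (s 2) * \<eta> 2"
definition vform :: "(2 \<Rightarrow> 'a) \<Rightarrow> (4, 'a) mpoly" where "vform s = mconst (s 1) * \<eta> 3 + mconst (s 2) * \<eta> 4"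

lemma meval_uform: "meval (uform s) w = lin2 s (uu w)"
  by (simp add: uform_def lin2_def)

lemma meval_vform: "meval (vform s) w = lin2 s (vv w)"
  by (simp add: vform_def lin2_def)

lemma homogeneous_uform: "homogeneous 1 (uform s)"
  unfolding uform_def by (intro homogeneous_add homogeneous_cmult homogeneous_eta)

lemma homogeneous_vform: "homogeneous 1 (vform s)"
  unfolding vform_def by (intro homogeneous_add homogeneous_cmult homogeneous_eta)

lemma pull_tau_I: "w \<in> affine_cone D \<Longrightarrow> meval (pull (I.tau s s')) w = lin2 s (uu w) * lin2 s' (uu w)"
  unfolding meval_pull by (rule I.meval_tau[OF param_I_pt])

lemma pull_tau_II: "w \<in> affine_cone D \<Longrightarrow> meval (pull (II.tau s s')) w = lin2 s (vv w) * lin2 s' (vv w)"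
  unfolding meval_pull by (rule II.meval_tau) (simp add: param_II_pt cone_D_iff)

lemma uform_not_zero_on:
  assumes "s \<noteq> (\<lambda>_. 0)" shows "\<not> zero_on D (uform s)"
proof
  assume z: "zero_on D (uform s)"
  have "zero_on D (pull (I.tau s s))" using z by (simp add: zero_on_def pull_tau_I meval_uform del: meval_msubst)
  then show False using pull_not_zero_on[OF I.tau_not_zero_on[OF assms assms]] by blast
qed

lemma vform_not_zero_on:
  assumes "s \<noteq> (\<lambda>_. 0)" shows "\<not> zero_on D (vform s)"
proof
  assume z: "zero_on D (vform s)"
  have "zero_on D (pull (II.tau s s))" using z by (simp add: zero_on_def pull_tau_II meval_vform del: meval_msubst)
  then show False using pull_not_zero_on[OF II.tau_not_zero_on[OF assms assms]] by blast
qed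

text \<open>The tangent plane \<open>tau s s\<close> pulls back to the square of the linear form
  \<open>uform s\<close>. Thus half of its divisor, a fibre of the projection from the cone, pulls
  back to a plane section of \<open>D\<close>.\<close>

lemma ord_uform:
  assumes P: "P \<in> D" and s: "s \<noteq> (\<lambda>_. 0)"
  shows "2 * D.ord P (uform s) = order_at C (proj_pt P) (I.tau s s)"
proof -
  have "D.ord P (uform s ^ 2) = D.ord P (pull (I.tau s s))"
    by (rule order_at_cong) (simp add: pull_tau_I meval_uform power2_eq_square del: meval_msubst)
  then show ?thesis
    using D.ord_power[OF P homogeneous_uform uform_not_zero_on[OF s], of 2]
      ord_pull[OF P I.homogeneous_tau I.tau_not_zero_on[OF s s]] by simp
qed

lemma ord_vform:
  assumes P: "P \<in> D" and s: "s \<noteq> (\<lambda>_. 0)"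
  shows "2 * D.ord P (vform s) = order_at C (proj_pt P) (II.tau s s)"
proof -
  have "D.ord P (vform s ^ 2) = D.ord P (pull (II.tau s s))"
    by (rule order_at_cong) (simp add: pull_tau_II meval_vform power2_eq_square del: meval_msubst)
  then show ?thesis
    using D.ord_power[OF P homogeneous_vform vform_not_zero_on[OF s], of 2]
      ord_pull[OF P II.homogeneous_tau II.tau_not_zero_on[OF s s]] by simp
qed

lemma fibre_indicator:
  assumes "P \<in> D" "R \<in> D"
  shows "of_bool (R = P) + of_bool (iota_pt R = P) = (of_bool (proj_pt R = proj_pt P) :: nat)"
  using proj_pt_fibre[OF assms(2,1)] proj_pt_iota[OF assms(2)] iota_pt_no_fixed_point[OF assms(2)] iota_pt_iota_pt[of R] by auto

lemma meval_eta_expand: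
  assumes "homogeneous 1 f"
  obtains s s' where "\<And>w. meval f w = lin2 s (uu w) + lin2 s' (vv w)"
proof -
  obtain c where c: "\<And>x. meval f x = (\<Sum>t\<in>UNIV. c t * meval (\<eta> t) x)"
    by (rule D.linear_form_expand[OF assms]) (rule that)
  show ?thesis
    by (rule that[of "\<lambda>t. if t = 1 then c 1 else c 2" "\<lambda>t. if t = 1 then c 3 else c 4"])
      (simp add: c sum_4[OF four_distinct] lin2_def)
qed

end

text \<open>The two coverings use complementary pairs of cones in the same diagonal coordinates of
  \<open>C\<close>, which makes their plane sections comparable with divisors on
  \<open>C\<close>.\<close>

locale covering_pair =
  one: diagonal_covering C \<xi> V a b i j k l rj rk rl si sk sl D \<eta> +
  two: diagonal_covering C \<xi> V a b k l i j rj' rk' rl' si' sk' sl' D' \<eta>'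
  for C :: "(4, 'a::{alg_closed_field, field_char_0}) proj set" and \<xi> V a b i j k l rj rk rl si sk sl D \<eta>
    rj' rk' rl' si' sk' sl' D' \<eta>' +
  fixes \<psi> :: "(4, 'a) proj \<Rightarrow> (4, 'a) proj"
  assumes iso: "iso_over UNIV D D' \<psi>"
    and compatible: "P \<in> D \<Longrightarrow> two.proj_pt (\<psi> P) = one.proj_pt P"
begin

lemma psi_in: "P \<in> D \<Longrightarrow> \<psi> P \<in> D'"
  using iso by (auto simp: iso_over_def morphism_over_def)

lemma psi_bij: "bij_betw \<psi> D D'"
proof -
  obtain g where g: "\<And>P. P \<in> D \<Longrightarrow> \<psi> P \<in> D'" "\<And>Q. Q \<in> D' \<Longrightarrow> g Q \<in> D"
    "\<And>P. P \<in> D \<Longrightarrow> g (\<psi> P) = P" "\<And>Q. Q \<in> D' \<Longrightarrow> \<psi> (g Q) = Q"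
    by (rule iso_overE[OF iso]) (rule that)
  show ?thesis by (rule bij_betwI[of \<psi> D D' g]) (use g in auto)
qed

lemma bezout_psi:
  assumes g: "homogeneous n g" "\<not> zero_on D' g"
  defines "A \<equiv> {R\<in>D. meval g (rep_proj (\<psi> R)) = 0}"
  shows "finite A" "(\<Sum>R\<in>A. order_at D' (\<psi> R) g) = 4 * n"
proof -
  let ?B = "{S\<in>D'. meval g (rep_proj S) = 0}"
  have bij: "bij_betw \<psi> A ?B"
    using psi_bij psi_in unfolding bij_betw_def inj_on_def A_def by (auto 0 4 simp: image_iff)
  show "finite A" using bij_betw_finite[OF bij] two.D.finite_zeros[OF g] by blast
  have "(\<Sum>R\<in>A. order_at D' (\<psi> R) g) = (\<Sum>S\<in>?B. order_at D' S g)" by (rule sum.reindex_bij_betw[OF bij])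
  also have "\<dots> = 4 * n" using two.D.bezout[OF g] by simp
  finally show "(\<Sum>R\<in>A. order_at D' (\<psi> R) g) = 4 * n" .
qed

text \<open>Transport goes from the source of an isomorphism to its target, so it is applied to the
  inverse of \<open>\<psi>\<close>.\<close>

lemma principal_pullback:
  assumes g: "homogeneous n g" "\<not> zero_on D' g" "homogeneous n g'" "\<not> zero_on D' g'"
  shows "one.D.principal (\<lambda>P. int (order_at D' (\<psi> P) g) - int (order_at D' (\<psi> P) g'))"
proof -
  obtain f where f: "morphism_over UNIV D D' \<psi>" "morphism_over UNIV D' D f" "\<And>P. P \<in> D \<Longrightarrow> f (\<psi> P) = P"
    "\<And>Q. Q \<in> D' \<Longrightarrow> \<psi> (f Q) = Q" by (rule iso_overE[OF iso]) (rule that)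
  have iso': "iso_over UNIV D' D f" unfolding iso_over_def using f by blast
  have pr: "two.D.principal (\<lambda>P. int (order_at D' P g) - int (order_at D' P g'))"
    unfolding two.D.principal_def using g by blast
  obtain m F G where FG: "homogeneous m F" "homogeneous m G" "\<not> zero_on D F" "\<not> zero_on D G"
    "\<And>P. P \<in> D' \<Longrightarrow> int (order_at D' P g) - int (order_at D' P g') = int (order_at D (f P) F) - int (order_at D (f P) G)"
    by (rule two.D.principal_transport[OF pr iso' two.D.nonempty]) (rule that)
  have "\<forall>P\<in>D. int (order_at D' (\<psi> P) g) - int (order_at D' (\<psi> P) g') = int (order_at D P F) - int (order_at D P G)"
    using FG(5)[OF psi_in] f(3) by simp
  then show ?thesis unfolding one.D.principal_def using FG(1-4) by blast
qed

text \<open>Take a hyperplane section of \<open>D'\<close> through \<open>\<psi> w0\<close>. A plane through the points of \<open>D\<close>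
  corresponding to the other three meets \<open>D\<close> in a fourth point, and it remains to see that this
  is the other point \<open>w1\<close> of the fibre. The norm of the equation of the plane shows that the
  images on \<open>C\<close> of the fourth point and of \<open>w0\<close> are equivalent, hence equal. The two points do
  not coincide, because otherwise the equation would be an eigenvector of the involution, and the
  fibres of the projections from two different cones would be equivalent.\<close>

lemma fourth_point:
  assumes w0: "w0 \<in> D" and w1: "w1 \<in> D" and fib: "one.proj_pt w1 = one.proj_pt w0" "w1 \<noteq> w0"
    and r: "r \<noteq> (\<lambda>_. 0)" and r0: "meval (two.uform r) (rep_proj (\<psi> w0)) = 0"
  obtains f where "homogeneous 1 f" "\<not> zero_on D f"
    "\<And>R. R \<in> D \<Longrightarrow> order_at D R f + of_bool (R = w0) = order_at D' (\<psi> R) (two.uform r) + of_bool (R = w1)"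
proof -
  let ?g = "two.uform r" and ?\<tau> = "two.I.tau r r"
  have g: "homogeneous 1 ?g" "\<not> zero_on D' ?g" by (rule two.homogeneous_uform, rule two.uform_not_zero_on[OF r])
  have \<tau>: "homogeneous 1 ?\<tau>" "\<not> zero_on C ?\<tau>" by (rule two.I.homogeneous_tau, rule two.I.tau_not_zero_on[OF r r])
  define \<Delta> where "\<Delta> R = order_at D' (\<psi> R) ?g" for R
  have \<Delta>\<tau>: "2 * \<Delta> R = order_at C (one.proj_pt R) ?\<tau>" if "R \<in> D" for R
    using two.ord_uform[OF psi_in[OF that] r] compatible[OF that] by (simp add: \<Delta>_def)
  \<comment> \<open>Twice the section depends only on the image in \<open>C\<close>, so the section
    is symmetric under the involution.\<close>
  have \<Delta>iota: "\<Delta> (one.iota_pt R) = \<Delta> R" if "R \<in> D" for R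
    using \<Delta>\<tau>[OF that] \<Delta>\<tau>[of "one.iota_pt R"] that by simp
  define A where "A = {R\<in>D. meval ?g (rep_proj (\<psi> R)) = 0}"
  have A: "finite A" "sum \<Delta> A = 4" "A \<subseteq> D" using bezout_psi[OF g] by (auto simp: A_def \<Delta>_def)
  have \<Delta>0: "\<Delta> R = 0 \<longleftrightarrow> R \<notin> A" if "R \<in> D" for R
    using two.D.ord_pos_iff[OF psi_in[OF that] g] that by (auto simp: \<Delta>_def A_def)
  have w0A: "w0 \<in> A" using w0 r0 by (simp add: A_def)
  \<comment> \<open>The section without \<open>w0\<close> has degree three, which matches the number
    of conditions that a plane can satisfy.\<close>
  define \<Delta>' where "\<Delta>' R = \<Delta> R - of_bool (R = w0)" for R
  have \<Delta>': "\<Delta> R = \<Delta>' R + of_bool (R = w0)" if "R \<in> D" for R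
    using \<Delta>0[OF that] w0A by (auto simp: \<Delta>'_def)
  have "sum \<Delta> A = (\<Sum>R\<in>A. \<Delta>' R + of_bool (R = w0))" by (rule sum.cong) (use A(3) \<Delta>' in auto)
  also have "\<dots> = sum \<Delta>' A + 1" using A(1) w0A by (simp add: sum.distrib)
  finally have sum3: "sum \<Delta>' A = 3" using A(2) by simp
  obtain f where f: "homogeneous 1 f" "\<not> zero_on D f" and le: "\<And>R. R \<in> D \<Longrightarrow> \<Delta>' R \<le> order_at D R f"
  proof (rule one.D.ex_form_through[of "UNIV :: 4 set" 3 1 \<eta> A \<Delta>'])
    show "\<forall>t\<in>UNIV. c t = 0" if z: "zero_on D (\<Sum>t\<in>UNIV. mconst (c t) * \<eta> t)" for c
    proof
      fix t show "c t = 0" by (rule one.D.linear_form_coeffs_zero) (use z in \<open>simp add: zero_on_def\<close>)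
    qed
    show "\<Delta>' R = 0" if "R \<in> D - A" for R using that \<Delta>0[of R] by (simp add: \<Delta>'_def)
  qed (use A sum3 one.homogeneous_eta in auto)
  define B where "B = A \<union> {R\<in>D. meval f (rep_proj R) = 0}"
  have B: "finite B" "B \<subseteq> D" "A \<subseteq> B" using A one.D.finite_zeros[OF f] by (auto simp: B_def)
  have outside: "order_at D R f = 0" "\<Delta>' R = 0" if "R \<in> D" "R \<notin> B" for R
    using that one.D.ord_eq_0[OF that(1) f(1)] \<Delta>0[of R] by (auto simp: B_def \<Delta>'_def)
  have "(\<Sum>R\<in>B. order_at D R f) = 4" using one.D.bezout_superset[OF f B(1,2)] by (auto simp: B_def)
  moreover have "sum \<Delta>' B = sum \<Delta>' A"
    by (rule sum.mono_neutral_right[OF B(1,3)]) (use B(2) \<Delta>0 w0A in \<open>auto simp: \<Delta>'_def\<close>)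
  moreover have "(\<Sum>R\<in>B. order_at D R f - \<Delta>' R) = (\<Sum>R\<in>B. order_at D R f) - sum \<Delta>' B"
    by (rule sum_subtractf_nat) (use B(2) le in auto)
  ultimately have "(\<Sum>R\<in>B. order_at D R f - \<Delta>' R) = 1" using sum3 by simp
  then obtain w where w: "w \<in> B" "order_at D w f - \<Delta>' w = 1"
    "\<forall>R\<in>B. w \<noteq> R \<longrightarrow> order_at D R f - \<Delta>' R = 0" unfolding sum_eq_1_iff[OF B(1)] by blast
  have wD: "w \<in> D" using w(1) B(2) by blast
  have ordf: "order_at D R f + of_bool (R = w0) = \<Delta> R + of_bool (R = w)" if "R \<in> D" for R
  proof -
    have "order_at D R f = \<Delta>' R + of_bool (R = w)"
      using w outside[OF that] le[OF that] by (cases "R \<in> B"; cases "R = w") auto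
    then show ?thesis using \<Delta>'[OF that] by simp
  qed
  obtain s s' where s: "\<And>x. meval f x = lin2 s (one.uu x) + lin2 s' (one.vv x)"
    by (rule one.meval_eta_expand[OF f(1)]) (rule that)
  define f' where "f' = one.iota_form f"
  have neg: "lin2 t (\<lambda>m. - v m) = - lin2 t v" for t v :: "2 \<Rightarrow> 'a" by (simp add: lin2_def)
  have f': "meval f' x = lin2 s (one.uu x) - lin2 s' (one.vv x)" for x
    unfolding f'_def one.meval_iota_form s one.uu_iota neg by simp
  have hf': "homogeneous 1 f'" "\<not> zero_on D f'"
    unfolding f'_def by (rule one.homogeneous_iota_form[OF f(1)], rule one.iota_form_not_zero_on[OF f(2)])
  have ordf': "order_at D R f' = order_at D (one.iota_pt R) f" if "R \<in> D" for R
    unfolding f'_def by (rule one.order_iota_form[OF that f(1)])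
  have ww0: "w \<noteq> w0"
  proof
    assume "w = w0"
    then have of: "order_at D R f = \<Delta> R" if "R \<in> D" for R using ordf[OF that] by simp
    have "order_at D R f \<le> order_at D R f'" if "R \<in> D" for R
      using ordf'[OF that] of[OF that] of[of "one.iota_pt R"] \<Delta>iota[OF that] that by simp
    from one.D.proportional_of_divisor_le[OF hf' f this] obtain c where
      "c \<noteq> 0" "zero_on D (f' - mconst c * f)" by blast
    then have z: "lin2 s (one.uu x) - lin2 s' (one.vv x) = c * (lin2 s (one.uu x) + lin2 s' (one.vv x))"
      if "x \<in> affine_cone D" for x using that by (simp add: zero_on_def f' s)
    \<comment> \<open>These are the coefficients of \<open>f' - c f\<close>. All of them vanish, and
      since \<open>c\<close> cannot be both 1 and \<open>-1\<close>, either the part of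
      \<open>f\<close> in \<open>u\<close> or its part in \<open>v\<close> is zero.\<close>
    define e where "e = (\<lambda>t::4. if t = 1 then (1 - c) * s 1 else if t = 2 then (1 - c) * s 2
      else if t = 3 then (- 1 - c) * s' 1 else (- 1 - c) * s' 2)"
    have "e t = 0" for t
    proof (rule one.D.linear_form_coeffs_zero)
      fix x assume "x \<in> affine_cone D"
      from z[OF this] show "(\<Sum>t\<in>UNIV. e t * meval (\<eta> t) x) = 0"
        unfolding sum_4[OF one.four_distinct] by (simp add: e_def lin2_def algebra_simps)
    qed
    from this[of 1] this[of 2] this[of 3] this[of 4]
    have "c = 1 \<or> s = (\<lambda>_. 0)" "c = -1 \<or> s' = (\<lambda>_. 0)" by (auto simp: e_def fun_2_eq_iff)
    moreover have "(1::'a) \<noteq> -1" by simp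
    ultimately consider "s = (\<lambda>_. 0)" | "s' = (\<lambda>_. 0)" by metis
    then show False
    proof cases
      case 1
      have ev: "meval f x = meval (one.vform s') x" for x using s 1 by (simp add: one.meval_vform lin2_def)
      then have s'0: "s' \<noteq> (\<lambda>_. 0)" using f(2) by (auto simp: zero_on_def one.meval_vform lin2_def)
      \<comment> \<open>Twice the plane section is the pullback of a tangent plane of the cone
        \<open>j\<close> and also of the cone \<open>k\<close>; so these have equal divisors on
        \<open>C\<close>, and half of their difference is the zero divisor.\<close>
      have half: "2 * (0::int) = int (order_at C Q (one.II.tau s' s')) - int (order_at C Q ?\<tau>)" if Q: "Q \<in> C" for Q
      proof -
        obtain R where R: "R \<in> D" "one.proj_pt R = Q" by (rule one.proj_pt_surjective[OF Q]) (rule that)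
        have "order_at D R f = order_at D R (one.vform s')" by (rule order_at_cong) (rule ev)
        then show ?thesis using one.ord_vform[OF R(1) s'0] \<Delta>\<tau>[OF R(1)] of[OF R(1)] R(2) by simp
      qed
      show False
      proof (rule one.I.cones_inequivalent[OF one.II.diagonal_cone_axioms two.I.diagonal_cone_axioms _ s'0 r])
        show "j \<noteq> k" using one.I.dist by auto
        show "one.I.principal (\<lambda>_. 0)" unfolding one.I.principal_def using \<tau> by fastforce
        show "\<And>Q. Q \<in> C \<Longrightarrow> 2 * (0::int) = int (order_at C Q (one.II.tau s' s')) - int (order_at C Q ?\<tau>)" by (rule half)
      qed
    next
      case 2
      have ev: "meval f x = meval (one.uform s) x" for x using s 2 by (simp add: one.meval_uform lin2_def)
      then have s0: "s \<noteq> (\<lambda>_. 0)" using f(2) by (auto simp: zero_on_def one.meval_uform lin2_def)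
      have half: "2 * (0::int) = int (order_at C Q (one.I.tau s s)) - int (order_at C Q ?\<tau>)" if Q: "Q \<in> C" for Q
      proof -
        obtain R where R: "R \<in> D" "one.proj_pt R = Q" by (rule one.proj_pt_surjective[OF Q]) (rule that)
        have "order_at D R f = order_at D R (one.uform s)" by (rule order_at_cong) (rule ev)
        then show ?thesis using one.ord_uform[OF R(1) s0] \<Delta>\<tau>[OF R(1)] of[OF R(1)] R(2) by simp
      qed
      show False
      proof (rule one.I.cones_inequivalent[OF one.I.diagonal_cone_axioms two.I.diagonal_cone_axioms _ s0 r])
        show "i \<noteq> k" using one.I.dist by auto
        show "one.I.principal (\<lambda>_. 0)" unfolding one.I.principal_def using \<tau> by fastforce
        show "\<And>Q. Q \<in> C \<Longrightarrow> 2 * (0::int) = int (order_at C Q (one.I.tau s s)) - int (order_at C Q ?\<tau>)" by (rule half)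
      qed
    qed
  qed
  \<comment> \<open>The norm of \<open>f\<close> to \<open>C\<close>: the product
    \<open>f f'\<close> is \<open>(lin2 s u)^2 - (lin2 s' v)^2\<close>, a difference of pulled back
    tangent planes.\<close>
  define m where "m = one.I.tau s s - one.II.tau s' s'"
  have m: "homogeneous 1 m"
    unfolding m_def by (intro homogeneous_diff one.I.homogeneous_tau one.II.homogeneous_tau)
  have pm: "meval (f * f') x = meval (one.pull m) x" if "x \<in> affine_cone D" for x
    using one.pull_tau_I[OF that, of s s] one.pull_tau_II[OF that, of s' s']
    by (simp add: m_def s f' algebra_simps)
  have ff': "\<not> zero_on D (f * f')" by (rule one.D.not_zero_on_mult[OF f(1) hf'(1) f(2) hf'(2)])
  have mC: "\<not> zero_on C m"
  proof
    assume 0: "zero_on C m"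
    have "zero_on D (f * f')" unfolding zero_on_def
    proof
      fix x assume x: "x \<in> affine_cone D"
      have "meval (f * f') x = meval m (one.pt x)" using pm[OF x] by (simp only: one.meval_pull)
      then show "meval (f * f') x = 0" using 0 one.pt_in_cone[OF x] by (simp add: zero_on_def)
    qed
    then show False using ff' by blast
  qed
  \<comment> \<open>Adding the divisors of \<open>f\<close> and of its conjugate gives the sum over
    the fibre; the symmetric part \<open>2 \<Delta>\<close> is the tangent plane, and the indicators
    of \<open>w\<close> and \<open>w0\<close> become those of their images.\<close>
  have ordm: "int (order_at C (one.proj_pt R) m) - int (order_at C (one.proj_pt R) ?\<tau>)
      = of_bool (one.proj_pt R = one.proj_pt w) - of_bool (one.proj_pt R = one.proj_pt w0)" if R: "R \<in> D" for R
  proof -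
    have iR: "one.iota_pt R \<in> D" using R by simp
    have "order_at C (one.proj_pt R) m = order_at D R (f * f')"
      using one.ord_pull[OF R m mC] order_at_cong[of D "f * f'" "one.pull m" R, OF pm] by simp
    also have "\<dots> = order_at D R f + order_at D (one.iota_pt R) f"
      using one.D.ord_mult[OF R f hf'] ordf'[OF R] by simp
    finally have "order_at C (one.proj_pt R) m + (of_bool (R = w0) + of_bool (one.iota_pt R = w0))
        = 2 * \<Delta> R + (of_bool (R = w) + of_bool (one.iota_pt R = w))"
      using ordf[OF R] ordf[OF iR] \<Delta>iota[OF R] by simp
    then have "order_at C (one.proj_pt R) m + of_bool (one.proj_pt R = one.proj_pt w0)
        = order_at C (one.proj_pt R) ?\<tau> + of_bool (one.proj_pt R = one.proj_pt w)"
      unfolding one.fibre_indicator[OF w0 R] one.fibre_indicator[OF wD R] \<Delta>\<tau>[OF R] .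
    then show ?thesis by (auto simp: of_bool_def split: if_splits)
  qed
  have "one.I.principal (\<lambda>Q. of_bool (Q = one.proj_pt w) - of_bool (Q = one.proj_pt w0))"
    unfolding one.I.principal_def
  proof (intro exI conjI ballI)
    show "homogeneous 1 m" "homogeneous 1 ?\<tau>" "\<not> zero_on C m" "\<not> zero_on C ?\<tau>" using m mC \<tau> by blast+
    fix Q assume "Q \<in> C"
    then obtain R where "R \<in> D" "one.proj_pt R = Q" by (rule one.proj_pt_surjective)
    then show "of_bool (Q = one.proj_pt w) - of_bool (Q = one.proj_pt w0) = int (order_at C Q m) - int (order_at C Q ?\<tau>)"
      using ordm[of R] by simp
  qed
  then have "one.proj_pt w = one.proj_pt w0" by (rule one.I.principal_imp_eq) (use one.proj_pt_in w0 wD in auto)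
  then have "w = w1" using one.proj_pt_fibre[OF w0 wD] one.proj_pt_fibre[OF w0 w1] fib ww0 by auto
  then show ?thesis using that[OF f] ordf unfolding \<Delta>_def by blast
qed

text \<open>Plane sections of one curve are equivalent to each other, so the section of
  \<open>D'\<close> may be chosen through \<open>\<psi> w0\<close> and compared with the plane of
  \<open>fourth_point\<close>.\<close>

lemma hyperplane_sections:
  assumes w0: "w0 \<in> D" and w1: "w1 \<in> D" and fib: "one.proj_pt w1 = one.proj_pt w0" "w1 \<noteq> w0"
    and h: "homogeneous 1 h" "\<not> zero_on D h" and h': "homogeneous 1 h'" "\<not> zero_on D' h'"
  shows "one.D.principal (\<lambda>P. int (order_at D P h) - int (order_at D' (\<psi> P) h') - of_bool (P = w1) + of_bool (P = w0))"
proof -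
  let ?u = "two.uu (rep_proj (\<psi> w0))"
  \<comment> \<open>The coefficients of the linear form in \<open>u\<close> that vanishes at
    \<open>\<psi> w0\<close>.\<close>
  define r where "r = (\<lambda>t::2. if t = 1 then ?u 2 else - ?u 1)"
  have "rep_proj (\<psi> w0) \<in> affine_cone D'" using psi_in[OF w0] by simp
  from two.uu_nonzero[OF this] have r: "r \<noteq> (\<lambda>_. 0)" by (auto simp: r_def fun_2_eq_iff)
  have r0: "meval (two.uform r) (rep_proj (\<psi> w0)) = 0" by (simp add: two.meval_uform lin2_def r_def)
  obtain f where f: "homogeneous 1 f" "\<not> zero_on D f"
    "\<And>R. R \<in> D \<Longrightarrow> order_at D R f + of_bool (R = w0) = order_at D' (\<psi> R) (two.uform r) + of_bool (R = w1)"
    by (rule fourth_point[OF w0 w1 fib r r0]) (rule that)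
  have "one.D.principal (\<lambda>P. int (order_at D P h) - int (order_at D P f))"
    unfolding one.D.principal_def using h f(1,2) by blast
  from one.D.principal_add[OF this principal_pullback[OF two.homogeneous_uform two.uform_not_zero_on[OF r] h']]
  show ?thesis
  proof (rule one.D.principal_cong)
    fix P assume "P \<in> D"
    from f(3)[OF this] have "int (order_at D P f) + of_bool (P = w0) = int (order_at D' (\<psi> P) (two.uform r)) + of_bool (P = w1)"
      by (metis of_nat_add of_nat_of_bool)
    then show "int (order_at D P h) - int (order_at D P f) + (int (order_at D' (\<psi> P) (two.uform r)) - int (order_at D' (\<psi> P) h'))
      = int (order_at D P h) - int (order_at D' (\<psi> P) h') - of_bool (P = w1) + of_bool (P = w0)" by simp
  qed
qed

end

section \<open>From conics to coverings\<close>

text \<open>The forms \<open>tA\<close>, \<open>tB\<close>, \<open>tC\<close> do not involve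
  \<open>\<xi> i\<close>, so they factor through the projection \<open>L\<close>. Composed with the
  parametrisation \<open>R\<close> they are binary quadratic forms on the conic
  \<open>tA tC = tB^2\<close> without common zero, to which \<open>binary_conic_square_roots\<close>
  applies.\<close>

lemma (in diagonal_cone) conic_parameters:
  fixes L :: "3 \<Rightarrow> (4, 'a) mpoly" and R :: "3 \<Rightarrow> (2, 'a) mpoly"
  assumes L: "\<And>\<kappa>. homogeneous 1 (L \<kappa>)"
    and ker: "\<And>x. (\<forall>\<kappa>. meval (L \<kappa>) x = 0) \<longleftrightarrow> (\<forall>t. t \<noteq> i \<longrightarrow> co t x = 0)"
    and G: "\<And>x. meval G (\<lambda>\<kappa>. meval (L \<kappa>) x) = 0 \<Longrightarrow>
      minor i j * (co j x)\<^sup>2 + minor i k * (co k x)\<^sup>2 + minor i l * (co l x)\<^sup>2 = 0"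
    and R: "\<And>\<kappa>. homogeneous 2 (R \<kappa>)"
      "\<And>u. u \<noteq> (\<lambda>_. 0) \<Longrightarrow> (\<lambda>\<kappa>. meval (R \<kappa>) u) \<noteq> (\<lambda>_. 0)"
      "\<And>u. u \<noteq> (\<lambda>_. 0) \<Longrightarrow> meval G (\<lambda>\<kappa>. meval (R \<kappa>) u) = 0"
  obtains s s' where "\<And>u. lin2 s u = 0 \<Longrightarrow> lin2 s' u = 0 \<Longrightarrow> u = (\<lambda>_. 0)"
    "\<And>x u. param x (\<lambda>m. if m = 1 then lin2 s u else lin2 s' u) \<longleftrightarrow> (\<forall>\<kappa>. meval (L \<kappa>) x = meval (R \<kappa>) u)"
proof -
  let ?J = "{j, k, l}"
  have nJ: "t \<in> ?J \<longleftrightarrow> t \<noteq> i" for t using dist UNIV_4[OF dist] by auto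
  \<comment> \<open>The kernel of \<open>L\<close> is spanned by the vertex, so \<open>L\<close> is
    injective, hence bijective, on the span of the other three basis vectors.\<close>
  have surj: "\<exists>x. \<forall>\<kappa>. meval (L \<kappa>) x = b \<kappa>" for b
  proof -
    have "\<exists>y. \<forall>\<kappa>\<in>UNIV. (\<Sum>t\<in>?J. meval (L \<kappa>) (V t) * y t) = b \<kappa>"
    proof (rule injective_system_solvable)
      have "card ?J = 3" using dist by simp
      then show "card (UNIV :: 3 set) \<le> card ?J" by simp
      fix y assume 0: "\<And>\<kappa>. \<kappa> \<in> UNIV \<Longrightarrow> (\<Sum>t\<in>?J. meval (L \<kappa>) (V t) * y t) = 0"
      define y' where "y' t = (if t \<in> ?J then y t else 0)" for t
      have "meval (L \<kappa>) (\<lambda>m. \<Sum>t\<in>UNIV. y' t * V t m) = (\<Sum>t\<in>?J. meval (L \<kappa>) (V t) * y t)" for \<kappa>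
        unfolding linear_form_add(3)[OF L]
        by (rule sum.mono_neutral_cong_right) (auto simp: y'_def)
      then have "\<forall>\<kappa>. meval (L \<kappa>) (\<lambda>m. \<Sum>t\<in>UNIV. y' t * V t m) = 0" using 0 by simp
      then have "\<forall>t. t \<noteq> i \<longrightarrow> co t (\<lambda>m. \<Sum>t\<in>UNIV. y' t * V t m) = 0" using ker by blast
      then show "\<forall>t\<in>?J. y t = 0" unfolding dual nJ[symmetric] by (auto simp: y'_def)
    qed simp_all
    then obtain y where "\<And>\<kappa>. (\<Sum>t\<in>?J. meval (L \<kappa>) (V t) * y t) = b \<kappa>" by blast
    then have "\<forall>\<kappa>. meval (L \<kappa>) (\<lambda>m. \<Sum>t\<in>?J. y t * V t m) = b \<kappa>"
      unfolding linear_form_add(3)[OF L] by (simp add: mult.commute)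
    then show ?thesis by - (rule exI[of _ "\<lambda>m. \<Sum>t\<in>?J. y t * V t m"], assumption)
  qed
  have "\<forall>\<kappa>. \<exists>x. \<forall>\<kappa>'. meval (L \<kappa>') x = of_bool (\<kappa>' = \<kappa>)" by (rule allI) (rule surj)
  from choice[OF this] obtain e where e: "\<forall>\<kappa> \<kappa>'. meval (L \<kappa>') (e \<kappa>) = of_bool (\<kappa>' = \<kappa>)" ..
  have co_L: "co t z = (\<Sum>\<kappa>\<in>UNIV. meval (L \<kappa>) z * co t (e \<kappa>))" if "t \<noteq> i" for t z
  proof -
    let ?y = "\<lambda>m. \<Sum>\<kappa>\<in>UNIV. meval (L \<kappa>) z * e \<kappa> m"
    have "\<forall>\<kappa>. meval (L \<kappa>) (\<lambda>m. z m - ?y m) = 0"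
      unfolding linear_form_add(2)[OF L] linear_form_add(3)[OF L] by (simp add: e)
    then have "co t (\<lambda>m. z m - ?y m) = 0" using ker that by blast
    then show ?thesis unfolding linear_form_add(2,3)[OF homogeneous_xi] by simp
  qed
  define pull where "pull g = (\<Sum>\<kappa>\<in>UNIV. mconst (meval g (e \<kappa>)) * R \<kappa>)" for g
  have hpull: "homogeneous 2 (pull g)" for g unfolding pull_def by (intro homogeneous_sum homogeneous_cmult R)
  have ni: "j \<noteq> i" "k \<noteq> i" "l \<noteq> i" using dist by auto
  have tL: "meval g z = (\<Sum>\<kappa>\<in>UNIV. meval (L \<kappa>) z * meval g (e \<kappa>))" if "g \<in> {tA, tB, tC}" for g z
  proof -
    have lin: "c * (\<Sum>\<kappa>\<in>UNIV. x \<kappa> * y \<kappa>) + d * (\<Sum>\<kappa>\<in>UNIV. x \<kappa> * w \<kappa>) = (\<Sum>\<kappa>\<in>UNIV. x \<kappa> * (c * y \<kappa> + d * w \<kappa>))"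
      for c d :: 'a and x y w :: "3 \<Rightarrow> 'a"
      by (simp add: sum_distrib_left sum.distrib algebra_simps)
    have co: "meval (mconst c * \<xi> s + mconst d * \<xi> t) z
        = (\<Sum>\<kappa>\<in>UNIV. meval (L \<kappa>) z * meval (mconst c * \<xi> s + mconst d * \<xi> t) (e \<kappa>))"
      if "s \<noteq> i" "t \<noteq> i" for c d s t
      using lin[of c "\<lambda>\<kappa>. meval (L \<kappa>) z" "\<lambda>\<kappa>. co s (e \<kappa>)" d "\<lambda>\<kappa>. co t (e \<kappa>)"]
      by (simp flip: co_L[OF that(1), of z] co_L[OF that(2), of z])
    have "mconst (- rl) = - (mconst rl :: (4, 'a) mpoly)" by (simp add: mconst_def single_uminus)
    then have forms: "tA = mconst rk * \<xi> k + mconst rl * \<xi> l" "tB = mconst rj * \<xi> j + mconst 0 * \<xi> j"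
      "tC = mconst rk * \<xi> k + mconst (- rl) * \<xi> l"
      by (simp_all add: tA_def tB_def tC_def) (simp add: mconst_def)
    from that consider "g = tA" | "g = tB" | "g = tC" by blast
    then show ?thesis
    proof cases
      case 1 show ?thesis unfolding 1 forms(1) by (rule co[OF ni(2,3)])
    next
      case 2 show ?thesis unfolding 2 forms(2) by (rule co[OF ni(1,1)])
    next
      case 3 show ?thesis unfolding 3 forms(3) by (rule co[OF ni(2,3)])
    qed
  qed
  have tR: "meval g x = meval (pull g) u" if "\<forall>\<kappa>. meval (L \<kappa>) x = meval (R \<kappa>) u" "g \<in> {tA, tB, tC}" for g x u
    unfolding tL[OF that(2), of x] pull_def using that(1) by (simp add: mult.commute)
  have rel: "meval tA x * meval tC x = (meval tB x)\<^sup>2"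
    if "minor i j * (co j x)\<^sup>2 + minor i k * (co k x)\<^sup>2 + minor i l * (co l x)\<^sup>2 = 0" for x
  proof -
    have "meval tA x * meval tC x - (meval tB x)\<^sup>2 = rk\<^sup>2 * (co k x)\<^sup>2 - rl\<^sup>2 * (co l x)\<^sup>2 - rj\<^sup>2 * (co j x)\<^sup>2"
      by (simp add: tA_def tB_def tC_def algebra_simps power2_eq_square)
    also have "\<dots> = 0" unfolding roots using that by (simp add: algebra_simps)
    finally show ?thesis by simp
  qed
  have eq: "meval (pull tA) u * meval (pull tC) u = (meval (pull tB) u)\<^sup>2" for u
  proof (cases "u = (\<lambda>_. 0)")
    case True
    have "meval (pull g) (\<lambda>_. 0) = 0" for g by (rule meval_at_0[OF hpull]) simp
    then show ?thesis by (simp add: True)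
  next
    case False
    obtain x where x: "\<forall>\<kappa>. meval (L \<kappa>) x = meval (R \<kappa>) u" using surj[of "\<lambda>\<kappa>. meval (R \<kappa>) u"] by blast
    have "meval G (\<lambda>\<kappa>. meval (L \<kappa>) x) = 0" using R(3)[OF False] x by simp
    from rel[OF G[OF this]] show ?thesis using tR[OF x] by simp
  qed
  have t_eq: "co t x = co t y" if "t \<noteq> i" "meval tA x = meval tA y" "meval tB x = meval tB y" "meval tC x = meval tC y" for t x y
  proof -
    have "t \<in> ?J" using that(1) nJ by blast
    then show ?thesis using that(2-4) by (auto simp: co_span)
  qed
  have nz: "meval (pull tA) u \<noteq> 0 \<or> meval (pull tB) u \<noteq> 0 \<or> meval (pull tC) u \<noteq> 0" if u: "u \<noteq> (\<lambda>_. 0)" for u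
  proof (rule ccontr)
    assume 0: "\<not> ?thesis"
    obtain x where x: "\<forall>\<kappa>. meval (L \<kappa>) x = meval (R \<kappa>) u" using surj[of "\<lambda>\<kappa>. meval (R \<kappa>) u"] by blast
    have "meval g (\<lambda>_. 0) = 0" if "g \<in> {tA, tB, tC}" for g
      using that meval_at_0[OF homogeneous_xi] by (auto simp: tA_def tB_def tC_def)
    then have "co t x = co t (\<lambda>_. 0)" if "t \<noteq> i" for t
      by (intro t_eq[OF that]) (use 0 tR[OF x] in auto)
    then have "\<forall>t. t \<noteq> i \<longrightarrow> co t x = 0" using meval_at_0[OF homogeneous_xi] by simp
    then have "\<forall>\<kappa>. meval (R \<kappa>) u = 0" using ker[of x] x by simp
    then show False using R(2)[OF u] by (simp add: fun_eq_iff)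
  qed
  obtain s s' where s: "\<And>u. meval (pull tA) u = (lin2 s u)\<^sup>2" "\<And>u. meval (pull tB) u = lin2 s u * lin2 s' u"
    "\<And>u. meval (pull tC) u = (lin2 s' u)\<^sup>2" "\<And>u. lin2 s u = 0 \<Longrightarrow> lin2 s' u = 0 \<Longrightarrow> u = (\<lambda>_. 0)"
    by (rule binary_conic_square_roots[OF hpull hpull hpull eq], rule nz, assumption) (rule that)
  show ?thesis
  proof (rule that[OF s(4)])
    fix x u
    have "param x (\<lambda>m. if m = 1 then lin2 s u else lin2 s' u) \<longleftrightarrow>
      meval tA x = meval (pull tA) u \<and> meval tB x = meval (pull tB) u \<and> meval tC x = meval (pull tC) u"
      by (simp add: param_def s(1-3))
    also have "\<dots> \<longleftrightarrow> (\<forall>\<kappa>. meval (L \<kappa>) x = meval (R \<kappa>) u)"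
    proof
      assume *: "meval tA x = meval (pull tA) u \<and> meval tB x = meval (pull tB) u \<and> meval tC x = meval (pull tC) u"
      obtain y where y: "\<forall>\<kappa>. meval (L \<kappa>) y = meval (R \<kappa>) u" using surj[of "\<lambda>\<kappa>. meval (R \<kappa>) u"] by blast
      have "\<forall>t. t \<noteq> i \<longrightarrow> co t (\<lambda>m. x m - y m) = 0"
        unfolding linear_form_add(2)[OF homogeneous_xi] using t_eq[of _ x y] * tR[OF y] by simp
      then have "\<forall>\<kappa>. meval (L \<kappa>) (\<lambda>m. x m - y m) = 0" using ker by blast
      then show "\<forall>\<kappa>. meval (L \<kappa>) x = meval (R \<kappa>) u" unfolding linear_form_add(2)[OF L] using y by simp
    next
      assume "\<forall>\<kappa>. meval (L \<kappa>) x = meval (R \<kappa>) u"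
      from tR[OF this] show "meval tA x = meval (pull tA) u \<and> meval tB x = meval (pull tB) u \<and> meval tC x = meval (pull tC) u"
        by simp
    qed
    finally show "param x (\<lambda>m. if m = 1 then lin2 s u else lin2 s' u) \<longleftrightarrow> (\<forall>\<kappa>. meval (L \<kappa>) x = meval (R \<kappa>) u)" .
  qed
qed

lemma cone_over_kernel:
  fixes q :: "(4, 'a::field) mpoly"
  assumes cone: "cone_over q L G" and \<xi>: "\<And>t. homogeneous 1 (\<xi> t)"
    and q: "\<And>x. (\<forall>k. meval (mdiff k q) x = 0) \<longleftrightarrow> (\<forall>t. t \<noteq> i \<longrightarrow> meval (\<xi> t) x = 0)"
  shows "(\<forall>\<kappa>. meval (L \<kappa>) x = 0) \<longleftrightarrow> (\<forall>t. t \<noteq> i \<longrightarrow> meval (\<xi> t) x = 0)"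
proof (cases "x = (\<lambda>_. 0)")
  case True
  have L: "homogeneous 1 (L \<kappa>)" for \<kappa> using cone by (simp add: cone_over_def)
  show ?thesis unfolding True using meval_at_0[OF L] meval_at_0[OF \<xi>] by simp
next
  case False
  have L: "homogeneous 1 (L \<kappa>)" for \<kappa> using cone by (simp add: cone_over_def)
  obtain c where c: "c \<noteq> 0" "rep_proj (abs_proj x) = (\<lambda>i. c * x i)" by (rule rep_abs_proj[OF False])
  have "(\<forall>\<kappa>. vanishes (L \<kappa>) (abs_proj x)) \<longleftrightarrow> (\<forall>k. vanishes (mdiff k q) (abs_proj x))"
    using cone by (simp add: cone_over_def)
  then show ?thesis
    unfolding vanishes_rep q c(2) meval_scale[OF L] meval_scale[OF \<xi>] using c(1) by simp
qed

lemma parametrises_facts: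
  assumes "parametrises R G" "homogeneous 2 G" "u \<noteq> (\<lambda>_. 0)"
  shows "(\<lambda>\<kappa>. meval (R \<kappa>) u) \<noteq> (\<lambda>_. 0)" "meval G (\<lambda>\<kappa>. meval (R \<kappa>) u) = 0"
proof -
  have R: "\<And>\<kappa>. homogeneous 2 (R \<kappa>)" using assms(1) by (simp add: parametrises_def)
  have "\<exists>\<kappa>. \<not> vanishes (R \<kappa>) (abs_proj u)" using assms(1) by (simp add: parametrises_def)
  then show n: "(\<lambda>\<kappa>. meval (R \<kappa>) u) \<noteq> (\<lambda>_. 0)" using vanishes_abs[OF R assms(3)] by (auto simp: fun_eq_iff)
  have "proj_of R (abs_proj u) \<in> zeros {G}"
    using assms(1) unfolding parametrises_def iso_over_def morphism_over_def by blast
  then show "meval G (\<lambda>\<kappa>. meval (R \<kappa>) u) = 0"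
    unfolding proj_of_abs[OF R assms(3)] zeros_def by (simp add: vanishes_abs[OF assms(2) n])
qed

text \<open>A linear change of the parameters on each conic turns \<open>R i\<close>,
  \<open>R j\<close> into the standard parametrisations, and \<open>M i\<close>, \<open>M j\<close>
  into the coordinates \<open>\<eta>\<close>. The set \<open>D\<close> and the map
  \<open>\<pi>\<close> remain the same.\<close>

lemma covering_of_conics:
  fixes C :: "(4, 'k::field_char_0 alg_closure) proj set"
  assumes dq: "diagonal_quadrics C \<xi> V a b"
    and Q: "\<And>i. \<exists>g. g \<noteq> 0 \<and> (\<forall>x. meval (Q i) x = (\<Sum>t\<in>UNIV. g * (a i * b t - a t * b i) * (meval (\<xi> t) x)\<^sup>2))"
      "\<And>i x. (\<forall>k. meval (mdiff k (Q i)) x = 0) \<longleftrightarrow> (\<forall>t. t \<noteq> i \<longrightarrow> meval (\<xi> t) x = 0)"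
    and cones: "\<And>i. cone_over (Q i) (L i) (G i)"
    and dist: "distinct [i, j, k, l]"
    and cov: "conic_covering L G i j R M D \<pi>"
  obtains rj rk rl si sk sl \<eta> where "diagonal_covering C \<xi> V a b i j k l rj rk rl si sk sl D \<eta>"
    "\<And>P. P \<in> D \<Longrightarrow> diagonal_covering.proj_pt V i j k l rj rk rl si \<eta> P = \<pi> P"
proof -
  obtain rj rk rl where I: "diagonal_cone C \<xi> V a b i j k l rj rk rl"
    by (rule diagonal_quadrics.ex_diagonal_cone[OF dq dist]) (rule that)
  have dist': "distinct [j, i, k, l]" using dist by auto
  obtain si sk sl where II: "diagonal_cone C \<xi> V a b j i k l si sk sl"
    by (rule diagonal_quadrics.ex_diagonal_cone[OF dq dist']) (rule that)
  interpret I: diagonal_cone C \<xi> V a b i j k l rj rk rl by (rule I)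
  interpret II: diagonal_cone C \<xi> V a b j i k l si sk sl by (rule II)
  have L: "homogeneous 1 (L n \<kappa>)" "homogeneous 2 (G n)" "Q n = msubst (G n) (L n)" for n \<kappa>
    using cones[of n] by (simp_all add: cone_over_def)
  have ker: "(\<forall>\<kappa>. meval (L n \<kappa>) x = 0) \<longleftrightarrow> (\<forall>t. t \<noteq> n \<longrightarrow> meval (\<xi> t) x = 0)" for n x
    by (rule cone_over_kernel[OF cones I.homogeneous_xi Q(2)])
  have G: "I.minor n p * (meval (\<xi> p) x)\<^sup>2 + I.minor n q * (meval (\<xi> q) x)\<^sup>2 + I.minor n r * (meval (\<xi> r) x)\<^sup>2 = 0"
    if "distinct [n, p, q, r]" "meval (G n) (\<lambda>\<kappa>. meval (L n \<kappa>) x) = 0" for n p q r x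
  proof -
    obtain g where g: "g \<noteq> 0" "meval (Q n) x = (\<Sum>t\<in>UNIV. g * (a n * b t - a t * b n) * (meval (\<xi> t) x)\<^sup>2)"
      using Q(1) by blast
    have "0 = g * (I.minor n p * (meval (\<xi> p) x)\<^sup>2 + I.minor n q * (meval (\<xi> q) x)\<^sup>2 + I.minor n r * (meval (\<xi> r) x)\<^sup>2)"
      using that(2) g(2) unfolding L(3) sum_4[OF that(1)] I.minor_def by (simp add: algebra_simps)
    then show ?thesis using g(1) by simp
  qed
  note cv = cov[unfolded conic_covering_def, THEN conjunct1] cov[unfolded conic_covering_def, THEN conjunct2]
  note cv = cv(1) cv(2)[THEN conjunct1] cv(2)[THEN conjunct2, THEN conjunct2, THEN conjunct2]
  have par: "parametrises (R n) (G n)" "\<And>k. homogeneous 1 (M n k)" if "n \<in> {i, j}" for n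
    using bspec[OF cv(1) that] by blast+
  have hR: "homogeneous 2 (R n \<kappa>)" if "n \<in> {i, j}" for n \<kappa> using par(1)[OF that] by (simp add: parametrises_def)
  obtain s s' where s: "\<And>u. lin2 s u = 0 \<Longrightarrow> lin2 s' u = 0 \<Longrightarrow> u = (\<lambda>_. 0)"
    "\<And>x u. I.param x (\<lambda>m. if m = 1 then lin2 s u else lin2 s' u) \<longleftrightarrow> (\<forall>\<kappa>. meval (L i \<kappa>) x = meval (R i \<kappa>) u)"
  proof (rule I.conic_parameters[of "L i" "G i" "R i"])
    have n: "i \<in> {i, j}" by simp
    show "\<And>\<kappa>. homogeneous 2 (R i \<kappa>)" by (rule hR[OF n])
    show "\<And>u. u \<noteq> (\<lambda>_. 0) \<Longrightarrow> (\<lambda>\<kappa>. meval (R i \<kappa>) u) \<noteq> (\<lambda>_. 0)"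
      by (rule parametrises_facts(1)[OF par(1)[OF n] L(2)])
    show "\<And>u. u \<noteq> (\<lambda>_. 0) \<Longrightarrow> meval (G i) (\<lambda>\<kappa>. meval (R i \<kappa>) u) = 0"
      by (rule parametrises_facts(2)[OF par(1)[OF n] L(2)])
  qed (rule L(1), rule ker, erule G[OF dist], rule that)
  obtain r r' where r: "\<And>u. lin2 r u = 0 \<Longrightarrow> lin2 r' u = 0 \<Longrightarrow> u = (\<lambda>_. 0)"
    "\<And>x u. II.param x (\<lambda>m. if m = 1 then lin2 r u else lin2 r' u) \<longleftrightarrow> (\<forall>\<kappa>. meval (L j \<kappa>) x = meval (R j \<kappa>) u)"
  proof (rule II.conic_parameters[of "L j" "G j" "R j"])
    have n: "j \<in> {i, j}" by simp
    show "\<And>\<kappa>. homogeneous 2 (R j \<kappa>)" by (rule hR[OF n])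
    show "\<And>u. u \<noteq> (\<lambda>_. 0) \<Longrightarrow> (\<lambda>\<kappa>. meval (R j \<kappa>) u) \<noteq> (\<lambda>_. 0)"
      by (rule parametrises_facts(1)[OF par(1)[OF n] L(2)])
    show "\<And>u. u \<noteq> (\<lambda>_. 0) \<Longrightarrow> meval (G j) (\<lambda>\<kappa>. meval (R j \<kappa>) u) = 0"
      by (rule parametrises_facts(2)[OF par(1)[OF n] L(2)])
  qed (rule L(1), rule ker, erule G[OF dist'], rule that)
  define lf where "lf s n = mconst (s (1::2)) * M n 1 + mconst (s 2) * M n 2" for s n
  define \<eta> where "\<eta> t = (if t = 1 then lf s i else if t = 2 then lf s' i else if t = (3::4) then lf r j else lf r' j)" for t
  have lf: "meval (lf s n) w = lin2 s (lin_pair (M n) w)" for s n w by (simp add: lf_def lin2_def lin_pair_def)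
  have hlf: "homogeneous 1 (lf s n)" if "n \<in> {i, j}" for s n
    unfolding lf_def by (intro homogeneous_add homogeneous_cmult par(2)[OF that])
  have \<eta>: "meval (\<eta> 1) w = lin2 s (lin_pair (M i) w)" "meval (\<eta> 2) w = lin2 s' (lin_pair (M i) w)"
    "meval (\<eta> 3) w = lin2 r (lin_pair (M j) w)" "meval (\<eta> 4) w = lin2 r' (lin_pair (M j) w)" for w
    by (simp_all add: \<eta>_def lf)
  have lifts: "lifts L i j R M w x \<longleftrightarrow> w \<noteq> (\<lambda>_. 0) \<and>
      I.param x (\<lambda>t. if t = 1 then meval (\<eta> 1) w else meval (\<eta> 2) w) \<and>
      II.param x (\<lambda>t. if t = 1 then meval (\<eta> 3) w else meval (\<eta> 4) w)" for w x
    unfolding \<eta> s(2) r(2) lifts_def by auto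
  have Dlift: "D = {abs_proj w | w. \<exists>x. lifts L i j R M w x}"
    and \<pi>: "\<And>w x. lifts L i j R M w x \<Longrightarrow> \<pi> (abs_proj w) = abs_proj x"
    using cv(3) by blast+
  have cover: "diagonal_covering C \<xi> V a b i j k l rj rk rl si sk sl D \<eta>"
  proof (unfold_locales)
    show "homogeneous 1 (\<eta> t)" for t using hlf[of i] hlf[of j] by (simp add: \<eta>_def)
    show "w = (\<lambda>_. 0)" if 0: "\<forall>t. meval (\<eta> t) w = 0" for w
    proof (rule ccontr)
      assume w: "w \<noteq> (\<lambda>_. 0)"
      have "lin_pair (M i) w = (\<lambda>_. 0)" by (rule s(1)) (simp_all only: \<eta>[symmetric] 0)
      moreover have "lin_pair (M j) w = (\<lambda>_. 0)" by (rule r(1)) (simp_all only: \<eta>[symmetric] 0)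
      ultimately have "\<forall>n\<in>{i, j}. \<forall>k. meval (M n k) w = 0" by (auto simp: lin_pair_def fun_eq_iff)
      then have "\<forall>n\<in>{i, j}. \<forall>k. vanishes (M n k) (abs_proj w)" using vanishes_abs[OF par(2) w] by blast
      then show False using cv(2) by blast
    qed
    show "D = {abs_proj w | w x. w \<noteq> (\<lambda>_. 0) \<and>
      I.param x (\<lambda>t. if t = 1 then meval (\<eta> 1) w else meval (\<eta> 2) w) \<and>
      II.param x (\<lambda>t. if t = 1 then meval (\<eta> 3) w else meval (\<eta> 4) w)}"
      unfolding Dlift lifts by blast
  qed
  interpret cover: diagonal_covering C \<xi> V a b i j k l rj rk rl si sk sl D \<eta> by (rule cover)
  show ?thesis
  proof (rule that[OF cover])
    fix P assume P: "P \<in> D"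
    then obtain w x where w: "P = abs_proj w" "lifts L i j R M w x" unfolding Dlift by blast
    then have "w \<noteq> (\<lambda>_. 0)" "I.param x (cover.uu w)" "II.param x (cover.vv w)"
      unfolding lifts cover.uu_def cover.vv_def by blast+
    then have "w \<in> affine_cone D" "x = cover.pt w"
      using P w(1) cover.params_imp_pt(1) by (simp_all add: affine_cone_def)
    then show "cover.proj_pt P = \<pi> P" using \<pi>[OF w(2)] w(1) cover.proj_pt_abs by simp
  qed
qed

section \<open>Divisors\<close>

text \<open>Finiteness of the zeros gives \<open>Abs_poly_mapping\<close> its intended
  meaning.\<close>

lemma (in projective_curve) lookup_form_div:
  assumes "homogeneous n F" "\<not> zero_on Z F"
  shows "Poly_Mapping.lookup (form_div Z F) P = (if P \<in> Z then int (ord P F) else 0)"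
proof -
  have "{P. (if P \<in> Z then int (ord P F) else 0) \<noteq> 0} \<subseteq> {P\<in>Z. meval F (rep_proj P) = 0}"
    using ord_pos_iff[OF _ assms] by (auto split: if_splits)
  then have "finite {P. (if P \<in> Z then int (ord P F) else 0) \<noteq> 0}"
    using finite_zeros[OF assms] finite_subset by blast
  then show ?thesis unfolding form_div_def by simp
qed

text \<open>For a target such as \<open>E'\<close>, finiteness comes from \<open>Z\<close>: with a
  local formula \<open>a\<close> for \<open>f\<close>, a zero of \<open>F\<close> is the image of a
  zero of \<open>a k\<close> or of \<open>F\<close> composed with \<open>a\<close>.\<close>

lemma (in projective_curve) lookup_form_div_iso:
  fixes Y :: "('j::finite, 'a) proj set"
  assumes iso: "iso_over S Z Y f" and F: "homogeneous n F" "\<not> zero_on Y F"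
  shows "Poly_Mapping.lookup (form_div Y F) Q = (if Q \<in> Y then int (order_at Y Q F) else 0)"
proof -
  obtain g where g: "morphism_over S Z Y f" "morphism_over S Y Z g" "\<And>P. P \<in> Z \<Longrightarrow> f P \<in> Y"
    "\<And>Q. Q \<in> Y \<Longrightarrow> g Q \<in> Z" "\<And>P. P \<in> Z \<Longrightarrow> g (f P) = P" "\<And>Q. Q \<in> Y \<Longrightarrow> f (g Q) = Q"
    by (rule iso_overE[OF iso]) (rule that)
  obtain y where y: "y \<in> affine_cone Y" "meval F y \<noteq> 0" using F(2) by (auto simp: zero_on_def)
  have y': "y \<noteq> (\<lambda>_. 0)" "abs_proj y \<in> Y" using y(1) by (auto simp: affine_cone_def)
  define P0 where "P0 = g (abs_proj y)"
  have P0: "P0 \<in> Z" "f P0 = abs_proj y" using g(4,6) y'(2) by (auto simp: P0_def)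
  obtain a where a: "local_rep S Z f P0 a" using g(1) P0(1) by (auto simp: morphism_over_def)
  obtain d where ha: "\<And>j. homogeneous d (a j)" and a0: "\<exists>j. meval (a j) (rep_proj P0) \<noteq> 0"
    and af: "\<And>x. x \<in> affine_cone Z \<Longrightarrow> (\<lambda>j. meval (a j) x) \<noteq> (\<lambda>_. 0) \<Longrightarrow> f (abs_proj x) = abs_proj (\<lambda>j. meval (a j) x)"
    by (rule local_repD[OF a]) (rule that)
  obtain k where k: "meval (a k) (rep_proj P0) \<noteq> 0" using a0 by blast
  let ?K = "msubst F a" and ?y = "\<lambda>j. meval (a j) (rep_proj P0)"
  have hK: "homogeneous (d * n) ?K" by (rule homogeneous_msubst[OF F(1) ha])
  have ny: "?y \<noteq> (\<lambda>_. 0)" using k by (auto simp: fun_eq_iff)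
  have "abs_proj ?y = abs_proj y" using af[of "rep_proj P0"] P0 ny by simp
  then have "\<not> vanishes F (abs_proj ?y)" using y vanishes_abs[OF F(1) y'(1)] by simp
  then have K: "\<not> zero_on Z ?K" by (intro not_zero_onI[OF P0(1)]) (simp add: vanishes_abs[OF F(1) ny])
  have ak: "\<not> zero_on Z (a k)" by (rule not_zero_onI[OF P0(1) k])
  let ?A = "{P\<in>Z. meval (a k) (rep_proj P) = 0} \<union> {P\<in>Z. meval ?K (rep_proj P) = 0}"
  have "{Q. (if Q \<in> Y then int (order_at Y Q F) else 0) \<noteq> 0} \<subseteq> f ` ?A"
  proof
    fix Q assume "Q \<in> {Q. (if Q \<in> Y then int (order_at Y Q F) else 0) \<noteq> 0}"
    then have Q: "Q \<in> Y" "order_at Y Q F \<noteq> 0" by (auto split: if_splits)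
    let ?P = "g Q"
    have P: "?P \<in> Z" "f ?P = Q" using g(4,6) Q(1) by auto
    have "?P \<in> ?A"
    proof (rule ccontr)
      assume "?P \<notin> ?A"
      then have n: "meval (a k) (rep_proj ?P) \<noteq> 0" "meval ?K (rep_proj ?P) \<noteq> 0" using P(1) by auto
      have "local_rep S Z f ?P a" using a n(1) unfolding local_rep_def vanishes_rep by blast
      from order_at_iso[OF iso P(1) this F(1)] have "ord ?P ?K = order_at Y Q F" by (simp add: P(2))
      then show False using ord_eq_0[OF P(1) hK n(2)] Q(2) by simp
    qed
    then show "Q \<in> f ` ?A" by (rule image_eqI[where f = f, OF P(2)[symmetric]])
  qed
  moreover have "finite ?A" using finite_zeros[OF ha ak] finite_zeros[OF hK K] by blast
  ultimately have "finite {Q. (if Q \<in> Y then int (order_at Y Q F) else 0) \<noteq> 0}"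
    using finite_surj by blast
  then show ?thesis unfolding form_div_def by simp
qed

lemma (in smooth_irreducible) ex_order_one:
  assumes P: "P \<in> Z"
  shows "\<exists>n t. homogeneous n t \<and> \<not> zero_on Z t \<and> order_at Z P t = 1"
proof -
  obtain d t where t: "uniformizer Z P d t" "\<not> zero_on Z t" using smooth[OF P] by blast
  have h: "homogeneous d t" using t(1) by (simp add: uniformizer_def)
  from order_at_local_assoc(2)[OF P t h local_assoc_uniformizer] show ?thesis using h t(2) by blast
qed

text \<open>Every admissible choice in the definite description yields 1, because an isomorphism
  preserves orders.\<close>

lemma ram_index_iso:
  fixes Z :: "('i::finite, 'a::field) proj set" and Y :: "('j::finite, 'a) proj set"
  assumes iso: "iso_over S Z Y f" and P: "P \<in> Z"
    and t: "homogeneous n t" "\<not> zero_on Y t" "order_at Y (f P) t = 1"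
  shows "ram_index Z Y f P = 1"
  unfolding ram_index_def
proof (rule the_equality)
  have "morphism_over UNIV Z Y f" using iso_over_UNIV[OF iso] by (simp add: iso_over_def)
  then obtain F where F: "local_rep UNIV Z f P F" using P by (auto simp: morphism_over_def)
  have "order_at Z P (msubst t F) = 1" using order_at_iso[OF iso P F t(1)] t(3) by simp
  then show "\<exists>F n t. local_rep UNIV Z f P F \<and> homogeneous n t \<and> not_identically_zero_on Y t \<and>
      order_at Y (f P) t = 1 \<and> 1 = order_at Z P (msubst t F)"
    using F t not_identically_zero_on_iff[OF t(1), of Y] by metis
next
  fix e
  assume "\<exists>F n t. local_rep UNIV Z f P F \<and> homogeneous n t \<and> not_identically_zero_on Y t \<and>
      order_at Y (f P) t = 1 \<and> e = order_at Z P (msubst t F)"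
  then show "e = 1" using order_at_iso[OF iso P] by metis
qed

lemma lookup_push_div:
  "Poly_Mapping.lookup (push_div f d) Q = (\<Sum>P\<in>Poly_Mapping.keys d. if f P = Q then Poly_Mapping.lookup d P else 0)"
  unfolding push_div_def frag_extend_def lookup_sum
  by (rule sum.cong) (auto simp: lookup_single when_def)

theorem theorem7p4:
  fixes A B f fd :: "(4, 'k::field_char_0) mpoly"
    and Q :: "4 \<Rightarrow> (4, 'k alg_closure) mpoly"
    and L :: "4 \<Rightarrow> 3 \<Rightarrow> (4, 'k alg_closure) mpoly"
    and G :: "4 \<Rightarrow> (3, 'k alg_closure) mpoly"
    and R :: "4 \<Rightarrow> 3 \<Rightarrow> (2, 'k alg_closure) mpoly"
    and M :: "4 \<Rightarrow> 2 \<Rightarrow> (4, 'k alg_closure) mpoly"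
    and C D Dd :: "(4, 'k alg_closure) proj set"
    and \<pi> \<pi>d \<psi> :: "(4, 'k alg_closure) proj \<Rightarrow> (4, 'k alg_closure) proj"
    and h :: "(4, 'k alg_closure) proj \<Rightarrow> 'k alg_closure"
    and e e' :: "'k \<times> 'k \<times> 'k \<times> 'k \<times> 'k"
    and E E' :: "(3, 'k alg_closure) proj set"
    and \<phi> \<phi>' :: "(3, 'k alg_closure) proj \<Rightarrow> (3, 'k alg_closure) proj"
    and T T' :: "(3, 'k alg_closure) proj"
    and \<alpha> \<beta> :: "(4, 'k alg_closure) proj \<Rightarrow> (3, 'k alg_closure) proj"
    and p y :: "4 \<Rightarrow> (3, 'k alg_closure) proj"
    and \<aa> :: "4 \<Rightarrow> (4, 'k alg_closure) divisor"
    and H Hd :: "(4, 'k alg_closure) divisor"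
    and l ld :: "(4, 'k alg_closure) mpoly"
  assumes K: "number_field TYPE('k)"
    \<comment> \<open>the curve \<open>C\<close>, its Jacobian \<open>E\<close>, the conics \<open>\<Gamma>\<^sub>i\<close> and the fibres of the projections\<close>
    and C: "nonsingular_pair A B" "C = quadric_intersection A B"
    and E: "elliptic_curve e E" "jacobian_iso C E \<alpha>"
    and cones: "singular_quadrics A B Q" "\<And>i. cone_over (Q i) (L i) (G i)"
    and fibres: "\<And>i. y i \<in> zeros {G i}"
      "\<And>i. \<aa> i = pullback_div C (zeros {G i}) (proj_of (L i)) (frag_of (y i))"
    \<comment> \<open>the 2-torsion point \<open>T\<close>, the ordering of the conics and the Galois action\<close>
    and T: "T \<in> E" "T \<noteq> pt_inf" "ell_add E T T = pt_inf" "\<And>\<sigma>. \<sigma> \<in> galois_group \<Longrightarrow> gal_pt \<sigma> T = T"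
    and order: "lin_equiv C (\<aa> 1 - \<aa> 2) (\<aa> 3 - \<aa> 4)" "represents C E \<alpha> (\<aa> 1 - \<aa> 2) T"
    and galois: "\<And>\<sigma>. \<sigma> \<in> galois_group \<Longrightarrow> \<exists>\<tau>\<in>pair_perms. acts_as L G \<sigma> \<tau>"
    \<comment> \<open>the isogeny and its dual\<close>
    and E': "elliptic_curve e' E'"
    and isogenies: "dual_two_isogenies base_field E E' \<phi> \<phi>'"
      "isogeny_kernel E \<phi> = {pt_inf, T}" "isogeny_kernel E' \<phi>' = {pt_inf, T'}" "T' \<noteq> pt_inf"
    \<comment> \<open>the constructions from the pairs of points on \<open>\<Gamma>\<^sub>1, \<Gamma>\<^sub>2\<close> and on \<open>\<Gamma>\<^sub>3, \<Gamma>\<^sub>4\<close>\<close>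
    and points: "rational_pair L G 1 2 p" "rational_pair L G 3 4 p"
    and forms: "tangent_product L G 1 2 p f" "tangent_product L G 3 4 p fd"
    and D: "conic_covering L G 1 2 R M D \<pi>"
      "function_field_sqrt base_field D C \<pi> (form_quot (base_change f) ((mvar 1)\<^sup>2))"
      "isogeny_covering D C \<pi> E' \<phi>' \<alpha> \<beta>"
    and Dd: "conic_covering L G 3 4 R M Dd \<pi>d"
      "function_field_sqrt base_field Dd C \<pi>d (form_quot (base_change fd) ((mvar 1)\<^sup>2))"
    \<comment> \<open>the scaling of the pushout forms and the isomorphism of coverings\<close>
    and scaling: "rational_fun base_field C h"
      "ae_eq C (form_quot (base_change f) (base_change fd)) (\<lambda>P. (h P)\<^sup>2)"
    and iso: "iso_over base_field D Dd \<psi>" "\<And>P. P \<in> D \<Longrightarrow> \<pi>d (\<psi> P) = \<pi> P"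
    \<comment> \<open>the hyperplane sections\<close>
    and H: "homogeneous 1 l" "l \<noteq> 0" "H = form_div D l"
    and Hd: "homogeneous 1 ld" "ld \<noteq> 0" "Hd = form_div Dd ld"
  shows "represents D E' \<beta> (H - pullback_div D Dd \<psi> Hd) T'"
proof -
  obtain \<xi> V a b where dq: "diagonal_quadrics C \<xi> V a b"
    and Qg: "\<And>i. \<exists>g. g \<noteq> 0 \<and> (\<forall>x. meval (Q i) x = (\<Sum>t\<in>UNIV. g * (a i * b t - a t * b i) * (meval (\<xi> t) x)\<^sup>2))"
    and Qd: "\<And>i x. (\<forall>k. meval (mdiff k (Q i)) x = 0) \<longleftrightarrow> (\<forall>t. t \<noteq> i \<longrightarrow> meval (\<xi> t) x = 0)"
    by (rule simultaneous_diagonalisation[OF C(1) cones(1), folded C(2)]) (rule that)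
  have "distinct [1, 2, 3, 4 :: 4]" "distinct [3, 4, 1, 2 :: 4]" by simp_all
  note dist = this
  obtain rj rk rl si sk sl \<eta> where one: "diagonal_covering C \<xi> V a b 1 2 3 4 rj rk rl si sk sl D \<eta>"
    and pr1: "\<And>P. P \<in> D \<Longrightarrow> diagonal_covering.proj_pt V 1 2 3 4 rj rk rl si \<eta> P = \<pi> P"
    by (rule covering_of_conics[OF dq Qg Qd cones(2) dist(1) D(1)]) (rule that)
  obtain rj' rk' rl' si' sk' sl' \<eta>' where two: "diagonal_covering C \<xi> V a b 3 4 1 2 rj' rk' rl' si' sk' sl' Dd \<eta>'"
    and pr2: "\<And>P. P \<in> Dd \<Longrightarrow> diagonal_covering.proj_pt V 3 4 1 2 rj' rk' rl' si' \<eta>' P = \<pi>d P"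
    by (rule covering_of_conics[OF dq Qg Qd cones(2) dist(2) Dd(1)]) (rule that)
  interpret one: diagonal_covering C \<xi> V a b 1 2 3 4 rj rk rl si sk sl D \<eta> by (rule one)
  interpret two: diagonal_covering C \<xi> V a b 3 4 1 2 rj' rk' rl' si' sk' sl' Dd \<eta>' by (rule two)
  have iso': "iso_over UNIV D Dd \<psi>" by (rule iso_over_UNIV[OF iso(1)])
  have \<psi>in: "\<psi> P \<in> Dd" if "P \<in> D" for P using iso' that by (auto simp: iso_over_def morphism_over_def)
  have pair: "covering_pair C \<xi> V a b 1 2 3 4 rj rk rl si sk sl D \<eta> rj' rk' rl' si' sk' sl' Dd \<eta>' \<psi>"
    by unfold_locales (rule iso', simp add: pr1 pr2[OF \<psi>in] iso(2))
  interpret pair: covering_pair C \<xi> V a b 1 2 3 4 rj rk rl si sk sl D \<eta> rj' rk' rl' si' sk' sl' Dd \<eta>' \<psi>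
    by (rule pair)
  have l: "\<not> zero_on D l"
    by (rule linear_form_nonzero[OF H(1,2)]) (rule one.D.linear_form_not_zero_on[OF H(1)])
  have ld: "\<not> zero_on Dd ld"
    by (rule linear_form_nonzero[OF Hd(1,2)]) (rule two.D.linear_form_not_zero_on[OF Hd(1)])

  let ?B = "{R\<in>D. meval ld (rep_proj (\<psi> R)) = 0}"
  note B = pair.bezout_psi[OF Hd(1) ld]
  have ram: "ram_index D Dd \<psi> P = 1" if "P \<in> D" for P
    using two.D.ex_order_one[OF \<psi>in[OF that]] ram_index_iso[OF iso' that] by metis
  define d where "d = H - pullback_div D Dd \<psi> Hd"
  let ?d = "\<lambda>P. int (order_at D P l) - int (order_at Dd (\<psi> P) ld)"
  have "Poly_Mapping.lookup (pullback_div D Dd \<psi> Hd) P = (if P \<in> D then int (order_at Dd (\<psi> P) ld) else 0)" for P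
  proof -
    have e: "(if P \<in> D then int (ram_index D Dd \<psi> P) * Poly_Mapping.lookup Hd (\<psi> P) else 0)
        = (if P \<in> D then int (order_at Dd (\<psi> P) ld) else 0)" for P
      unfolding Hd(3) two.D.lookup_form_div[OF Hd(1) ld] using ram \<psi>in by simp
    have "{P. (if P \<in> D then int (order_at Dd (\<psi> P) ld) else 0) \<noteq> 0} \<subseteq> ?B"
      using two.D.ord_pos_iff[OF \<psi>in Hd(1) ld] by (auto split: if_splits)
    then have "finite {P. (if P \<in> D then int (order_at Dd (\<psi> P) ld) else 0) \<noteq> 0}" using B(1) finite_subset by blast
    then show ?thesis unfolding pullback_div_def e by simp
  qed
  then have d: "Poly_Mapping.lookup d P = (if P \<in> D then ?d P else 0)" for P
    unfolding d_def lookup_minus H(3) one.D.lookup_form_div[OF H(1) l] by simp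
  have keys: "Poly_Mapping.keys d \<subseteq> D" using d by (auto simp: in_keys_iff split: if_splits)
  \<comment> \<open>Both plane sections have degree 4; the sums are compared over a common finite
    set containing both supports.\<close>
  have degree: "div_degree d = 0"
  proof -
    let ?S = "{R\<in>D. meval l (rep_proj R) = 0} \<union> ?B"
    have S: "finite ?S" using one.D.finite_zeros[OF H(1) l] B(1) by blast
    have z: "order_at Dd (\<psi> P) ld = 0" if "P \<in> D" "P \<notin> ?B" for P
      using two.D.ord_eq_0[OF \<psi>in[OF that(1)] Hd(1)] that by blast
    have z': "order_at D P l = 0" if "P \<in> D" "meval l (rep_proj P) \<noteq> 0" for P
      by (rule one.D.ord_eq_0[OF that(1) H(1) that(2)])
    have "Poly_Mapping.keys d \<subseteq> ?S"
    proof
      fix P assume "P \<in> Poly_Mapping.keys d"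
      then have P: "P \<in> D" "order_at D P l \<noteq> 0 \<or> order_at Dd (\<psi> P) ld \<noteq> 0"
        by (auto simp: in_keys_iff d split: if_splits)
      then show "P \<in> ?S" using z[OF P(1)] z'[OF P(1)]
        by (cases "meval l (rep_proj P) = 0"; cases "meval ld (rep_proj (\<psi> P)) = 0") simp_all
    qed
    then have "div_degree d = (\<Sum>P\<in>?S. Poly_Mapping.lookup d P)"
      unfolding div_degree_def by (intro sum.mono_neutral_left[OF S]) (auto simp: in_keys_iff)
    also have "\<dots> = (\<Sum>P\<in>?S. ?d P)" by (rule sum.cong) (auto simp: d)
    also have "\<dots> = int (\<Sum>P\<in>?S. order_at D P l) - int (\<Sum>P\<in>?S. order_at Dd (\<psi> P) ld)"
      by (simp add: sum_subtractf)
    also have "(\<Sum>P\<in>?S. order_at Dd (\<psi> P) ld) = (\<Sum>P\<in>?B. order_at Dd (\<psi> P) ld)"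
    proof (rule sum.mono_neutral_right[OF S])
      show "\<forall>P\<in>?S - ?B. order_at Dd (\<psi> P) ld = 0" by (intro ballI z) auto
    qed auto
    also have "(\<Sum>P\<in>?S. order_at D P l) = 4 * 1" by (rule one.D.bezout_superset[OF H(1) l S]) auto
    finally show ?thesis using B(2) by simp
  qed

  have \<beta>: "iso_over UNIV D E' \<beta>" and \<phi>\<beta>: "\<And>P. P \<in> D \<Longrightarrow> \<phi>' (\<beta> P) = \<alpha> (\<pi> P)"
    using D(3) by (auto simp: isogeny_covering_def jacobian_iso_def)
  obtain \<gamma> where \<gamma>: "morphism_over UNIV D E' \<beta>" "morphism_over UNIV E' D \<gamma>" "\<And>P. P \<in> D \<Longrightarrow> \<beta> P \<in> E'"
    "\<And>Q. Q \<in> E' \<Longrightarrow> \<gamma> Q \<in> D" "\<And>P. P \<in> D \<Longrightarrow> \<gamma> (\<beta> P) = P" "\<And>Q. Q \<in> E' \<Longrightarrow> \<beta> (\<gamma> Q) = Q"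
    by (rule iso_overE[OF \<beta>]) (rule that)
  have \<alpha>: "iso_over UNIV C E \<alpha>" using E(2) by (simp add: jacobian_iso_def)
  have \<alpha>inj: "P = P'" if "P \<in> C" "P' \<in> C" "\<alpha> P = \<alpha> P'" for P P'
    using \<alpha> that unfolding iso_over_def by metis
  have "pt_inf \<in> isogeny_kernel E' \<phi>'" "T' \<in> isogeny_kernel E' \<phi>'" using isogenies(3) by simp_all
  then have ker: "pt_inf \<in> E'" "T' \<in> E'" "\<phi>' pt_inf = pt_inf" "\<phi>' T' = pt_inf" by (simp_all add: isogeny_kernel_def)
  \<comment> \<open>The points of \<open>D\<close> that correspond to \<open>0\<close> and
    \<open>T'\<close>. As \<open>\<phi>'\<close> kills \<open>T'\<close> and \<open>\<alpha>\<close>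
    is injective, they have the same image on \<open>C\<close> and form a fibre of
    \<open>\<pi>\<close>.\<close>
  define w0 w1 where w: "w0 = \<gamma> pt_inf" "w1 = \<gamma> T'"
  have wD: "w0 \<in> D" "w1 \<in> D" "\<beta> w0 = pt_inf" "\<beta> w1 = T'" using \<gamma>(4,6) ker by (simp_all add: w)
  have "\<alpha> (\<pi> w1) = \<alpha> (\<pi> w0)" using \<phi>\<beta>[OF wD(1)] \<phi>\<beta>[OF wD(2)] wD(3,4) ker by simp
  then have fibre: "one.proj_pt w1 = one.proj_pt w0"
    using \<alpha>inj one.proj_pt_in wD(1,2) by (simp add: pr1)
  have ne: "w1 \<noteq> w0" using wD(3,4) isogenies(4) by auto
  \<comment> \<open>The principal divisor \<open>d - w1 + w0\<close> on \<open>D\<close>, carried to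
    \<open>E'\<close> by \<open>\<beta>\<close>, becomes the image of \<open>d\<close> minus
    \<open>T'\<close> plus the origin.\<close>
  obtain n F F' where F: "homogeneous n F" "homogeneous n F'" "\<not> zero_on E' F" "\<not> zero_on E' F'"
    "\<And>P. P \<in> D \<Longrightarrow> ?d P - of_bool (P = w1) + of_bool (P = w0)
        = int (order_at E' (\<beta> P) F) - int (order_at E' (\<beta> P) F')"
    by (rule one.D.principal_transport[OF pair.hyperplane_sections[OF wD(1,2) fibre ne H(1) l Hd(1) ld] \<beta> one.D.nonempty])
      (rule that)
  have push: "Poly_Mapping.lookup (push_div \<beta> d) Q = (if Q \<in> E' then ?d (\<gamma> Q) else 0)" for Q
  proof (cases "Q \<in> E'")
    case True
    have "(\<beta> P = Q) = (P = \<gamma> Q)" if "P \<in> Poly_Mapping.keys d" for P using that keys \<gamma>(5,6) True by auto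
    then have "Poly_Mapping.lookup (push_div \<beta> d) Q
        = (\<Sum>P\<in>Poly_Mapping.keys d. if P = \<gamma> Q then Poly_Mapping.lookup d P else 0)"
      unfolding lookup_push_div by (intro sum.cong) auto
    also have "\<dots> = Poly_Mapping.lookup d (\<gamma> Q)" by (simp add: in_keys_iff)
    finally show ?thesis using True \<gamma>(4) by (simp add: d)
  next
    case False
    then have "\<beta> P \<noteq> Q" if "P \<in> Poly_Mapping.keys d" for P using that keys \<gamma>(3) by auto
    then show ?thesis using False unfolding lookup_push_div by simp
  qed
  have "lin_equiv E' (push_div \<beta> d) (frag_of T' - frag_of pt_inf)" unfolding lin_equiv_def
  proof (intro conjI)
    show "Poly_Mapping.keys (push_div \<beta> d) \<subseteq> E'" using push by (auto simp: in_keys_iff split: if_splits)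
    show "Poly_Mapping.keys (frag_of T' - frag_of pt_inf) \<subseteq> E'"
      using keys_diff[of "frag_of T'" "frag_of pt_inf"] ker(1,2) by auto
    show "\<exists>n F G. homogeneous n F \<and> homogeneous n G \<and> not_identically_zero_on E' F \<and> not_identically_zero_on E' G \<and>
        push_div \<beta> d - (frag_of T' - frag_of pt_inf) = form_div E' F - form_div E' G"
    proof (rule exI[of _ n], rule exI[of _ F], rule exI[of _ F'], intro conjI F(1,2))
      show "not_identically_zero_on E' F" "not_identically_zero_on E' F'"
        using F not_identically_zero_on_iff by blast+
      show "push_div \<beta> d - (frag_of T' - frag_of pt_inf) = form_div E' F - form_div E' F'"
      proof (rule poly_mapping_eqI)
        fix Q
        have "(\<gamma> Q = w1) = (T' = Q)" "(\<gamma> Q = w0) = (pt_inf = Q)" if "Q \<in> E'"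
          using \<gamma>(5,6) wD that by metis+
        then show "Poly_Mapping.lookup (push_div \<beta> d - (frag_of T' - frag_of pt_inf)) Q
          = Poly_Mapping.lookup (form_div E' F - form_div E' F') Q"
          using F(5)[OF \<gamma>(4), of Q] \<gamma>(6)[of Q] ker(1,2)
          by (auto simp: lookup_minus lookup_single push when_def
            one.D.lookup_form_div_iso[OF \<beta> F(1,3)] one.D.lookup_form_div_iso[OF \<beta> F(2,4)])
      qed
    qed
  qed
  then show ?thesis using keys degree unfolding represents_def d_def by blast
qed

end
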